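(* Let $\boldsymbol\theta\in\boldsymbol\Theta_{p,q}$ and $f\in\mathcal F_d$ (VARMA$(p,q)$ parameter space and regularity class defined in the context), and assume that the Gaussian cross-covariances satisfy the asymptotic linearity property: for any positive integer $i$ and any $\boldsymbol\tau\in\mathbb R^{(p+q)d^2}$, under $\mathrm P^{(n)}_{\boldsymbol\theta;f}$ as $n\to\infty$, $$(n-i)^{1/2}\big[\mathrm{vec}(\boldsymbol\Gamma^{(n)}_{i;\mathcal N}(\boldsymbol\theta+n^{-1/2}\boldsymbol\tau))-\mathrm{vec}(\boldsymbol\Gamma^{(n)}_{i;\mathcal N}(\boldsymbol\theta))\big]=(\boldsymbol\Sigma\otimes\boldsymbol\Sigma^{-1})\,\mathbf c_{i,\boldsymbol\theta}'\boldsymbol\tau+o_{\rm P}(1),$$ and that $\mathrm E[\mathrm{vec}(\boldsymbol\epsilon_t\boldsymbol\epsilon_t')(\mathrm{vec}(\boldsymbol\epsilon_t\boldsymbol\epsilon_t'))']<\infty$. Let $\hat{\boldsymbol\theta}^{(n)}_{\mathcal N}$ be the Gaussian quasi-maximum likelihood estimator, $Q^{(n)}_{m;\mathcal N}(\hat{\boldsymbol\theta}^{(n)}_{\mathcal N})$ the Gaussian portmanteau statistic with $m$ lags, and $Q^{(n)**}_{m;\mathcal N}(\boldsymbol\theta)$ its oracle approximation (all defined in the context). Then, under $\mathrm P^{(n)}_{\boldsymbol\theta;f}$ and under contiguous alternatives $\mathrm P^{(n)}_{\boldsymbol\theta+n^{-1/2}\boldsymbol\tau;f}$: (i) for all $\delta,\varepsilon>0$,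 there exist integers $M_{\delta,\varepsilon}$ and $N_{\delta,\varepsilon}$ such that $$\mathrm P\Big(\big|Q^{(n)}_{m;\mathcal N}(\hat{\boldsymbol\theta}^{(n)}_{\mathcal N})-Q^{(n)**}_{m;\mathcal N}(\boldsymbol\theta)\big|<\delta\Big)>1-\varepsilon$$ for all $n\ge N_{\delta,\varepsilon}$ and fixed $m\ge M_{\delta,\varepsilon}$; (ii) $Q^{(n)**}_{m;\mathcal N}(\boldsymbol\theta)$ is asymptotically chi-square with $d^2(m-p-q)$ degrees of freedom as $n\to\infty$ (for fixed $m>p+q$).
   Context: Prime denotes transposition. Model: the $d$-dimensional VARMA$(p,q)$ model is $$\Big(\mathbf I_d-\sum_{i=1}^p\mathbf A_iL^i\Big)\mathbf X_t=\Big(\mathbf I_d+\sum_{j=1}^q\mathbf B_jL^j\Big)\boldsymbol\epsilon_t,$$ with $d\times d$ matrices $\mathbf A_i,\mathbf B_j$, lag operator $L$, and i.i.d. mean-zero $d$-dimensional innovations $\boldsymbol\epsilon_t$ with density $f$. The parameter is $\boldsymbol\theta=(\mathrm{vec}(\mathbf A_1)',\dots,\mathrm{vec}(\mathbf A_p)',\mathrm{vec}(\mathbf B_1)',\dots,\mathrm{vec}(\mathbf B_q)')'\in\mathbb R^{(p+q)d^2}$. The parameter space $\boldsymbol\Theta_{p,q}$ is the set of all $\boldsymbol\theta$ such that: (i) all solutions $z\in\mathbb C$ of $\det(\mathbf I_d-\sum_{i=1}^p\mathbf A_iz^i)=0$ and of $\det(\mathbf I_d+\sum_{i=1}^q\mathbf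 B_iz^i)=0$ lie outside the unit ball in $\mathbb C$; (ii) $\det(\mathbf A_p)\neq0\neq\det(\mathbf B_q)$; (iii) $\mathbf I_d-\sum_{i=1}^p\mathbf A_iz^i$ and $\mathbf I_d+\sum_{i=1}^q\mathbf B_iz^i$ have no common left factors other than $\mathbf I_d$. Class $\mathcal F_d$: Lebesgue densities $f$ on $\mathbb R^d$ such that (i) $f(\mathbf x)>0$ for all $\mathbf x$; (ii) $\int\mathbf xf(\mathbf x)\,d\mathbf x=\mathbf 0$ and $\int\mathbf x\mathbf x'f(\mathbf x)\,d\mathbf x$ is finite and positive definite (this covariance matrix of $\boldsymbol\epsilon_t$ is denoted $\boldsymbol\Sigma$); (iii) $f^{1/2}$ is mean-square differentiable: there is a square-integrable vector $\mathbf Df^{1/2}$ with $(\mathbf h'\mathbf h)^{-1}\int[f^{1/2}(\mathbf x+\mathbf h)-f^{1/2}(\mathbf x)-\mathbf h'\mathbf Df^{1/2}(\mathbf x)]^2d\mathbf x\to0$ as $\mathbf 0\neq\mathbf h\to\mathbf 0$; (iv) with $\boldsymbol\varphi_f=(\varphi_{f1},\dots,\varphi_{fd})':=-2\,\mathbf Df^{1/2}/f^{1/2}$, $\int[\varphi_{fi}(\mathbf x)]^4f(\mathbf x)\,d\mathbf x<\infty$ for $i=1,\dots,d$; (v) $\boldsymbol\varphi_f$ is piecewise Lipschitz: there exist $K\in\mathbb R$ and a finite measurable partition $I_1,\dots,I_J$ of $\mathbb R^d$ such that $\|\boldsymbol\varphi_f(\mathbf x)-\boldsymbol\varphi_f(\mathbf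 y)\|\le K\|\mathbf x-\mathbf y\|$ for all $\mathbf x,\mathbf y\in I_j$, $j=1,\dots,J$. Observations and residuals: $\mathbf X^{(n)}=(\mathbf X_1,\dots,\mathbf X_n)$ is observed; all initial values (values of $\mathbf X_t$ and of innovations/residuals at times $t\le0$) are set to $\mathbf 0$. The residuals are computed recursively as $\mathbf Z_t(\boldsymbol\theta)=\mathbf X_t-\sum_{i=1}^p\mathbf A_i\mathbf X_{t-i}-\sum_{j=1}^q\mathbf B_j\mathbf Z_{t-j}(\boldsymbol\theta)$, $t=1,\dots,n$. $\mathrm P^{(n)}_{\boldsymbol\theta;f}$ is the distribution of $\mathbf X^{(n)}$ under parameter $\boldsymbol\theta$ and innovation density $f$. Gaussian cross-covariance matrices: $\boldsymbol\Gamma^{(n)}_{i;\mathcal N}(\boldsymbol\theta):=-(n-i)^{-1}\boldsymbol\Sigma^{-1}\sum_{t=i+1}^n\mathbf Z_t(\boldsymbol\theta)\mathbf Z_{t-i}'(\boldsymbol\theta)$, $i=1,\dots,n-1$. Matrices $\mathbf c_{i,\boldsymbol\theta}$: let $\mathbf G_u,\mathbf H_u$ be the Green matrices, $\sum_{u\ge0}\mathbf G_uz^u=(\mathbf I_d-\sum_{i=1}^p\mathbf A_iz^i)^{-1}$ and $\sum_{u\ge0}\mathbf H_uz^u=(\mathbf I_d+\sum_{i=1}^q\mathbf B_iz^i)^{-1}$ for $|z|<1$, with $\mathbf G_u=\mathbf H_u=\mathbf 0$ for $u<0$, and $\mathbf B_0=\mathbf I_d$. For $i\ge1$, $\mathbf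 c_{i,\boldsymbol\theta}$ is the $(p+q)d^2\times d^2$ matrix obtained by stacking vertically the $p$ blocks $\sum_{j=0}^{i-r}\sum_{k=0}^{\min(q,i-j-r)}(\mathbf G_{i-j-k-r}\mathbf B_k)\otimes\mathbf H_j'$, $r=1,\dots,p$ (empty sums are zero), followed by the $q$ blocks $\mathbf I_d\otimes\mathbf H_{i-s}'$, $s=1,\dots,q$. QMLE: $\hat{\boldsymbol\theta}^{(n)}_{\mathcal N}$ is the solution of $\boldsymbol\Delta^{(n)}_{\mathcal N}(\boldsymbol\theta)=\mathbf 0$, where $\boldsymbol\Delta^{(n)}_{\mathcal N}(\boldsymbol\theta):=\sum_{i=1}^{n-1}\mathbf c_{i,\boldsymbol\theta}(n-i)^{1/2}\mathrm{vec}(\boldsymbol\Gamma^{(n)}_{i;\mathcal N}(\boldsymbol\theta))$; under the finite fourth-order moment assumption it is root-$n$ consistent (known fact taken for granted). Portmanteau statistic ($1\le m\le n-1$): with $\widehat{\boldsymbol\Sigma}:=n^{-1}\sum_{t=1}^n\mathbf Z_t(\hat{\boldsymbol\theta}^{(n)}_{\mathcal N})\mathbf Z_t'(\hat{\boldsymbol\theta}^{(n)}_{\mathcal N})$, $$Q^{(n)}_{m;\mathcal N}(\hat{\boldsymbol\theta}^{(n)}_{\mathcal N}):=\sum_{i=1}^m(n-i)\,\mathrm{vec}(\boldsymbol\Gamma^{(n)}_{i;\mathcal N}(\hat{\boldsymbol\theta}^{(n)}_{\mathcal N}))'\,(\widehat{\boldsymbol\Sigma}\otimes\widehat{\boldsymbol\Sigma}^{-1})^{-1}\,\mathrm{vec}(\boldsymbol\Gamma^{(n)}_{i;\mathcal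 N}(\hat{\boldsymbol\theta}^{(n)}_{\mathcal N})).$$ Oracle approximation: define $\boldsymbol\Gamma^{(n)**}_{i;\mathcal N}(\boldsymbol\theta)$, $1\le i\le m$, by $$(n-i)^{1/2}\mathrm{vec}(\boldsymbol\Gamma^{(n)**}_{i;\mathcal N}(\boldsymbol\theta)):=(n-i)^{1/2}\mathrm{vec}(\boldsymbol\Gamma^{(n)}_{i;\mathcal N}(\boldsymbol\theta))-(\boldsymbol\Sigma\otimes\boldsymbol\Sigma^{-1})\mathbf c_{i,\boldsymbol\theta}'\Big(\sum_{j=1}^{m}\mathbf c_{j,\boldsymbol\theta}(\boldsymbol\Sigma\otimes\boldsymbol\Sigma^{-1})\mathbf c_{j,\boldsymbol\theta}'\Big)^{-1}\Big(\sum_{j=1}^{m}\mathbf c_{j,\boldsymbol\theta}(n-j)^{1/2}\mathrm{vec}(\boldsymbol\Gamma^{(n)}_{j;\mathcal N}(\boldsymbol\theta))\Big),$$ and $$Q^{(n)**}_{m;\mathcal N}(\boldsymbol\theta):=\sum_{i=1}^m(n-i)\,\mathrm{vec}(\boldsymbol\Gamma^{(n)**}_{i;\mathcal N}(\boldsymbol\theta))'\,(\boldsymbol\Sigma\otimes\boldsymbol\Sigma^{-1})^{-1}\,\mathrm{vec}(\boldsymbol\Gamma^{(n)**}_{i;\mathcal N}(\boldsymbol\theta)).$$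
   Formalization: In (ii) the sum of the c_j(Σ⊗Σ^{-1})c_j' over j ≤ m is assumed invertible, since it can be singular for some m > p+q and the oracle statistic is then undefined; in (i) N may depend on the fixed m, since no single N serves all m up to n−1. *)

theory Defs
  imports
    "HOL-Probability.Probability"
    "HOL-Computational_Algebra.Polynomial"
begin

section \<open>Matrices\<close>

definition outer :: "real^'m \<Rightarrow> real^'n \<Rightarrow> real^'n^'m" where
  "outer x y = (\<chi> r s. x $ r * y $ s)"

text \<open>
  A vector of length \<open>d\<^sup>2\<close> is indexed by pairs (column, row).  In the lexicographic order of the
  pairs \<open>vecm\<close> stacks the columns of a matrix on top of each other and \<open>kron\<close> is the usual
  block Kronecker product, so that \<open>vec (A X B) = (B' \<otimes> A) vec X\<close>.
\<close>

definition vecm :: "real^'n^'m \<Rightarrow> real^('n \<times> 'm)" where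
  "vecm A = (\<chi> cr. A $ snd cr $ fst cr)"

definition unvec :: "real^('n \<times> 'm) \<Rightarrow> real^'n^'m" where
  "unvec v = (\<chi> r c. v $ (c, r))"

definition kron :: "real^'n^'m \<Rightarrow> real^'l^'k \<Rightarrow> real^('n \<times> 'l)^('m \<times> 'k)" where
  "kron A B = (\<chi> rk cl. A $ fst rk $ fst cl * B $ snd rk $ snd cl)"

definition pos_def :: "real^'n^'n \<Rightarrow> bool" where
  "pos_def S \<longleftrightarrow> transpose S = S \<and> (\<forall>v. v \<noteq> 0 \<longrightarrow> v \<bullet> (S *v v) > 0)"

section \<open>VARMA parameters\<close>

text \<open>
  The parameter space is \<open>real^('l \<times> ('d \<times> 'd))\<close> with \<open>CARD('l) = p + q\<close> and \<open>CARD('d) = d\<close>.  The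
  linearly ordered type \<open>'l\<close> enumerates the blocks \<open>vec A\<^sub>1, \<dots>, vec A\<^sub>p, vec B\<^sub>1, \<dots>, vec B\<^sub>q\<close>;
  \<open>block_index k\<close> is its \<open>k\<close>-th element, counting from 1.
\<close>

type_synonym ('l, 'd) param = "real^('l \<times> 'd \<times> 'd)"

definition block_index :: "nat \<Rightarrow> 'l::{finite,linorder}" where
  "block_index k = (THE l. card {..l} = k)"

definition block :: "('l::{finite,linorder}, 'd::finite) param \<Rightarrow> nat \<Rightarrow> real^'d^'d" where
  "block \<theta> k = unvec (\<chi> cr. \<theta> $ (block_index k, cr))"

definition ar_coeff :: "('l::{finite,linorder}, 'd::finite) param \<Rightarrow> nat \<Rightarrow> real^'d^'d" where
  "ar_coeff \<theta> i = block \<theta> i"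

text \<open>The value at 0 is the convention \<open>B\<^sub>0 = I\<close>.\<close>

definition ma_coeff :: "nat \<Rightarrow> ('l::{finite,linorder}, 'd::finite) param \<Rightarrow> nat \<Rightarrow> real^'d^'d" where
  "ma_coeff p \<theta> j = (if j = 0 then mat 1 else block \<theta> (p + j))"

definition monom_mat :: "real^'d^'d \<Rightarrow> nat \<Rightarrow> (real poly)^'d^'d" where
  "monom_mat A i = (\<chi> r s. monom (A $ r $ s) i)"

definition ar_poly :: "nat \<Rightarrow> ('l::{finite,linorder}, 'd::finite) param \<Rightarrow> (real poly)^'d^'d" where
  "ar_poly p \<theta> = mat 1 - (\<Sum>i=1..p. monom_mat (ar_coeff \<theta> i) i)"

definition ma_poly :: "nat \<Rightarrow> nat \<Rightarrow> ('l::{finite,linorder}, 'd::finite) param \<Rightarrow> (real poly)^'d^'d" where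
  "ma_poly p q \<theta> = mat 1 + (\<Sum>j=1..q. monom_mat (ma_coeff p \<theta> j) j)"

definition eval_mat :: "(real poly)^'d^'d \<Rightarrow> complex \<Rightarrow> complex^'d^'d" where
  "eval_mat P z = (\<chi> r s. poly (map_poly of_real (P $ r $ s)) z)"

text \<open>
  Left factors of a matrix polynomial are only determined up to unimodular matrices (those with
  constant nonzero determinant), and every unimodular matrix is a left factor of every square
  matrix polynomial.  Having no common left factor other than the identity therefore means that
  all common left factors are unimodular.
\<close>

definition left_coprime :: "(real poly)^'d^'d \<Rightarrow> (real poly)^'d^'d \<Rightarrow> bool" where
  "left_coprime P Q \<longleftrightarrow> (\<forall>L R S. P = L ** R \<and> Q = L ** S \<longrightarrow> is_unit (det L))"

text \<open>
  The condition on the last autoregressive (moving average) coefficient is void for \<open>p = 0\<close>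
  (\<open>q = 0\<close>).
\<close>

definition varma_params :: "nat \<Rightarrow> nat \<Rightarrow> ('l::{finite,linorder}, 'd::finite) param set" where
  "varma_params p q = {\<theta>.
     (\<forall>z. det (eval_mat (ar_poly p \<theta>) z) = 0 \<longrightarrow> cmod z > 1) \<and>
     (\<forall>z. det (eval_mat (ma_poly p q \<theta>) z) = 0 \<longrightarrow> cmod z > 1) \<and>
     (p \<ge> 1 \<longrightarrow> det (ar_coeff \<theta> p) \<noteq> 0) \<and>
     (q \<ge> 1 \<longrightarrow> det (ma_coeff p \<theta> q) \<noteq> 0) \<and>
     left_coprime (ar_poly p \<theta>) (ma_poly p q \<theta>)}"

section \<open>Innovation densities\<close>

definition innov :: "(real^'d \<Rightarrow> real) \<Rightarrow> (real^'d) measure" where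
  "innov f = density lborel (\<lambda>x. ennreal (f x))"

definition innov_cov :: "(real^'d \<Rightarrow> real) \<Rightarrow> real^'d^'d" where
  "innov_cov f = (LINT x|innov f. outer x x)"

text \<open>
  \<open>D\<close> is the mean-square derivative of the root density.  It is determined only almost everywhere,
  so the Lipschitz condition asks for a version of it.
\<close>

definition score :: "(real^'d \<Rightarrow> real) \<Rightarrow> (real^'d \<Rightarrow> real^'d) \<Rightarrow> real^'d \<Rightarrow> real^'d" where
  "score f D x = (- 2 / sqrt (f x)) *\<^sub>R D x"

definition ms_root_derivative :: "(real^'d \<Rightarrow> real) \<Rightarrow> (real^'d \<Rightarrow> real^'d) \<Rightarrow> bool" where
  "ms_root_derivative f D \<longleftrightarrow>
     D \<in> borel_measurable borel \<and> integrable lborel (\<lambda>x. (norm (D x))\<^sup>2) \<and>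
     ((\<lambda>h. (LINT x|lborel. (sqrt (f (x + h)) - sqrt (f x) - h \<bullet> D x)\<^sup>2) / (h \<bullet> h)) \<longlongrightarrow> 0) (at 0)"

definition piecewise_Lipschitz :: "(real^'d \<Rightarrow> real^'d) \<Rightarrow> bool" where
  "piecewise_Lipschitz g \<longleftrightarrow>
     (\<exists>K Is. finite Is \<and> partition_on UNIV Is \<and> Is \<subseteq> sets borel \<and>
        (\<forall>I\<in>Is. \<forall>x\<in>I. \<forall>y\<in>I. norm (g x - g y) \<le> K * norm (x - y)))"

definition density_class :: "(real^'d \<Rightarrow> real) set" where
  "density_class = {f.
     f \<in> borel_measurable borel \<and> prob_space (innov f) \<and> (\<forall>x. f x > 0) \<and>
     integrable (innov f) (\<lambda>x. x) \<and> (LINT x|innov f. x) = 0 \<and>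
     integrable (innov f) (\<lambda>x. outer x x) \<and> pos_def (innov_cov f) \<and>
     (\<exists>D. ms_root_derivative f D \<and>
          (\<forall>i. integrable lborel (\<lambda>x. (score f D x $ i) ^ 4 * f x)) \<and>
          piecewise_Lipschitz (score f D))}"

section \<open>Observations and residuals\<close>

text \<open>All values at times \<open>t \<le> 0\<close> are 0, hence the restriction of the lags to \<open>i < t\<close>.\<close>

fun varma_path :: "nat \<Rightarrow> nat \<Rightarrow> ('l::{finite,linorder}, 'd::finite) param \<Rightarrow>
    (nat \<Rightarrow> real^'d) \<Rightarrow> nat \<Rightarrow> real^'d" where
  "varma_path p q \<theta> e t =
     (if t = 0 then 0
      else (\<Sum>i\<in>{i. 1 \<le> i \<and> i \<le> p \<and> i < t}. ar_coeff \<theta> i *v varma_path p q \<theta> e (t - i))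
         + e t
         + (\<Sum>j\<in>{j. 1 \<le> j \<and> j \<le> q \<and> j < t}. ma_coeff p \<theta> j *v e (t - j)))"

declare varma_path.simps [simp del]

fun resid :: "nat \<Rightarrow> nat \<Rightarrow> ('l::{finite,linorder}, 'd::finite) param \<Rightarrow>
    (nat \<Rightarrow> real^'d) \<Rightarrow> nat \<Rightarrow> real^'d" where
  "resid p q \<theta> x t =
     (if t = 0 then 0
      else x t
         - (\<Sum>i\<in>{i. 1 \<le> i \<and> i \<le> p \<and> i < t}. ar_coeff \<theta> i *v x (t - i))
         - (\<Sum>j\<in>{j. 1 \<le> j \<and> j \<le> q \<and> j < t}. ma_coeff p \<theta> j *v resid p q \<theta> x (t - j)))"

declare resid.simps [simp del]

definition sample_space :: "nat \<Rightarrow> (nat \<Rightarrow> real^'d) measure" where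
  "sample_space n = (\<Pi>\<^sub>M t\<in>{1..n}. borel)"

definition varma_law :: "nat \<Rightarrow> nat \<Rightarrow> ('l::{finite,linorder}, 'd::finite) param \<Rightarrow>
    (real^'d \<Rightarrow> real) \<Rightarrow> nat \<Rightarrow> (nat \<Rightarrow> real^'d) measure" where
  "varma_law p q \<theta> f n =
     distr (\<Pi>\<^sub>M t\<in>{1..n}. innov f) (sample_space n) (\<lambda>e. restrict (varma_path p q \<theta> e) {1..n})"

section \<open>Cross-covariances and the matrices \<open>c\<^sub>i\<close>\<close>

text \<open>
  In the rest of the theory \<open>S\<close> stands for the innovation covariance matrix and \<open>x\<close> for the observed
  series.
\<close>

definition gauss_ccov :: "nat \<Rightarrow> nat \<Rightarrow> real^'d^'d \<Rightarrow> nat \<Rightarrow> nat \<Rightarrow>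
    ('l::{finite,linorder}, 'd::finite) param \<Rightarrow> (nat \<Rightarrow> real^'d) \<Rightarrow> real^'d^'d" where
  "gauss_ccov p q S n i \<theta> x =
     (- 1 / (real n - real i)) *\<^sub>R
       (matrix_inv S ** (\<Sum>t=i+1..n. outer (resid p q \<theta> x t) (resid p q \<theta> x (t - i))))"

definition green :: "(real poly)^'d^'d \<Rightarrow> nat \<Rightarrow> real^'d^'d" where
  "green P = (THE G. \<forall>z. cmod z < 1 \<longrightarrow>
     (\<lambda>u. \<chi> r s. complex_of_real (G u $ r $ s) * z ^ u) sums matrix_inv (eval_mat P z))"

text \<open>
  The blocks of \<open>c\<^sub>i\<close>.  The side conditions on \<open>j\<close> and \<open>k\<close> say \<open>j \<le> i - r\<close> and
  \<open>k \<le> min q (i - j - r)\<close> without truncated subtraction, so all indices of Green matrices are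
  nonnegative except in \<open>H\<^bsub>i-s\<^esub>\<close>, which is 0 for \<open>i < s\<close>.
\<close>

definition c_ar_block :: "nat \<Rightarrow> nat \<Rightarrow> ('l::{finite,linorder}, 'd::finite) param \<Rightarrow> nat \<Rightarrow> nat \<Rightarrow>
    real^('d \<times> 'd)^('d \<times> 'd)" where
  "c_ar_block p q \<theta> i r =
     (\<Sum>j\<in>{j. j + r \<le> i}. \<Sum>k\<in>{k. k \<le> q \<and> k + j + r \<le> i}.
        kron (green (ar_poly p \<theta>) (i - j - k - r) ** ma_coeff p \<theta> k)
             (transpose (green (ma_poly p q \<theta>) j)))"

definition c_ma_block :: "nat \<Rightarrow> nat \<Rightarrow> ('l::{finite,linorder}, 'd::finite) param \<Rightarrow> nat \<Rightarrow> nat \<Rightarrow>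
    real^('d \<times> 'd)^('d \<times> 'd)" where
  "c_ma_block p q \<theta> i s =
     kron (mat 1) (transpose (if s \<le> i then green (ma_poly p q \<theta>) (i - s) else 0))"

definition c_mat :: "nat \<Rightarrow> nat \<Rightarrow> ('l::{finite,linorder}, 'd::finite) param \<Rightarrow> nat \<Rightarrow>
    real^('d \<times> 'd)^('l \<times> 'd \<times> 'd)" where
  "c_mat p q \<theta> i = (\<chi> lr. let k = card {..fst lr} in
     (if k \<le> p then c_ar_block p q \<theta> i k else c_ma_block p q \<theta> i (k - p)) $ snd lr)"

section \<open>Estimating function and portmanteau statistics\<close>

definition gauss_score :: "nat \<Rightarrow> nat \<Rightarrow> real^'d^'d \<Rightarrow> nat \<Rightarrow>
    ('l::{finite,linorder}, 'd::finite) param \<Rightarrow> (nat \<Rightarrow> real^'d) \<Rightarrow> ('l, 'd) param" where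
  "gauss_score p q S n \<theta> x =
     (\<Sum>i=1..n-1. c_mat p q \<theta> i *v (sqrt (real n - real i) *\<^sub>R vecm (gauss_ccov p q S n i \<theta> x)))"

definition resid_cov :: "nat \<Rightarrow> nat \<Rightarrow> nat \<Rightarrow> ('l::{finite,linorder}, 'd::finite) param \<Rightarrow>
    (nat \<Rightarrow> real^'d) \<Rightarrow> real^'d^'d" where
  "resid_cov p q n \<theta> x = (1 / real n) *\<^sub>R (\<Sum>t=1..n. outer (resid p q \<theta> x t) (resid p q \<theta> x t))"

definition ccov_var :: "real^'d^'d \<Rightarrow> real^('d \<times> 'd)^('d \<times> 'd)" where
  "ccov_var S = kron S (matrix_inv S)"

text \<open>To be evaluated at the estimator; \<open>S\<close> enters only through the cross-covariances.\<close>

definition portmanteau :: "nat \<Rightarrow> nat \<Rightarrow> real^'d^'d \<Rightarrow> nat \<Rightarrow> nat \<Rightarrow>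
    ('l::{finite,linorder}, 'd::finite) param \<Rightarrow> (nat \<Rightarrow> real^'d) \<Rightarrow> real" where
  "portmanteau p q S m n \<theta> x =
     (\<Sum>i=1..m. (real n - real i) *
        (vecm (gauss_ccov p q S n i \<theta> x) \<bullet>
          (matrix_inv (ccov_var (resid_cov p q n \<theta> x)) *v vecm (gauss_ccov p q S n i \<theta> x))))"

definition c_gram :: "nat \<Rightarrow> nat \<Rightarrow> real^'d^'d \<Rightarrow> nat \<Rightarrow> ('l::{finite,linorder}, 'd::finite) param \<Rightarrow>
    real^('l \<times> 'd \<times> 'd)^('l \<times> 'd \<times> 'd)" where
  "c_gram p q S m \<theta> = (\<Sum>j=1..m. c_mat p q \<theta> j ** ccov_var S ** transpose (c_mat p q \<theta> j))"

text \<open>The oracle versions are meaningful only if \<open>c_gram p q S m \<theta>\<close> is invertible.\<close>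

definition oracle_ccov :: "nat \<Rightarrow> nat \<Rightarrow> real^'d^'d \<Rightarrow> nat \<Rightarrow> nat \<Rightarrow> nat \<Rightarrow>
    ('l::{finite,linorder}, 'd::finite) param \<Rightarrow> (nat \<Rightarrow> real^'d) \<Rightarrow> real^'d^'d" where
  "oracle_ccov p q S m n i \<theta> x = unvec ((1 / sqrt (real n - real i)) *\<^sub>R
     (sqrt (real n - real i) *\<^sub>R vecm (gauss_ccov p q S n i \<theta> x)
      - (ccov_var S ** transpose (c_mat p q \<theta> i) ** matrix_inv (c_gram p q S m \<theta>)) *v
          (\<Sum>j=1..m. c_mat p q \<theta> j *v
             (sqrt (real n - real j) *\<^sub>R vecm (gauss_ccov p q S n j \<theta> x)))))"

definition oracle_portmanteau :: "nat \<Rightarrow> nat \<Rightarrow> real^'d^'d \<Rightarrow> nat \<Rightarrow> nat \<Rightarrow>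
    ('l::{finite,linorder}, 'd::finite) param \<Rightarrow> (nat \<Rightarrow> real^'d) \<Rightarrow> real" where
  "oracle_portmanteau p q S m n \<theta> x =
     (\<Sum>i=1..m. (real n - real i) *
        (vecm (oracle_ccov p q S m n i \<theta> x) \<bullet>
          (matrix_inv (ccov_var S) *v vecm (oracle_ccov p q S m n i \<theta> x))))"

section \<open>Asymptotics\<close>

definition to_zero_in_prob :: "(nat \<Rightarrow> 'a measure) \<Rightarrow> (nat \<Rightarrow> 'a \<Rightarrow> 'b::real_normed_vector) \<Rightarrow> bool" where
  "to_zero_in_prob P Y \<longleftrightarrow>
     (\<forall>\<eta>>0. (\<lambda>n. measure (P n) {x \<in> space (P n). norm (Y n x) > \<eta>}) \<longlonglongrightarrow> 0)"

definition bounded_in_prob :: "(nat \<Rightarrow> 'a measure) \<Rightarrow> (nat \<Rightarrow> 'a \<Rightarrow> 'b::real_normed_vector) \<Rightarrow> bool" where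
  "bounded_in_prob P Y \<longleftrightarrow>
     (\<forall>\<epsilon>>0. \<exists>K. \<forall>\<^sub>F n in sequentially. measure (P n) {x \<in> space (P n). norm (Y n x) > K} < \<epsilon>)"

definition chi_square :: "nat \<Rightarrow> real measure" where
  "chi_square k =
     distr (\<Pi>\<^sub>M i\<in>{..<k}. density lborel std_normal_density) borel (\<lambda>z. \<Sum>i<k. (z i)\<^sup>2)"

definition asymp_linear_ccov :: "nat \<Rightarrow> nat \<Rightarrow> (real^'d \<Rightarrow> real) \<Rightarrow>
    ('l::{finite,linorder}, 'd::finite) param \<Rightarrow> bool" where
  "asymp_linear_ccov p q f \<theta> \<longleftrightarrow>
     (\<forall>i\<ge>1. \<forall>\<tau>. to_zero_in_prob (varma_law p q \<theta> f) (\<lambda>n x.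
        sqrt (real n - real i) *\<^sub>R
          (vecm (gauss_ccov p q (innov_cov f) n i (\<theta> + (1 / sqrt n) *\<^sub>R \<tau>) x)
           - vecm (gauss_ccov p q (innov_cov f) n i \<theta> x))
        - (ccov_var (innov_cov f) ** transpose (c_mat p q \<theta> i)) *v \<tau>))"

text \<open>
  \<open>T n x\<close> is the quasi-maximum likelihood estimate from the sample \<open>x\<close> of size \<open>n\<close>.  A root of the
  estimating function need not exist for every sample nor be unique, so an estimator is a measurable
  function which is a root with probability tending to 1 and is root-\<open>n\<close> consistent, both under the
  parameter \<open>\<theta>\<close>.
\<close>

definition gaussian_qmle :: "nat \<Rightarrow> nat \<Rightarrow> (real^'d \<Rightarrow> real) \<Rightarrow>
    ('l::{finite,linorder}, 'd::finite) param \<Rightarrow>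
    (nat \<Rightarrow> (nat \<Rightarrow> real^'d) \<Rightarrow> ('l, 'd) param) \<Rightarrow> bool" where
  "gaussian_qmle p q f \<theta> T \<longleftrightarrow>
     (\<forall>n. T n \<in> borel_measurable (sample_space n)) \<and>
     (\<lambda>n. measure (varma_law p q \<theta> f n)
        {x \<in> space (varma_law p q \<theta> f n). gauss_score p q (innov_cov f) n (T n x) x = 0})
       \<longlonglongrightarrow> 1 \<and>
     bounded_in_prob (varma_law p q \<theta> f) (\<lambda>n x. sqrt n *\<^sub>R (T n x - \<theta>))"

end

theory Submission
 imports Defs "HOL-Complex_Analysis.Complex_Analysis" "HOL-Real_Asymp.Real_Asymp"
begin

text \<open>
 Let \<open>V = \<Sigma> \<otimes> \<Sigma>\<^sup>-\<^sup>1\<close>, and let \<open>W\<^sub>i\<close> be the scaled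
 cross-covariance vector of lag \<open>i\<close> at \<open>\<theta>\<close>. Subtracting the projection on the span of
 the vectors \<open>V c\<^sub>i' \<tau>\<close>, the oracle statistic is the quadratic form \<open>\<Sum>W\<^sub>i'
 V\<^sup>-\<^sup>1 W\<^sub>i - g' C\<^sup>-\<^sup>1 g\<close> with \<open>g = \<Sum>c\<^sub>i W\<^sub>i\<close> and
 \<open>C = \<Sum>c\<^sub>i V c\<^sub>i'\<close>, where \<open>i <= m\<close> (\<open>projected_form\<close>). It does
 not change when \<open>V c\<^sub>i' \<tau>\<close> is added to \<open>W\<^sub>i\<close>; and by asymptotic linearity
 this is, up to negligible terms, what a change of the parameter by \<open>\<tau>\<close> over root \<open>n\<close>
 does.

 This form is a sum of \<open>d\<^sup>2 (m - p - q)\<close> squares of linear forms that are orthonormal for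
 \<open>V\<close> (\<open>projected_form_decomposition\<close>). Under any parameter, the residuals at this parameter
 are the noise, and their lagged products are uncorrelated and finitely dependent; a central limit theorem by blocks
 (\<open>block_central_limit\<close>) shows that the linear forms are asymptotically independent and standard normal.
 Invariance replaces the parameter of the law by \<open>\<theta>\<close>. Characteristic functions of linear forms
 become Laplace transforms of sums of squares by averaging over a Gaussian vector
 (\<open>laplace_of_asymptotically_gaussian\<close>).

 Now compare the two statistics. At the estimator the portmanteau statistic is the same quadratic form without its
 second term, and with an estimate in place of \<open>\<Sigma>\<close>. By invariance the difference to the oracle
 statistic is \<open>g' C\<^sup>-\<^sup>1 g\<close>, with \<open>g\<close> formed at the estimator, plus negligible
 terms. Since the estimator solves the estimating equation, in which all lags occur, \<open>g\<close> is minus the sum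
 over the lags beyond \<open>m\<close>. The \<open>c\<^sub>i\<close> decay geometrically
 (\<open>c_mat_uniform_decay\<close>), so this sum is small for large \<open>m\<close>, uniformly in \<open>n\<close>.
 And \<open>C\<close> is bounded below for large \<open>m\<close> (\<open>c_gram_eventually_coercive\<close>): a
 direction annihilated by all \<open>c\<^sub>i'\<close> vanishes, because the autoregressive and the moving average
 polynomial are left coprime and the last autoregressive coefficient is invertible
 (\<open>coprime_relation_trivial\<close>). Asymptotic linearity is assumed for fixed directions only; finite nets and
 Lipschitz estimates of the residuals in the parameter (\<open>varma_uniform_bounds\<close>) make it uniform over
 bounded sets, so that it applies at the random estimator.

 Linearity and the properties of the estimator are assumed under \<open>\<theta>\<close>. They are carried over to
 local alternatives by the inequality \<open>Q(A) <= K P(A) + \<epsilon>\<close>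
 (\<open>varma_shift_contiguity\<close>). It holds since a local alternative amounts to a predictable shift of the
 noise, small enough for mean-square differentiability of the root density to control the likelihood ratio.
\<close>

no_notation fps_nth (infixl "$" 75)

section \<open>Matrices\<close>

lemma norm_vec_sq: "(norm (x::'a::real_normed_vector^'n))\<^sup>2 = (\<Sum>i\<in>UNIV. (norm (x$i))\<^sup>2)"
 unfolding norm_vec_def L2_set_def by (simp add: sum_nonneg)

lemma norm_matrix_vector_mult_le: "norm ((A::real^'n^'m) *v x) <= norm A * norm x"
proof -
 have "(norm (A *v x))\<^sup>2 = (\<Sum>i\<in>UNIV. (A$i \<bullet> x)\<^sup>2)"
  by (simp add: norm_vec_sq matrix_vector_mult_def inner_vec_def)
 also have "... <= (\<Sum>i\<in>UNIV. (norm (A$i))\<^sup>2 * (norm x)\<^sup>2)"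
  by (intro sum_mono) (metis Cauchy_Schwarz_ineq power2_norm_eq_inner)
 also have "... = (norm A * norm x)\<^sup>2"
  by (simp add: norm_vec_sq[of A] sum_distrib_right power_mult_distrib)
 finally show ?thesis by (rule power2_le_imp_le) simp
qed

lemma norm_transpose [simp]: "norm (transpose (A::real^'n^'m)) = norm A"
proof -
 have "(norm (transpose A))\<^sup>2 = (norm A)\<^sup>2"
  unfolding norm_vec_sq transpose_def by (simp, rule sum.swap)
 thus ?thesis by simp
qed

lemma norm_matrix_matrix_mult_le: "norm ((A::real^'n^'m) ** (B::real^'k^'n)) <= norm A * norm B"
proof -
 have "(norm (A ** B))\<^sup>2 = (\<Sum>k\<in>UNIV. \<Sum>i\<in>UNIV. ((A ** B)$i$k)\<^sup>2)"
  unfolding norm_vec_sq by (simp, rule sum.swap)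
 also have "... = (\<Sum>k\<in>UNIV. (norm (A *v column k B))\<^sup>2)"
  by (simp add: norm_vec_sq matrix_vector_mult_def matrix_matrix_mult_def column_def)
 also have "... <= (\<Sum>k\<in>UNIV. (norm A * norm (column k B))\<^sup>2)"
  by (intro sum_mono power_mono norm_matrix_vector_mult_le) auto
 also have "... = (norm A)\<^sup>2 * (\<Sum>k\<in>UNIV. (norm (column k B))\<^sup>2)"
  by (simp add: power_mult_distrib sum_distrib_left)
 also have "(\<Sum>k\<in>UNIV. (norm (column k B))\<^sup>2) = (norm (transpose B))\<^sup>2"
  unfolding norm_vec_sq[of "transpose B"] by (simp add: column_def transpose_def)
 finally have "(norm (A ** B))\<^sup>2 <= (norm A * norm B)\<^sup>2"
  by (simp add: power_mult_distrib)
 thus ?thesis by (rule power2_le_imp_le) simp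
qed

lemma bounded_bilinear_matrix_vector_mult:
 "bounded_bilinear ((*v) :: real^'n^'m => real^'n => real^'m)"
proof
 show "\<exists>K. \<forall>a b. norm ((a::real^'n^'m) *v b) <= norm a * norm b * K"
  using norm_matrix_vector_mult_le by (intro exI[of _ 1]) auto
qed (auto simp: matrix_vector_mult_def vec_eq_iff algebra_simps sum.distrib sum_distrib_left)

lemma bounded_bilinear_matrix_matrix_mult:
 "bounded_bilinear ((**) :: real^'n^'m => real^'k^'n => real^'k^'m)"
proof
 show "\<exists>K. \<forall>a b. norm ((a::real^'n^'m) ** (b::real^'k^'n)) <= norm a * norm b * K"
  using norm_matrix_matrix_mult_le by (intro exI[of _ 1]) auto
qed (auto simp: matrix_matrix_mult_def vec_eq_iff algebra_simps sum.distrib sum_distrib_left)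

lemma sum_UNIV_prod: "(\<Sum>x\<in>UNIV. f (x :: 'a::finite \<times> 'b::finite)) = (\<Sum>a\<in>UNIV. \<Sum>b\<in>UNIV. f (a, b))"
 by (simp add: sum.cartesian_product flip: UNIV_Times_UNIV)

lemma norm_vecm [simp]: "norm (vecm (A::real^'n^'m)) = norm A"
proof -
 have "(norm (vecm A))\<^sup>2 = (\<Sum>c\<in>UNIV. \<Sum>r\<in>UNIV. (A$r$c)\<^sup>2)"
  unfolding norm_vec_sq vecm_def by (simp add: sum_UNIV_prod)
 also have "... = (norm A)\<^sup>2" unfolding norm_vec_sq by (simp, rule sum.swap)
 finally show ?thesis by simp
qed

lemma vecm_unvec [simp]: "vecm (unvec v) = v"
 by (simp add: vecm_def unvec_def vec_eq_iff)

lemma unvec_vecm [simp]: "unvec (vecm A) = A"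
 by (simp add: vecm_def unvec_def vec_eq_iff)

lemma norm_unvec [simp]: "norm (unvec v) = norm v"
 by (metis norm_vecm vecm_unvec)

lemma linear_vecm: "linear vecm"
 by (rule linearI) (auto simp: vecm_def vec_eq_iff)

lemma norm_outer [simp]: "norm (outer (x::real^'n) (y::real^'m)) = norm x * norm y"
proof -
 have "(norm (outer x y))\<^sup>2 = (norm x * norm y)\<^sup>2"
  unfolding norm_vec_sq power_mult_distrib
  by (simp add: outer_def norm_vec_sq power_mult_distrib sum_product)
 thus ?thesis by simp
qed

lemma bounded_bilinear_outer: "bounded_bilinear (outer :: real^'n => real^'m => _)"
proof
 show "\<exists>K. \<forall>a b. norm (outer (a::real^'n) (b::real^'m)) <= norm a * norm b * K"
  by (intro exI[of _ 1]) auto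
qed (auto simp: outer_def vec_eq_iff algebra_simps)

lemma norm_kron [simp]: "norm (kron (A::real^'m^'n) (B::real^'k^'l)) = norm A * norm B"
proof -
 have "(norm (kron A B))\<^sup>2 = (\<Sum>r\<in>UNIV. \<Sum>k\<in>UNIV. \<Sum>c\<in>UNIV. \<Sum>l\<in>UNIV. (A$r$c)\<^sup>2 * (B$k$l)\<^sup>2)"
  unfolding norm_vec_sq kron_def
  by (simp add: sum_UNIV_prod power_mult_distrib)
 also have "... = (\<Sum>r\<in>UNIV. \<Sum>c\<in>UNIV. (A$r$c)\<^sup>2 * (\<Sum>k\<in>UNIV. \<Sum>l\<in>UNIV. (B$k$l)\<^sup>2))"
  by (simp add: sum_distrib_left) (intro sum.cong refl, rule sum.swap)
 also have "... = (norm A * norm B)\<^sup>2"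
  by (simp add: norm_vec_sq sum_distrib_right power_mult_distrib)
 finally show ?thesis by simp
qed

lemma bounded_bilinear_kron: "bounded_bilinear (kron :: real^'m^'n => real^'k^'l => _)"
proof
 show "\<exists>K. \<forall>a b. norm (kron (a::real^'m^'n) (b::real^'k^'l)) <= norm a * norm b * K"
  by (intro exI[of _ 1]) auto
qed (auto simp: kron_def vec_eq_iff algebra_simps)

lemma transpose_kron: "transpose (kron A B) = kron (transpose A) (transpose B)"
 by (simp add: kron_def transpose_def vec_eq_iff)

lemma kron_mult: "kron A B ** kron C D = kron (A ** C) ((B::real^'a^'b) ** D)"
 by (simp add: kron_def matrix_matrix_mult_def vec_eq_iff sum_product sum_UNIV_prod mult_ac)
   (intro allI, rule sum.swap)

lemma kron_mat_1: "kron (mat 1) (mat 1) = mat 1"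
 by (auto simp: kron_def mat_def vec_eq_iff prod_eq_iff)

lemma kron_vecm: "kron (A::real^'n^'m) (B::real^'k^'l) *v vecm X = vecm (B ** X ** transpose A)"
proof -
 have "(\<Sum>x\<in>UNIV. \<Sum>y\<in>UNIV. A $ a $ x * B $ b $ y * X $ y $ x) =
    (\<Sum>x\<in>UNIV. (\<Sum>y\<in>UNIV. B $ b $ y * X $ y $ x) * A $ a $ x)" for a b
  unfolding sum_distrib_right by (simp only: mult_ac)
 thus ?thesis
  by (simp add: kron_def vecm_def matrix_matrix_mult_def matrix_vector_mult_def transpose_def vec_eq_iff
   sum_UNIV_prod)
qed

lemma matrix_inv:
 assumes "invertible (A::'a::semiring_1^'n^'m)"
 shows "A ** matrix_inv A = mat 1" "matrix_inv A ** A = mat 1"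
proof -
 have "A ** matrix_inv A = mat 1 \<and> matrix_inv A ** A = mat 1"
  unfolding matrix_inv_def by (rule someI_ex) (use assms in \<open>auto simp: invertible_def\<close>)
 thus "A ** matrix_inv A = mat 1" "matrix_inv A ** A = mat 1" by auto
qed

lemma matrix_inv_eqI:
 assumes "A ** B = mat 1" shows "matrix_inv (A::'a::field^'n^'n) = B"
proof -
 have BA: "B ** A = mat 1" using assms matrix_left_right_inverse by blast
 hence "invertible A" using assms by (auto simp: invertible_def)
 hence "matrix_inv A = (matrix_inv A) ** (A ** B)" by (simp add: assms matrix_mul_rid)
 also have "... = B" using matrix_inv[OF \<open>invertible A\<close>] by (simp add: matrix_mul_assoc matrix_mul_lid)
 finally show ?thesis .
qed

lemma matrix_inv_component:
 assumes "det (A::'a::field^'n^'n) ~= 0"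
 shows "matrix_inv A $ r $ s = det (\<chi> i j. if j = r then (if i = s then 1 else 0) else A $ i $ j) / det A"
proof -
 have inv: "invertible A" using assms invertible_det_nz by blast
 have "A *v (column s (matrix_inv A)) = axis s 1"
  using matrix_inv(1)[OF inv]
  by (auto simp: vec_eq_iff matrix_vector_mult_def matrix_matrix_mult_def column_def mat_def axis_def)
 hence "column s (matrix_inv A) = (\<chi> k. det (\<chi> i j. if j = k then axis s 1 $ i else A $ i $ j) / det A)"
  using cramer[OF assms] by blast
 hence "column s (matrix_inv A) $ r = (\<chi> k. det (\<chi> i j. if j = k then axis s 1 $ i else A $ i $ j) / det A) $ r"
  by simp
 thus ?thesis by (simp add: column_def axis_def cong: if_cong)
qed

lemma continuous_on_det:
 assumes "\<And>i j. continuous_on S (%x. A x $ i $ j)"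
 shows "continuous_on S (%x. det (A x :: 'a::real_normed_field^'n^'n))"
 unfolding det_def by (intro continuous_intros assms)

lemma continuous_on_matrix_inv: "continuous_on {A::real^'n^'n. invertible A} matrix_inv"
proof -
 have "continuous_on {A::real^'n^'n. invertible A}
   (%A. \<chi> r s. det (\<chi> i j. if j = r then (if i = s then 1 else 0) else A $ i $ j) / det A)"
  apply (intro continuous_on_vec_lambda continuous_on_divide continuous_on_det)
  subgoal for r s i j by (cases "j = r") (auto intro!: continuous_intros)
  by (auto simp: invertible_det_nz intro!: continuous_on_component continuous_on_id)
 thus ?thesis
  by (rule continuous_on_eq) (auto simp: invertible_det_nz vec_eq_iff matrix_inv_component)
qed

lemma open_invertible: "open {A::real^'n^'n. invertible A}"
proof -
 have "open ((%A::real^'n^'n. det A) -` (-{0}))"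
  by (intro open_vimage continuous_on_det continuous_intros)
 also have "(%A::real^'n^'n. det A) -` (-{0}) = {A. invertible A}" by (auto simp: invertible_det_nz)
 finally show ?thesis .
qed

lemma isCont_matrix_inv: "invertible A ==> isCont matrix_inv (A::real^'n^'n)"
 using continuous_on_matrix_inv open_invertible continuous_on_eq_continuous_at by blast

lemma matrix_inv_singular: "\<not> invertible A ==> matrix_inv (A::'a::semiring_1^'n^'n) = (SOME B. False)"
 unfolding matrix_inv_def invertible_def by (rule arg_cong[where f=Eps]) auto

text \<open>On singular matrices \<open>matrix_inv\<close> is an unspecified constant, so it is still measurable.\<close>

lemma borel_measurable_matrix_inv [measurable]:
 "(matrix_inv :: real^'n^'n => _) \<in> borel_measurable borel"
proof -
 have "(%A::real^'n^'n. if A \<in> {A. invertible A} then matrix_inv A else (SOME B. False)) \<in> borel_measurable borel"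
  by (rule borel_measurable_continuous_on_if[OF borel_open[OF open_invertible] continuous_on_matrix_inv
   continuous_on_const])
 also have "(%A::real^'n^'n. if A \<in> {A. invertible A} then matrix_inv A else (SOME B. False)) = matrix_inv"
  by (auto simp: matrix_inv_singular fun_eq_iff)
 finally show ?thesis .
qed

section \<open>Linear recursions and their impulse responses\<close>

definition lagsum :: "nat => (nat => real^'d^'d) => (nat => real^'d) => nat => real^'d" where
 "lagsum k a x t = (\<Sum>i\<in>{i. 1 <= i \<and> i <= k \<and> i <= t}. a i *v x (t - i))"

text \<open>
 With \<open>a\<^sub>0 = 0\<close> these are the coefficients of the inverse of \<open>I - \<Sum>a\<^sub>i
 z\<^sup>i\<close>. The recursion makes sense without any stability, so that nearby parameters can be compared before
 they are known to be stable.
\<close>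

fun impulse :: "nat => (nat => real^'d^'d) => nat => real^'d^'d" where
 "impulse k a u = (if u = 0 then mat 1
   else \<Sum>i\<in>{i. 1 <= i \<and> i <= k \<and> i <= u}. a i ** impulse k a (u - i))"

declare impulse.simps [simp del]

lemma impulse_0 [simp]: "impulse k a 0 = mat 1"
 by (simp add: impulse.simps)

lemma finite_lags [simp]: "finite {i. 1 <= i \<and> i <= k \<and> i <= (t::nat)}"
 by (rule finite_subset[of _ "{..t}"]) auto

lemma sum_lags: "(\<Sum>i\<in>{i. 1 <= i \<and> i <= k \<and> i <= (t::nat)}. f i) = (\<Sum>i=0..t. if 1 <= i \<and> i <= k then f i else 0)"
 by (intro sum.mono_neutral_cong_left) auto

lemma sum_lags': "(\<Sum>i\<in>{i. 1 <= i \<and> i <= k \<and> i <= (t::nat)}. f i) = (\<Sum>i=1..k. if i <= t then f i else 0)"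
 by (intro sum.mono_neutral_cong_left) auto

lemma matrix_vector_mult_sum_left: "(\<Sum>i\<in>A. M i) *v (x::real^'n) = (\<Sum>i\<in>A. M i *v x)"
 by (rule linear_sum[OF bounded_linear.linear[OF bounded_bilinear.bounded_linear_left[OF bounded_bilinear_matrix_vector_mult]]])

lemma matrix_vector_mult_sum_right: "(M::real^'n^'m) *v (\<Sum>i\<in>A. x i) = (\<Sum>i\<in>A. M *v x i)"
 by (rule linear_sum[OF bounded_linear.linear[OF bounded_bilinear.bounded_linear_right[OF bounded_bilinear_matrix_vector_mult]]])

text \<open>
 Superposition: the response to an input is the convolution of the input with the impulse response, by associativity
 of the Cauchy product.
\<close>

lemma convolution_solves_recursion:
 fixes y :: "nat => real^'d" and a :: "nat => real^'d^'d" and k :: nat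
 defines "x \<equiv> %t. \<Sum>u=0..t. impulse k a u *v y (t - u)"
 shows "x t = lagsum k a x t + y t"
proof -
 define \<alpha> where "\<alpha> i = (if 1 <= i \<and> i <= k then a i else 0)" for i
 have imp: "impulse k a u = (\<Sum>i=0..u. \<alpha> i ** impulse k a (u - i))" if "u > 0" for u
 proof -
  have "impulse k a u = (\<Sum>i\<in>{i. 1 <= i \<and> i <= k \<and> i <= u}. a i ** impulse k a (u - i))"
   using that by (subst impulse.simps) simp
  also have "... = (\<Sum>i=0..u. \<alpha> i ** impulse k a (u - i))"
   unfolding sum_lags
   by (intro sum.cong refl) (simp add: \<alpha>_def bounded_bilinear.zero_left[OF bounded_bilinear_matrix_matrix_mult])
  finally show ?thesis .
 qed
 have \<alpha>0: "\<alpha> 0 = 0" by (simp add: \<alpha>_def)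
 have "lagsum k a x t = (\<Sum>i=0..t. \<alpha> i *v x (t - i))"
  unfolding lagsum_def sum_lags by (intro sum.cong) (auto simp: \<alpha>_def)
 also have "... = (\<Sum>j=0..t. \<Sum>i=0..t-j. \<alpha> j *v (impulse k a i *v y (t - j - i)))"
  unfolding x_def by (simp add: matrix_vector_mult_sum_right)
 also have "... = (\<Sum>j=0..t. \<Sum>i=0..j. \<alpha> i *v (impulse k a (j - i) *v y (t - j)))"
  by (rule fps_mult_assoc_lemma[symmetric])
 also have "... = (\<Sum>j=0..t. (\<Sum>i=0..j. \<alpha> i ** impulse k a (j - i)) *v y (t - j))"
  by (auto simp: matrix_vector_mult_sum_left matrix_vector_mul_assoc intro!: sum.neutral)
 also have "... = (\<Sum>j=0..t. if j = 0 then 0 else impulse k a j *v y (t - j))"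
  by (intro sum.cong refl) (auto simp: imp \<alpha>0)
 also have "... + y t = x t"
  unfolding x_def by (simp add: sum.atLeast_Suc_atMost)
 finally show ?thesis by simp
qed

lemma lagsum_cong: "(\<And>s. s < t ==> x s = y s) ==> lagsum k a x t = lagsum k a y t"
 unfolding lagsum_def by (intro sum.cong) auto

lemma variation_of_constants:
 fixes x y :: "nat => real^'d"
 assumes "\<And>t. t < n ==> x t = lagsum k a x t + y t" "t < n"
 shows "x t = (\<Sum>u=0..t. impulse k a u *v y (t - u))"
 using assms(2)
proof (induction t rule: less_induct)
 case (less t)
 thus ?case
  using assms(1)[OF less.prems] convolution_solves_recursion[of k a y t]
   lagsum_cong[of t x "%t. \<Sum>u=0..t. impulse k a u *v y (t - u)" k a] by auto
qed

lemma convolution_young_1: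
 fixes w u :: "nat => real"
 assumes "\<And>i. w i >= 0" "\<And>i. u i >= 0" "\<And>n. (\<Sum>i<n. w i) <= W"
 shows "(\<Sum>t<n. \<Sum>i=0..t. w i * u (t - i)) <= W * (\<Sum>t<n. u t)"
proof -
 have "(\<Sum>t<n. \<Sum>i=0..t. w i * u (t - i)) = (\<Sum>i<n. \<Sum>t=i..<n. w i * u (t - i))"
  unfolding sum.Sigma[OF finite_lessThan ballI[OF finite_atLeastAtMost]] sum.Sigma[OF finite_lessThan ballI[OF finite_atLeastLessThan]]
  by (rule sum.reindex_bij_witness[of _ "%(i,t). (t,i)" "%(t,i). (i,t)"]) auto
 also have "... <= (\<Sum>i<n. w i * (\<Sum>t<n. u t))"
 proof (intro sum_mono)
  fix i assume "i \<in> {..<n}"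
  have "(\<Sum>t=i..<n. u (t - i)) = (\<Sum>t<n-i. u t)"
   by (rule sum.reindex_bij_witness[of _ "%t. t + i" "%t. t - i"]) auto
  also have "... <= (\<Sum>t<n. u t)" by (rule sum_mono2) (auto simp: assms)
  finally show "(\<Sum>t=i..<n. w i * u (t - i)) <= w i * (\<Sum>t<n. u t)"
   by (simp add: sum_distrib_left[symmetric] mult_left_mono assms)
 qed
 also have "... <= W * (\<Sum>t<n. u t)"
  by (simp add: sum_distrib_right[symmetric] mult_right_mono assms sum_nonneg)
 finally show ?thesis .
qed

text \<open>
 Young's inequality for exponent \<open>p\<close> implies it for \<open>2 p\<close>: by Cauchy-Schwarz with weights
 \<open>w\<close> the square of a convolution is at most \<open>W\<close> times the convolution of the squares.
\<close>

lemma convolution_young_double: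
 fixes w u :: "nat => real"
 assumes young: "\<And>u::nat => real. (\<And>i. u i >= 0) ==>
   (\<Sum>t<n. (\<Sum>i=0..t. w i * u (t - i)) ^ p) <= W ^ p * (\<Sum>t<n. u t ^ p)"
  and w: "\<And>i. w i >= 0" and u: "\<And>i. u i >= 0" and W: "\<And>n. (\<Sum>i<n. w i) <= W"
 shows "(\<Sum>t<n. (\<Sum>i=0..t. w i * u (t - i)) ^ (2 * p)) <= W ^ (2 * p) * (\<Sum>t<n. u t ^ (2 * p))"
proof -
 have W0: "W >= 0" using W[of 0] by simp
 have "(\<Sum>i=0..t. w i * u (t - i))\<^sup>2 <= W * (\<Sum>i=0..t. w i * (u (t - i))\<^sup>2)" for t
 proof -
  have "(\<Sum>i=0..t. w i * u (t - i))\<^sup>2 = (\<Sum>i=0..t. sqrt (w i) * (sqrt (w i) * u (t - i)))\<^sup>2"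
   using w by (simp add: mult.assoc[symmetric])
  also have "... <= (\<Sum>i=0..t. (sqrt (w i))\<^sup>2) * (\<Sum>i=0..t. (sqrt (w i) * u (t - i))\<^sup>2)"
   by (rule Cauchy_Schwarz_ineq_sum)
  also have "... = (\<Sum>i=0..t. w i) * (\<Sum>i=0..t. w i * (u (t - i))\<^sup>2)"
   using w by (simp add: power_mult_distrib)
  also have "... <= W * (\<Sum>i=0..t. w i * (u (t - i))\<^sup>2)"
   using W[of "Suc t"] w by (intro mult_right_mono sum_nonneg) (auto simp: lessThan_Suc_atMost atLeast0AtMost)
  finally show ?thesis .
 qed
 hence "(\<Sum>t<n. (\<Sum>i=0..t. w i * u (t - i)) ^ (2 * p)) <= (\<Sum>t<n. (W * (\<Sum>i=0..t. w i * (u (t - i))\<^sup>2)) ^ p)"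
  unfolding power_mult by (intro sum_mono power_mono) auto
 also have "... = W ^ p * (\<Sum>t<n. (\<Sum>i=0..t. w i * (u (t - i))\<^sup>2) ^ p)"
  by (subst sum_distrib_left) (simp only: power_mult_distrib)
 also have "... <= W ^ p * (W ^ p * (\<Sum>t<n. ((u t)\<^sup>2) ^ p))"
  using W0 by (intro mult_left_mono young) auto
 finally show ?thesis by (simp add: power_mult[symmetric] power_add[symmetric] mult_2 mult.assoc[symmetric])
qed

lemma convolution_young:
 fixes w u :: "nat => real"
 assumes w: "\<And>i. w i >= 0" and u: "\<And>i. u i >= 0" and W: "\<And>n. (\<Sum>i<n. w i) <= W"
  and p: "p \<in> {1,2,4}"
 shows "(\<Sum>t<n. (\<Sum>i=0..t. w i * u (t - i)) ^ p) <= W ^ p * (\<Sum>t<n. u t ^ p)"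
proof -
 have 1: "(\<Sum>t<n. (\<Sum>i=0..t. w i * u (t - i)) ^ 1) <= W ^ 1 * (\<Sum>t<n. u t ^ 1)"
  if "\<And>i. u i >= 0" for u :: "nat => real"
  using convolution_young_1[OF w that W] by simp
 have 2: "(\<Sum>t<n. (\<Sum>i=0..t. w i * u (t - i)) ^ 2) <= W ^ 2 * (\<Sum>t<n. u t ^ 2)"
  if "\<And>i. u i >= 0" for u :: "nat => real"
  using convolution_young_double[OF 1 w that W] by simp
 have 4: "(\<Sum>t<n. (\<Sum>i=0..t. w i * u (t - i)) ^ 4) <= W ^ 4 * (\<Sum>t<n. u t ^ 4)"
  if "\<And>i. u i >= 0" for u :: "nat => real"
  using convolution_young_double[OF 2 w that W] by simp
 show ?thesis using p 1[OF u] 2[OF u] 4[OF u] by auto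
qed

lemma impulse_perturbation:
 fixes a a' :: "nat => real^'d^'d"
 assumes r: "r > 0" and M: "\<And>n. (\<Sum>u<n. norm (impulse k a u) * r ^ u) <= M"
  and near: "M * (\<Sum>i=1..k. norm (a' i - a i) * r ^ i) <= 1/2"
 shows "norm (impulse k a' u *v v) * r ^ u <= 2 * M * norm v"
proof -
 define x where "x t = impulse k a' t *v v" for t
 define D where "D = (\<Sum>i=1..k. norm (a' i - a i) * r ^ i)"
 define y where "y t = lagsum k (%i. a' i - a i) x t + (if t = 0 then v else 0)" for t
 have M0: "M >= 0" using M[of 0] by simp
 have xrec: "x t = lagsum k a' x t + (if t = 0 then v else 0)" for t
 proof (cases "t = 0")
  case True
  hence no_lags: "{i. 1 <= i \<and> i <= k \<and> i <= t} = {}" by auto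
  show ?thesis unfolding x_def lagsum_def no_lags using True by simp
 next
  case False
  hence "impulse k a' t *v v = (\<Sum>i\<in>{i. 1 <= i \<and> i <= k \<and> i <= t}. a' i ** impulse k a' (t - i)) *v v"
   by (subst impulse.simps) simp
  thus ?thesis using False
   unfolding x_def lagsum_def matrix_vector_mult_sum_left matrix_vector_mul_assoc by simp
 qed
 have lag: "lagsum k a x t + lagsum k (%i. a' i - a i) x t = lagsum k a' x t" for t
  unfolding lagsum_def sum.distrib[symmetric]
  by (intro sum.cong refl) (metis add.commute diff_add_cancel matrix_vector_mult_add_rdistrib)
 have "x t = lagsum k a x t + y t" for t
  unfolding y_def add.assoc[symmetric] lag by (rule xrec)
 hence x: "x t = (\<Sum>u=0..t. impulse k a u *v y (t - u))" for t
  using variation_of_constants[of "Suc t" x k a y t] by blast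
 define \<xi> where "\<xi> t = norm (x t) * r ^ t" for t
 define \<upsilon> where "\<upsilon> t = norm (y t) * r ^ t" for t
 have \<xi>: "\<xi> t <= (\<Sum>u=0..t. (norm (impulse k a u) * r ^ u) * \<upsilon> (t - u))" for t
 proof -
  have "\<xi> t <= (\<Sum>u=0..t. norm (impulse k a u *v y (t - u))) * r ^ t"
   unfolding \<xi>_def x[of t] using r by (intro mult_right_mono norm_sum) auto
  also have "... <= (\<Sum>u=0..t. norm (impulse k a u) * norm (y (t - u))) * r ^ t"
   using r by (intro mult_right_mono sum_mono norm_matrix_vector_mult_le) auto
  also have "... = (\<Sum>u=0..t. (norm (impulse k a u) * r ^ u) * \<upsilon> (t - u))"
   unfolding \<upsilon>_def sum_distrib_right
   by (intro sum.cong refl) (simp add: power_add[symmetric] mult_ac)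
  finally show ?thesis .
 qed
 have up: "\<upsilon> t <= (\<Sum>i=0..t. (if 1 <= i \<and> i <= k then norm (a' i - a i) * r ^ i else 0) * \<xi> (t - i)) + (if t = 0 then norm v else 0)" for t
 proof -
  have "\<upsilon> t <= (norm (lagsum k (%i. a' i - a i) x t) + norm (if t = 0 then v else 0)) * r ^ t"
   unfolding \<upsilon>_def y_def using r by (intro mult_right_mono norm_triangle_ineq) auto
  also have "... = norm (lagsum k (%i. a' i - a i) x t) * r ^ t + (if t = 0 then norm v else 0)"
   by (simp add: distrib_right)
  also have "norm (lagsum k (%i. a' i - a i) x t) <= (\<Sum>i\<in>{i. 1 <= i \<and> i <= k \<and> i <= t}. norm (a' i - a i) * norm (x (t - i)))"
   unfolding lagsum_def by (intro sum_norm_le norm_matrix_vector_mult_le)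
  also have "... * r ^ t = (\<Sum>i\<in>{i. 1 <= i \<and> i <= k \<and> i <= t}. (norm (a' i - a i) * r ^ i) * \<xi> (t - i))"
   unfolding \<xi>_def sum_distrib_right
   by (intro sum.cong refl) (auto simp: power_add[symmetric] mult_ac)
  also have "... = (\<Sum>i=0..t. (if 1 <= i \<and> i <= k then norm (a' i - a i) * r ^ i else 0) * \<xi> (t - i))"
   unfolding sum_lags by (intro sum.cong) auto
  finally show ?thesis using r by (simp add: mult_right_mono)
 qed
 have \<xi>0: "\<xi> t >= 0" and \<upsilon>0: "\<upsilon> t >= 0" for t using r by (auto simp: \<xi>_def \<upsilon>_def)
 have "(\<Sum>t<Suc u. \<xi> t) <= M * (\<Sum>t<Suc u. \<upsilon> t)"
  by (rule order.trans[OF sum_mono[OF \<xi>] convolution_young_1]) (use r M \<upsilon>0 in auto)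
 also have "(\<Sum>t<Suc u. \<upsilon> t) <= D * (\<Sum>t<Suc u. \<xi> t) + norm v"
 proof -
  have "(\<Sum>t<Suc u. \<upsilon> t) <= (\<Sum>t<Suc u. \<Sum>i=0..t. (if 1 <= i \<and> i <= k then norm (a' i - a i) * r ^ i else 0) * \<xi> (t - i))
     + (\<Sum>t<Suc u. if t = 0 then norm v else 0)"
   unfolding sum.distrib[symmetric] by (rule sum_mono[OF up])
  also have "(\<Sum>t<Suc u. \<Sum>i=0..t. (if 1 <= i \<and> i <= k then norm (a' i - a i) * r ^ i else 0) * \<xi> (t - i)) <= D * (\<Sum>t<Suc u. \<xi> t)"
  proof (rule convolution_young_1)
   show "(\<Sum>i<n. if 1 <= i \<and> i <= k then norm (a' i - a i) * r ^ i else 0) <= D" for n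
   proof -
    have "(\<Sum>i<n. if 1 <= i \<and> i <= k then norm (a' i - a i) * r ^ i else 0) = (\<Sum>i\<in>{1..k} \<inter> {..<n}. norm (a' i - a i) * r ^ i)"
     by (intro sum.mono_neutral_cong_right) auto
    also have "... <= D" unfolding D_def using r by (intro sum_mono2) auto
    finally show ?thesis .
   qed
  qed (use r \<xi>0 in auto)
  also have "(\<Sum>t<Suc u. if t = 0 then norm v else 0) = norm v" by (simp add: sum.delta)
  finally show ?thesis by simp
 qed
 finally have "(\<Sum>t<Suc u. \<xi> t) <= M * (D * (\<Sum>t<Suc u. \<xi> t) + norm v)" using M0 by (simp add: mult_left_mono)
 also have "... = M * D * (\<Sum>t<Suc u. \<xi> t) + M * norm v" by (simp add: algebra_simps)
 also have "M * D * (\<Sum>t<Suc u. \<xi> t) <= 1/2 * (\<Sum>t<Suc u. \<xi> t)"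
  using near \<xi>0 by (intro mult_right_mono sum_nonneg) (auto simp: D_def)
 finally have "(\<Sum>t<Suc u. \<xi> t) <= 2 * (M * norm v)" by linarith
 moreover have "\<xi> u <= (\<Sum>t<Suc u. \<xi> t)" using \<xi>0 by (simp add: sum_nonneg)
 ultimately show ?thesis by (simp add: \<xi>_def x_def mult.assoc)
qed

lemma norm_matrix_le_basis:
 fixes A :: "real^'n^'m"
 assumes "\<And>v. norm (A *v v) <= C * norm v"
 shows "norm A <= C * CARD('n)"
proof -
 have "norm A = norm (transpose A)" by simp
 also have "... <= (\<Sum>j\<in>UNIV. norm (transpose A $ j))"
  unfolding norm_vec_def by (rule L2_set_le_sum) auto
 also have "... = (\<Sum>j\<in>UNIV. norm (A *v axis j 1))"
  by (simp add: matrix_vector_mul_component column_def transpose_def matrix_vector_mult_basis)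
 also have "... <= (\<Sum>j\<in>(UNIV::'n set). C * norm (axis j (1::real) :: real^'n))"
  by (intro sum_mono assms)
 finally show ?thesis by (simp add: mult.commute)
qed

section \<open>Stable recursions: geometric decay and Green matrices\<close>

definition lag_poly :: "nat => (nat => real^'d^'d) => (real poly)^'d^'d" where
 "lag_poly k a = mat 1 - (\<Sum>i=1..k. monom_mat (a i) i)"

lemma eval_mat_lag_poly:
 "eval_mat (lag_poly k a) z $ r $ s = (if r = s then 1 else 0) - (\<Sum>i=1..k. of_real (a i $ r $ s) * z ^ i)"
proof -
 have "map_poly complex_of_real (lag_poly k a $ r $ s) =
  (if r = s then 1 else 0) - (\<Sum>i=1..k. monom (of_real (a i $ r $ s)) i)"
  by (intro poly_eqI) (simp add: lag_poly_def coeff_map_poly mat_def monom_mat_def coeff_sum)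
 thus ?thesis by (simp add: eval_mat_def poly_sum poly_monom)
qed

lemma holomorphic_det:
 assumes "\<And>i j. (%z. A z $ i $ j) holomorphic_on S"
 shows "(%z. det (A z :: complex^'n^'n)) holomorphic_on S"
 unfolding det_def by (intro holomorphic_intros assms)

lemma impulse_conv: "impulse k a u $ r $ s = (if u = 0 \<and> r = s then 1 else 0) +
  (\<Sum>i=1..k. \<Sum>l\<in>UNIV. if i <= u then a i $ r $ l * impulse k a (u - i) $ l $ s else 0)"
proof (cases "u = 0")
 case False
 hence "impulse k a u $ r $ s = (\<Sum>i\<in>{i. 1 <= i \<and> i <= k \<and> i <= u}. (a i ** impulse k a (u - i)) $ r $ s)"
  by (subst impulse.simps) (simp only: if_False sum_component)
 also have "... = (\<Sum>i=1..k. if i <= u then (a i ** impulse k a (u - i)) $ r $ s else 0)"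
  by (rule sum_lags')
 also have "... = (\<Sum>i=1..k. \<Sum>l\<in>UNIV. if i <= u then a i $ r $ l * impulse k a (u - i) $ l $ s else 0)"
  by (intro sum.cong refl) (simp add: matrix_matrix_mult_def)
 finally show ?thesis using False by simp
next
 case True
 have "(\<Sum>i=1..k. \<Sum>l\<in>UNIV. if i <= u then a i $ r $ l * impulse k a (u - i) $ l $ s else 0) = 0"
  unfolding True by (intro sum.neutral ballI) auto
 thus ?thesis by (simp add: True mat_def)
qed

text \<open>
 The inverse of the matrix polynomial is holomorphic on a disc of radius larger than 1, because the zero set of the
 determinant is closed and misses the closed unit disc. The recursion identifies its Taylor coefficients with the
 impulse response, and a power series converges absolutely inside its disc.
\<close>

lemma impulse_decay:
 fixes a :: "nat => real^'d^'d"
 assumes stable: "\<And>z. det (eval_mat (lag_poly k a) z) = 0 ==> cmod z > 1"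
 shows "\<exists>r>1. \<exists>M. \<forall>n. (\<Sum>u<n. norm (impulse k a u) * r ^ u) <= M"
proof -
 define M where "M z = eval_mat (lag_poly k a) z" for z
 have M: "M z $ r $ s = (if r = s then 1 else 0) - (\<Sum>i=1..k. of_real (a i $ r $ s) * z ^ i)" for z r s
  unfolding M_def by (rule eval_mat_lag_poly)
 have holM: "(%z. M z $ i $ j) holomorphic_on S" for i j S
  unfolding M by (intro holomorphic_intros)
 have contdet: "continuous_on UNIV (%z. det (M z))"
  by (intro continuous_on_det holomorphic_on_imp_continuous_on holM)
 have "closed ((%z. det (M z)) -` {0})" by (intro closed_vimage contdet closed_singleton)
 moreover have "cball 0 1 \<inter> ((%z. det (M z)) -` {0}) = {}"
  using stable unfolding M_def by (force simp: not_less)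
 ultimately obtain d where d: "d > 0" "\<And>x y. x \<in> cball 0 1 ==> det (M y) = 0 ==> d <= dist x y"
  using separate_compact_closed[of "cball (0::complex) 1" "(%z. det (M z)) -` {0}"] compact_cball by blast
 define R where "R = 1 + d"
 have det: "det (M z) ~= 0" if "z \<in> ball 0 R" for z
 proof
  assume 0: "det (M z) = 0"
  hence z: "cmod z > 1" using stable M_def by auto
  have z0: "z ~= 0" using z by auto
  have "z - z / of_real (cmod z) = of_real (cmod z - 1) * (z / of_real (cmod z))"
   using z by (auto simp: left_diff_distrib diff_divide_distrib)
  hence "cmod (z - z / of_real (cmod z)) = cmod z - 1"
   using z z0 by (simp add: norm_mult norm_divide del: of_real_diff)
  moreover have "d <= dist (z / of_real (cmod z)) z"
   using z z0 by (intro d(2) 0) (auto simp: norm_divide)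
  ultimately show False using that by (simp add: R_def dist_norm norm_minus_commute)
 qed
 define f where "f r s z = det (\<chi> i j. if j = r then (if i = s then 1 else 0) else M z $ i $ j) / det (M z)" for r s z
 have fM: "f r s z = matrix_inv (M z) $ r $ s" if "z \<in> ball 0 R" for r s z
  unfolding f_def by (rule matrix_inv_component[OF det[OF that], symmetric])
 have holf: "f r s holomorphic_on ball 0 R" for r s
  unfolding f_def
 proof (intro holomorphic_on_divide holomorphic_det det holM)
  show "(%z. (\<chi> i j. if j = r then if i = s then 1 else 0 else M z $ i $ j) $ i $ j) holomorphic_on ball 0 R" for i j
   using holM by (cases "j = r") auto
 qed
 define F where "F r s = fps_expansion (f r s) 0" for r s
 have R: "R > 1" using d by (simp add: R_def)
 have expF: "f r s has_fps_expansion F r s" for r s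
  unfolding F_def by (rule has_fps_expansion_fps_expansion[OF open_ball _ holf]) (use R in auto)
 have eq: "f r s z = (if r = s then 1 else 0) + (\<Sum>i=1..k. \<Sum>l\<in>UNIV. of_real (a i $ r $ l) * (z ^ i * f l s z))"
  if z: "z \<in> ball 0 R" for r s z
 proof -
  have "invertible (M z)" using det[OF z] by (simp add: invertible_det_nz)
  from matrix_inv(1)[OF this] have "(\<Sum>l\<in>UNIV. M z $ r $ l * f l s z) = (if r = s then 1 else 0)"
   unfolding vec_eq_iff fM[OF z] by (simp add: matrix_matrix_mult_def mat_def)
  moreover have "(\<Sum>l\<in>UNIV. M z $ r $ l * f l s z) = (\<Sum>l\<in>UNIV. if r = l then f l s z else 0) -
    (\<Sum>l\<in>UNIV. \<Sum>i=1..k. of_real (a i $ r $ l) * (z ^ i * f l s z))"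
   unfolding M sum_subtractf[symmetric]
   by (intro sum.cong refl) (simp add: left_diff_distrib sum_distrib_right mult.assoc)
  ultimately show ?thesis
   by (subst sum.swap) (simp add: algebra_simps)
 qed
 have h1: "(%z. (if r = s then 1 else 0) + (\<Sum>i=1..k. \<Sum>l\<in>UNIV. of_real (a i $ r $ l) * (z ^ i * f l s z)))
   has_fps_expansion fps_const (if r = s then 1 else 0) + (\<Sum>i=1..k. \<Sum>l\<in>UNIV. fps_const (of_real (a i $ r $ l)) * (fps_X ^ i * F l s))" for r s
  by (intro has_fps_expansion_add has_fps_expansion_sum has_fps_expansion_cmult_left
    has_fps_expansion_mult has_fps_expansion_const has_fps_expansion_fps_X_power expF)
 have h2: "eventually (%z. f r s z = (if r = s then 1 else 0) + (\<Sum>i=1..k. \<Sum>l\<in>UNIV. of_real (a i $ r $ l) * (z ^ i * f l s z))) (nhds 0)" for r s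
  using R by (intro eventually_nhds_in_open[of "ball 0 R" 0, THEN eventually_mono] eq) auto
 have "f r s has_fps_expansion fps_const (if r = s then 1 else 0) + (\<Sum>i=1..k. \<Sum>l\<in>UNIV. fps_const (of_real (a i $ r $ l)) * (fps_X ^ i * F l s))" for r s
  by (rule has_fps_expansion_cong[OF h2 refl, THEN iffD2, OF h1])
 from fps_expansion_unique_complex[OF expF this]
 have Feq: "F r s = fps_const (if r = s then 1 else 0) + (\<Sum>i=1..k. \<Sum>l\<in>UNIV. fps_const (of_real (a i $ r $ l)) * (fps_X ^ i * F l s))" for r s .
 have Fnth: "fps_nth (F r s) u = (if u = 0 \<and> r = s then 1 else 0) +
  (\<Sum>i=1..k. \<Sum>l\<in>UNIV. if i <= u then of_real (a i $ r $ l) * fps_nth (F l s) (u - i) else 0)" for r s u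
  by (subst Feq) (auto simp: fps_sum_nth fps_X_power_mult_nth not_less intro!: sum.cong)
 have F: "fps_nth (F r s) u = of_real (impulse k a u $ r $ s)" for r s u
 proof (induction u arbitrary: r rule: less_induct)
  case (less u)
  have "fps_nth (F r s) u = (if u = 0 \<and> r = s then 1 else 0) +
   (\<Sum>i=1..k. \<Sum>l\<in>UNIV. if i <= u then of_real (a i $ r $ l) * of_real (impulse k a (u - i) $ l $ s) else 0)"
   unfolding Fnth[of r s u]
  proof (intro arg_cong2[where f="(+)"] refl sum.cong)
   fix i l assume "i \<in> {1..k}"
   thus "(if i <= u then of_real (a i $ r $ l) * fps_nth (F l s) (u - i) else 0) =
     (if i <= u then complex_of_real (a i $ r $ l) * of_real (impulse k a (u - i) $ l $ s) else 0)"
    using less.IH[of "u - i" l] by auto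
  qed
  also have "... = of_real (impulse k a u $ r $ s)"
   unfolding impulse_conv[of k a u r s]
   by (simp add: of_real_sum if_distrib[where f=complex_of_real] cong: if_cong)
  finally show ?case .
 qed
 define r where "r = 1 + d/3"
 have r: "r > 1" using d by (simp add: r_def)
 have summ: "summable (%u. norm (fps_nth (F i j) u * of_real r ^ u))" for i j
 proof (rule powser_insidea)
  have "(%n. fps_nth (F i j) n * of_real (1 + d/2) ^ n) sums f i j (of_real (1 + d/2))"
  proof (rule has_fps_expansion_imp_sums_complex[OF expF])
   show "f i j holomorphic_on eball 0 R" using holf by simp
   show "ereal (cmod (complex_of_real (1 + d / 2))) < ereal R"
    using d by (simp add: R_def abs_of_pos del: of_real_add)
  qed
  thus "summable (%n. fps_nth (F i j) n * complex_of_real (1 + d/2) ^ n)" by (rule sums_summable)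
  show "cmod (of_real r) < cmod (complex_of_real (1 + d/2))"
   using d by (simp add: r_def del: of_real_add)
 qed
 have "(\<Sum>u<n. norm (impulse k a u) * r ^ u) <= (\<Sum>i\<in>UNIV. \<Sum>j\<in>UNIV. \<Sum>u. norm (fps_nth (F i j) u * of_real r ^ u))" for n
 proof -
  have "norm (impulse k a u) * r ^ u <= (\<Sum>i\<in>UNIV. \<Sum>j\<in>UNIV. norm (fps_nth (F i j) u * of_real r ^ u))" for u
  proof -
   have "norm (impulse k a u) <= (\<Sum>i\<in>UNIV. norm (impulse k a u $ i))"
    unfolding norm_vec_def[of "impulse k a u"] by (rule L2_set_le_sum) auto
   also have "... <= (\<Sum>i\<in>UNIV. \<Sum>j\<in>UNIV. norm (impulse k a u $ i $ j))"
   proof (intro sum_mono)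
    show "norm (impulse k a u $ i) <= (\<Sum>j\<in>UNIV. norm (impulse k a u $ i $ j))" for i
     unfolding norm_vec_def[of "impulse k a u $ i"] by (rule L2_set_le_sum) auto
   qed
   finally have "norm (impulse k a u) * r ^ u <= (\<Sum>i\<in>UNIV. \<Sum>j\<in>UNIV. norm (impulse k a u $ i $ j)) * r ^ u"
    using r by (intro mult_right_mono) auto
   thus ?thesis using r by (simp add: F norm_mult norm_power sum_distrib_right)
  qed
  hence "(\<Sum>u<n. norm (impulse k a u) * r ^ u) <= (\<Sum>u<n. \<Sum>i\<in>UNIV. \<Sum>j\<in>UNIV. norm (fps_nth (F i j) u * of_real r ^ u))"
   by (intro sum_mono)
  also have "... = (\<Sum>i\<in>UNIV. \<Sum>j\<in>UNIV. \<Sum>u<n. norm (fps_nth (F i j) u * of_real r ^ u))"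
   by (subst sum.swap, intro sum.cong refl, rule sum.swap)
  also have "... <= (\<Sum>i\<in>UNIV. \<Sum>j\<in>UNIV. \<Sum>u. norm (fps_nth (F i j) u * of_real r ^ u))"
   by (intro sum_mono sum_le_suminf summ) auto
  finally show ?thesis .
 qed
 thus ?thesis using r by blast
qed

lemma sums_delayed:
 fixes h :: "nat => 'a::real_normed_vector"
 assumes "h sums s" shows "(%u. if i <= u then h (u - i) else 0) sums s"
 using assms sums_iff_shift[of "%u. if i <= u then h (u - i) else 0" i s] by simp

lemma sums_matrixI:
 fixes F :: "nat => complex^'n^'m"
 assumes "\<And>r s. (%u. F u $ r $ s) sums (S $ r $ s)" shows "F sums S"
 unfolding sums_def
proof (intro vec_tendstoI)
 show "(%n. (\<Sum>u<n. F u) $ r $ s) \<longlonglongrightarrow> S $ r $ s" for r s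
  using assms[of r s] by (simp add: sums_def sum_component)
qed

lemma sums_matrixD:
 fixes F :: "nat => complex^'n^'m"
 assumes "F sums S" shows "(%u. F u $ r $ s) sums (S $ r $ s)"
 using tendsto_vec_nth[OF tendsto_vec_nth[OF assms[unfolded sums_def]], of r s] by (simp add: sums_def sum_component)

text \<open>
 The Green matrices are specified through the limit of their power series. The impulse response satisfies this
 specification, and two power series that agree near 0 have equal coefficients.
\<close>

lemma green_lag_poly:
 fixes a :: "nat => real^'d^'d"
 assumes r: "r >= 1" and bd: "\<And>u. norm (impulse k a u) * r ^ u <= C"
 shows "green (lag_poly k a) = impulse k a"
proof -
 define P where "P = lag_poly k a"
 have sums: "(%u. \<chi> r s. complex_of_real (impulse k a u $ r $ s) * z ^ u) sums matrix_inv (eval_mat P z)"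
  if z: "cmod z < 1" for z
 proof -
  define g where "g l s u = complex_of_real (impulse k a u $ l $ s) * z ^ u" for l s u
  define S where "S l s = (\<Sum>u. g l s u)" for l s
  have "summable (g l s)" for l s
  proof (rule summable_norm_cancel, rule summable_comparison_test')
   show "summable (%u. C * cmod z ^ u)" using z by (intro summable_mult summable_geometric) auto
   have "norm (impulse k a u) * 1 <= norm (impulse k a u) * r ^ u" for u
    using r by (intro mult_left_mono one_le_power) auto
   hence "norm (impulse k a u) <= C" for u using bd[of u] order.trans by fastforce
   moreover have "\<bar>impulse k a u $ l $ s\<bar> <= norm (impulse k a u)" for u
    using Finite_Cartesian_Product.norm_nth_le[of "impulse k a u" l]
     component_le_norm_cart[of "impulse k a u $ l" s] by linarith
   ultimately have "\<bar>impulse k a u $ l $ s\<bar> <= C" for u using order.trans by blast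
   thus "norm (norm (g l s u)) <= C * cmod z ^ u" if "u >= 0" for u
    by (simp add: g_def norm_mult norm_power mult_right_mono)
  qed
  hence gS: "g l s sums S l s" for l s unfolding S_def by (rule summable_sums)
  have "(%u. (if u = 0 then (if r = s then 1 else 0) else 0) + (\<Sum>i=1..k. \<Sum>l\<in>UNIV. of_real (a i $ r $ l) * (z ^ i * (if i <= u then g l s (u - i) else 0))))
    sums ((if r = s then 1 else 0) + (\<Sum>i=1..k. \<Sum>l\<in>UNIV. of_real (a i $ r $ l) * (z ^ i * S l s)))" for r s
   using sums_single[of 0 "%_. if r = s then 1 else 0::complex"]
   by (intro sums_add sums_sum sums_mult sums_delayed gS) (simp add: eq_commute)
  moreover have "(if u = 0 then (if r = s then 1 else 0) else 0) + (\<Sum>i=1..k. \<Sum>l\<in>UNIV. of_real (a i $ r $ l) * (z ^ i * (if i <= u then g l s (u - i) else 0))) = g r s u" for r s u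
  proof -
   have "g r s u = (if u = 0 then (if r = s then 1 else 0) else 0) + (\<Sum>i=1..k. \<Sum>l\<in>UNIV. complex_of_real (if i <= u then a i $ r $ l * impulse k a (u - i) $ l $ s else 0) * z ^ u)"
    unfolding g_def impulse_conv[of k a u r s] by (simp add: distrib_right sum_distrib_right)
   also have "... = (if u = 0 then (if r = s then 1 else 0) else 0) + (\<Sum>i=1..k. \<Sum>l\<in>UNIV. of_real (a i $ r $ l) * (z ^ i * (if i <= u then g l s (u - i) else 0)))"
    by (intro arg_cong2[where f="(+)"] refl sum.cong) (auto simp: g_def power_add[symmetric])
   finally show ?thesis by simp
  qed
  ultimately have "g r s sums ((if r = s then 1 else 0) + (\<Sum>i=1..k. \<Sum>l\<in>UNIV. of_real (a i $ r $ l) * (z ^ i * S l s)))" for r s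
   by simp
  with gS have S: "S r s = (if r = s then 1 else 0) + (\<Sum>i=1..k. \<Sum>l\<in>UNIV. of_real (a i $ r $ l) * (z ^ i * S l s))" for r s
   using sums_unique2 by blast
  have "eval_mat P z ** (\<chi> l s. S l s) = mat 1"
  proof -
   have "(\<Sum>l\<in>UNIV. eval_mat P z $ r $ l * S l s) = (\<Sum>l\<in>UNIV. if r = l then S l s else 0) -
    (\<Sum>l\<in>UNIV. \<Sum>i=1..k. of_real (a i $ r $ l) * (z ^ i * S l s))" for r s
    unfolding P_def eval_mat_lag_poly sum_subtractf[symmetric]
    by (intro sum.cong refl) (simp add: left_diff_distrib sum_distrib_right mult.assoc)
   also have "... r s = (if r = s then 1 else 0)" for r s
    by (subst sum.swap) (simp add: S[of r s])
   finally show ?thesis by (simp add: vec_eq_iff matrix_matrix_mult_def mat_def)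
  qed
  hence "matrix_inv (eval_mat P z) = (\<chi> l s. S l s)" by (rule matrix_inv_eqI)
  thus ?thesis
   by (intro sums_matrixI) (use gS in \<open>simp add: g_def[abs_def]\<close>)
 qed
 show ?thesis unfolding green_def P_def[symmetric]
 proof (rule the_equality)
  show "\<forall>z. cmod z < 1 \<longrightarrow> (%u. \<chi> r s. complex_of_real (impulse k a u $ r $ s) * z ^ u) sums matrix_inv (eval_mat P z)"
   using sums by blast
  fix G :: "nat => real^'d^'d" assume G: "\<forall>z. cmod z < 1 \<longrightarrow> (%u. \<chi> r s. complex_of_real (G u $ r $ s) * z ^ u) sums matrix_inv (eval_mat P z)"
  have exp: "(%z. matrix_inv (eval_mat P z) $ r $ s) has_fps_expansion Abs_fps (%u. of_real (H u $ r $ s))"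
   if H: "\<And>z. cmod z < 1 ==> (%u. \<chi> r s. complex_of_real (H u $ r $ s) * z ^ u) sums matrix_inv (eval_mat P z)" for H :: "nat => real^'d^'d" and r s
  proof (rule has_fps_expansionI)
   have "eventually (%z::complex. z \<in> ball 0 1) (nhds 0)" by (intro eventually_nhds_in_open) auto
   thus "\<forall>\<^sub>F u in nhds 0. (%n. fps_nth (Abs_fps (%u. of_real (H u $ r $ s))) n * u ^ n) sums (matrix_inv (eval_mat P u) $ r $ s)"
   proof eventually_elim
    case (elim z)
    thus ?case using sums_matrixD[OF H, of z r s] by simp
   qed
  qed
  show "G = impulse k a"
  proof (rule ext)
   fix u
   have "Abs_fps (%u. complex_of_real (G u $ r $ s)) = Abs_fps (%u. of_real (impulse k a u $ r $ s))" for r s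
    by (rule fps_expansion_unique_complex[OF exp exp]) (use G sums in auto)
   from arg_cong[OF this, of "%F. fps_nth F u"] show "G u = impulse k a u"
    by (simp add: vec_eq_iff)
  qed
 qed
qed

lemma isCont_impulse:
 fixes a :: "'p::t2_space => nat => real^'d^'d"
 assumes "\<And>i. isCont (%\<theta>. a \<theta> i) \<theta>0"
 shows "isCont (%\<theta>. impulse k (a \<theta>) u) \<theta>0"
proof (induction u rule: less_induct)
 case (less u)
 show ?case
 proof (cases "u = 0")
  case False
  have "isCont (%\<theta>. \<Sum>i\<in>{i. 1 <= i \<and> i <= k \<and> i <= u}. a \<theta> i ** impulse k (a \<theta>) (u - i)) \<theta>0"
  proof (intro continuous_sum bounded_bilinear.continuous[OF bounded_bilinear_matrix_matrix_mult] assms)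
   show "isCont (%\<theta>. impulse k (a \<theta>) (u - i)) \<theta>0" if "i \<in> {i. 1 <= i \<and> i <= k \<and> i <= u}" for i
    using that by (intro less.IH) auto
  qed
  moreover have "impulse k (a \<theta>) u = (\<Sum>i\<in>{i. 1 <= i \<and> i <= k \<and> i <= u}. a \<theta> i ** impulse k (a \<theta>) (u - i))" for \<theta>
   using False by (subst impulse.simps) (simp only: if_False)
  ultimately show ?thesis by simp
 qed simp
qed

section \<open>Uniform stability near a parameter\<close>

text \<open>
 The sign turns the moving average polynomial into \<open>I - \<Sum>a\<^sub>i z\<^sup>i\<close>, so that both
 polynomials are instances of \<open>lag_poly\<close>.
\<close>

definition ma_lag :: "nat => ('l::{finite,linorder}, 'd::finite) param => nat => real^'d^'d" where
 "ma_lag p \<theta> j = - ma_coeff p \<theta> j"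

lemma ar_poly_eq: "ar_poly p \<theta> = lag_poly p (ar_coeff \<theta>)"
 by (simp add: ar_poly_def lag_poly_def)

lemma ma_poly_eq: "ma_poly p q \<theta> = lag_poly q (ma_lag p \<theta>)"
 by (simp add: ma_poly_def lag_poly_def ma_lag_def monom_mat_def vec_eq_iff minus_monom[symmetric] sum_negf)

lemma block_diff: "block \<theta> k - block \<theta>' k = block (\<theta> - \<theta>') k"
 by (simp add: block_def unvec_def vec_eq_iff)

lemma norm_block_le: "norm (block (\<theta>::('l::{finite,linorder}, 'd::finite) param) k) <= norm \<theta>"
proof -
 have "(norm (block \<theta> k))\<^sup>2 = (\<Sum>cr\<in>UNIV. (\<theta> $ (block_index k, cr))\<^sup>2)"
  unfolding block_def norm_unvec norm_vec_sq by simp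
 also have "... <= (\<Sum>l\<in>UNIV. \<Sum>cr\<in>UNIV. (\<theta> $ (l, cr))\<^sup>2)"
  by (rule member_le_sum) (auto intro!: sum_nonneg)
 also have "... = (norm \<theta>)\<^sup>2" by (simp add: norm_vec_sq sum_UNIV_prod)
 finally show ?thesis by (rule power2_le_imp_le) simp
qed

lemma norm_ar_coeff_diff: "norm (ar_coeff \<theta> i - ar_coeff \<theta>' i) <= norm (\<theta> - \<theta>')"
 unfolding ar_coeff_def block_diff by (rule norm_block_le)

lemma norm_ma_coeff_diff: "norm (ma_coeff p \<theta> i - ma_coeff p \<theta>' i) <= norm (\<theta> - \<theta>')"
 unfolding ma_coeff_def by (cases "i = 0") (auto simp: block_diff norm_block_le)

lemma norm_ma_lag_diff: "norm (ma_lag p \<theta> i - ma_lag p \<theta>' i) <= norm (\<theta> - \<theta>')"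
 unfolding ma_lag_def using norm_ma_coeff_diff[of p \<theta>' i \<theta>] by (simp add: norm_minus_commute)

definition geom_stable :: "nat => nat => real => real => ('l::{finite,linorder}, 'd::finite) param => bool" where
 "geom_stable p q C \<rho> \<theta> \<longleftrightarrow> (\<forall>u. norm (impulse p (ar_coeff \<theta>) u) <= C * \<rho> ^ u \<and>
   norm (impulse q (ma_lag p \<theta>) u) <= C * \<rho> ^ u)"

text \<open>
 Stability is an open condition: a perturbation of size \<open>\<eta>\<close> adds to the recursion an input of size
 \<open>\<eta>\<close> times the solution, which is absorbed when \<open>\<eta>\<close> times the weighted mass of the
 unperturbed response is small enough.
\<close>

lemma impulse_uniform_decay:
 fixes a :: "'p::real_normed_vector => nat => real^'d^'d"
 assumes stable: "\<And>z. det (eval_mat (lag_poly k (a \<theta>0)) z) = 0 ==> cmod z > 1"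
  and lip: "\<And>\<theta> i. norm (a \<theta> i - a \<theta>0 i) <= norm (\<theta> - \<theta>0)"
 shows "\<exists>\<eta>>0. \<exists>r>1. \<exists>C. \<forall>\<theta>. norm (\<theta> - \<theta>0) <= \<eta> \<longrightarrow> (\<forall>u. norm (impulse k (a \<theta>) u) <= C / r ^ u)"
proof -
 obtain r M where r: "r > 1" and M: "\<And>n. (\<Sum>u<n. norm (impulse k (a \<theta>0) u) * r ^ u) <= M"
  using impulse_decay[OF stable] by blast
 have M0: "M >= 0" using M[of 0] by simp
 define S where "S = (\<Sum>i=1..k. r ^ i)"
 have S0: "S >= 0" using r by (auto simp: S_def intro!: sum_nonneg)
 define \<eta> where "\<eta> = 1 / (2 * (M * S + 1))"
 have \<eta>: "\<eta> > 0" using M0 S0 by (simp add: \<eta>_def add_nonneg_pos)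
 have "norm (impulse k (a \<theta>) u) <= (2 * M * CARD('d)) / r ^ u" if \<theta>: "norm (\<theta> - \<theta>0) <= \<eta>" for \<theta> u
 proof -
  have "(\<Sum>i=1..k. norm (a \<theta> i - a \<theta>0 i) * r ^ i) <= (\<Sum>i=1..k. \<eta> * r ^ i)"
   using r by (intro sum_mono mult_right_mono order.trans[OF lip \<theta>]) auto
  also have "... = \<eta> * S" by (simp add: S_def sum_distrib_left)
  finally have "M * (\<Sum>i=1..k. norm (a \<theta> i - a \<theta>0 i) * r ^ i) <= M * (\<eta> * S)" using M0 by (rule mult_left_mono)
  also have "... = (M * S) / (2 * (M * S + 1))" by (simp add: \<eta>_def)
  also have "... <= 1/2" using mult_nonneg_nonneg[OF M0 S0] by (simp add: divide_simps)
  finally have near: "M * (\<Sum>i=1..k. norm (a \<theta> i - a \<theta>0 i) * r ^ i) <= 1/2" .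
  have "norm (impulse k (a \<theta>) u *v v) <= (2 * M / r ^ u) * norm v" for v
   using impulse_perturbation[OF _ M near, of u v] r by (simp add: field_simps)
  from norm_matrix_le_basis[OF this] show ?thesis by (simp add: field_simps)
 qed
 with \<eta> r show ?thesis by blast
qed

lemma geom_stable_neighbourhood:
 fixes \<theta>0 :: "('l::{finite,linorder}, 'd::finite) param"
 assumes "\<theta>0 \<in> varma_params p q"
 shows "\<exists>\<eta>>0. \<exists>\<rho>>0. \<rho> < 1 \<and> (\<exists>C>0. \<forall>\<theta>. norm (\<theta> - \<theta>0) <= \<eta> \<longrightarrow> geom_stable p q C \<rho> \<theta>)"
proof -
 have ar: "det (eval_mat (lag_poly p (ar_coeff \<theta>0)) z) = 0 ==> cmod z > 1"
  and ma: "det (eval_mat (lag_poly q (ma_lag p \<theta>0)) z) = 0 ==> cmod z > 1" for z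
  using assms unfolding varma_params_def ar_poly_eq ma_poly_eq by auto
 obtain \<eta>1 r1 C1 where 1: "\<eta>1 > 0" "r1 > 1" "\<And>\<theta> u. norm (\<theta> - \<theta>0) <= \<eta>1 ==> norm (impulse p (ar_coeff \<theta>) u) <= C1 / r1 ^ u"
  using impulse_uniform_decay[where a=ar_coeff and ?\<theta>0.0=\<theta>0 and k=p, OF ar norm_ar_coeff_diff] by blast
 obtain \<eta>2 r2 C2 where 2: "\<eta>2 > 0" "r2 > 1" "\<And>\<theta> u. norm (\<theta> - \<theta>0) <= \<eta>2 ==> norm (impulse q (ma_lag p \<theta>) u) <= C2 / r2 ^ u"
  using impulse_uniform_decay[where a="ma_lag p" and ?\<theta>0.0=\<theta>0 and k=q, OF ma norm_ma_lag_diff] by blast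
 define \<rho> where "\<rho> = max (1 / r1) (1 / r2)"
 define C where "C = \<bar>C1\<bar> + \<bar>C2\<bar> + 1"
 have \<rho>: "\<rho> > 0" "\<rho> < 1" using 1(2) 2(2) by (auto simp: \<rho>_def less_max_iff_disj)
 have le: "c / r ^ u <= C * \<rho> ^ u" if "c <= C" "r > 1" "1 / r <= \<rho>" for c r and u :: nat
 proof -
  have "c / r ^ u = c * (1 / r) ^ u" by (simp add: power_divide)
  also have "... <= C * \<rho> ^ u" using that by (intro mult_mono power_mono) (auto simp: C_def)
  finally show ?thesis .
 qed
 have "geom_stable p q C \<rho> \<theta>" if "norm (\<theta> - \<theta>0) <= min \<eta>1 \<eta>2" for \<theta>
  unfolding geom_stable_def
 proof (intro allI conjI)
  fix u
  have "C1 / r1 ^ u <= C * \<rho> ^ u" "C2 / r2 ^ u <= C * \<rho> ^ u"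
   by (rule le; use 1(2) 2(2) in \<open>simp add: C_def \<rho>_def\<close>)+
  thus "norm (impulse p (ar_coeff \<theta>) u) <= C * \<rho> ^ u" "norm (impulse q (ma_lag p \<theta>) u) <= C * \<rho> ^ u"
   using 1(3)[of \<theta> u] 2(3)[of \<theta> u] that by linarith+
 qed
 moreover have "C > 0" by (simp add: C_def add_nonneg_pos)
 ultimately show ?thesis using 1(1) 2(1) \<rho> by (intro exI[of _ "min \<eta>1 \<eta>2"]) auto
qed

lemma green_eq_impulse:
 assumes "geom_stable p q C \<rho> \<theta>" "0 < \<rho>" "\<rho> < 1"
 shows "green (ar_poly p \<theta>) = impulse p (ar_coeff \<theta>)" "green (ma_poly p q \<theta>) = impulse q (ma_lag p \<theta>)"
proof -
 have "norm (impulse p (ar_coeff \<theta>) u) * (1/\<rho>) ^ u <= C" "norm (impulse q (ma_lag p \<theta>) u) * (1/\<rho>) ^ u <= C" for u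
  using assms by (auto simp: geom_stable_def power_divide field_simps)
 with green_lag_poly[of "1/\<rho>"] assms(2,3)
 show "green (ar_poly p \<theta>) = impulse p (ar_coeff \<theta>)" "green (ma_poly p q \<theta>) = impulse q (ma_lag p \<theta>)"
  unfolding ar_poly_eq ma_poly_eq by auto
qed

section \<open>Paths and residuals as solutions of recursions\<close>

lemma lag_set_Suc: "{i. 1 <= i \<and> i <= k \<and> i < Suc s} = {i. 1 <= i \<and> i <= k \<and> i <= s}"
 by auto

lemma varma_path_0 [simp]: "varma_path p q \<theta> e 0 = 0" by (simp add: varma_path.simps)
lemma resid_0 [simp]: "resid p q \<theta> e 0 = 0" by (simp add: resid.simps)

lemma varma_path_Suc:
 "varma_path p q \<theta> e (Suc s) = lagsum p (ar_coeff \<theta>) (%s. varma_path p q \<theta> e (Suc s)) s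
   + (e (Suc s) - lagsum q (ma_lag p \<theta>) (%s. e (Suc s)) s)"
proof -
 have "lagsum p (ar_coeff \<theta>) (%s. varma_path p q \<theta> e (Suc s)) s
   = (\<Sum>i\<in>{i. 1 <= i \<and> i <= p \<and> i < Suc s}. ar_coeff \<theta> i *v varma_path p q \<theta> e (Suc s - i))"
  unfolding lagsum_def lag_set_Suc by (intro sum.cong) (auto simp: Suc_diff_le)
 moreover have "- lagsum q (ma_lag p \<theta>) (%s. e (Suc s)) s = (\<Sum>i\<in>{i. 1 <= i \<and> i <= q \<and> i < Suc s}. ma_coeff p \<theta> i *v e (Suc s - i))"
  unfolding lagsum_def lag_set_Suc sum_negf[symmetric] ma_lag_def
  by (intro sum.cong) (auto simp: Suc_diff_le bounded_bilinear.minus_left[OF bounded_bilinear_matrix_vector_mult])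
 ultimately show ?thesis by (subst varma_path.simps) simp
qed

lemma resid_Suc:
 "resid p q \<theta> x (Suc s) = lagsum q (ma_lag p \<theta>) (%s. resid p q \<theta> x (Suc s)) s
   + (x (Suc s) - lagsum p (ar_coeff \<theta>) (%s. x (Suc s)) s)"
proof -
 have "lagsum p (ar_coeff \<theta>) (%s. x (Suc s)) s
   = (\<Sum>i\<in>{i. 1 <= i \<and> i <= p \<and> i < Suc s}. ar_coeff \<theta> i *v x (Suc s - i))"
  unfolding lagsum_def lag_set_Suc by (intro sum.cong) (auto simp: Suc_diff_le)
 moreover have "lagsum q (ma_lag p \<theta>) (%s. resid p q \<theta> x (Suc s)) s = - (\<Sum>i\<in>{i. 1 <= i \<and> i <= q \<and> i < Suc s}. ma_coeff p \<theta> i *v resid p q \<theta> x (Suc s - i))"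
  unfolding lagsum_def lag_set_Suc sum_negf[symmetric] ma_lag_def
  by (intro sum.cong) (auto simp: Suc_diff_le bounded_bilinear.minus_left[OF bounded_bilinear_matrix_vector_mult])
 ultimately show ?thesis by (subst resid.simps) simp
qed

lemma varma_path_cong:
 assumes "\<And>s. 1 <= s ==> s <= t ==> e s = e' s" shows "varma_path p q \<theta> e t = varma_path p q \<theta> e' t"
 using assms
proof (induction t rule: less_induct)
 case (less t)
 show ?case
 proof (cases t)
  case (Suc s)
  have "lagsum p (ar_coeff \<theta>) (%s. varma_path p q \<theta> e (Suc s)) s = lagsum p (ar_coeff \<theta>) (%s. varma_path p q \<theta> e' (Suc s)) s"
   by (intro lagsum_cong less) (auto simp: Suc)
  moreover have "lagsum q (ma_lag p \<theta>) (%s. e (Suc s)) s = lagsum q (ma_lag p \<theta>) (%s. e' (Suc s)) s"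
   by (intro lagsum_cong less) (auto simp: Suc)
  ultimately show ?thesis using less.prems[of t] unfolding Suc varma_path_Suc[of p q \<theta> e s] varma_path_Suc[of p q \<theta> e' s] by simp
 qed simp
qed

lemma resid_cong:
 assumes "\<And>s. 1 <= s ==> s <= t ==> x s = x' s" shows "resid p q \<theta> x t = resid p q \<theta> x' t"
 using assms
proof (induction t rule: less_induct)
 case (less t)
 show ?case
 proof (cases t)
  case (Suc s)
  have "lagsum q (ma_lag p \<theta>) (%s. resid p q \<theta> x (Suc s)) s = lagsum q (ma_lag p \<theta>) (%s. resid p q \<theta> x' (Suc s)) s"
   by (intro lagsum_cong less) (auto simp: Suc)
  moreover have "lagsum p (ar_coeff \<theta>) (%s. x (Suc s)) s = lagsum p (ar_coeff \<theta>) (%s. x' (Suc s)) s"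
   by (intro lagsum_cong less) (auto simp: Suc)
  ultimately show ?thesis using less.prems[of t] unfolding Suc resid_Suc[of p q \<theta> x s] resid_Suc[of p q \<theta> x' s] by simp
 qed simp
qed

lemma resid_varma_path:
 assumes "1 <= t" shows "resid p q \<theta> (varma_path p q \<theta> e) t = e t"
 using assms
proof (induction t rule: less_induct)
 case (less t)
 then obtain s where t: "t = Suc s" by (cases t) auto
 have "lagsum q (ma_lag p \<theta>) (%s. resid p q \<theta> (varma_path p q \<theta> e) (Suc s)) s = lagsum q (ma_lag p \<theta>) (%s. e (Suc s)) s"
  by (intro lagsum_cong less.IH) (auto simp: t)
 thus ?case unfolding t resid_Suc[of p q \<theta> _ s] varma_path_Suc[of p q \<theta> e s] by simp
qed

lemma varma_path_resid:
 assumes "1 <= t" shows "varma_path p q \<theta> (resid p q \<theta> x) t = x t"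
 using assms
proof (induction t rule: less_induct)
 case (less t)
 then obtain s where t: "t = Suc s" by (cases t) auto
 have "lagsum p (ar_coeff \<theta>) (%s. varma_path p q \<theta> (resid p q \<theta> x) (Suc s)) s = lagsum p (ar_coeff \<theta>) (%s. x (Suc s)) s"
  by (intro lagsum_cong less.IH) (auto simp: t)
 thus ?case unfolding t varma_path_Suc[of p q \<theta> _ s] resid_Suc[of p q \<theta> x s] by simp
qed

section \<open>Power sums of residuals\<close>

text \<open>
 The recursions start at time 0, whereas the model counts from 1; \<open>psum\<close> belongs to the first convention
 and \<open>ssq\<close> below to the second.
\<close>

definition psum :: "nat => nat => (nat => real^'d) => real" where
 "psum P n x = (\<Sum>s<n. norm (x s) ^ P)"

lemma psum_nonneg [simp]: "0 <= psum P n x" by (simp add: psum_def sum_nonneg)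

lemma power_add_le: "(a + b) ^ P <= 2 ^ P * (a ^ P + b ^ P)" if "a >= 0" "b >= 0" for a b :: real
proof -
 have "(a + b) ^ P <= (2 * max a b) ^ P" using that by (intro power_mono) auto
 also have "... = 2 ^ P * (max a b) ^ P" by (simp add: power_mult_distrib)
 also have "(max a b) ^ P <= a ^ P + b ^ P" using that by (auto simp: max_def)
 finally show ?thesis by simp
qed

lemma psum_add_le: "psum P n (%s. x s + y s) <= 2 ^ P * (psum P n x + psum P n y)"
proof -
 have "norm (x s + y s) ^ P <= 2 ^ P * (norm (x s) ^ P + norm (y s) ^ P)" for s
  by (rule order.trans[OF power_mono[OF norm_triangle_ineq] power_add_le]) auto
 hence "psum P n (%s. x s + y s) <= (\<Sum>s<n. 2 ^ P * (norm (x s) ^ P + norm (y s) ^ P))"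
  unfolding psum_def by (rule sum_mono)
 thus ?thesis by (simp add: psum_def sum_distrib_left[symmetric] sum.distrib)
qed

lemma psum_diff_le: "psum P n (%s. x s - y s) <= 2 ^ P * (psum P n x + psum P n y)"
 using psum_add_le[of P n x "%s. - y s"] by (simp add: psum_def)

lemma psum_convolution_le:
 assumes "\<And>s. s < n ==> norm (z s) <= (\<Sum>u=0..s. w u * norm (y (s - u)))"
  and "\<And>u. w u >= 0" "\<And>n. (\<Sum>u<n. w u) <= W" "P \<in> {1,2,4}"
 shows "psum P n z <= W ^ P * psum P n y"
proof -
 have "psum P n z <= (\<Sum>s<n. (\<Sum>u=0..s. w u * norm (y (s - u))) ^ P)"
  unfolding psum_def using assms(1) by (intro sum_mono power_mono) auto
 also have "... <= W ^ P * psum P n y"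
  unfolding psum_def by (rule convolution_young) (use assms in auto)
 finally show ?thesis .
qed

lemma psum_solution_le:
 assumes x: "\<And>s. s < n ==> x s = lagsum k a x s + y s"
  and imp: "\<And>u. norm (impulse k a u) <= C * \<rho> ^ u" and \<rho>: "0 < \<rho>" "\<rho> < 1" and "C >= 0" and P: "P \<in> {1,2,4}"
 shows "psum P n x <= (C / (1 - \<rho>)) ^ P * psum P n y"
proof (rule psum_convolution_le[OF _ _ _ P])
 show "norm (x s) <= (\<Sum>u=0..s. (C * \<rho> ^ u) * norm (y (s - u)))" if "s < n" for s
 proof -
  have "norm (x s) <= (\<Sum>u=0..s. norm (impulse k a u *v y (s - u)))"
   by (subst variation_of_constants[OF x that]) (auto intro: norm_sum)
  also have "... <= (\<Sum>u=0..s. (C * \<rho> ^ u) * norm (y (s - u)))"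
   by (intro sum_mono order.trans[OF norm_matrix_vector_mult_le] mult_right_mono imp) auto
  finally show ?thesis .
 qed
 show "(\<Sum>u<n. C * \<rho> ^ u) <= C / (1 - \<rho>)" for n
 proof -
  have "(\<Sum>u<n. \<rho> ^ u) <= (\<Sum>u. \<rho> ^ u)" using \<rho> by (intro sum_le_suminf summable_geometric) auto
  also have "... = 1 / (1 - \<rho>)" using \<rho> by (simp add: suminf_geometric)
  finally show ?thesis using \<open>C >= 0\<close> mult_left_mono[of "(\<Sum>u<n. \<rho> ^ u)" "1 / (1 - \<rho>)" C] by (simp add: sum_distrib_left)
 qed
qed (use \<rho> \<open>C >= 0\<close> in auto)

lemma psum_lagsum_le:
 assumes a: "\<And>i. i >= 1 ==> norm (a i) <= D" and D: "D >= 0" and P: "P \<in> {1,2,4}"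
 shows "psum P n (lagsum k a x) <= (k * D) ^ P * psum P n x"
proof (rule psum_convolution_le[OF _ _ _ P])
 show "norm (lagsum k a x s) <= (\<Sum>u=0..s. (if 1 <= u \<and> u <= k then D else 0) * norm (x (s - u)))" for s
 proof -
  have "norm (lagsum k a x s) <= (\<Sum>i\<in>{i. 1 <= i \<and> i <= k \<and> i <= s}. norm (a i *v x (s - i)))"
   unfolding lagsum_def by (rule norm_sum)
  also have "... <= (\<Sum>i\<in>{i. 1 <= i \<and> i <= k \<and> i <= s}. D * norm (x (s - i)))"
   by (intro sum_mono order.trans[OF norm_matrix_vector_mult_le] mult_right_mono a) auto
  also have "... = (\<Sum>u=0..s. (if 1 <= u \<and> u <= k then D else 0) * norm (x (s - u)))"
   unfolding sum_lags by (intro sum.cong) auto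
  finally show ?thesis .
 qed
 show "(\<Sum>u<n. if 1 <= u \<and> u <= k then D else 0) <= k * D" for n
 proof -
  have "(\<Sum>u<n. if 1 <= u \<and> u <= k then D else 0) = (\<Sum>u\<in>{1..k}\<inter>{..<n}. D)"
   by (intro sum.mono_neutral_cong_right) auto
  also have "... <= (\<Sum>u\<in>{1..k}. D)" using D by (intro sum_mono2) auto
  finally show ?thesis by simp
 qed
qed (use D in auto)

lemma varma_path_psum_le:
 assumes st: "geom_stable p q C \<rho> \<theta>" and \<rho>: "0 < \<rho>" "\<rho> < 1" and C: "C >= 0" and P: "P \<in> {1,2,4}"
  and D: "norm \<theta> <= D"
 shows "psum P n (%s. varma_path p q \<theta> e (Suc s)) <= (C / (1 - \<rho>)) ^ P * (2 ^ P * (1 + (q * D) ^ P)) * psum P n (%s. e (Suc s))"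
proof -
 have D0: "D >= 0" using D norm_ge_zero order.trans by blast
 have "psum P n (%s. varma_path p q \<theta> e (Suc s)) <= (C / (1 - \<rho>)) ^ P * psum P n (%s. e (Suc s) - lagsum q (ma_lag p \<theta>) (%s. e (Suc s)) s)"
  using st by (intro psum_solution_le[OF varma_path_Suc] \<rho> C P) (auto simp: geom_stable_def)
 also have "psum P n (%s. e (Suc s) - lagsum q (ma_lag p \<theta>) (%s. e (Suc s)) s) <= 2 ^ P * (psum P n (%s. e (Suc s)) + (q * D) ^ P * psum P n (%s. e (Suc s)))"
  using norm_block_le[of \<theta>] D order.trans
  by (intro order.trans[OF psum_diff_le] mult_left_mono add_left_mono psum_lagsum_le P D0)
    (auto simp: ma_lag_def ma_coeff_def)
 finally show ?thesis using C \<rho> by (simp add: algebra_simps mult_right_mono)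
qed

lemma resid_psum_le:
 assumes st: "geom_stable p q C \<rho> \<theta>" and \<rho>: "0 < \<rho>" "\<rho> < 1" and C: "C >= 0" and P: "P \<in> {1,2,4}"
  and D: "norm \<theta> <= D"
 shows "psum P n (%s. resid p q \<theta> x (Suc s)) <= (C / (1 - \<rho>)) ^ P * (2 ^ P * (1 + (p * D) ^ P)) * psum P n (%s. x (Suc s))"
proof -
 have D0: "D >= 0" using D norm_ge_zero order.trans by blast
 have "psum P n (%s. resid p q \<theta> x (Suc s)) <= (C / (1 - \<rho>)) ^ P * psum P n (%s. x (Suc s) - lagsum p (ar_coeff \<theta>) (%s. x (Suc s)) s)"
  using st by (intro psum_solution_le[OF resid_Suc] \<rho> C P) (auto simp: geom_stable_def)
 also have "psum P n (%s. x (Suc s) - lagsum p (ar_coeff \<theta>) (%s. x (Suc s)) s) <= 2 ^ P * (psum P n (%s. x (Suc s)) + (p * D) ^ P * psum P n (%s. x (Suc s)))"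
  using norm_block_le[of \<theta>] D order.trans
  by (intro order.trans[OF psum_diff_le] mult_left_mono add_left_mono psum_lagsum_le P D0)
    (auto simp: ar_coeff_def)
 finally show ?thesis using C \<rho> by (simp add: algebra_simps mult_right_mono)
qed

text \<open>
 The difference of two residual sequences solves the recursion of the first parameter, with an input that is linear in
 the difference of the parameters.
\<close>

lemma resid_diff_psum_le:
 assumes st: "geom_stable p q C \<rho> \<theta>" "geom_stable p q C \<rho> \<theta>'" and \<rho>: "0 < \<rho>" "\<rho> < 1" and C: "C >= 0" and P: "P \<in> {1,2,4}"
  and D: "norm \<theta>' <= D"
 shows "psum P n (%s. resid p q \<theta> x (Suc s) - resid p q \<theta>' x (Suc s)) <=
   (C / (1 - \<rho>)) ^ P * (2 ^ P * (q ^ P * ((C / (1 - \<rho>)) ^ P * (2 ^ P * (1 + (p * D) ^ P))) + p ^ P)) * norm (\<theta> - \<theta>') ^ P * psum P n (%s. x (Suc s))"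
proof -
 define Z where "Z s = resid p q \<theta> x (Suc s)" for s
 define Z' where "Z' s = resid p q \<theta>' x (Suc s)" for s
 define X where "X s = x (Suc s)" for s
 define K where "K = (C / (1 - \<rho>)) ^ P * (2 ^ P * (1 + (p * D) ^ P))"
 have Z: "Z s = lagsum q (ma_lag p \<theta>) Z s + (X s - lagsum p (ar_coeff \<theta>) X s)"
  and Z': "Z' s = lagsum q (ma_lag p \<theta>') Z' s + (X s - lagsum p (ar_coeff \<theta>') X s)" for s
  unfolding Z_def[abs_def] Z'_def[abs_def] X_def[abs_def] by (rule resid_Suc)+
 define y where "y s = lagsum q (%i. ma_lag p \<theta> i - ma_lag p \<theta>' i) Z' s - lagsum p (%i. ar_coeff \<theta> i - ar_coeff \<theta>' i) X s" for s
 have l1: "lagsum k a (%s. z s - z' s) s = lagsum k a z s - lagsum k a z' s" for k a s and z z' :: "nat => real^'b"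
  unfolding lagsum_def by (simp add: matrix_vector_mult_diff_distrib sum_subtractf)
 have l2: "lagsum k (%i. a i - b i) z s = lagsum k a z s - lagsum k b z s" for k a b s and z :: "nat => real^'b"
  unfolding lagsum_def by (simp add: matrix_vector_mult_diff_rdistrib sum_subtractf)
 have rec: "Z s - Z' s = lagsum q (ma_lag p \<theta>) (%s. Z s - Z' s) s + y s" for s
 proof -
  have "z - z' = lz - l1 + ((l1 - lz') - (ax - ax'))"
   if "z = lz + (x - ax)" "z' = lz' + (x - ax')" for z z' lz l1 lz' x ax ax' :: "real^'b"
   unfolding that by simp
  from this[OF Z[of s] Z'[of s]] show ?thesis unfolding l1 y_def l2 .
 qed
 have "psum P n (%s. Z s - Z' s) <= (C / (1 - \<rho>)) ^ P * psum P n y"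
  using st by (intro psum_solution_le[OF rec] \<rho> C P) (auto simp: geom_stable_def)
 also have "psum P n y <= 2 ^ P * ((q * norm (\<theta> - \<theta>')) ^ P * (K * psum P n X) + (p * norm (\<theta> - \<theta>')) ^ P * psum P n X)"
 proof -
  have "psum P n (lagsum q (%i. ma_lag p \<theta> i - ma_lag p \<theta>' i) Z') <= (q * norm (\<theta> - \<theta>')) ^ P * psum P n Z'"
   by (intro psum_lagsum_le norm_ma_lag_diff P) auto
  also have "psum P n Z' <= K * psum P n X"
   unfolding Z'_def[abs_def] X_def[abs_def] K_def by (rule resid_psum_le[OF st(2) \<rho> C P D])
  finally have "psum P n (lagsum q (%i. ma_lag p \<theta> i - ma_lag p \<theta>' i) Z') <= (q * norm (\<theta> - \<theta>')) ^ P * (K * psum P n X)"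
   by (simp add: mult_left_mono)
  moreover have "psum P n (lagsum p (%i. ar_coeff \<theta> i - ar_coeff \<theta>' i) X) <= (p * norm (\<theta> - \<theta>')) ^ P * psum P n X"
   by (intro psum_lagsum_le norm_ar_coeff_diff P) auto
  ultimately show ?thesis unfolding y_def[abs_def]
   by (intro order.trans[OF psum_diff_le] mult_left_mono add_mono) auto
 qed
 also have "... = 2 ^ P * (q ^ P * K + p ^ P) * norm (\<theta> - \<theta>') ^ P * psum P n X"
  by (simp add: power_mult_distrib algebra_simps)
 finally show ?thesis using C \<rho> unfolding Z_def Z'_def X_def K_def by (simp add: mult.assoc mult_left_mono)
qed

definition ssq :: "nat => nat => (nat => real^'d) => real" where
 "ssq P n x = (\<Sum>t=1..n. norm (x t) ^ P)"

lemma psum_eq_ssq: "psum P n (%s. x (Suc s)) = ssq P n x"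
 unfolding psum_def ssq_def by (rule sum.reindex_bij_witness[of _ "%t. t - 1" Suc]) auto

lemma ssq_nonneg [simp]: "0 <= ssq P n x"
 by (simp add: ssq_def sum_nonneg)

lemma ssq_cong: "(\<And>t. 1 <= t ==> t <= n ==> x t = y t) ==> ssq P n x = ssq P n y"
 unfolding ssq_def by (intro sum.cong) auto

text \<open>
 Residuals at nearby parameters are comparable in every norm that is needed, uniformly in the sample size, because the
 sample can be recovered from the residuals at any one of the parameters.
\<close>

lemma varma_uniform_bounds:
 fixes \<theta>0 :: "('l::{finite,linorder}, 'd::finite) param"
 assumes "\<theta>0 \<in> varma_params p q"
 obtains \<eta> \<rho> C K where "\<eta> > 0" "0 < \<rho>" "\<rho> < 1" "C > 0" "K > 0"
  "\<And>\<theta>. norm (\<theta> - \<theta>0) <= \<eta> ==> geom_stable p q C \<rho> \<theta>"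
  "\<And>\<theta>1 \<theta>2 P n x. norm (\<theta>1 - \<theta>0) <= \<eta> ==> norm (\<theta>2 - \<theta>0) <= \<eta> ==> P \<in> {1,2,4} ==>
    ssq P n (resid p q \<theta>2 x) <= K * ssq P n (resid p q \<theta>1 x)"
  "\<And>\<theta>1 \<theta>2 \<theta>3 P n x. norm (\<theta>1 - \<theta>0) <= \<eta> ==> norm (\<theta>2 - \<theta>0) <= \<eta> ==> norm (\<theta>3 - \<theta>0) <= \<eta> ==> P \<in> {1,2,4} ==>
    ssq P n (%t. resid p q \<theta>2 x t - resid p q \<theta>3 x t) <= K * norm (\<theta>2 - \<theta>3) ^ P * ssq P n (resid p q \<theta>1 x)"
proof -
 obtain \<eta> \<rho> C where \<eta>: "\<eta> > 0" and \<rho>: "0 < \<rho>" "\<rho> < 1" and C: "C > 0"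
  and st: "\<And>\<theta>. norm (\<theta> - \<theta>0) <= \<eta> ==> geom_stable p q C \<rho> \<theta>"
  using geom_stable_neighbourhood[OF assms] by blast
 define D where "D = norm \<theta>0 + \<eta>"
 have D: "norm \<theta> <= D" if "norm (\<theta> - \<theta>0) <= \<eta>" for \<theta>
  using that norm_triangle_ineq[of "\<theta> - \<theta>0" \<theta>0] by (simp add: D_def)
 define Kp where "Kp P = (C / (1 - \<rho>)) ^ P * (2 ^ P * (1 + (q * D) ^ P))" for P :: nat
 define Kr where "Kr P = (C / (1 - \<rho>)) ^ P * (2 ^ P * (1 + (p * D) ^ P))" for P :: nat
 define Kd where "Kd P = (C / (1 - \<rho>)) ^ P * (2 ^ P * (real q ^ P * ((C / (1 - \<rho>)) ^ P * (2 ^ P * (1 + (p * D) ^ P))) + real p ^ P))" for P :: nat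
 have D0: "D >= 0" using \<eta> by (simp add: D_def)
 have nonneg: "Kp P >= 0" "Kr P >= 0" "Kd P >= 0" for P
  unfolding Kp_def Kr_def Kd_def using C \<rho> D0 by auto
 define K where "K = 1 + (\<Sum>P\<in>{1,2,4}. Kr P * Kp P + Kd P * Kp P)"
 have K: "Kr P * Kp P <= K" "Kd P * Kp P <= K" if "P \<in> {1,2,4}" for P
  using that nonneg mult_nonneg_nonneg[OF nonneg(2) nonneg(1)] mult_nonneg_nonneg[OF nonneg(3) nonneg(1)]
  unfolding K_def by (auto simp: add_nonneg_nonneg add_increasing add_increasing2)
 have x: "ssq P n x <= Kp P * ssq P n (resid p q \<theta>1 x)" if "norm (\<theta>1 - \<theta>0) <= \<eta>" "P \<in> {1,2,4}" for P n x \<theta>1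
 proof -
  have "ssq P n x = ssq P n (varma_path p q \<theta>1 (resid p q \<theta>1 x))"
   by (rule ssq_cong) (simp add: varma_path_resid)
  also have "... <= Kp P * ssq P n (resid p q \<theta>1 x)"
   unfolding psum_eq_ssq[symmetric] Kp_def
   using that st C \<rho> D by (intro varma_path_psum_le) auto
  finally show ?thesis .
 qed
 show ?thesis
 proof (rule that[OF \<eta> \<rho> C _ st])
  show "K > 0" unfolding K_def using nonneg by (intro add_pos_nonneg sum_nonneg add_nonneg_nonneg mult_nonneg_nonneg) auto
  fix \<theta>1 \<theta>2 :: "('l, 'd) param" and P n x
  assume 1: "norm (\<theta>1 - \<theta>0) <= \<eta>" and 2: "norm (\<theta>2 - \<theta>0) <= \<eta>" and P: "P \<in> {1,2,4::nat}"
  have "ssq P n (resid p q \<theta>2 x) <= Kr P * ssq P n x"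
   unfolding psum_eq_ssq[symmetric] Kr_def using st C \<rho> D 2 P by (intro resid_psum_le) auto
  also have "... <= Kr P * (Kp P * ssq P n (resid p q \<theta>1 x))"
   by (intro mult_left_mono x 1 P nonneg)
  also have "... <= K * ssq P n (resid p q \<theta>1 x)"
   using K(1)[OF P] by (simp add: mult.assoc[symmetric] mult_right_mono)
  finally show "ssq P n (resid p q \<theta>2 x) <= K * ssq P n (resid p q \<theta>1 x)" .
  fix \<theta>3 :: "('l, 'd) param" assume 3: "norm (\<theta>3 - \<theta>0) <= \<eta>"
  have "ssq P n (%t. resid p q \<theta>2 x t - resid p q \<theta>3 x t) <= Kd P * norm (\<theta>2 - \<theta>3) ^ P * ssq P n x"
   unfolding psum_eq_ssq[symmetric] Kd_def using st C \<rho> D 2 3 P by (intro resid_diff_psum_le) auto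
  also have "... <= Kd P * norm (\<theta>2 - \<theta>3) ^ P * (Kp P * ssq P n (resid p q \<theta>1 x))"
   by (intro mult_left_mono x 1 P nonneg mult_nonneg_nonneg) auto
  also have "... = (Kd P * Kp P) * (norm (\<theta>2 - \<theta>3) ^ P * ssq P n (resid p q \<theta>1 x))" by (simp add: mult_ac)
  also have "... <= K * (norm (\<theta>2 - \<theta>3) ^ P * ssq P n (resid p q \<theta>1 x))"
   using K(2)[OF P] by (intro mult_right_mono) auto
  finally show "ssq P n (%t. resid p q \<theta>2 x t - resid p q \<theta>3 x t) <= K * norm (\<theta>2 - \<theta>3) ^ P * ssq P n (resid p q \<theta>1 x)"
   by (simp add: mult.assoc)
 qed
qed

section \<open>Decay and continuity of the matrices \<open>c\<^sub>i\<close>\<close>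

text \<open>
 The blocks of \<open>c_mat\<close> as functions of arbitrary sequences in place of the Green matrices: estimates and
 continuity are proved for impulse responses, which are given by a recursion.
\<close>

definition c_ar_with :: "(nat => real^'d^'d) => (nat => real^'d^'d) => nat => nat => ('l::{finite,linorder}, 'd::finite) param => nat => nat =>
  real^('d \<times> 'd)^('d \<times> 'd)" where
 "c_ar_with G H p q \<theta> i r =
   (\<Sum>j\<in>{j. j + r <= i}. \<Sum>k\<in>{k. k <= q \<and> k + j + r <= i}.
    kron (G (i - j - k - r) ** ma_coeff p \<theta> k) (transpose (H j)))"

definition c_block_with :: "(nat => real^'d^'d) => (nat => real^'d^'d) => nat => nat => ('l::{finite,linorder}, 'd::finite) param => nat => nat =>
  real^('d \<times> 'd)^('d \<times> 'd)" where
 "c_block_with G H p q \<theta> i k = (if k <= p then c_ar_with G H p q \<theta> i k else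
   kron (mat 1) (transpose (if k - p <= i then H (i - (k - p)) else 0)))"

lemma c_mat_eq: "c_mat p q \<theta> i = (\<chi> lr. c_block_with (green (ar_poly p \<theta>)) (green (ma_poly p q \<theta>)) p q \<theta> i (card {..fst lr}) $ snd lr)"
 unfolding c_mat_def c_block_with_def c_ar_with_def c_ar_block_def c_ma_block_def Let_def by simp

lemma c_mat_eq_impulse:
 assumes "geom_stable p q C \<rho> \<theta>" "0 < \<rho>" "\<rho> < 1"
 shows "c_mat p q \<theta> i = (\<chi> lr. c_block_with (impulse p (ar_coeff \<theta>)) (impulse q (ma_lag p \<theta>)) p q \<theta> i (card {..fst lr}) $ snd lr)"
 unfolding c_mat_eq green_eq_impulse[OF assms] by simp

lemma norm_stacked_le:
 fixes F :: "'l::finite => real^'n^'m"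
 shows "norm ((\<chi> lr. F (fst lr) $ snd lr) :: real^'n^('l \<times> 'm)) <= (\<Sum>l\<in>UNIV. norm (F l))"
proof -
 have "(norm ((\<chi> lr. F (fst lr) $ snd lr) :: real^'n^('l \<times> 'm)))\<^sup>2 = (\<Sum>l\<in>UNIV. (norm (F l))\<^sup>2)"
  unfolding norm_vec_sq[of "\<chi> lr. F (fst lr) $ snd lr"] by (simp add: sum_UNIV_prod norm_vec_sq[symmetric])
 also have "... = (L2_set (%l. norm (F l)) UNIV)\<^sup>2"
  unfolding L2_set_def by (simp add: sum_nonneg)
 finally have "norm ((\<chi> lr. F (fst lr) $ snd lr) :: real^'n^('l \<times> 'm)) = L2_set (%l. norm (F l)) UNIV"
  by simp
 also have "... <= (\<Sum>l\<in>UNIV. norm (F l))" by (rule L2_set_le_sum) auto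
 finally show ?thesis .
qed

lemma card_atMost_pos: "1 <= card {..l::'l::{finite,linorder}}"
 by (metis One_nat_def Suc_leI atMost_iff card_gt_0_iff empty_iff finite order_refl)

lemma card_atMost_le: "card {..l::'l::{finite,linorder}} <= CARD('l)"
 by (intro card_mono) auto

lemma geom_index_le:
 fixes \<rho> :: real
 assumes "0 < \<rho>" "\<rho> < 1" "v <= u + w" shows "\<rho> ^ u <= \<rho> ^ v / \<rho> ^ w"
proof -
 have "\<rho> ^ (u + w) <= \<rho> ^ v" using assms by (intro power_decreasing) auto
 thus ?thesis using assms by (simp add: power_add field_simps)
qed

lemma norm_c_block_le:
 fixes \<theta> :: "('l::{finite,linorder}, 'd::finite) param"
 assumes st: "geom_stable p q C \<rho> \<theta>" and \<rho>: "0 < \<rho>" "\<rho> < 1" and C: "C > 0"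
  and D: "norm \<theta> <= D" and k: "k <= p + q"
 shows "norm (c_block_with (impulse p (ar_coeff \<theta>)) (impulse q (ma_lag p \<theta>)) p q \<theta> i k)
   <= (real q + 1) * (norm (mat 1 :: real^'d^'d) + D) * (C * C + C) / \<rho> ^ (p + q) * ((real i + 1) * \<rho> ^ i)"
proof -
 define N where "N = norm (mat 1 :: real^'d^'d)"
 have D0: "D >= 0" using D norm_ge_zero order.trans by blast
 have N: "N >= 0" by (simp add: N_def)
 have B: "norm (ma_coeff p \<theta> j) <= N + D" for j
  using norm_block_le[of \<theta> "p+j"] D D0 N by (cases "j = 0") (auto simp: ma_coeff_def N_def intro!: add_increasing)
 have imp: "norm (impulse p (ar_coeff \<theta>) u) <= C * \<rho> ^ u" "norm (impulse q (ma_lag p \<theta>) u) <= C * \<rho> ^ u" for u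
  using st by (auto simp: geom_stable_def)
 show ?thesis
 proof (cases "k <= p")
  case True
  have summand: "norm (kron (impulse p (ar_coeff \<theta>) (i - j - k' - k) ** ma_coeff p \<theta> k') (transpose (impulse q (ma_lag p \<theta>) j)))
    <= C * C * (N + D) * (\<rho> ^ i / \<rho> ^ (p + q))" if "k' <= q" "k' + j + k <= i" for j k'
  proof -
   have "norm (kron (impulse p (ar_coeff \<theta>) (i - j - k' - k) ** ma_coeff p \<theta> k') (transpose (impulse q (ma_lag p \<theta>) j)))
     <= ((C * \<rho> ^ (i - j - k' - k)) * (N + D)) * (C * \<rho> ^ j)"
    unfolding norm_kron norm_transpose
    using C \<rho> N D0 by (intro mult_mono order.trans[OF norm_matrix_matrix_mult_le] imp B) auto
   also have "... = C * C * (N + D) * \<rho> ^ ((i - j - k' - k) + j)" by (simp add: power_add)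
   also have "... <= C * C * (N + D) * (\<rho> ^ i / \<rho> ^ (p + q))"
    using that True C N D0 by (intro mult_left_mono geom_index_le \<rho>) auto
   finally show ?thesis .
  qed
  have "norm (c_ar_with (impulse p (ar_coeff \<theta>)) (impulse q (ma_lag p \<theta>)) p q \<theta> i k)
   <= (\<Sum>j\<in>{j. j + k <= i}. \<Sum>k'\<in>{k'. k' <= q \<and> k' + j + k <= i}. C * C * (N + D) * (\<rho> ^ i / \<rho> ^ (p + q)))"
   unfolding c_ar_with_def by (intro sum_norm_le summand) auto
  also have "... <= (\<Sum>j\<in>{j. j + k <= i}. (real q + 1) * (C * C * (N + D) * (\<rho> ^ i / \<rho> ^ (p + q))))"
  proof (intro sum_mono)
   fix j
   have "card {k'. k' <= q \<and> k' + j + k <= i} <= card {..q}" by (intro card_mono) auto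
   hence "real (card {k'. k' <= q \<and> k' + j + k <= i}) <= real q + 1" by simp
   moreover have "0 <= C * C * (N + D) * (\<rho> ^ i / \<rho> ^ (p + q))" using C N D0 \<rho> by simp
   ultimately show "(\<Sum>k'\<in>{k'. k' <= q \<and> k' + j + k <= i}. C * C * (N + D) * (\<rho> ^ i / \<rho> ^ (p + q))) <= (real q + 1) * (C * C * (N + D) * (\<rho> ^ i / \<rho> ^ (p + q)))"
    unfolding sum_constant by (rule mult_right_mono)
  qed
  also have "... <= (real i + 1) * ((real q + 1) * (C * C * (N + D) * (\<rho> ^ i / \<rho> ^ (p + q))))"
  proof -
   have "card {j. j + k <= i} <= card {..i}" by (intro card_mono) auto
   hence "real (card {j. j + k <= i}) <= real i + 1" by simp
   thus ?thesis unfolding sum_constant using C N D0 \<rho> by (intro mult_right_mono) auto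
  qed
  also have "... = (real q + 1) * (N + D) * (C * C) / \<rho> ^ (p + q) * ((real i + 1) * \<rho> ^ i)" by simp
  also have "... <= (real q + 1) * (N + D) * (C * C + C) / \<rho> ^ (p + q) * ((real i + 1) * \<rho> ^ i)"
   using C N D0 \<rho> by (intro mult_right_mono divide_right_mono mult_left_mono) auto
  finally show ?thesis using True by (simp add: c_block_with_def N_def)
 next
  case False
  have "norm (c_block_with (impulse p (ar_coeff \<theta>)) (impulse q (ma_lag p \<theta>)) p q \<theta> i k) <= N * (C * (\<rho> ^ i / \<rho> ^ (p + q)))"
  proof (cases "k - p <= i")
   case True
   have "norm (impulse q (ma_lag p \<theta>) (i - (k - p))) <= C * \<rho> ^ (i - (k - p))" by (rule imp)
   also have "... <= C * (\<rho> ^ i / \<rho> ^ (p + q))" using k C by (intro mult_left_mono geom_index_le \<rho>) auto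
   finally have "N * norm (impulse q (ma_lag p \<theta>) (i - (k - p))) <= N * (C * (\<rho> ^ i / \<rho> ^ (p + q)))"
    using N by (rule mult_left_mono)
   thus ?thesis using False True unfolding c_block_with_def N_def by simp
  next
   case nle: False
   have "transpose (0::real^'d^'d) = 0" by (simp add: transpose_def vec_eq_iff)
   thus ?thesis using False nle N C \<rho>
    by (simp add: c_block_with_def bounded_bilinear.zero_right[OF bounded_bilinear_kron])
  qed
  also have "... = 1 * N * C / \<rho> ^ (p + q) * (1 * \<rho> ^ i)" by simp
  also have "... <= (real q + 1) * (N + D) * (C * C + C) / \<rho> ^ (p + q) * ((real i + 1) * \<rho> ^ i)"
   using C N D0 \<rho> by (intro mult_mono divide_right_mono) auto
  finally show ?thesis by (simp add: N_def)
 qed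
qed

lemma c_mat_uniform_decay:
 fixes \<theta>0 :: "('l::{finite,linorder}, 'd::finite) param"
 assumes pq: "p + q = CARD('l)" and \<rho>: "0 < \<rho>" "\<rho> < 1" and C: "C > 0"
  and st: "\<And>\<theta>. norm (\<theta> - \<theta>0) <= \<eta> ==> geom_stable p q C \<rho> \<theta>" and \<eta>: "\<eta> > 0"
 obtains K where "K > 0" "\<And>\<theta> i. norm (\<theta> - \<theta>0) <= \<eta> ==> norm (c_mat p q \<theta> i) <= K * ((real i + 1) * \<rho> ^ i)"
proof -
 define D where "D = norm \<theta>0 + \<eta>"
 define K where "K = (real q + 1) * (norm (mat 1 :: real^'d^'d) + D) * (C * C + C) / \<rho> ^ (p + q)"
 have D: "norm \<theta> <= D" if "norm (\<theta> - \<theta>0) <= \<eta>" for \<theta>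
  using that norm_triangle_ineq[of "\<theta> - \<theta>0" \<theta>0] by (simp add: D_def)
 have K: "K > 0" unfolding K_def D_def using C \<eta> \<rho>
  by (intro divide_pos_pos mult_pos_pos add_nonneg_pos) (auto simp: add_nonneg_pos)
 have "norm (c_mat p q \<theta> i) <= (CARD('l) * K) * ((real i + 1) * \<rho> ^ i)" if \<theta>: "norm (\<theta> - \<theta>0) <= \<eta>" for \<theta> i
 proof -
  have "norm (c_mat p q \<theta> i) <= (\<Sum>l\<in>(UNIV::'l set). norm (c_block_with (impulse p (ar_coeff \<theta>)) (impulse q (ma_lag p \<theta>)) p q \<theta> i (card {..l})))"
   unfolding c_mat_eq_impulse[OF st[OF \<theta>] \<rho>] by (rule norm_stacked_le)
  also have "... <= (\<Sum>l\<in>(UNIV::'l set). K * ((real i + 1) * \<rho> ^ i))"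
   unfolding K_def using card_atMost_le pq by (intro sum_mono norm_c_block_le st \<theta> \<rho> C D) auto
  finally show ?thesis by simp
 qed
 moreover have "CARD('l) * K > 0" using K by simp
 ultimately show ?thesis using that by blast
qed

lemma isCont_c_mat:
 fixes \<theta>0 :: "('l::{finite,linorder}, 'd::finite) param"
 assumes \<rho>: "0 < \<rho>" "\<rho> < 1"
  and st: "\<And>\<theta>. norm (\<theta> - \<theta>0) <= \<eta> ==> geom_stable p q C \<rho> \<theta>" and \<eta>: "\<eta> > 0"
 shows "isCont (%\<theta>. c_mat p q \<theta> i) \<theta>0"
proof -
 have block: "isCont (%\<theta>::('l, 'd) param. block \<theta> k) \<theta>0" for k
  unfolding isCont_def
 proof (rule LIM_zero_cancel)
  have "((%\<theta>. norm (\<theta> - \<theta>0)) \<longlongrightarrow> 0) (at \<theta>0)" by (intro tendsto_norm_zero LIM_zero tendsto_ident_at)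
  hence "((%\<theta>. norm (block \<theta> k - block \<theta>0 k)) \<longlongrightarrow> 0) (at \<theta>0)"
   by (rule Lim_null_comparison[rotated]) (auto simp: block_diff norm_block_le)
  thus "((%\<theta>. block \<theta> k - block \<theta>0 k) \<longlongrightarrow> 0) (at \<theta>0)" by (rule tendsto_norm_zero_cancel)
 qed
 have ma: "isCont (%\<theta>::('l, 'd) param. ma_coeff p \<theta> k) \<theta>0" for k
  unfolding ma_coeff_def using block by (cases "k = 0") auto
 have ar: "isCont (%\<theta>::('l, 'd) param. ar_coeff \<theta> k) \<theta>0" for k
  unfolding ar_coeff_def by (rule block)
 have mal: "isCont (%\<theta>::('l, 'd) param. ma_lag p \<theta> k) \<theta>0" for k
  unfolding ma_lag_def by (intro continuous_minus ma)
 have tr: "isCont (%\<theta>. transpose (F \<theta> :: real^'d^'d)) \<theta>0" if "isCont F \<theta>0" for F :: "('l, 'd) param => _"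
  using that unfolding isCont_def transpose_def by (intro tendsto_vec_lambda tendsto_vec_nth)
 have blk: "isCont (%\<theta>. c_block_with (impulse p (ar_coeff \<theta>)) (impulse q (ma_lag p \<theta>)) p q \<theta> i k) \<theta>0" for k
 proof (cases "k <= p")
  case True
  thus ?thesis unfolding c_block_with_def c_ar_with_def
   by (simp, intro continuous_sum bounded_bilinear.continuous[OF bounded_bilinear_kron]
     bounded_bilinear.continuous[OF bounded_bilinear_matrix_matrix_mult] tr isCont_impulse ma ar mal)
 next
  case False
  thus ?thesis unfolding c_block_with_def
   by (cases "k - p <= i") (simp_all add: bounded_bilinear.continuous[OF bounded_bilinear_kron] tr isCont_impulse mal)
 qed
 have "isCont (%\<theta>. (\<chi> lr. c_block_with (impulse p (ar_coeff \<theta>)) (impulse q (ma_lag p \<theta>)) p q \<theta> i (card {..fst lr}) $ snd lr) :: real^('d \<times> 'd)^('l \<times> 'd \<times> 'd)) \<theta>0"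
  using blk unfolding isCont_def by (intro tendsto_vec_lambda tendsto_vec_nth)
 moreover have "eventually (%\<theta>. c_mat p q \<theta> i = (\<chi> lr. c_block_with (impulse p (ar_coeff \<theta>)) (impulse q (ma_lag p \<theta>)) p q \<theta> i (card {..fst lr}) $ snd lr)) (nhds \<theta>0)"
  unfolding eventually_nhds_metric
  by (rule exI[of _ \<eta>]) (auto simp: \<eta> dist_norm intro!: c_mat_eq_impulse[OF st \<rho>])
 ultimately show ?thesis using isCont_cong by force
qed

section \<open>Projections as sums of squares\<close>

text \<open>
 Gram-Schmidt. The last hypothesis says that \<open>M\<close> is its own Gram matrix with respect to \<open>B\<close>,
 that is, the kernel of a projection. Splitting off the normalised row of a nonzero diagonal entry leaves such a
 kernel with fewer nonzero diagonal entries. The third conclusion keeps the new vector orthogonal to the ones found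
 before.
\<close>

lemma orthonormal_decomposition:
 fixes B :: "('i => real) => ('i => real) => real" and M :: "'i => 'i => real"
 assumes I: "finite I"
  and diff: "\<And>x y z. B (%i. x i - y i) z = B x z - B y z"
  and scale: "\<And>c x y. B (%i. c * x i) y = c * B x y"
  and sym: "\<And>x y. B x y = B y x"
  and nonneg: "\<And>x. B x x >= 0" and def: "\<And>x i. B x x = 0 ==> i \<in> I ==> x i = 0"
  and M: "\<And>i j. i \<in> I ==> j \<in> I ==> B (M i) (M j) = M i j"
 shows "\<exists>K u. (\<forall>i\<in>I. \<forall>j\<in>I. M i j = (\<Sum>k<K. u k i * u k j)) \<and>
  (\<forall>k<K::nat. \<forall>l<K. B (u k) (u l) = (if k = l then 1 else 0)) \<and>
  (\<forall>w. (\<forall>i\<in>I. B (M i) w = 0) \<longrightarrow> (\<forall>k<K. B (u k) w = 0))"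
 using M
proof (induction "card {i\<in>I. M i i ~= 0}" arbitrary: M rule: less_induct)
 case (less M)
 note M = less.prems
 have zero: "M i j = 0" if "M i i = 0" "i \<in> I" "j \<in> I" for i j
  using M[of i i] that def by auto
 show ?case
 proof (cases "\<exists>i\<in>I. M i i ~= 0")
  case False
  hence "M i j = 0" if "i \<in> I" "j \<in> I" for i j using zero that by blast
  thus ?thesis by (intro exI[of _ 0]) auto
 next
  case True
  then obtain i0 where i0: "i0 \<in> I" "M i0 i0 ~= 0" by blast
  have pos: "M i0 i0 > 0" using M[OF i0(1) i0(1)] nonneg[of "M i0"] i0(2) by simp
  define s where "s = sqrt (M i0 i0)"
  have s: "s > 0" "s * s = M i0 i0" using pos by (auto simp: s_def)
  define u where "u i = inverse s * M i0 i" for i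
  have Mu: "B (M i) u = u i" if "i \<in> I" for i
  proof -
   have "B (M i) u = inverse s * B (M i0) (M i)"
    unfolding u_def using sym scale[of "inverse s" "M i0" "M i"] by metis
   thus ?thesis using M[OF i0(1) that] by (simp add: u_def)
  qed
  have uu: "B u u = 1"
  proof -
   have "B u u = inverse s * B (M i0) u" unfolding u_def[abs_def] by (rule scale)
   also have "... = inverse s * (inverse s * (s * s))" unfolding Mu[OF i0(1)] by (simp add: u_def s(2))
   also have "... = 1" using s(1) by (simp add: field_simps)
   finally show ?thesis .
  qed
  define M' where "M' i j = M i j - u i * u j" for i j
  have BM'r: "B (M' i) w = B (M i) w - u i * B u w" for i w
   unfolding M'_def[abs_def] diff scale ..
  have M': "B (M' i) (M' j) = M' i j" if "i \<in> I" "j \<in> I" for i j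
  proof -
   have "B (M i) (M' j) = B (M j) (M i) - u j * B u (M i)" by (subst sym) (rule BM'r)
   moreover have "B u (M i) = u i" by (subst sym) (rule Mu[OF that(1)])
   moreover have "B u (M' j) = u j - u j" by (subst sym) (simp add: BM'r Mu[OF that(2)] uu)
   ultimately have "B (M' i) (M' j) = (M j i - u j * u i) - u i * (u j - u j)"
    unfolding BM'r[of i] M[OF that(2,1)] by simp
   also have "M j i = M i j" using M[OF that] M[OF that(2,1)] sym[of "M i" "M j"] by simp
   finally show ?thesis unfolding M'_def[of i j] by simp
  qed
  have "M' i i = 0" if "i \<in> I" "M i i = 0" for i
  proof -
   have "M i i0 = 0" using zero[OF that(2,1) i0(1)] .
   hence "u i = 0" using M[OF i0(1) that(1)] M[OF that(1) i0(1)] sym[of "M i0" "M i"] by (simp add: u_def)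
   thus ?thesis using that by (simp add: M'_def)
  qed
  moreover have M'0: "M' i0 i0 = 0"
  proof -
   have "u i0 * u i0 = inverse s * inverse s * (M i0 i0 * (s * s))" by (simp add: u_def s(2))
   also have "... = M i0 i0" using s(1) by (simp add: field_simps)
   finally show ?thesis by (simp add: M'_def)
  qed
  ultimately have "{i\<in>I. M' i i ~= 0} \<subset> {i\<in>I. M i i ~= 0}" using i0 by auto
  hence "card {i\<in>I. M' i i ~= 0} < card {i\<in>I. M i i ~= 0}" using I by (intro psubset_card_mono) auto
  from less.hyps[OF this M'] obtain K :: nat and v :: "nat => 'i => real" where
   v: "(\<forall>i\<in>I. \<forall>j\<in>I. M' i j = (\<Sum>k<K. v k i * v k j)) \<and>
    (\<forall>k<K. \<forall>l<K. B (v k) (v l) = (if k = l then 1 else 0)) \<and>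
    (\<forall>w. (\<forall>i\<in>I. B (M' i) w = 0) \<longrightarrow> (\<forall>k<K. B (v k) w = 0))"
   by blast
  have v1: "\<And>i j. i \<in> I ==> j \<in> I ==> M' i j = (\<Sum>k<K. v k i * v k j)"
   and v2: "\<And>k l. k < K ==> l < K ==> B (v k) (v l) = (if k = l then 1 else 0)"
   and v3: "\<And>w k. (\<And>i. i\<in>I ==> B (M' i) w = 0) ==> k<K ==> B (v k) w = 0"
   using v by blast+
  have vu: "B (v k) u = 0" if "k < K" for k
   using that by (intro v3) (simp_all add: BM'r Mu uu)
  define w where "w k = (if k = K then u else v k)" for k
  have "M i j = (\<Sum>k<Suc K. w k i * w k j)" if "i \<in> I" "j \<in> I" for i j
   using v1[OF that] by (simp add: w_def M'_def)
  moreover have "B (w k) (w l) = (if k = l then 1 else 0)" if "k < Suc K" "l < Suc K" for k l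
   using that v2[of k l] vu[of k] vu[of l] sym[of u "v l"] uu by (auto simp: w_def less_Suc_eq)
  moreover have "B (w k) z = 0" if z: "\<And>i. i \<in> I ==> B (M i) z = 0" and k: "k < Suc K" for z k
  proof -
   have "B u z = 0" unfolding u_def[abs_def] scale using z i0 by simp
   moreover from this have "B (v k) z = 0" if "k < K" using that z by (intro v3) (simp_all add: BM'r)
   ultimately show ?thesis using k by (auto simp: w_def less_Suc_eq)
  qed
  ultimately show ?thesis by (intro exI[of _ "Suc K"] exI[of _ w]) blast
 qed
qed

section \<open>A Bezout identity for left coprime matrix polynomials\<close>

lemma det_replace_column_diff:
 fixes L :: "'a::comm_ring_1^'n^'n"
 shows "det (\<chi> i k. if k = j then v$i - c * L$i$j else L$i$k) = det (\<chi> i k. if k = j then v$i else L$i$k) - c * det L"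
proof -
 have tr: "det (\<chi> i k. F k $ i) = det (\<chi> k. F k)" for F :: "'n => 'a^'n"
 proof -
  have "(\<chi> i k. F k $ i) = transpose (\<chi> k. F k)" by (simp add: transpose_def)
  thus ?thesis by (simp only: det_transpose)
 qed
 have "(\<chi> i k. if k = j then v$i - c * L$i$j else L$i$k) = (\<chi> i k. (if k = j then v + (-c) *s column j L else column k L) $ i)"
  by (simp add: vec_eq_iff column_def)
 hence "det (\<chi> i k. if k = j then v$i - c * L$i$j else L$i$k) = det (\<chi> k. if k = j then v + (-c) *s column j L else column k L)"
  by (simp only: tr)
 also have "... = det (\<chi> k. if k = j then v else column k L) + (-c) * det (\<chi> k. if k = j then column j L else column k L)"
  by (simp only: det_row_add det_row_mul)
 also have "(\<chi> k. if k = j then column j L else column k L) = transpose L" by (simp add: vec_eq_iff transpose_def column_def)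
 also have "det (\<chi> k. if k = j then v else column k L) = det (\<chi> i k. (if k = j then v else column k L) $ i)" by (simp only: tr)
 also have "(\<chi> i k. (if k = j then v else column k L) $ i) = (\<chi> i k. if k = j then v$i else L$i$k)"
  by (simp add: vec_eq_iff column_def)
 finally show ?thesis by simp
qed

lemma poly_det: "poly (det M) (t::real) = det (\<chi> i j. poly (M $ i $ j) t)"
proof -
 have "poly (of_int k) t = of_int k" for k by (metis of_int_poly poly_pCons poly_0 mult_zero_right add.right_neutral)
 thus ?thesis unfolding det_def by (simp add: poly_sum poly_prod)
qed

text \<open>
 Cramer's rule over a polynomial ring, by evaluation at the infinitely many points where the determinant does not
 vanish.
\<close>

lemma cramer_poly:
 fixes M :: "(real poly)^'n^'n"
 assumes "det M ~= 0"
 shows "(\<Sum>j\<in>UNIV. M$i$j * det (\<chi> i' k. if k = j then v$i' else M$i'$k)) = det M * v$i"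
proof -
 define P where "P = (\<Sum>j\<in>UNIV. M$i$j * det (\<chi> i' k. if k = j then v$i' else M$i'$k)) - det M * v$i"
 have "poly P t = 0" if t: "poly (det M) t ~= 0" for t
 proof -
  define N where "N = (\<chi> i j. poly (M $ i $ j) t)"
  define b where "b = (\<chi> i. poly (v $ i) t)"
  have d: "det N ~= 0" using t by (simp add: N_def poly_det)
  have e: "poly (det (\<chi> i' k. if k = j then v$i' else M$i'$k)) t = det (\<chi> i' k. if k = j then b$i' else N$i'$k)" for j
   unfolding poly_det by (rule arg_cong[where f=det]) (simp add: vec_eq_iff b_def N_def)
  have "N *v (\<chi> k. det (\<chi> i j. if j = k then b$i else N$i$j) / det N) = b" using cramer[OF d] by blast
  hence "(\<Sum>j\<in>UNIV. N$i$j * (det (\<chi> i' k. if k = j then b$i' else N$i'$k) / det N)) = b$i"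
   by (auto simp: matrix_vector_mult_def vec_eq_iff)
  hence "(\<Sum>j\<in>UNIV. N$i$j * det (\<chi> i' k. if k = j then b$i' else N$i'$k)) = det N * b$i"
   using d by (simp add: sum_divide_distrib[symmetric] field_simps)
  thus ?thesis unfolding P_def by (simp add: poly_sum e) (simp add: N_def b_def poly_det)
 qed
 hence "- {t. poly (det M) t = 0} \<subseteq> {t. poly P t = 0}" by auto
 moreover have "infinite (- {t. poly (det M) t = 0})"
  using poly_roots_finite[OF assms] by (simp add: finite_compl infinite_UNIV_char_0)
 ultimately have "P = 0" using poly_roots_finite finite_subset by blast
 thus ?thesis by (simp add: P_def)
qed

text \<open>
 Among the combinations \<open>A U + B V\<close> with nonzero determinant choose \<open>L\<close> with determinant of
 least degree. For a column \<open>v\<close> of \<open>A\<close> or \<open>B\<close>, Cramer's rule expresses the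
 solution of \<open>L w = v\<close> by quotients of determinants by \<open>det L\<close>; division with remainder
 applied to such a determinant yields another combination of smaller degree, so the remainder is 0. Hence
 \<open>L\<close> is a common left factor and therefore unimodular.
\<close>

lemma left_coprime_bezout:
 fixes A B :: "(real poly)^'n^'n"
 assumes cop: "left_coprime A B" and A: "det A ~= 0"
 shows "\<exists>U V. A ** U + B ** V = mat 1"
proof -
 define P where "P L \<longleftrightarrow> det L ~= 0 \<and> (\<exists>U V. L = A ** U + B ** V)" for L
 have "A = A ** mat 1 + B ** 0"
  by (simp add: vec_eq_iff matrix_mul_rid)
 hence "P A" unfolding P_def using A by blast
 then obtain L where L: "P L" and minL: "\<And>L'. P L' ==> degree (det L) <= degree (det L')"
  using ex_has_least_nat[of P A "%L. degree (det L)"] by blast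
 from L obtain U V where d: "det L ~= 0" and UV: "L = A ** U + B ** V" by (auto simp: P_def)
 define R where "R v j = det (\<chi> i k. if k = j then v$i else L$i$k)" for v :: "(real poly)^'n" and j
 have dvd: "det L dvd R v j" if v: "v = A *v x + B *v y" for v x y j
 proof -
  define c where "c = R v j div det L"
  \<comment> \<open>Column \<open>j\<close> of \<open>L\<close> is replaced by \<open>v\<close> minus \<open>c\<close> times that
   column, so that the determinant becomes the remainder.\<close>
  define L' where "L' = (\<chi> i k. if k = j then v$i - c * L$i$j else L$i$k)"
  have dL': "det L' = R v j mod det L"
   unfolding L'_def det_replace_column_diff R_def[symmetric] c_def by (simp add: minus_div_mult_eq_mod)
  have "L' = A ** (\<chi> i k. if k = j then x$i - c * U$i$j else U$i$k) + B ** (\<chi> i k. if k = j then y$i - c * V$i$j else V$i$k)"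
   unfolding L'_def v
   by (auto simp: vec_eq_iff UV matrix_matrix_mult_def matrix_vector_mult_def sum_subtractf algebra_simps sum_distrib_left)
  hence "det L' = 0 \<or> degree (det L) <= degree (det L')" using minL[of L'] unfolding P_def by blast
  hence "R v j mod det L = 0" using degree_mod_less[OF d, of "R v j"] dL' by auto
  thus ?thesis by auto
 qed
 have solve: "\<exists>w. v = L *v w" if "\<And>j. det L dvd R v j" for v
 proof -
  have "det L * (L *v (\<chi> j. R v j div det L)) $ i = det L * v $ i" for i
  proof -
   have "det L * (L$i$j * (R v j div det L)) = L$i$j * R v j" for j
    using that[of j] by (metis dvd_mult_div_cancel mult.left_commute)
   hence "det L * (L *v (\<chi> j. R v j div det L)) $ i = (\<Sum>j\<in>UNIV. L$i$j * R v j)"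
    unfolding matrix_vector_mult_def vec_lambda_beta sum_distrib_left by (simp only:)
   thus ?thesis using cramer_poly[OF d, of i v] by (simp add: R_def)
  qed
  hence "L *v (\<chi> j. R v j div det L) = v" using d by (simp add: vec_eq_iff)
  thus ?thesis by metis
 qed
 have fact: "\<exists>W. N = L ** W" if "\<And>k j. det L dvd R (column k N) j" for N
 proof -
  have "\<forall>k. \<exists>w. column k N = L *v w" using solve that by blast
  then obtain w where w: "\<And>k. column k N = L *v w k" by metis
  have "N = L ** (\<chi> i k. w k $ i)"
   using w by (simp add: vec_eq_iff column_def matrix_vector_mult_def matrix_matrix_mult_def)
  thus ?thesis by blast
 qed
 have "column k A = A *v axis k 1 + B *v 0" "column k B = A *v 0 + B *v axis k 1" for k
  by (simp_all add: vec_eq_iff column_def matrix_vector_mult_def axis_def if_distrib cong: if_cong)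
 with dvd fact obtain R' S' where "A = L ** R'" "B = L ** S'" by metis
 hence "is_unit (det L)" using cop unfolding left_coprime_def by blast
 then obtain W where W: "mat 1 = L ** W" using fact[of "mat 1"] unit_imp_dvd by blast
 have "A ** (U ** W) + B ** (V ** W) = mat 1"
  unfolding matrix_mul_assoc W UV by (simp add: vec_eq_iff matrix_matrix_mult_def distrib_right sum.distrib)
 thus ?thesis by blast
qed

section \<open>Sequences of matrices under convolution\<close>

text \<open>
 Multiplication of formal power series with matrix coefficients. Matrix polynomials enter through their coefficient
 sequences, so that polynomials and Green matrices can be multiplied with each other.
\<close>

definition cauchy :: "(nat => real^'d^'d) => (nat => real^'d^'d) => nat => real^'d^'d" (infixl "\<odot>" 70) where
 "(F \<odot> G) n = (\<Sum>i=0..n. F i ** G (n - i))"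

definition unit_seq :: "nat => real^'d^'d" where
 "unit_seq n = (if n = 0 then mat 1 else 0)"

lemma matrix_mult_sum_left: "(\<Sum>i\<in>A. M i) ** (N::real^'n^'k) = (\<Sum>i\<in>A. (M i::real^'k^'m) ** N)"
 by (rule linear_sum[OF bounded_linear.linear[OF bounded_bilinear.bounded_linear_left[OF bounded_bilinear_matrix_matrix_mult]]])

lemma matrix_mult_sum_right: "(M::real^'k^'m) ** (\<Sum>i\<in>A. N i) = (\<Sum>i\<in>A. M ** (N i::real^'n^'k))"
 by (rule linear_sum[OF bounded_linear.linear[OF bounded_bilinear.bounded_linear_right[OF bounded_bilinear_matrix_matrix_mult]]])

lemmas matrix_mult_zero [simp] = bounded_bilinear.zero_left[OF bounded_bilinear_matrix_matrix_mult]
 bounded_bilinear.zero_right[OF bounded_bilinear_matrix_matrix_mult]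

lemma cauchy_assoc: "(F \<odot> G) \<odot> H = F \<odot> (G \<odot> H)"
proof (rule ext)
 fix n
 have "((F \<odot> G) \<odot> H) n = (\<Sum>j=0..n. \<Sum>i=0..j. F i ** (G (j - i) ** H (n - j)))"
  by (simp add: cauchy_def matrix_mult_sum_left matrix_mul_assoc)
 also have "... = (\<Sum>j=0..n. \<Sum>i=0..n - j. F j ** (G i ** H (n - j - i)))"
  by (rule fps_mult_assoc_lemma)
 also have "... = (F \<odot> (G \<odot> H)) n"
  by (simp add: cauchy_def matrix_mult_sum_right)
 finally show "((F \<odot> G) \<odot> H) n = (F \<odot> (G \<odot> H)) n" .
qed

lemma cauchy_unit_left [simp]: "unit_seq \<odot> F = F"
proof (rule ext)
 fix n
 have "(unit_seq \<odot> F) n = (\<Sum>i=0..n. if i = 0 then F n else 0)"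
  unfolding cauchy_def by (intro sum.cong) (auto simp: unit_seq_def matrix_mul_lid)
 thus "(unit_seq \<odot> F) n = F n" by (simp add: sum.delta)
qed

lemma cauchy_unit_right [simp]: "F \<odot> unit_seq = F"
proof (rule ext)
 fix n
 have "(F \<odot> unit_seq) n = (\<Sum>i=0..n. if i = n then F n else 0)"
  unfolding cauchy_def by (intro sum.cong) (auto simp: unit_seq_def matrix_mul_rid)
 thus "(F \<odot> unit_seq) n = F n" by (simp add: sum.delta)
qed

lemma cauchy_add_right: "H \<odot> (%n. F n + G n) = (%n. (H \<odot> F) n + (H \<odot> G) n)"
 by (rule ext) (simp add: cauchy_def bounded_bilinear.add_right[OF bounded_bilinear_matrix_matrix_mult] sum.distrib)

lemma cauchy_minus_left: "(%n. - F n) \<odot> H = (%n. - (F \<odot> H) n)"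
 by (rule ext) (simp add: cauchy_def bounded_bilinear.minus_left[OF bounded_bilinear_matrix_matrix_mult] sum_negf)

lemma cauchy_minus_right: "H \<odot> (%n. - F n) = (%n. - (H \<odot> F) n)"
 by (rule ext) (simp add: cauchy_def bounded_bilinear.minus_right[OF bounded_bilinear_matrix_matrix_mult] sum_negf)

lemma cauchy_zero_right [simp]: "F \<odot> (%_. 0) = (%_. 0)"
 by (rule ext) (simp add: cauchy_def)

definition coeff_seq :: "(real poly)^'d^'d => nat => real^'d^'d" where
 "coeff_seq P n = (\<chi> r s. coeff (P $ r $ s) n)"

lemma coeff_seq_mult: "coeff_seq (P ** Q) = coeff_seq P \<odot> coeff_seq Q"
proof (rule ext)
 fix n
 have "(\<Sum>k\<in>UNIV. \<Sum>i\<le>n. coeff (P $ r $ k) i * coeff (Q $ k $ s) (n - i)) =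
  (\<Sum>i=0..n. \<Sum>k\<in>UNIV. coeff (P $ r $ k) i * coeff (Q $ k $ s) (n - i))" for r s
  unfolding atLeast0AtMost by (rule sum.swap)
 thus "coeff_seq (P ** Q) n = (coeff_seq P \<odot> coeff_seq Q) n"
  by (simp add: coeff_seq_def cauchy_def matrix_matrix_mult_def vec_eq_iff coeff_sum coeff_mult)
qed

lemma coeff_seq_add: "coeff_seq (P + Q) n = coeff_seq P n + coeff_seq Q n"
 by (simp add: coeff_seq_def vec_eq_iff)

lemma coeff_seq_one: "coeff_seq (mat 1) = unit_seq"
 by (rule ext) (simp add: coeff_seq_def unit_seq_def vec_eq_iff mat_def)

lemma coeff_seq_lag_poly: "coeff_seq (lag_poly k a) n = (if n = 0 then mat 1 else if n <= k then - a n else 0)"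
proof -
 have "coeff_seq (lag_poly k a) n $ r $ s = (if n = 0 then mat 1 else if n <= k then - a n else 0) $ r $ s" for r s
  by (auto simp: coeff_seq_def lag_poly_def mat_def monom_mat_def coeff_sum sum.delta)
 thus ?thesis by (simp add: vec_eq_iff)
qed

lemma coeff_seq_finite: "\<exists>N. \<forall>n>N. coeff_seq P n = 0"
proof -
 have "coeff_seq P n = 0" if "n > (\<Sum>r\<in>UNIV. \<Sum>s\<in>UNIV. degree (P $ r $ s))" for n
 proof -
  have "degree (P $ r $ s) < n" for r s
  proof -
   have "degree (P $ r $ s) <= (\<Sum>s\<in>UNIV. degree (P $ r $ s))" by (rule member_le_sum) auto
   also have "... <= (\<Sum>r\<in>UNIV. \<Sum>s\<in>UNIV. degree (P $ r $ s))" by (rule member_le_sum) auto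
   finally show ?thesis using that by simp
  qed
  thus ?thesis by (simp add: coeff_seq_def vec_eq_iff coeff_eq_0)
 qed
 thus ?thesis by blast
qed

lemma lag_poly_impulse: "coeff_seq (lag_poly k a) \<odot> impulse k a = unit_seq"
proof (rule ext)
 fix n
 have "(coeff_seq (lag_poly k a) \<odot> impulse k a) n = impulse k a n + (\<Sum>i=1..n. coeff_seq (lag_poly k a) i ** impulse k a (n - i))"
  unfolding cauchy_def by (simp add: sum.atLeast_Suc_atMost coeff_seq_lag_poly matrix_mul_lid)
 also have "(\<Sum>i=1..n. coeff_seq (lag_poly k a) i ** impulse k a (n - i)) = - (\<Sum>i\<in>{i. 1 <= i \<and> i <= k \<and> i <= n}. a i ** impulse k a (n - i))"
  unfolding sum_negf[symmetric]
  by (intro sum.mono_neutral_cong_right) (auto simp: coeff_seq_lag_poly bounded_bilinear.minus_left[OF bounded_bilinear_matrix_matrix_mult])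
 also have "impulse k a n + ... = unit_seq n"
 proof (cases "n = 0")
  case True
  hence no_lags: "{i. 1 <= i \<and> i <= k \<and> i <= n} = {}" by auto
  show ?thesis unfolding no_lags using True by (simp add: unit_seq_def)
 next
  case False
  hence "impulse k a n = (\<Sum>i\<in>{i. 1 <= i \<and> i <= k \<and> i <= n}. a i ** impulse k a (n - i))"
   by (subst impulse.simps) simp
  thus ?thesis using False by (simp add: unit_seq_def)
 qed
 finally show "(coeff_seq (lag_poly k a) \<odot> impulse k a) n = unit_seq n" .
qed

lemma cauchy_cancel_left:
 assumes "F 0 = mat 1" "F \<odot> G = (%_. 0)" shows "G n = 0"
proof (induction n rule: less_induct)
 case (less n)
 have "(F \<odot> G) n = F 0 ** G n + (\<Sum>i=1..n. F i ** G (n - i))"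
  unfolding cauchy_def by (simp add: sum.atLeast_Suc_atMost)
 moreover have "(\<Sum>i=1..n. F i ** G (n - i)) = 0" by (intro sum.neutral) (auto simp: less.IH)
 ultimately show ?case using assms by (simp add: matrix_mul_lid)
qed

lemma impulse_lag_poly: "impulse k a \<odot> coeff_seq (lag_poly k a) = unit_seq"
proof -
 let ?P = "coeff_seq (lag_poly k a)" and ?G = "impulse k a"
 have "?P \<odot> (%n. (?G \<odot> ?P) n + - unit_seq n) = (%n. 0)"
 proof -
  have "?P \<odot> (%n. - unit_seq n) = (%n. - ?P n)"
   using cauchy_minus_right[of ?P unit_seq] by simp
  thus ?thesis unfolding cauchy_add_right cauchy_assoc[symmetric] lag_poly_impulse by (simp add: fun_eq_iff)
 qed
 from cauchy_cancel_left[OF _ this] show ?thesis by (auto simp: coeff_seq_lag_poly fun_eq_iff)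
qed

text \<open>
 With \<open>\<alpha>\<close>, \<open>\<beta>\<close> the two polynomials and \<open>\<kappa> = a
 \<alpha>\<^sup>-\<^sup>1\<close>, the relation reads \<open>\<kappa> \<beta> = - b\<close>. By the Bezout identity
 \<open>\<kappa> = \<kappa> (\<alpha> U + \<beta> V) = a U - b V\<close> is a polynomial. Since \<open>\<kappa>
 \<alpha> = a\<close> has degree at most that of \<open>\<alpha>\<close>, whose leading coefficient is invertible,
 \<open>\<kappa>\<close> is constant; and its constant term is that of \<open>a\<close>, namely 0.
\<close>

lemma coprime_relation_trivial:
 fixes a b :: "nat => real^'d^'d"
 assumes cop: "left_coprime (lag_poly k A) (lag_poly l B)"
  and lead: "k >= 1 ==> det (A k) ~= 0"
  and a0: "a 0 = 0" and ak: "\<And>n. n > k ==> a n = 0" and bl: "\<exists>N. \<forall>n>N. b n = 0"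
  and rel: "\<And>n. (impulse l B \<odot> a \<odot> impulse k A \<odot> coeff_seq (lag_poly l B)) n + (impulse l B \<odot> b) n = 0"
 shows "a n = 0 \<and> b n = 0"
proof -
 let ?\<alpha> = "coeff_seq (lag_poly k A)" and ?\<beta> = "coeff_seq (lag_poly l B)"
 let ?G = "impulse k A" and ?H = "impulse l B"
 define \<kappa> where "\<kappa> = a \<odot> ?G"
 have "?\<beta> \<odot> (%n. (?H \<odot> a \<odot> ?G \<odot> ?\<beta>) n + (?H \<odot> b) n) = (%_. 0)" unfolding rel by simp
 hence ab: "(a \<odot> ?G \<odot> ?\<beta>) n + b n = 0" for n
  unfolding cauchy_add_right cauchy_assoc[symmetric] lag_poly_impulse by (simp add: fun_eq_iff)
 have \<kappa>\<beta>: "\<kappa> \<odot> ?\<beta> = (%n. - b n)" using ab by (simp add: \<kappa>_def fun_eq_iff eq_neg_iff_add_eq_0)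
 have \<kappa>\<alpha>: "\<kappa> \<odot> ?\<alpha> = a" unfolding \<kappa>_def cauchy_assoc impulse_lag_poly by simp
 have "det (lag_poly k A) ~= 0"
 proof
  assume "det (lag_poly k A) = 0"
  hence "poly (det (lag_poly k A)) 0 = 0" by simp
  moreover have "(\<chi> i j. poly (lag_poly k A $ i $ j) 0) = mat 1"
   using coeff_seq_lag_poly[of k A 0] unfolding coeff_seq_def poly_0_coeff_0 by simp
  ultimately show False unfolding poly_det by simp
 qed
 from left_coprime_bezout[OF cop this] obtain U V where "lag_poly k A ** U + lag_poly l B ** V = mat 1" by blast
 hence "coeff_seq (lag_poly k A ** U + lag_poly l B ** V) = unit_seq" by (simp add: coeff_seq_one)
 hence "(%n. (?\<alpha> \<odot> coeff_seq U) n + (?\<beta> \<odot> coeff_seq V) n) = unit_seq"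
  by (simp add: fun_eq_iff coeff_seq_add coeff_seq_mult)
 hence "\<kappa> \<odot> (%n. (?\<alpha> \<odot> coeff_seq U) n + (?\<beta> \<odot> coeff_seq V) n) = \<kappa>" by simp
 then have \<kappa>: "\<kappa> n = (a \<odot> coeff_seq U) n - (b \<odot> coeff_seq V) n" for n
  unfolding cauchy_add_right cauchy_assoc[symmetric] \<kappa>\<alpha> \<kappa>\<beta> cauchy_minus_left by (simp add: fun_eq_iff)
 obtain N1 where N1: "\<And>n. n > N1 ==> coeff_seq U n = 0" using coeff_seq_finite by blast
 obtain N2 where N2: "\<And>n. n > N2 ==> coeff_seq V n = 0" using coeff_seq_finite by blast
 obtain N3 where N3: "\<And>n. n > N3 ==> b n = 0" using bl by blast
 have fin: "(F \<odot> P) n = 0" if F: "\<And>n. n > N ==> F n = 0" and P: "\<And>n. n > N' ==> P n = 0" and n: "n > N + N'" for F P N N' n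
  unfolding cauchy_def
 proof (intro sum.neutral ballI)
  fix i assume "i \<in> {0..n}"
  hence "i > N \<or> n - i > N'" using n by auto
  thus "F i ** P (n - i) = 0" using F P by auto
 qed
 have \<kappa>fin: "\<kappa> n = 0" if "n > k + N1 + N3 + N2" for n
 proof -
  have "(a \<odot> coeff_seq U) n = 0" by (rule fin[of k _ N1]) (use ak N1 that in auto)
  moreover have "(b \<odot> coeff_seq V) n = 0" by (rule fin[of N3 _ N2]) (use N3 N2 that in auto)
  ultimately show ?thesis unfolding \<kappa> by simp
 qed
 have \<kappa>0: "\<kappa> n = 0" for n
 proof (rule ccontr)
  assume "\<kappa> n ~= 0"
  define S where "S = {n. \<kappa> n ~= 0}"
  have "S \<subseteq> {..k + N1 + N3 + N2}" using \<kappa>fin by (force simp: S_def not_less[symmetric])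
  hence S: "finite S" using finite_subset by blast
  have "S ~= {}" using \<open>\<kappa> n ~= 0\<close> by (auto simp: S_def)
  define N where "N = Max S"
  have N: "\<kappa> N ~= 0" "\<And>n. n > N ==> \<kappa> n = 0"
   using Max_in[OF S \<open>S ~= {}\<close>] Max_ge[OF S] unfolding N_def[symmetric] by (auto simp: S_def not_le[symmetric])
  have "\<kappa> 0 = 0" by (simp add: \<kappa>_def cauchy_def a0)
  hence Npos: "N > 0" using N by (cases N) auto
  have "(\<kappa> \<odot> ?\<alpha>) (N + k) = \<kappa> N ** ?\<alpha> k"
  proof -
   have "(\<kappa> \<odot> ?\<alpha>) (N + k) = (\<Sum>i=0..N+k. if i = N then \<kappa> N ** ?\<alpha> k else 0)"
    unfolding cauchy_def
   proof (intro sum.cong refl)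
    fix i assume "i \<in> {0..N+k}"
    hence "i > N \<or> i = N \<or> N + k - i > k" by auto
    thus "\<kappa> i ** ?\<alpha> (N + k - i) = (if i = N then \<kappa> N ** ?\<alpha> k else 0)"
     using N by (auto simp: coeff_seq_lag_poly)
   qed
   thus ?thesis by (simp add: sum.delta)
  qed
  moreover have "(\<kappa> \<odot> ?\<alpha>) (N + k) = 0" unfolding \<kappa>\<alpha> using Npos by (intro ak) auto
  ultimately have 0: "\<kappa> N ** ?\<alpha> k = 0" by simp
  have "invertible (?\<alpha> k)"
  proof (cases "k = 0")
   case False
   hence "invertible (A k)" using lead by (simp add: invertible_det_nz)
   hence "invertible (- A k)" unfolding invertible_def
    by (metis bounded_bilinear.minus_left[OF bounded_bilinear_matrix_matrix_mult]
      bounded_bilinear.minus_right[OF bounded_bilinear_matrix_matrix_mult] minus_minus)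
   thus ?thesis using False by (simp add: coeff_seq_lag_poly)
  qed (simp add: coeff_seq_lag_poly invertible_det_nz)
  hence "\<kappa> N = \<kappa> N ** ?\<alpha> k ** matrix_inv (?\<alpha> k)"
   using matrix_inv(1) by (metis matrix_mul_assoc matrix_mul_rid)
  then show False using 0 N(1) by simp
 qed
 have "a = (%_. 0)" unfolding \<kappa>\<alpha>[symmetric] using \<kappa>0 by (auto simp: cauchy_def fun_eq_iff)
 moreover have "b n = 0" using fun_cong[OF \<kappa>\<beta>, of n] \<kappa>0 by (simp add: cauchy_def)
 ultimately show ?thesis by simp
qed

section \<open>Identifiability\<close>

lemma inj_card_atMost: "inj (%l::'l::{finite,linorder}. card {..l})"
proof (rule linorder_injI)
 show "card {..x} ~= card {..y}" if "x < y" for x y :: 'l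
 proof -
  have "{..x} \<subset> {..y}" using that by auto
  hence "card {..x} < card {..y}" by (intro psubset_card_mono) auto
  thus ?thesis by simp
 qed
qed

lemma bij_card_atMost: "bij_betw (%l::'l::{finite,linorder}. card {..l}) UNIV {1..CARD('l)}"
proof -
 have "(%l::'l. card {..l}) ` UNIV = {1..CARD('l)}"
  by (rule card_subset_eq) (use card_atMost_pos card_atMost_le card_image[OF inj_card_atMost] in auto)
 thus ?thesis using inj_card_atMost by (auto simp: bij_betw_def)
qed

lemma block_index_card: "block_index (card {..l}) = (l::'l::{finite,linorder})"
 unfolding block_index_def using inj_card_atMost by (auto simp: inj_def)

lemma vecm_block: "vecm (block \<tau> (card {..l})) = (\<chi> cr. \<tau> $ (l, cr))"
 by (simp add: block_def block_index_card)

lemma transpose_stacked_mult: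
 fixes F :: "'l::finite => real^'n^'m" and \<tau> :: "real^('l \<times> 'm)"
 shows "transpose ((\<chi> lr. F (fst lr) $ snd lr) :: real^'n^('l \<times> 'm)) *v \<tau> = (\<Sum>l\<in>UNIV. transpose (F l) *v (\<chi> m. \<tau> $ (l, m)))"
 by (simp add: vec_eq_iff matrix_vector_mult_def transpose_def sum_UNIV_prod)

lemma transpose_kron_vecm:
 "transpose (kron G (transpose H)) *v vecm X = vecm (H ** X ** (G::real^'d^'d))"
 for H :: "real^'d^'d"
 unfolding transpose_kron transpose_transpose kron_vecm by simp

lemma transpose_sum: "transpose (\<Sum>i\<in>A. M i) = (\<Sum>i\<in>A. transpose (M i :: real^'n^'m))"
 by (simp add: transpose_def vec_eq_iff)

lemma c_ar_convolution:
 assumes "\<And>r. r \<notin> {1..p} ==> a r = 0"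
  and "\<And>k. k <= q ==> \<beta> k = ma_coeff p \<theta> k" "\<And>k. k > q ==> \<beta> k = 0"
 shows "(\<Sum>r=1..p. transpose (c_ar_with G H p q \<theta> i r) *v vecm (a r)) = vecm ((H \<odot> a \<odot> G \<odot> \<beta>) i)"
proof -
 have reverse: "(\<Sum>k=0..N. G k ** \<beta> (N - k)) = (\<Sum>k=0..N. G (N - k) ** \<beta> k)" for N
  by (rule sum.reindex_bij_witness[of _ "%k. N - k" "%k. N - k"]) auto
 define X where "X j r = H j ** (a r ** (G \<odot> \<beta>) (i - j - r))" for j r
 have lv: "vecm (\<Sum>i\<in>A. f i) = (\<Sum>i\<in>A. vecm (f i))" for A :: "nat set" and f :: "nat => real^'a^'a"
  by (rule linear_sum[OF linear_vecm])
 have X: "(\<Sum>k\<in>{k. k <= q \<and> k + j + r <= i}. H j ** a r ** (G (i - j - k - r) ** ma_coeff p \<theta> k)) = X j r" if "j + r <= i" for j r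
 proof -
  have "(G \<odot> \<beta>) (i - j - r) = (\<Sum>k=0..i-j-r. G (i - j - r - k) ** \<beta> k)"
   unfolding cauchy_def by (rule reverse)
  also have "... = (\<Sum>k\<in>{k. k <= q \<and> k + j + r <= i}. G (i - j - k - r) ** ma_coeff p \<theta> k)"
  proof (rule sum.mono_neutral_cong_right)
   show "\<forall>k\<in>{0..i - j - r} - {k. k <= q \<and> k + j + r <= i}. G (i - j - r - k) ** \<beta> k = 0"
   proof
    fix k assume k: "k \<in> {0..i - j - r} - {k. k <= q \<and> k + j + r <= i}"
    hence "k > q" using that by auto
    thus "G (i - j - r - k) ** \<beta> k = 0" using assms(3) by simp
   qed
   show "G (i - j - r - k) ** \<beta> k = G (i - j - k - r) ** ma_coeff p \<theta> k" if "k \<in> {k. k <= q \<and> k + j + r <= i}" for k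
    using that assms(2)[of k] by (simp add: diff_commute add_ac)
  qed (use that in auto)
  finally show ?thesis unfolding X_def by (simp add: matrix_mult_sum_right matrix_mul_assoc)
 qed
 have "(\<Sum>r=1..p. transpose (c_ar_with G H p q \<theta> i r) *v vecm (a r)) = vecm (\<Sum>r=1..p. \<Sum>j\<in>{j. j + r <= i}. X j r)"
  unfolding c_ar_with_def transpose_sum matrix_vector_mult_sum_left transpose_kron_vecm lv[symmetric]
  by (intro arg_cong[where f=vecm] sum.cong refl X) auto
 also have "(\<Sum>r=1..p. \<Sum>j\<in>{j. j + r <= i}. X j r) = (\<Sum>r=1..p. \<Sum>j=0..i. if j + r <= i then X j r else 0)"
  by (intro sum.cong refl sum.mono_neutral_cong_left) auto
 also have "... = (\<Sum>j=0..i. \<Sum>r=1..p. if j + r <= i then X j r else 0)" by (rule sum.swap)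
 also have "... = (\<Sum>j=0..i. \<Sum>r=0..i-j. X j r)"
 proof (rule sum.cong[OF refl])
  fix j assume j: "j \<in> {0..i}"
  have "(\<Sum>r=1..p. if j + r <= i then X j r else 0) = (\<Sum>r\<in>{1..p}\<inter>{0..i-j}. X j r)"
   using j by (intro sum.mono_neutral_cong_right) auto
  also have "... = (\<Sum>r=0..i-j. X j r)"
   by (intro sum.mono_neutral_left) (auto simp: X_def assms(1))
  finally show "(\<Sum>r=1..p. if j + r <= i then X j r else 0) = (\<Sum>r=0..i-j. X j r)" .
 qed
 also have "... = (H \<odot> (a \<odot> (G \<odot> \<beta>))) i"
  unfolding cauchy_def[of H] cauchy_def[of a] X_def matrix_mult_sum_right ..
 finally show ?thesis by (simp only: cauchy_assoc)
qed

text \<open>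
 The matrices \<open>c\<^sub>i\<close> encode the derivative of the residuals with respect to the parameter: in the
 direction \<open>\<tau>\<close> it is the convolution of the residuals with the coefficients on the right-hand side.
\<close>

lemma c_mat_transpose_mult:
 fixes \<theta> \<tau> :: "('l::{finite,linorder}, 'd::finite) param"
 assumes pq: "p + q = CARD('l)" and st: "geom_stable p q C \<rho> \<theta>" "0 < \<rho>" "\<rho> < 1"
 defines "a \<equiv> %r. if 1 <= r \<and> r <= p then block \<tau> r else 0"
  and "b \<equiv> %s. if 1 <= s \<and> s <= q then block \<tau> (p + s) else 0"
  and "G \<equiv> impulse p (ar_coeff \<theta>)" and "H \<equiv> impulse q (ma_lag p \<theta>)"
 shows "transpose (c_mat p q \<theta> i) *v \<tau> = vecm ((H \<odot> a \<odot> G \<odot> coeff_seq (lag_poly q (ma_lag p \<theta>))) i + (H \<odot> b) i)"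
proof -
 let ?F = "%k. transpose (c_block_with G H p q \<theta> i k) *v vecm (block \<tau> k)"
 have "transpose (c_mat p q \<theta> i) *v \<tau> = (\<Sum>l\<in>(UNIV::'l set). ?F (card {..l}))"
  unfolding c_mat_eq_impulse[OF st] vecm_block G_def H_def
  by (rule transpose_stacked_mult[where F="%l. c_block_with (impulse p (ar_coeff \<theta>)) (impulse q (ma_lag p \<theta>)) p q \<theta> i (card {..l})"])
 also have "... = (\<Sum>k\<in>{1..p+q}. ?F k)"
  unfolding pq by (rule sum.reindex_bij_betw[OF bij_card_atMost])
 also have "... = (\<Sum>k=1..p. ?F k) + (\<Sum>k=p+1..p+q. ?F k)"
  using sum.ub_add_nat[of 1 p ?F q] by simp
 also have "(\<Sum>k=p+1..p+q. ?F k) = (\<Sum>s=1..q. ?F (p + s))"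
  by (rule sum.reindex_bij_witness[of _ "%s. p + s" "%k. k - p"]) auto
 also have "(\<Sum>k=1..p. ?F k) = (\<Sum>r=1..p. transpose (c_ar_with G H p q \<theta> i r) *v vecm (a r))"
  by (intro sum.cong refl) (simp add: c_block_with_def a_def)
 also have "... = vecm ((H \<odot> a \<odot> G \<odot> coeff_seq (lag_poly q (ma_lag p \<theta>))) i)"
  by (rule c_ar_convolution) (auto simp: a_def coeff_seq_lag_poly ma_lag_def ma_coeff_def)
 also have "(\<Sum>s=1..q. ?F (p + s)) = vecm ((H \<odot> b) i)"
 proof -
  have "?F (p + s) = vecm (if s <= i then H (i - s) ** b s else 0)" if "s \<in> {1..q}" for s
  proof -
   have "transpose (0::real^'d^'d) = 0" by (simp add: transpose_def vec_eq_iff)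
   moreover have "vecm (0::real^'d^'d) = 0" by (rule linear_0[OF linear_vecm])
   moreover have "\<not> p + s <= p" using that by auto
   ultimately show ?thesis using that
    by (simp add: c_block_with_def transpose_kron_vecm b_def bounded_bilinear.zero_right[OF bounded_bilinear_kron] del: transpose_matrix_vector)
  qed
  hence "(\<Sum>s=1..q. ?F (p + s)) = vecm (\<Sum>s=1..q. if s <= i then H (i - s) ** b s else 0)"
   by (simp add: linear_sum[OF linear_vecm])
  also have "(\<Sum>s=1..q. if s <= i then H (i - s) ** b s else 0) = (\<Sum>s=0..i. H (i - s) ** b s)"
  proof -
   have "(\<Sum>s=1..q. if s <= i then H (i - s) ** b s else 0) = (\<Sum>s\<in>{1..q}\<inter>{0..i}. H (i - s) ** b s)"
    by (intro sum.mono_neutral_cong_right) auto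
   also have "... = (\<Sum>s=0..i. H (i - s) ** b s)"
    by (intro sum.mono_neutral_left) (auto simp: b_def)
   finally show ?thesis .
  qed
  also have "... = (H \<odot> b) i" unfolding cauchy_def
   by (rule sum.reindex_bij_witness[of _ "%k. i - k" "%k. i - k"]) auto
  finally show ?thesis .
 qed
 finally show ?thesis by (simp add: linear_add[OF linear_vecm])
qed

text \<open>
 A direction that no residual notices satisfies the relation of \<open>coprime_relation_trivial\<close>, so
 coprimeness and the invertibility of the last autoregressive coefficient force it to vanish.
\<close>

lemma c_mat_identifies:
 fixes \<theta> \<tau> :: "('l::{finite,linorder}, 'd::finite) param"
 assumes pq: "p + q = CARD('l)" and \<theta>: "\<theta> \<in> varma_params p q"
  and st: "geom_stable p q C \<rho> \<theta>" "0 < \<rho>" "\<rho> < 1"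
  and zero: "\<And>i. i >= 1 ==> transpose (c_mat p q \<theta> i) *v \<tau> = 0"
 shows "\<tau> = 0"
proof -
 define a where "a r = (if 1 <= r \<and> r <= p then block \<tau> r else 0)" for r
 define b where "b s = (if 1 <= s \<and> s <= q then block \<tau> (p + s) else 0)" for s
 let ?G = "impulse p (ar_coeff \<theta>)" and ?H = "impulse q (ma_lag p \<theta>)" and ?\<beta> = "coeff_seq (lag_poly q (ma_lag p \<theta>))"
 have rel: "(?H \<odot> a \<odot> ?G \<odot> ?\<beta>) i + (?H \<odot> b) i = 0" for i
 proof (cases "i = 0")
  case True
  have "(?H \<odot> a) 0 = 0" "(?H \<odot> b) 0 = 0" by (simp_all add: cauchy_def a_def b_def)
  thus ?thesis unfolding True by (simp add: cauchy_def)
 next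
  case False
  have "vecm ((?H \<odot> a \<odot> ?G \<odot> ?\<beta>) i + (?H \<odot> b) i) = 0"
   using c_mat_transpose_mult[OF pq st, of i \<tau>] zero[of i] False unfolding a_def[abs_def] b_def[abs_def] by simp
  thus ?thesis by (metis norm_eq_zero norm_vecm)
 qed
 have ab: "a n = 0 \<and> b n = 0" for n
 proof (rule coprime_relation_trivial[OF _ _ _ _ _ rel])
  show "left_coprime (lag_poly p (ar_coeff \<theta>)) (lag_poly q (ma_lag p \<theta>))"
   using \<theta> unfolding varma_params_def ar_poly_eq ma_poly_eq by simp
  show "det (ar_coeff \<theta> p) ~= 0" if "1 <= p" using \<theta> that unfolding varma_params_def by simp
  show "\<exists>N. \<forall>n>N. b n = 0" by (rule exI[of _ q]) (simp add: b_def)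
 qed (auto simp: a_def)
 have block0: "block \<tau> (card {..l}) = 0" for l :: 'l
 proof (cases "card {..l} <= p")
  case True thus ?thesis using ab[of "card {..l}"] card_atMost_pos[of l] by (simp add: a_def)
 next
  case False
  hence "1 <= card {..l} - p" "card {..l} - p <= q" "p + (card {..l} - p) = card {..l}"
   using card_atMost_le[of l] pq by linarith+
  thus ?thesis using ab[of "card {..l} - p"] by (simp add: b_def)
 qed
 have "\<tau> $ (l, cr) = 0" for l cr
 proof -
  have "(\<chi> cr. \<tau> $ (l, cr)) = 0" unfolding vecm_block[symmetric] block0 by (rule linear_0[OF linear_vecm])
  thus ?thesis by (cases cr) (simp add: vec_eq_iff)
 qed
 thus ?thesis by (simp add: vec_eq_iff)
qed

section \<open>The Gram matrices of the \<open>c\<^sub>i\<close>\<close>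

lemma dot_transpose: "(transpose A *v x) \<bullet> y = x \<bullet> ((A::real^'n^'m) *v y)"
 by (metis dot_lmul_matrix transpose_matrix_vector)

lemma pos_def_invertible:
 assumes "pos_def S" shows "invertible S"
proof -
 have "x = 0" if "S *v x = 0" for x using assms that unfolding pos_def_def by force
 thus ?thesis using matrix_left_invertible_ker[of S] invertible_left_inverse[of S] by blast
qed

lemma transpose_matrix_inv:
 assumes "invertible S" shows "transpose (matrix_inv S) = matrix_inv (transpose (S::real^'n^'n))"
 using matrix_inv(2)[OF assms] by (intro matrix_inv_eqI[symmetric]) (simp add: matrix_transpose_mul[symmetric] transpose_mat)

lemma pos_def_nonneg: "pos_def S ==> 0 <= v \<bullet> (S *v v)"
 unfolding pos_def_def by (cases "v = 0") (auto intro: less_imp_le)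

lemma quad_c_gram:
 "\<tau> \<bullet> (c_gram p q S m \<theta> *v \<tau>) = (\<Sum>j=1..m. (transpose (c_mat p q \<theta> j) *v \<tau>) \<bullet> (ccov_var S *v (transpose (c_mat p q \<theta> j) *v \<tau>)))"
 unfolding c_gram_def matrix_vector_mult_sum_left inner_sum_right dot_transpose
 by (simp only: matrix_vector_mul_assoc matrix_mul_assoc)

text \<open>
 The forms increase with \<open>m\<close>. If none of them were positive definite, compactness of the sphere would
 give a unit vector annihilated by all of them, contrary to identifiability. Monotonicity makes the lower bound
 uniform in \<open>m\<close>.
\<close>

lemma c_gram_eventually_coercive:
 fixes \<theta> :: "('l::{finite,linorder}, 'd::finite) param"
 assumes pq: "p + q = CARD('l)" and \<theta>: "\<theta> \<in> varma_params p q" and V: "pos_def (ccov_var S)"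
 shows "\<exists>M. \<exists>\<kappa>>0. \<forall>m\<ge>M. \<forall>\<tau>. \<tau> \<bullet> (c_gram p q S m \<theta> *v \<tau>) >= \<kappa> * (norm \<tau>)\<^sup>2"
proof -
 obtain \<eta> \<rho> C where st: "geom_stable p q C \<rho> \<theta>" "0 < \<rho>" "\<rho> < 1"
  using geom_stable_neighbourhood[OF \<theta>] by (metis diff_self norm_zero less_imp_le)
 define Q where "Q m \<tau> = \<tau> \<bullet> (c_gram p q S m \<theta> *v \<tau>)" for m and \<tau> :: "('l, 'd) param"
 have contQ: "continuous_on A (Q m)" for A m
  unfolding Q_def by (intro continuous_intros linear_continuous_on matrix_vector_mul_bounded_linear)
 have Q_mono: "Q m \<tau> <= Q m' \<tau>" if "m <= m'" for m m' \<tau>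
  unfolding Q_def quad_c_gram using that
  by (intro sum_mono2) (auto intro: pos_def_nonneg[OF V])
 define N where "N m = {\<tau> \<in> sphere (0::('l, 'd) param) 1. Q m \<tau> <= 0}" for m
 have "\<exists>M. N M = {}"
 proof (rule ccontr)
  assume ne: "\<nexists>M. N M = {}"
  have "\<Inter>(range N) ~= {}"
  proof (rule compact_nest)
   show "compact (N m)" for m
   proof -
    have "compact (sphere 0 1 \<inter> {\<tau>. Q m \<tau> <= 0})"
     by (intro compact_Int_closed compact_sphere closed_Collect_le contQ continuous_on_const)
    moreover have "N m = sphere 0 1 \<inter> {\<tau>. Q m \<tau> <= 0}" by (auto simp: N_def)
    ultimately show ?thesis by simp
   qed
   show "N m ~= {}" for m using ne by blast
   show "N n \<subseteq> N m" if "m <= n" for m n using Q_mono[OF that] order.trans by (fastforce simp: N_def)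
  qed
  then obtain \<tau> where \<tau>: "norm \<tau> = 1" "\<And>m. Q m \<tau> <= 0" by (auto simp: N_def)
  have "transpose (c_mat p q \<theta> i) *v \<tau> = 0" if "i >= 1" for i
  proof -
   let ?t = "%j. (transpose (c_mat p q \<theta> j) *v \<tau>) \<bullet> (ccov_var S *v (transpose (c_mat p q \<theta> j) *v \<tau>))"
   have "?t i <= (\<Sum>j=1..i. ?t j)" using that
    by (intro member_le_sum) (auto intro: pos_def_nonneg[OF V])
   hence "?t i <= 0" using \<tau>(2)[of i] unfolding Q_def quad_c_gram by simp
   thus ?thesis using V unfolding pos_def_def by (meson not_le)
  qed
  hence "\<tau> = 0" by (rule c_mat_identifies[OF pq \<theta> st])
  then show False using \<tau>(1) by simp
 qed
 then obtain M where M: "N M = {}" by blast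
 have "\<exists>\<kappa>>0. \<forall>\<tau>\<in>sphere 0 1. \<kappa> <= Q M \<tau>"
 proof -
  obtain x where x: "x \<in> sphere 0 1" "\<And>y. y \<in> sphere 0 1 ==> Q M x <= Q M y"
   using continuous_attains_inf[OF compact_sphere _ contQ, of 0 1 M] by (auto simp: sphere_eq_empty)
  hence "Q M x > 0" using M unfolding N_def by fastforce
  thus ?thesis using x by blast
 qed
 then obtain \<kappa> where \<kappa>: "\<kappa> > 0" "\<And>\<tau>. norm \<tau> = 1 ==> \<kappa> <= Q M \<tau>" by (auto simp: dist_norm)
 have "\<kappa> * (norm \<tau>)\<^sup>2 <= Q m \<tau>" if "m >= M" for m \<tau>
 proof (cases "\<tau> = 0")
  case False
  define \<sigma> where "\<sigma> = (1 / norm \<tau>) *\<^sub>R \<tau>"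
  have "\<tau> = norm \<tau> *\<^sub>R \<sigma>" "norm \<sigma> = 1" using False by (simp_all add: \<sigma>_def)
  moreover have "Q M (c *\<^sub>R \<sigma>) = c\<^sup>2 * Q M \<sigma>" for c by (simp add: Q_def matrix_vector_mult_scaleR power2_eq_square)
  ultimately have "Q M \<tau> = (norm \<tau>)\<^sup>2 * Q M \<sigma>" by metis
  also have "... >= (norm \<tau>)\<^sup>2 * \<kappa>" using \<kappa>(2)[OF \<open>norm \<sigma> = 1\<close>] by (intro mult_left_mono) auto
  finally show ?thesis using Q_mono[OF that, of \<tau>] by (simp add: mult.commute)
 qed (simp add: Q_def)
 thus ?thesis using \<kappa>(1) unfolding Q_def by blast
qed

section \<open>Consequences of mean-square differentiability\<close>

lemma density_classD:
 fixes f :: "real^'d => real"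
 assumes "f \<in> density_class"
 shows "f \<in> borel_measurable borel" "prob_space (innov f)" "\<And>x. f x > 0"
  "integrable lborel f" "(LINT x|lborel. f x) = 1"
  "integrable (innov f) (%x. x)" "(LINT x|innov f. x) = 0"
  "integrable (innov f) (%x. outer x x)" "pos_def (innov_cov f)"
proof -
 show m: "f \<in> borel_measurable borel" and p: "prob_space (innov f)" and f: "\<And>x. f x > 0"
  "integrable (innov f) (%x. x)" "(LINT x|innov f. x) = 0"
  "integrable (innov f) (%x. outer x x)" "pos_def (innov_cov f)"
  using assms by (auto simp: density_class_def)
 have "(\<integral>\<^sup>+x. ennreal (f x) \<partial>lborel) = 1"
  using prob_space.emeasure_space_1[OF p] m by (simp add: innov_def emeasure_density)
 hence "has_bochner_integral lborel f 1"
  using m f(1) by (intro has_bochner_integral_nn_integral) (auto intro: less_imp_le)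
 thus "integrable lborel f" "(LINT x|lborel. f x) = 1" by (auto simp: has_bochner_integral_iff)
qed

lemma nn_integral_innov:
 assumes "f \<in> density_class" "g \<in> borel_measurable borel"
 shows "(\<integral>\<^sup>+x. g x \<partial>innov f) = (\<integral>\<^sup>+x. ennreal (f x) * g x \<partial>lborel)"
 unfolding innov_def using assms density_classD(1)[OF assms(1)] by (subst nn_integral_density) auto

lemma sets_innov [measurable_cong, simp]: "sets (innov f) = sets borel"
 by (simp add: innov_def)

lemma space_innov [simp]: "space (innov f) = UNIV"
 by (simp add: innov_def)

lemma nn_integral_shift:
 fixes h :: "'v::euclidean_space"
 assumes "g \<in> borel_measurable borel"
 shows "(\<integral>\<^sup>+x. g (x + h) \<partial>lborel) = (\<integral>\<^sup>+x. g x \<partial>lborel)"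
proof -
 have "(\<integral>\<^sup>+x. g x \<partial>distr lborel borel ((+) h)) = (\<integral>\<^sup>+x. g (h + x) \<partial>lborel)"
  using assms by (intro nn_integral_distr) auto
 thus ?thesis by (simp add: lborel_distr_plus add.commute)
qed

lemma integrable_shift:
 fixes h :: "'v::euclidean_space" and f :: "'v => real"
 assumes "integrable lborel f"
 shows "integrable lborel (%x. f (x + h))" "(LINT x|lborel. f (x + h)) = (LINT x|lborel. f x)"
proof -
 have "integrable (distr lborel borel ((+) h)) f" using assms by (simp add: lborel_distr_plus)
 thus "integrable lborel (%x. f (x + h))"
  using assms by (subst (asm) integrable_distr_eq) (auto simp: add.commute)
 have "integral\<^sup>L (distr lborel borel ((+) h)) f = (LINT x|lborel. f (h + x))"
  using assms by (intro integral_distr) auto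
 thus "(LINT x|lborel. f (x + h)) = (LINT x|lborel. f x)" by (simp add: lborel_distr_plus add.commute)
qed

lemma root_remainder:
 fixes f :: "real^'d => real"
 assumes f: "f \<in> density_class" and D: "ms_root_derivative f D"
 defines "R \<equiv> %h. LINT x|lborel. (sqrt (f (x + h)) - sqrt (f x) - h \<bullet> D x)\<^sup>2"
 shows "integrable lborel (%x. (sqrt (f (x + h)) - sqrt (f x))\<^sup>2)"
  "(LINT x|lborel. (sqrt (f (x + h)) - sqrt (f x))\<^sup>2) <= 4"
  "integrable lborel (%x. (h \<bullet> D x)\<^sup>2)"
  "integrable lborel (%x. (sqrt (f (x + h)) - sqrt (f x) - h \<bullet> D x)\<^sup>2)"
  "\<eta> > 0 ==> \<exists>\<delta>>0. \<forall>h. norm h < \<delta> \<longrightarrow> R h <= \<eta> * (norm h)\<^sup>2"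
proof -
 note [measurable] = density_classD(1)[OF f]
 have Dm [measurable]: "D \<in> borel_measurable borel" and Di: "integrable lborel (%x. (norm (D x))\<^sup>2)"
  and lim: "((%h. R h / (h \<bullet> h)) \<longlongrightarrow> 0) (at 0)"
  using D by (auto simp: ms_root_derivative_def R_def)
 have f0: "f x >= 0" for x using density_classD(3)[OF f, of x] by simp
 have fi: "integrable lborel f" "integrable lborel (%x. f (x + h))"
  using density_classD(4)[OF f] integrable_shift by auto
 have sq: "(a - b)\<^sup>2 <= 2 * a\<^sup>2 + 2 * b\<^sup>2" for a b :: real
  using zero_le_power2[of "a + b"] by (simp add: power2_eq_square algebra_simps)
 have bd: "(sqrt (f (x + h)) - sqrt (f x))\<^sup>2 <= 2 * f (x + h) + 2 * f x" for x
  using sq[of "sqrt (f (x + h))" "sqrt (f x)"] f0 by simp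
 show i1: "integrable lborel (%x. (sqrt (f (x + h)) - sqrt (f x))\<^sup>2)"
  by (rule Bochner_Integration.integrable_bound[of _ "%x. 2 * f (x + h) + 2 * f x"]) (use fi bd f0 in auto)
 have "(LINT x|lborel. (sqrt (f (x + h)) - sqrt (f x))\<^sup>2) <= (LINT x|lborel. 2 * f (x + h) + 2 * f x)"
  by (intro integral_mono i1) (use fi bd in auto)
 also have "... = 4" using fi density_classD(5)[OF f] integrable_shift(2)[OF fi(1), of h] by simp
 finally show "(LINT x|lborel. (sqrt (f (x + h)) - sqrt (f x))\<^sup>2) <= 4" .
 have cs: "(h \<bullet> D x)\<^sup>2 <= (norm h)\<^sup>2 * (norm (D x))\<^sup>2" for x
  using Cauchy_Schwarz_ineq[of h "D x"] by (simp add: power2_norm_eq_inner)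
 show i2: "integrable lborel (%x. (h \<bullet> D x)\<^sup>2)"
  by (rule Bochner_Integration.integrable_bound[of _ "%x. (norm h)\<^sup>2 * (norm (D x))\<^sup>2"]) (use Di cs in auto)
 show "integrable lborel (%x. (sqrt (f (x + h)) - sqrt (f x) - h \<bullet> D x)\<^sup>2)"
  by (rule Bochner_Integration.integrable_bound[of _ "%x. 2 * (sqrt (f (x + h)) - sqrt (f x))\<^sup>2 + 2 * (h \<bullet> D x)\<^sup>2"])
   (use i1 i2 sq in \<open>auto intro!: order.trans[OF sq]\<close>)
 assume \<eta>: "\<eta> > 0"
 from tendstoD[OF lim \<eta>] obtain \<delta> where \<delta>: "\<delta> > 0" "\<And>h. h ~= 0 ==> norm h < \<delta> ==> \<bar>R h / (h \<bullet> h)\<bar> < \<eta>"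
  by (auto simp: eventually_at dist_norm)
 have "R h <= \<eta> * (norm h)\<^sup>2" if "norm h < \<delta>" for h
 proof (cases "h = 0")
  case False
  hence "R h / (h \<bullet> h) <= \<eta>" using \<delta>(2)[of h] that by linarith
  thus ?thesis using False by (simp add: divide_le_eq power2_norm_eq_inner)
 qed (simp add: R_def)
 thus "\<exists>\<delta>>0. \<forall>h. norm h < \<delta> \<longrightarrow> R h <= \<eta> * (norm h)\<^sup>2" using \<delta>(1) by blast
qed

lemma hellinger_bound:
 fixes f :: "real^'d => real"
 assumes f: "f \<in> density_class"
 shows "\<exists>C\<ge>0. \<forall>h. (LINT x|lborel. (sqrt (f (x + h)) - sqrt (f x))\<^sup>2) <= C * (norm h)\<^sup>2"
proof -
 obtain D where D: "ms_root_derivative f D" using f by (auto simp: density_class_def)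
 have Di: "integrable lborel (%x. (norm (D x))\<^sup>2)" using D by (simp add: ms_root_derivative_def)
 note R = root_remainder[OF f D]
 obtain \<delta> where \<delta>: "\<delta> > 0" "\<And>h. norm h < \<delta> ==> (LINT x|lborel. (sqrt (f (x + h)) - sqrt (f x) - h \<bullet> D x)\<^sup>2) <= 1 * (norm h)\<^sup>2"
  using R(5)[of 1] by auto
 define I where "I = (LINT x|lborel. (norm (D x))\<^sup>2)"
 have I0: "I >= 0" by (simp add: I_def)
 have "(LINT x|lborel. (sqrt (f (x + h)) - sqrt (f x))\<^sup>2) <= (2 + 2 * I + 4 / \<delta>\<^sup>2) * (norm h)\<^sup>2" for h
 proof (cases "norm h < \<delta>")
  case True
  have sq: "a\<^sup>2 <= 2 * (a - b)\<^sup>2 + 2 * b\<^sup>2" for a b :: real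
   using zero_le_power2[of "a - 2 * b"] by (simp add: power2_eq_square algebra_simps)
  have "(LINT x|lborel. (sqrt (f (x + h)) - sqrt (f x))\<^sup>2) <= (LINT x|lborel. 2 * (sqrt (f (x + h)) - sqrt (f x) - h \<bullet> D x)\<^sup>2 + 2 * ((norm h)\<^sup>2 * (norm (D x))\<^sup>2))"
  proof (intro integral_mono R(1) Bochner_Integration.integrable_add integrable_mult_right R(4) Di)
   fix x
   have "(h \<bullet> D x)\<^sup>2 <= (norm h)\<^sup>2 * (norm (D x))\<^sup>2"
    using Cauchy_Schwarz_ineq[of h "D x"] by (simp add: power2_norm_eq_inner)
   thus "(sqrt (f (x + h)) - sqrt (f x))\<^sup>2 <= 2 * (sqrt (f (x + h)) - sqrt (f x) - h \<bullet> D x)\<^sup>2 + 2 * ((norm h)\<^sup>2 * (norm (D x))\<^sup>2)"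
    using sq[of "sqrt (f (x + h)) - sqrt (f x)" "h \<bullet> D x"] by linarith
  qed
  also have "... = 2 * (LINT x|lborel. (sqrt (f (x + h)) - sqrt (f x) - h \<bullet> D x)\<^sup>2) + 2 * ((norm h)\<^sup>2 * I)"
   using R(4) Di by (simp add: I_def)
  also have "... <= 2 * (1 * (norm h)\<^sup>2) + 2 * ((norm h)\<^sup>2 * I)" using \<delta>(2)[OF True] by simp
  also have "... <= (2 + 2 * I + 4 / \<delta>\<^sup>2) * (norm h)\<^sup>2" using \<delta>(1) by (simp add: algebra_simps)
  finally show ?thesis .
 next
  case False
  hence "1 <= (norm h)\<^sup>2 / \<delta>\<^sup>2" using \<delta>(1) by (simp add: power_mono)
  hence "4 <= 4 / \<delta>\<^sup>2 * (norm h)\<^sup>2" by simp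
  also have "... <= (2 + 2 * I + 4 / \<delta>\<^sup>2) * (norm h)\<^sup>2" using I0 by (intro mult_right_mono) auto
  finally show ?thesis using R(2)[of h] by simp
 qed
 moreover have "2 + 2 * I + 4 / \<delta>\<^sup>2 >= 0" using I0 by simp
 ultimately show ?thesis by blast
qed

text \<open>
 Where the density drops by a factor 4, its root drops by at least half. Then either the remainder of the
 differentiable root is at least \<open>s / 4\<close> with \<open>s\<close> the root, which costs
 \<open>o(|h|\<^sup>2)\<close>, or the linear term is, which by Markov's inequality for the fourth power of the score
 costs \<open>O(|h|\<^sup>4)\<close>. Such a bound, and not merely \<open>O(|h|\<^sup>2)\<close>, is needed since
 \<open>n\<close> shifts of order \<open>n\<^sup>-\<^sup>1\<^sup>/\<^sup>2\<close> will be added up.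
\<close>

lemma density_drop_bound:
 fixes f :: "real^'d => real"
 assumes f: "f \<in> density_class" and \<eta>: "\<eta> > 0"
 shows "\<exists>C\<ge>0. \<forall>h. measure (innov f) {x. 4 * f (x + h) < f x} <= \<eta> * (norm h)\<^sup>2 + C * (norm h) ^ 4"
proof -
 obtain D where D: "ms_root_derivative f D" and sc: "\<And>i. integrable lborel (%x. (score f D x $ i) ^ 4 * f x)"
  using f by (auto simp: density_class_def)
 note R = root_remainder[OF f D]
 note [measurable] = density_classD(1)[OF f]
 have Dm [measurable]: "D \<in> borel_measurable borel" using D by (simp add: ms_root_derivative_def)
 interpret prob_space "innov f" by (rule density_classD(2)[OF f])
 have fpos: "f x > 0" for x by (rule density_classD(3)[OF f])
 obtain \<delta> where \<delta>: "\<delta> > 0" "\<And>h. norm h < \<delta> ==> (LINT x|lborel. (sqrt (f (x + h)) - sqrt (f x) - h \<bullet> D x)\<^sup>2) <= \<eta> / 16 * (norm h)\<^sup>2"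
  using R(5)[of "\<eta> / 16"] \<eta> by auto
 define J where "J = (LINT x|lborel. (\<Sum>i\<in>UNIV. (score f D x $ i) ^ 4 * f x))"
 have J0: "J >= 0" unfolding J_def by (intro integral_nonneg_AE AE_I2 sum_nonneg mult_nonneg_nonneg) (auto intro: less_imp_le[OF fpos])
 \<comment> \<open>The second term makes the bound trivial when the norm of \<open>h\<close> is at least \<open>\<delta>\<close>.\<close>
 define C where "C = 16 * CARD('d) * J + 1 / \<delta> ^ 4"
 have C0: "C >= 0" using J0 \<delta>(1) by (simp add: C_def)
 have "measure (innov f) {x. 4 * f (x + h) < f x} <= \<eta> * (norm h)\<^sup>2 + C * (norm h) ^ 4" for h
 proof (cases "norm h < \<delta>")
  case True
  let ?r = "%x. (sqrt (f (x + h)) - sqrt (f x) - h \<bullet> D x)\<^sup>2"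
  let ?s = "%x. (\<Sum>i\<in>UNIV. (score f D x $ i) ^ 4 * f x)"
  have pt: "indicator {x. 4 * f (x + h) < f x} x * f x <= 16 * ?r x + 16 * CARD('d) * (norm h) ^ 4 * ?s x" for x
  proof (cases "4 * f (x + h) < f x")
   case True
   define s where "s = sqrt (f x)"
   define s' where "s' = sqrt (f (x + h))"
   have s: "s > 0" "s\<^sup>2 = f x" using fpos[of x] by (auto simp: s_def)
   have s': "s' >= 0" using fpos[of "x + h"] by (simp add: s'_def)
   have "2 * s' < s"
   proof (rule power2_less_imp_less)
    show "(2 * s')\<^sup>2 < s\<^sup>2" using True fpos[of "x+h"] s by (simp add: s'_def power_mult_distrib)
   qed (use s in simp)
   define w where "w = h \<bullet> D x"
   define r where "r = s' - s - w"
   have "r + w < - (s / 2)" using \<open>2 * s' < s\<close> by (simp add: r_def)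
   then consider "\<bar>r\<bar> >= s / 4" | "\<bar>w\<bar> >= s / 4" by linarith
   hence main: "s\<^sup>2 <= 16 * r\<^sup>2 + 256 * w ^ 4 / s\<^sup>2"
   proof cases
    case 1
    hence "(s/4)\<^sup>2 <= \<bar>r\<bar>\<^sup>2" using s by (intro power_mono) auto
    hence "s\<^sup>2 <= 16 * r\<^sup>2" by (simp add: power_divide)
    moreover have "256 * w ^ 4 / s\<^sup>2 >= 0" by simp
    ultimately show ?thesis by linarith
   next
    case 2
    hence "(s/4) ^ 4 <= \<bar>w\<bar> ^ 4" using s by (intro power_mono) auto
    hence "s\<^sup>2 * s\<^sup>2 <= 256 * w ^ 4" by (simp add: power_divide power_add[symmetric])
    hence "s\<^sup>2 <= 256 * w ^ 4 / s\<^sup>2" using s fpos[of x] by (simp add: le_divide_eq)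
    moreover have "16 * r\<^sup>2 >= 0" by simp
    ultimately show ?thesis by linarith
   qed
   have "256 * w ^ 4 / s\<^sup>2 <= 16 * CARD('d) * (norm h) ^ 4 * ?s x"
   proof -
    have Dx: "D x = (- s / 2) *\<^sub>R score f D x" using s by (simp add: score_def s_def[symmetric])
    have n4: "norm (score f D x) ^ 4 <= CARD('d) * (\<Sum>i\<in>UNIV. (score f D x $ i) ^ 4)"
    proof -
     have "norm (score f D x) ^ 4 = ((norm (score f D x))\<^sup>2)\<^sup>2" by simp
     also have "... = (\<Sum>i\<in>UNIV. (score f D x $ i)\<^sup>2 * 1)\<^sup>2" unfolding norm_vec_sq by simp
     also have "... <= (\<Sum>i\<in>UNIV. ((score f D x $ i)\<^sup>2)\<^sup>2) * (\<Sum>i\<in>(UNIV::'d set). 1\<^sup>2)"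
      by (rule Cauchy_Schwarz_ineq_sum)
     also have "... = CARD('d) * (\<Sum>i\<in>UNIV. (score f D x $ i) ^ 4)" by simp
     finally show ?thesis .
    qed
    have "\<bar>w\<bar> <= norm h * norm (D x)" unfolding w_def by (rule Cauchy_Schwarz_ineq2)
    hence "\<bar>w\<bar> ^ 4 <= (norm h * norm (D x)) ^ 4" by (intro power_mono) auto
    hence "w ^ 4 <= (norm h * (s / 2 * norm (score f D x))) ^ 4" using s unfolding Dx by simp
    also have "... = (norm h) ^ 4 * (s ^ 4 / 16 * norm (score f D x) ^ 4)" by (simp add: power_mult_distrib power_divide)
    finally have w4: "w ^ 4 <= (norm h) ^ 4 * (s ^ 4 / 16 * norm (score f D x) ^ 4)" .
    have "256 * w ^ 4 / s\<^sup>2 <= 256 * ((norm h) ^ 4 * (s ^ 4 / 16 * norm (score f D x) ^ 4)) / s\<^sup>2"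
     by (intro divide_right_mono mult_left_mono w4) auto
    also have "... = 16 * (norm h) ^ 4 * norm (score f D x) ^ 4 * s\<^sup>2"
    proof -
     have s4: "s ^ 4 = s\<^sup>2 * s\<^sup>2" by (simp add: power_add[symmetric])
     show ?thesis unfolding s4 using s fpos[of x] by simp
    qed
    also have "... <= 16 * (norm h) ^ 4 * (CARD('d) * (\<Sum>i\<in>UNIV. (score f D x $ i) ^ 4)) * s\<^sup>2"
     by (intro mult_right_mono mult_left_mono n4) auto
    finally show ?thesis unfolding s(2) sum_distrib_right[symmetric] by (simp add: mult_ac)
   qed
   thus ?thesis using main True unfolding s(2) by (simp add: r_def w_def s_def s'_def)
  next
   case False
   have "0 <= 16 * ?r x + 16 * CARD('d) * (norm h) ^ 4 * ?s x"
    by (intro add_nonneg_nonneg mult_nonneg_nonneg sum_nonneg) (auto intro: less_imp_le[OF fpos])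
   thus ?thesis using False by simp
  qed
  have si: "integrable lborel ?s" using sc by simp
  have "measure (innov f) {x. 4 * f (x + h) < f x} = (LINT x|innov f. indicator {x. 4 * f (x + h) < f x} x)"
   by (subst Bochner_Integration.integral_indicator) (auto simp: less_top[symmetric])
  also have "... = (LINT x|lborel. f x *\<^sub>R indicator {x. 4 * f (x + h) < f x} x)"
   unfolding innov_def by (subst integral_density) (auto intro: less_imp_le[OF fpos])
  also have "... <= (LINT x|lborel. 16 * ?r x + 16 * CARD('d) * (norm h) ^ 4 * ?s x)"
  proof (intro integral_mono)
   show "integrable lborel (%x. f x *\<^sub>R indicat_real {x. 4 * f (x + h) < f x} x)"
    by (rule Bochner_Integration.integrable_bound[OF density_classD(4)[OF f]]) (auto simp: indicator_def)
   show "integrable lborel (%x. 16 * ?r x + 16 * CARD('d) * (norm h) ^ 4 * ?s x)"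
    by (intro Bochner_Integration.integrable_add integrable_mult_right R(4) si)
   show "f x *\<^sub>R indicat_real {x. 4 * f (x + h) < f x} x <= 16 * ?r x + 16 * CARD('d) * (norm h) ^ 4 * ?s x" for x
    using pt[of x] by (simp add: mult.commute)
  qed
  also have "... = 16 * (LINT x|lborel. ?r x) + 16 * CARD('d) * (norm h) ^ 4 * J"
   unfolding J_def by (subst Bochner_Integration.integral_add) (intro integrable_mult_right R(4) si | simp)+
  also have "... <= \<eta> * (norm h)\<^sup>2 + C * (norm h) ^ 4"
   using \<delta>(2)[OF True] \<delta>(1) by (simp add: C_def algebra_simps add_increasing2)
  finally show ?thesis .
 next
  case False
  hence "1 <= (norm h) ^ 4 / \<delta> ^ 4" using \<delta>(1) by (simp add: power_mono)
  also have "... <= C * (norm h) ^ 4" using J0 by (simp add: C_def distrib_right)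
  finally have "1 <= \<eta> * (norm h)\<^sup>2 + C * (norm h) ^ 4" using \<eta> by (simp add: add_increasing)
  thus ?thesis using prob_le_1 order.trans by blast
 qed
 thus ?thesis using C0 by blast
qed

text \<open>
 With \<open>r\<^sup>2\<close> the ratio \<open>f (x + h) / f x\<close>, the truncation gives \<open>1 / r <=
 2\<close> and then \<open>1 / r <= 1 - (r - 1) + O((r - 1)\<^sup>2)\<close>. The integral of \<open>r - 1\<close>
 against \<open>f\<close> is of the order of the squared Hellinger distance of \<open>f\<close> and its shift, which
 is \<open>O(|h|\<^sup>2)\<close>.
\<close>

lemma truncated_root_ratio:
 fixes f :: "real^'d => real"
 assumes f: "f \<in> density_class"
 shows "\<exists>C\<ge>0. \<forall>h. (\<integral>\<^sup>+x. ennreal (if 4 * f (x + h) < f x then 0 else sqrt (f x / f (x + h)) * exp (- C * (norm h)\<^sup>2)) \<partial>innov f) <= 1"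
proof -
 obtain C where C: "C >= 0" "\<And>h. (LINT x|lborel. (sqrt (f (x + h)) - sqrt (f x))\<^sup>2) <= C * (norm h)\<^sup>2"
  using hellinger_bound[OF f] by blast
 obtain D where D: "ms_root_derivative f D" using f by (auto simp: density_class_def)
 note [measurable] = density_classD(1)[OF f]
 have fpos: "f x > 0" for x by (rule density_classD(3)[OF f])
 define c where "c = 5/2 * C"
 have "(\<integral>\<^sup>+x. ennreal (if 4 * f (x + h) < f x then 0 else sqrt (f x / f (x + h)) * exp (- c * (norm h)\<^sup>2)) \<partial>innov f) <= 1" for h
 proof -
  \<comment> \<open>This is \<open>f x\<close> times \<open>1 - (r - 1) + 2 (r - 1)\<^sup>2\<close>.\<close>
  let ?g = "%x. 3/2 * f x - 1/2 * f (x + h) + 5/2 * (sqrt (f (x + h)) - sqrt (f x))\<^sup>2"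
  let ?E = "exp (- c * (norm h)\<^sup>2)"
  have g: "f x * (if 4 * f (x + h) < f x then 0 else sqrt (f x / f (x + h)) * ?E) <= ?g x * ?E" for x
  proof -
   define s where "s = sqrt (f x)"
   define s' where "s' = sqrt (f (x + h))"
   have s: "s > 0" "f x = s\<^sup>2" and s': "s' > 0" "f (x + h) = s'\<^sup>2" using fpos less_imp_le[OF fpos] by (auto simp: s_def s'_def)
   have gs: "?g x = 3/2 * s\<^sup>2 - 1/2 * s'\<^sup>2 + 5/2 * (s' - s)\<^sup>2" using s(1) s'(1) by (simp add: s(2) s'(2))
   show ?thesis
   proof (cases "4 * f (x + h) < f x")
    case True
    hence "s'\<^sup>2 <= 3 * s\<^sup>2" using s s' zero_le_power2[of s] by linarith
    hence "3/2 * s\<^sup>2 - 1/2 * s'\<^sup>2 + 5/2 * (s' - s)\<^sup>2 >= 0" using zero_le_power2[of "s' - s"] by linarith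
    thus ?thesis unfolding gs using True by simp
   next
    case False
    hence "s\<^sup>2 <= (2 * s')\<^sup>2" using s s' by (simp add: power_mult_distrib)
    hence le: "s <= 2 * s'" by (rule power2_le_imp_le) (simp add: s'(1) less_imp_le)
    have "s\<^sup>2 * (s / s') <= 3/2 * s\<^sup>2 - 1/2 * s'\<^sup>2 + 5/2 * (s' - s)\<^sup>2"
    proof -
     have "(3/2 * s\<^sup>2 - 1/2 * s'\<^sup>2 + 5/2 * (s' - s)\<^sup>2) * s' - s\<^sup>2 * s = (s' - s)\<^sup>2 * (2 * s' - s)"
      by (simp add: power2_eq_square field_simps)
     also have "... >= 0" using le by simp
     finally show ?thesis using s' by (simp add: field_simps)
    qed
    hence "s\<^sup>2 * (s / s') * ?E <= (3/2 * s\<^sup>2 - 1/2 * s'\<^sup>2 + 5/2 * (s' - s)\<^sup>2) * ?E"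
     by (rule mult_right_mono) simp
    moreover have sq: "sqrt (f x / f (x + h)) = s / s'" by (simp add: real_sqrt_divide s_def s'_def)
    ultimately show ?thesis unfolding gs sq if_not_P[OF False] by (simp only: s(2) mult.assoc)
   qed
  qed
  have fi: "integrable lborel f" "integrable lborel (%x. f (x + h))"
   using density_classD(4)[OF f] integrable_shift by auto
  have gi: "integrable lborel (%x. ?g x * ?E)"
   using fi root_remainder(1)[OF f D, of h] by (intro integrable_mult_left Bochner_Integration.integrable_add Bochner_Integration.integrable_diff integrable_mult_right)
  have g0: "?g x * ?E >= 0" for x
   by (rule order.trans[OF _ g]) (auto intro!: mult_nonneg_nonneg less_imp_le[OF fpos] divide_nonneg_nonneg)
  have "(\<integral>\<^sup>+x. ennreal (if 4 * f (x + h) < f x then 0 else sqrt (f x / f (x + h)) * ?E) \<partial>innov f)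
    = (\<integral>\<^sup>+x. ennreal (f x * (if 4 * f (x + h) < f x then 0 else sqrt (f x / f (x + h)) * ?E)) \<partial>lborel)"
   by (subst nn_integral_innov[OF f]) (auto intro!: nn_integral_cong simp: ennreal_mult' less_imp_le[OF fpos])
  also have "... <= (\<integral>\<^sup>+x. ennreal (?g x * ?E) \<partial>lborel)" by (intro nn_integral_mono ennreal_leI g)
  also have "... = ennreal (LINT x|lborel. ?g x * ?E)" by (intro nn_integral_eq_integral gi AE_I2 g0)
  also have "(LINT x|lborel. ?g x * ?E) = (1 + 5/2 * (LINT x|lborel. (sqrt (f (x + h)) - sqrt (f x))\<^sup>2)) * ?E"
   using fi root_remainder(1)[OF f D, of h] density_classD(5)[OF f] integrable_shift(2)[OF fi(1), of h] by simp
  also have "... <= (1 + c * (norm h)\<^sup>2) * ?E" using C(2)[of h] by (intro mult_right_mono) (auto simp: c_def)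
  also have "... <= exp (c * (norm h)\<^sup>2) * ?E" by (intro mult_right_mono exp_ge_add_one_self) auto
  also have "... = 1" by (simp add: exp_add[symmetric])
  finally show ?thesis by (simp add: ennreal_leI)
 qed
 moreover have "c >= 0" using C by (simp add: c_def)
 ultimately show ?thesis by blast
qed

section \<open>Predictable shifts of white noise\<close>

abbreviation paths :: "nat => (nat => 'v::topological_space) measure" where
 "paths k \<equiv> PiM {1..k} (%_. borel)"

abbreviation noise :: "(real^'d => real) => nat => (nat => real^'d) measure" where
 "noise f k \<equiv> PiM {1..k} (%_. innov f)"

text \<open>
 The shift at time \<open>t\<close> may depend on the noise before \<open>t\<close> only; the second clause is the
 corresponding measurability.
\<close>

definition predictable :: "(nat => (nat => 'v::euclidean_space) => 'v) => bool" where
 "predictable \<delta> \<longleftrightarrow> (\<forall>t e e'. (\<forall>s. 1 <= s \<and> s < t \<longrightarrow> e s = e' s) \<longrightarrow> \<delta> t e = \<delta> t e') \<and>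
   (\<forall>t n. t <= Suc n \<longrightarrow> \<delta> t \<in> borel_measurable (paths n))"

lemma predictable_upd: "predictable \<delta> ==> t <= i ==> \<delta> t (e(i := y)) = \<delta> t e"
 unfolding predictable_def by (metis fun_upd_other not_le)

lemma predictable_measurable: "predictable \<delta> ==> t <= Suc n ==> \<delta> t \<in> borel_measurable (paths n)"
 unfolding predictable_def by blast

definition shear :: "(nat => (nat => 'v) => 'v) => nat => (nat => 'v) => nat => 'v::euclidean_space" where
 "shear \<delta> n e = (\<lambda>t\<in>{1..n}. e t + \<delta> t e)"

lemma measurable_weight:
 fixes \<delta> :: "nat => (nat => 'v::euclidean_space) => 'v"
 assumes "(%(h,y). w h y) \<in> borel_measurable (borel \<Otimes>\<^sub>M borel)" "predictable \<delta>" "t \<in> {1..n}"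
 shows "(%e. w (\<delta> t e) (e t)) \<in> borel_measurable (paths n)"
proof -
 have "(%e. (\<delta> t e, e t)) \<in> measurable (paths n) (borel \<Otimes>\<^sub>M borel)"
  using assms by (intro measurable_Pair predictable_measurable measurable_component_singleton) auto
 from measurable_compose[OF this assms(1)] show ?thesis by simp
qed

lemma measurable_shear:
 fixes \<delta> :: "nat => (nat => 'v::euclidean_space) => 'v"
 assumes "predictable \<delta>"
 shows "shear \<delta> n \<in> measurable (paths n) (paths n)"
 unfolding shear_def
 by (intro measurable_restrict borel_measurable_add measurable_component_singleton predictable_measurable assms) auto

locale borel_prob = prob_space \<mu> for \<mu> :: "'v::euclidean_space measure" +
 assumes sets_mu [measurable_cong, simp]: "sets \<mu> = sets borel"
begin

lemma space_mu [simp]: "space \<mu> = UNIV"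
 using sets_eq_imp_space_eq[OF sets_mu] by simp

sublocale P: product_sigma_finite "%_::nat. \<mu>"
 by unfold_locales

lemma sets_P [measurable_cong, simp]: "sets (PiM I (%_::nat. \<mu>)) = sets (PiM I (%_. borel))"
 by (intro sets_PiM_cong) auto

lemma measurable_P [simp]: "measurable (PiM I (%_::nat. \<mu>)) N = measurable (PiM I (%_. borel)) N"
 by (intro measurable_cong_sets) auto

lemma prob_space_P: "prob_space (PiM I (%_::nat. \<mu>))"
 by (intro prob_space_PiM) unfold_locales

lemma nn_integral_last:
 assumes "F \<in> borel_measurable (paths (Suc n))"
 shows "(\<integral>\<^sup>+e. F e \<partial>PiM {1..Suc n} (%_. \<mu>)) = (\<integral>\<^sup>+x. (\<integral>\<^sup>+y. F (x(Suc n := y)) \<partial>\<mu>) \<partial>PiM {1..n} (%_. \<mu>))"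
proof -
 have i: "insert (Suc n) {1..n} = {1..Suc n}" by auto
 show ?thesis
  using P.product_nn_integral_insert[of "{1..n}" "Suc n" F] assms unfolding i by simp
qed

lemma weight_prod_upd:
 assumes "predictable \<delta>"
 shows "(\<Prod>t\<in>{1..Suc n}. w (\<delta> t (x(Suc n := y))) ((x(Suc n := y)) t)) = (\<Prod>t\<in>{1..n}. w (\<delta> t x) (x t)) * (w (\<delta> (Suc n) x) y :: ennreal)"
proof -
 have "(\<Prod>t\<in>{1..Suc n}. w (\<delta> t (x(Suc n := y))) ((x(Suc n := y)) t)) = (\<Prod>t\<in>{1..Suc n}. w (\<delta> t x) ((x(Suc n := y)) t))"
  by (intro prod.cong refl) (simp add: predictable_upd[OF assms])
 also have "... = (\<Prod>t\<in>{1..n}. w (\<delta> t x) ((x(Suc n := y)) t)) * w (\<delta> (Suc n) x) y" by simp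
 also have "(\<Prod>t\<in>{1..n}. w (\<delta> t x) ((x(Suc n := y)) t)) = (\<Prod>t\<in>{1..n}. w (\<delta> t x) (x t))"
  by (intro prod.cong refl) auto
 finally show ?thesis .
qed

text \<open>
 Integrating out the last coordinate first, since the weights of the earlier times do not involve it: a
 supermartingale bound.
\<close>

lemma weight_product_le_1:
 assumes w: "(%(h,y). w h y) \<in> borel_measurable (borel \<Otimes>\<^sub>M borel)" and \<delta>: "predictable \<delta>"
  and le: "\<And>h. (\<integral>\<^sup>+y. w h y \<partial>\<mu>) <= 1"
 shows "(\<integral>\<^sup>+e. (\<Prod>t\<in>{1..n}. w (\<delta> t e) (e t)) \<partial>PiM {1..n} (%_. \<mu>)) <= 1"
proof (induction n)
 case 0
 show ?case by (simp add: PiM_empty nn_integral_count_space_finite)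
next
 case (Suc n)
 have wh: "w h \<in> borel_measurable borel" for h
  using measurable_compose[OF measurable_Pair1'[of h borel borel] w] by simp
 have "(\<integral>\<^sup>+e. (\<Prod>t\<in>{1..Suc n}. w (\<delta> t e) (e t)) \<partial>PiM {1..Suc n} (%_. \<mu>)) =
   (\<integral>\<^sup>+x. (\<integral>\<^sup>+y. (\<Prod>t\<in>{1..n}. w (\<delta> t x) (x t)) * w (\<delta> (Suc n) x) y \<partial>\<mu>) \<partial>PiM {1..n} (%_. \<mu>))"
  by (subst nn_integral_last) (intro borel_measurable_prod_ennreal measurable_weight w \<delta>, assumption, simp only: weight_prod_upd[OF \<delta>])
 also have "... = (\<integral>\<^sup>+x. (\<Prod>t\<in>{1..n}. w (\<delta> t x) (x t)) * (\<integral>\<^sup>+y. w (\<delta> (Suc n) x) y \<partial>\<mu>) \<partial>PiM {1..n} (%_. \<mu>))"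
  using wh by (intro nn_integral_cong nn_integral_cmult) simp
 also have "... <= (\<integral>\<^sup>+x. (\<Prod>t\<in>{1..n}. w (\<delta> t x) (x t)) * 1 \<partial>PiM {1..n} (%_. \<mu>))"
  by (intro nn_integral_mono mult_left_mono le) auto
 also have "... <= 1" using Suc by simp
 finally show ?case .
qed

lemma shear_change_of_variables:
 assumes w: "(%(h,y). w h y) \<in> borel_measurable (borel \<Otimes>\<^sub>M borel)" and \<delta>: "predictable \<delta>"
  and shift: "\<And>h g. g \<in> borel_measurable borel ==> (\<integral>\<^sup>+y. w h y * g (y + h) \<partial>\<mu>) = (\<integral>\<^sup>+y. g y \<partial>\<mu>)"
  and g: "g \<in> borel_measurable (paths n)"
 shows "(\<integral>\<^sup>+e. (\<Prod>t\<in>{1..n}. w (\<delta> t e) (e t)) * g (shear \<delta> n e) \<partial>PiM {1..n} (%_. \<mu>)) = (\<integral>\<^sup>+e. g e \<partial>PiM {1..n} (%_. \<mu>))"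
 using g
proof (induction n arbitrary: g)
 case 0
 show ?case by (simp add: PiM_empty nn_integral_count_space_finite shear_def restrict_def)
next
 case (Suc n)
 have i: "insert (Suc n) {1..n} = {1..Suc n}" by auto
 have upd: "(%(x, y). g (x(Suc n := y))) \<in> borel_measurable (paths n \<Otimes>\<^sub>M borel)"
  using measurable_compose[OF measurable_add_dim[of "Suc n" "{1..n}" "%_. borel"], of g] Suc.prems unfolding i by (simp add: split_beta')
 define G where "G x = (\<integral>\<^sup>+y. g (x(Suc n := y)) \<partial>\<mu>)" for x
 have G: "G \<in> borel_measurable (paths n)"
  unfolding G_def using upd by measurable
 have sh: "shear \<delta> (Suc n) (x(Suc n := y)) = (shear \<delta> n x)(Suc n := y + \<delta> (Suc n) x)" for x y
  by (auto simp: shear_def predictable_upd[OF \<delta>] fun_eq_iff)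
 have "(\<integral>\<^sup>+e. (\<Prod>t\<in>{1..Suc n}. w (\<delta> t e) (e t)) * g (shear \<delta> (Suc n) e) \<partial>PiM {1..Suc n} (%_. \<mu>)) =
   (\<integral>\<^sup>+x. (\<integral>\<^sup>+y. (\<Prod>t\<in>{1..n}. w (\<delta> t x) (x t)) * w (\<delta> (Suc n) x) y * g ((shear \<delta> n x)(Suc n := y + \<delta> (Suc n) x)) \<partial>\<mu>) \<partial>PiM {1..n} (%_. \<mu>))"
 proof (subst nn_integral_last)
  show "(%e. (\<Prod>t\<in>{1..Suc n}. w (\<delta> t e) (e t)) * g (shear \<delta> (Suc n) e)) \<in> borel_measurable (paths (Suc n))"
   by (intro borel_measurable_times_ennreal borel_measurable_prod_ennreal measurable_weight w \<delta>
     measurable_compose[OF measurable_shear[OF \<delta>] Suc.prems])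
 qed (simp only: weight_prod_upd[OF \<delta>] sh)
 also have "... = (\<integral>\<^sup>+x. (\<Prod>t\<in>{1..n}. w (\<delta> t x) (x t)) * G (shear \<delta> n x) \<partial>PiM {1..n} (%_. \<mu>))"
 proof (rule nn_integral_cong)
  fix x assume x: "x \<in> space (PiM {1..n} (%_. \<mu>))"
  have xs: "shear \<delta> n x \<in> space (paths n)" by (auto simp: shear_def space_PiM)
  have gx: "(%y. g ((shear \<delta> n x)(Suc n := y))) \<in> borel_measurable borel"
   using measurable_compose[OF measurable_Pair1'[OF xs] upd] by simp
  have wh: "w h \<in> borel_measurable borel" for h
   using measurable_compose[OF measurable_Pair1'[of h borel borel] w] by simp
  have "(\<integral>\<^sup>+y. (\<Prod>t\<in>{1..n}. w (\<delta> t x) (x t)) * w (\<delta> (Suc n) x) y * g ((shear \<delta> n x)(Suc n := y + \<delta> (Suc n) x)) \<partial>\<mu>)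
    = (\<integral>\<^sup>+y. (\<Prod>t\<in>{1..n}. w (\<delta> t x) (x t)) * (w (\<delta> (Suc n) x) y * g ((shear \<delta> n x)(Suc n := y + \<delta> (Suc n) x))) \<partial>\<mu>)"
   by (simp add: mult.assoc)
  also have "... = (\<Prod>t\<in>{1..n}. w (\<delta> t x) (x t)) * (\<integral>\<^sup>+y. w (\<delta> (Suc n) x) y * g ((shear \<delta> n x)(Suc n := y + \<delta> (Suc n) x)) \<partial>\<mu>)"
   by (intro nn_integral_cmult)
    (use measurable_compose[OF _ gx, of "%y. y + \<delta> (Suc n) x"] wh in \<open>auto intro!: borel_measurable_times_ennreal\<close>)
  also have "(\<integral>\<^sup>+y. w (\<delta> (Suc n) x) y * g ((shear \<delta> n x)(Suc n := y + \<delta> (Suc n) x)) \<partial>\<mu>) = G (shear \<delta> n x)"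
   unfolding G_def by (rule shift[OF gx])
  finally show "(\<integral>\<^sup>+y. (\<Prod>t\<in>{1..n}. w (\<delta> t x) (x t)) * w (\<delta> (Suc n) x) y * g ((shear \<delta> n x)(Suc n := y + \<delta> (Suc n) x)) \<partial>\<mu>)
    = (\<Prod>t\<in>{1..n}. w (\<delta> t x) (x t)) * G (shear \<delta> n x)" .
 qed
 also have "... = (\<integral>\<^sup>+e. G e \<partial>PiM {1..n} (%_. \<mu>))" by (rule Suc.IH[OF G])
 also have "... = (\<integral>\<^sup>+e. g e \<partial>PiM {1..Suc n} (%_. \<mu>))"
  unfolding G_def by (rule nn_integral_last[OF Suc.prems, symmetric])
 finally show ?case .
qed

text \<open>
 The shift at time \<open>t\<close> is independent of the noise at time \<open>t\<close>.
\<close>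

lemma nn_integral_current:
 assumes w: "(%(h,y). w h y) \<in> borel_measurable (borel \<Otimes>\<^sub>M borel)" and \<delta>: "predictable \<delta>" and t: "t \<in> {1..n}"
 shows "(\<integral>\<^sup>+e. w (\<delta> t e) (e t) \<partial>PiM {1..n} (%_. \<mu>)) = (\<integral>\<^sup>+e. (\<integral>\<^sup>+y. w (\<delta> t e) y \<partial>\<mu>) \<partial>PiM {1..n} (%_. \<mu>))"
proof -
 let ?I = "{1..n} - {t}"
 have i: "insert t ?I = {1..n}" using t by auto
 have m1: "(%e. w (\<delta> t e) (e t)) \<in> borel_measurable (paths n)" by (rule measurable_weight[OF w \<delta> t])
 define W where "W h = (\<integral>\<^sup>+y. w h y \<partial>\<mu>)" for h
 have W: "W \<in> borel_measurable borel" unfolding W_def using w by measurable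
 have dm: "\<delta> t \<in> borel_measurable (paths n)" using t by (intro predictable_measurable[OF \<delta>]) auto
 have m2: "(%e. W (\<delta> t e)) \<in> borel_measurable (paths n)" by (rule measurable_compose[OF dm W])
 have "(\<integral>\<^sup>+e. w (\<delta> t e) (e t) \<partial>PiM {1..n} (%_. \<mu>)) = (\<integral>\<^sup>+x. W (\<delta> t x) \<partial>PiM ?I (%_. \<mu>))"
  using P.product_nn_integral_insert[of ?I t "%e. w (\<delta> t e) (e t)"] m1 unfolding i
  by (simp add: predictable_upd[OF \<delta>] W_def)
 also have "... = (\<integral>\<^sup>+x. (\<integral>\<^sup>+y. W (\<delta> t (x(t := y))) \<partial>\<mu>) \<partial>PiM ?I (%_. \<mu>))"
  by (simp add: predictable_upd[OF \<delta>] emeasure_space_1[simplified])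
 also have "... = (\<integral>\<^sup>+e. W (\<delta> t e) \<partial>PiM {1..n} (%_. \<mu>))"
  using P.product_nn_integral_insert[of ?I t "%e. W (\<delta> t e)"] m2 unfolding i by simp
 finally show ?thesis unfolding W_def .
qed

end

lemma borel_prob_innov: "f \<in> density_class ==> borel_prob (innov f)"
 unfolding borel_prob_def borel_prob_axioms_def using density_classD(2) by auto

lemma innov_shift_ratio:
 fixes f :: "real^'d => real"
 assumes f: "f \<in> density_class" and g: "g \<in> borel_measurable borel"
 shows "(\<integral>\<^sup>+y. ennreal (f (y + h) / f y) * g (y + h) \<partial>innov f) = (\<integral>\<^sup>+y. g y \<partial>innov f)"
proof -
 note [measurable] = density_classD(1)[OF f] g
 have fpos: "f x > 0" for x by (rule density_classD(3)[OF f])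
 have "(\<integral>\<^sup>+y. ennreal (f (y + h) / f y) * g (y + h) \<partial>innov f) = (\<integral>\<^sup>+y. ennreal (f (y + h)) * g (y + h) \<partial>lborel)"
 proof (subst nn_integral_innov[OF f], measurable, rule nn_integral_cong)
  fix x
  have "ennreal (f x) * ennreal (f (x + h) / f x) = ennreal (f (x + h))"
   using fpos[of x] fpos[of "x+h"] by (simp add: ennreal_mult[symmetric])
  thus "ennreal (f x) * (ennreal (f (x + h) / f x) * g (x + h)) = ennreal (f (x + h)) * g (x + h)"
   by (simp add: mult.assoc[symmetric])
 qed
 also have "... = (\<integral>\<^sup>+y. ennreal (f y) * g y \<partial>lborel)"
  by (rule nn_integral_shift) measurable
 also have "... = (\<integral>\<^sup>+y. g y \<partial>innov f)" by (rule nn_integral_innov[OF f g, symmetric])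
 finally show ?thesis .
qed

text \<open>
 On the event that the shifted noise lies in \<open>A\<close>, at least one of the following holds: some density ratio
 drops by the factor 4 (\<open>D\<close>); the shifts are large (\<open>S\<close>); the likelihood ratio
 \<open>\<Lambda>\<close> of the original to the shifted noise exceeds \<open>K\<close>, which is rare because of the
 truncated root ratios (\<open>T\<close>); or \<open>\<Lambda> <= K\<close>, and then a change of variables bounds the
 probability by \<open>K\<close> times that of \<open>A\<close> (\<open>R\<close>). The constants make the first three
 at most \<open>2 \<epsilon> / 5\<close>, \<open>\<epsilon> / 5\<close> and \<open>\<epsilon> / 5\<close>.
\<close>

lemma shear_domination:
 fixes f :: "real^'d => real"
 assumes f: "f \<in> density_class" and s2: "s2 >= 0" and \<epsilon>: "\<epsilon> > 0"
 shows "\<exists>K\<ge>0. \<exists>s4>0. \<forall>n \<delta>. predictable \<delta> \<longrightarrow>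
   (\<integral>\<^sup>+e. (\<Sum>t\<in>{1..n}. ennreal ((norm (\<delta> t e))\<^sup>2)) \<partial>noise f n) <= ennreal s2 \<longrightarrow>
   (\<integral>\<^sup>+e. (\<Sum>t\<in>{1..n}. ennreal ((norm (\<delta> t e)) ^ 4)) \<partial>noise f n) <= ennreal s4 \<longrightarrow>
   (\<forall>A\<in>sets (paths n). measure (noise f n) {e\<in>space (noise f n). shear \<delta> n e \<in> A}
    <= K * measure (noise f n) A + \<epsilon>)"
proof -
 interpret borel_prob "innov f" by (rule borel_prob_innov[OF f])
 note [measurable] = density_classD(1)[OF f]
 have fpos: "f x > 0" for x by (rule density_classD(3)[OF f])
 obtain c where c: "c >= 0" "\<And>h. (\<integral>\<^sup>+x. ennreal (if 4 * f (x + h) < f x then 0 else sqrt (f x / f (x + h)) * exp (- c * (norm h)\<^sup>2)) \<partial>innov f) <= 1"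
  using truncated_root_ratio[OF f] by blast
 define \<eta> where "\<eta> = \<epsilon> / (5 * (s2 + 1))"
 have \<eta>: "\<eta> > 0" using \<epsilon> s2 by (simp add: \<eta>_def)
 obtain C where C: "C >= 0" "\<And>h. measure (innov f) {x. 4 * f (x + h) < f x} <= \<eta> * (norm h)\<^sup>2 + C * (norm h) ^ 4"
  using density_drop_bound[OF f \<eta>] by blast
 define s4 where "s4 = \<epsilon> / (5 * (C + 1))"
 have s4: "s4 > 0" using \<epsilon> C by (simp add: s4_def)
 define B where "B = 5 * (s2 + 1) / \<epsilon>"
 have B: "B > 0" using \<epsilon> s2 by (simp add: B_def)
 define K where "K = (5 * exp (c * B) / \<epsilon>)\<^sup>2"
 have sK: "sqrt K = 5 * exp (c * B) / \<epsilon>" "K > 0" using \<epsilon> by (simp_all add: K_def)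
 define wr where "wr h y = ennreal (f (y + h) / f y)" for h y
 define wt where "wt h y = ennreal (if 4 * f (y + h) < f y then 0 else sqrt (f y / f (y + h)) * exp (- c * (norm h)\<^sup>2))" for h y
 define wd where "wd h y = (indicator {z. 4 * f (z + h) < f z} y :: ennreal)" for h y
 have wm: "(%(h,y). wr h y) \<in> borel_measurable (borel \<Otimes>\<^sub>M borel)" "(%(h,y). wt h y) \<in> borel_measurable (borel \<Otimes>\<^sub>M borel)"
  unfolding wr_def wt_def by measurable
 have wdm: "(%(h,y). wd h y) \<in> borel_measurable (borel \<Otimes>\<^sub>M borel)"
 proof -
  have "(%(h,y). wd h y) = (%hy. if 4 * f (snd hy + fst hy) < f (snd hy) then 1 else 0)"
   by (auto simp: wd_def fun_eq_iff indicator_def)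
  thus ?thesis by (simp only:) measurable
 qed
 have main: "measure (noise f n) {e\<in>space (noise f n). shear \<delta> n e \<in> A}
    <= K * measure (noise f n) A + \<epsilon>"
  if \<delta>: "predictable \<delta>"
   and S2: "(\<integral>\<^sup>+e. (\<Sum>t\<in>{1..n}. ennreal ((norm (\<delta> t e))\<^sup>2)) \<partial>noise f n) <= ennreal s2"
   and S4: "(\<integral>\<^sup>+e. (\<Sum>t\<in>{1..n}. ennreal ((norm (\<delta> t e)) ^ 4)) \<partial>noise f n) <= ennreal s4"
   and A: "A \<in> sets (paths n)" for n \<delta> A
 proof -
  define Q where "Q = PiM {1..n} (%_::nat. innov f)"
  interpret Q: prob_space Q unfolding Q_def by (rule prob_space_P)
  have setsQ [measurable_cong]: "sets Q = sets (paths n)" unfolding Q_def by simp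
  have mQ: "measurable Q N = measurable (paths n) N" for N :: "'x measure" unfolding Q_def by simp
  have dm: "\<delta> t \<in> borel_measurable Q" if "t \<in> {1..n}" for t
   unfolding mQ using that by (intro predictable_measurable[OF \<delta>]) auto
  have wmQ: "(%e. w (\<delta> t e) (e t)) \<in> borel_measurable Q" if "(%(h,y). w h y) \<in> borel_measurable (borel \<Otimes>\<^sub>M borel)" "t \<in> {1..n}" for w :: "_ => _ => ennreal" and t
   unfolding mQ by (rule measurable_weight[OF that(1) \<delta> that(2)])
  define E where "E = {e\<in>space Q. shear \<delta> n e \<in> A}"
  define D where "D = (%e. \<Sum>t\<in>{1..n}. wd (\<delta> t e) (e t))"
  define S where "S = (%e. \<Sum>t\<in>{1..n}. ennreal ((norm (\<delta> t e))\<^sup>2))"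
  define T where "T = (%e. \<Prod>t\<in>{1..n}. wt (\<delta> t e) (e t))"
  define R where "R = (%e. (\<Prod>t\<in>{1..n}. wr (\<delta> t e) (e t)) * indicator A (shear \<delta> n e))"
  have shm: "shear \<delta> n \<in> measurable Q (paths n)" unfolding mQ by (rule measurable_shear[OF \<delta>])
  have Dm [measurable]: "D \<in> borel_measurable Q" unfolding D_def by (intro borel_measurable_sum wmQ wdm)
  have Sm [measurable]: "S \<in> borel_measurable Q" unfolding S_def
   by (intro borel_measurable_sum) (use dm in measurable)
  have Tm [measurable]: "T \<in> borel_measurable Q" unfolding T_def by (intro borel_measurable_prod_ennreal wmQ wm)
  have iAm: "(%e. indicator A (shear \<delta> n e) :: ennreal) \<in> borel_measurable Q"
   using measurable_compose[OF shm borel_measurable_indicator[OF A]] by simp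
  have Rm [measurable]: "R \<in> borel_measurable Q" unfolding R_def
   by (intro borel_measurable_times_ennreal iAm borel_measurable_prod_ennreal wmQ wm)
  have Em [measurable]: "E \<in> sets Q" unfolding E_def using measurable_sets[OF shm A] by (simp add: vimage_def Int_def conj_commute)
  have iD: "(\<integral>\<^sup>+e. D e \<partial>Q) <= ennreal (2 * \<epsilon> / 5)"
  proof -
   have "(\<integral>\<^sup>+e. D e \<partial>Q) = (\<Sum>t\<in>{1..n}. \<integral>\<^sup>+e. wd (\<delta> t e) (e t) \<partial>Q)"
    unfolding D_def by (intro nn_integral_sum wmQ wdm)
   also have "... = (\<Sum>t\<in>{1..n}. \<integral>\<^sup>+e. (\<integral>\<^sup>+y. wd (\<delta> t e) y \<partial>innov f) \<partial>Q)"
    unfolding Q_def by (intro sum.cong refl nn_integral_current wdm \<delta>)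
   also have "... <= (\<Sum>t\<in>{1..n}. \<integral>\<^sup>+e. ennreal \<eta> * ennreal ((norm (\<delta> t e))\<^sup>2) + ennreal C * ennreal (norm (\<delta> t e) ^ 4) \<partial>Q)"
   proof (intro sum_mono nn_integral_mono)
    fix t e
    have "(\<integral>\<^sup>+y. wd (\<delta> t e) y \<partial>innov f) = emeasure (innov f) {z. 4 * f (z + \<delta> t e) < f z}"
     unfolding wd_def by (subst nn_integral_indicator) auto
    also have "... = ennreal (measure (innov f) {z. 4 * f (z + \<delta> t e) < f z})" by (simp add: emeasure_eq_measure)
    also have "... <= ennreal (\<eta> * (norm (\<delta> t e))\<^sup>2 + C * (norm (\<delta> t e)) ^ 4)" by (intro ennreal_leI C(2))
    also have "... = ennreal \<eta> * ennreal ((norm (\<delta> t e))\<^sup>2) + ennreal C * ennreal (norm (\<delta> t e) ^ 4)"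
     using \<eta> C by (simp add: ennreal_plus ennreal_mult)
    finally show "(\<integral>\<^sup>+y. wd (\<delta> t e) y \<partial>innov f) <= ..." .
   qed
   also have "... = ennreal \<eta> * (\<integral>\<^sup>+e. (\<Sum>t\<in>{1..n}. ennreal ((norm (\<delta> t e))\<^sup>2)) \<partial>Q) + ennreal C * (\<integral>\<^sup>+e. (\<Sum>t\<in>{1..n}. ennreal ((norm (\<delta> t e)) ^ 4)) \<partial>Q)"
   proof -
    have m: "(%e. ennreal ((norm (\<delta> t e)) ^ k)) \<in> borel_measurable Q" if "Suc 0 <= t" "t <= n" for t k
    proof -
     have [measurable]: "\<delta> t \<in> borel_measurable Q" using that by (intro dm) auto
     show ?thesis by measurable
    qed
    have "(\<Sum>t\<in>{1..n}. \<integral>\<^sup>+e. ennreal \<eta> * ennreal ((norm (\<delta> t e))\<^sup>2) + ennreal C * ennreal (norm (\<delta> t e) ^ 4) \<partial>Q)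
      = (\<Sum>t\<in>{1..n}. ennreal \<eta> * (\<integral>\<^sup>+e. ennreal ((norm (\<delta> t e))\<^sup>2) \<partial>Q) + ennreal C * (\<integral>\<^sup>+e. ennreal (norm (\<delta> t e) ^ 4) \<partial>Q))"
    proof (intro sum.cong refl)
     fix t assume "t \<in> {1..n}"
     hence t: "Suc 0 <= t" "t <= n" by auto
     note [measurable] = m[OF t, of 2] m[OF t, of 4]
     show "(\<integral>\<^sup>+e. ennreal \<eta> * ennreal ((norm (\<delta> t e))\<^sup>2) + ennreal C * ennreal (norm (\<delta> t e) ^ 4) \<partial>Q)
       = ennreal \<eta> * (\<integral>\<^sup>+e. ennreal ((norm (\<delta> t e))\<^sup>2) \<partial>Q) + ennreal C * (\<integral>\<^sup>+e. ennreal (norm (\<delta> t e) ^ 4) \<partial>Q)"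
      by (subst nn_integral_add) (measurable, simp only: nn_integral_cmult[OF m[OF t, of 2]] nn_integral_cmult[OF m[OF t, of 4]])
    qed
    moreover have ns: "(\<integral>\<^sup>+e. (\<Sum>t\<in>{1..n}. ennreal (norm (\<delta> t e) ^ k)) \<partial>Q) = (\<Sum>t\<in>{1..n}. \<integral>\<^sup>+e. ennreal (norm (\<delta> t e) ^ k) \<partial>Q)" for k
     by (rule nn_integral_sum) (use m in auto)
    ultimately show ?thesis unfolding ns sum_distrib_left sum.distrib[symmetric] by (simp only:)
   qed
   also have "... <= ennreal \<eta> * ennreal s2 + ennreal C * ennreal s4"
    using S2 S4 unfolding Q_def by (intro add_mono mult_left_mono) auto
   also have "... = ennreal (\<eta> * s2 + C * s4)" using \<eta> C s2 s4 by (simp add: ennreal_plus ennreal_mult)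
   also have "... <= ennreal (2 * \<epsilon> / 5)"
   proof (rule ennreal_leI)
    have "\<eta> * s2 <= \<epsilon> / 5" using s2 \<epsilon> by (simp add: \<eta>_def field_simps)
    moreover have "C * s4 <= \<epsilon> / 5" using C \<epsilon> by (simp add: s4_def field_simps)
    ultimately show "\<eta> * s2 + C * s4 <= 2 * \<epsilon> / 5" by simp
   qed
   finally show ?thesis .
  qed
  have iT: "(\<integral>\<^sup>+e. T e \<partial>Q) <= 1" unfolding T_def Q_def
   by (rule weight_product_le_1[OF wm(2) \<delta>]) (simp add: wt_def c(2))
  have iR: "(\<integral>\<^sup>+e. R e \<partial>Q) = emeasure Q A"
  proof -
   have "(\<integral>\<^sup>+e. R e \<partial>Q) = (\<integral>\<^sup>+e. indicator A e \<partial>Q)" unfolding R_def Q_def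
    by (rule shear_change_of_variables[OF wm(1) \<delta>])
     (use A in \<open>auto simp: wr_def innov_shift_ratio[OF f] intro!: borel_measurable_indicator\<close>)
   thus ?thesis using A setsQ by simp
  qed
  have pt: "indicator E e <= D e + ennreal (1 / B) * S e + ennreal (exp (c * B) / sqrt K) * T e + ennreal K * R e" if e: "e \<in> space Q" for e
  proof (cases "e \<in> E \<and> (\<forall>t\<in>{1..n}. \<not> 4 * f (e t + \<delta> t e) < f (e t)) \<and> S e <= ennreal B")
   case False
   show ?thesis
   proof (cases "e \<in> E")
    case True
    then consider t where "t \<in> {1..n}" "4 * f (e t + \<delta> t e) < f (e t)" | "\<not> S e <= ennreal B" using False by auto
    thus ?thesis
    proof cases
     case 1
     hence "1 = wd (\<delta> t e) (e t)" by (simp add: wd_def)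
     also have "... <= D e" unfolding D_def using 1 by (intro member_le_sum) auto
     finally show ?thesis using True by (simp add: add_increasing2 indicator_def)
    next
     case 2
     hence "ennreal B <= S e" by simp
     hence "ennreal (1 / B) * ennreal B <= ennreal (1 / B) * S e" by (rule mult_left_mono) simp
     moreover have "ennreal (1 / B) * ennreal B = 1" using B by (simp add: ennreal_mult[symmetric])
     ultimately have "1 <= ennreal (1 / B) * S e" by simp
     hence "1 <= D e + ennreal (1 / B) * S e" by (simp add: add_increasing)
     thus ?thesis using True by (simp add: add_increasing2 indicator_def)
    qed
   qed simp
  next
   case True
   define \<Lambda> where "\<Lambda> = (\<Prod>t\<in>{1..n}. f (e t) / f (e t + \<delta> t e))"
   have \<Lambda>: "\<Lambda> > 0" unfolding \<Lambda>_def by (intro prod_pos divide_pos_pos ballI fpos)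
   have Rv: "R e = ennreal (1 / \<Lambda>)"
   proof -
    have "R e = (\<Prod>t\<in>{1..n}. wr (\<delta> t e) (e t))" using True by (simp add: R_def E_def)
    also have "... = ennreal (\<Prod>t\<in>{1..n}. f (e t + \<delta> t e) / f (e t))"
     unfolding wr_def by (subst prod_ennreal) (auto intro: divide_nonneg_nonneg less_imp_le[OF fpos])
    also have "(\<Prod>t\<in>{1..n}. f (e t + \<delta> t e) / f (e t)) = 1 / \<Lambda>"
     unfolding \<Lambda>_def by (simp add: prod_dividef)
    finally show ?thesis .
   qed
   define s where "s = (\<Sum>t\<in>{1..n}. (norm (\<delta> t e))\<^sup>2)"
   have "S e = ennreal s" unfolding S_def s_def by (rule sum_ennreal) auto
   hence sB: "s <= B" using True B by (simp add: ennreal_le_iff)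
   have Tv: "T e = ennreal (sqrt \<Lambda> * exp (- c * s))"
   proof -
    have "T e = (\<Prod>t\<in>{1..n}. ennreal (sqrt (f (e t) / f (e t + \<delta> t e)) * exp (- c * (norm (\<delta> t e))\<^sup>2)))"
     unfolding T_def wt_def using True by (intro prod.cong refl) auto
    also have "... = ennreal (\<Prod>t\<in>{1..n}. sqrt (f (e t) / f (e t + \<delta> t e)) * exp (- c * (norm (\<delta> t e))\<^sup>2))"
     by (rule prod_ennreal) (auto intro!: mult_nonneg_nonneg divide_nonneg_nonneg less_imp_le[OF fpos])
    also have "(\<Prod>t\<in>{1..n}. sqrt (f (e t) / f (e t + \<delta> t e)) * exp (- c * (norm (\<delta> t e))\<^sup>2)) = sqrt \<Lambda> * exp (- c * s)"
    proof -
     have "(\<Prod>t\<in>I. sqrt (g t)) = sqrt (\<Prod>t\<in>I. g t)" for I and g :: "nat => real"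
      by (induction I rule: infinite_finite_induct) (simp_all add: real_sqrt_mult)
     thus ?thesis
      unfolding prod.distrib \<Lambda>_def s_def exp_sum[symmetric, OF finite_atLeastAtMost]
      by (simp only: sum_distrib_left)
    qed
    finally show ?thesis .
   qed
   show ?thesis
   proof (cases "\<Lambda> <= K")
    case True
    hence "1 <= K * (1 / \<Lambda>)" using \<Lambda> by (simp add: le_divide_eq)
    hence "1 <= ennreal K * R e" unfolding Rv using sK \<Lambda> by (simp add: ennreal_mult[symmetric] del: ennreal_1)
    hence "1 <= D e + ennreal (1 / B) * S e + ennreal (exp (c * B) / sqrt K) * T e + ennreal K * R e" by (simp add: add_increasing)
    thus ?thesis by (simp add: indicator_def)
   next
    case False
    have "1 <= exp (c * B) / sqrt K * (sqrt \<Lambda> * exp (- c * s))"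
    proof -
     have "1 <= sqrt \<Lambda> / sqrt K" using False sK(2) by simp
     moreover have "1 <= exp (c * B) * exp (- c * s)"
      using sB c(1) by (simp add: exp_add[symmetric] mult_left_mono)
     ultimately have "1 * 1 <= (sqrt \<Lambda> / sqrt K) * (exp (c * B) * exp (- c * s))" by (intro mult_mono) auto
     thus ?thesis by (simp add: mult_ac)
    qed
    hence "ennreal 1 <= ennreal (exp (c * B) / sqrt K * (sqrt \<Lambda> * exp (- c * s)))" by (rule ennreal_leI)
    also have "... = ennreal (exp (c * B) / sqrt K) * T e" unfolding Tv
     using sK(2) \<Lambda> by (intro ennreal_mult) auto
    finally have "1 <= ennreal (exp (c * B) / sqrt K) * T e" by simp
    hence "1 <= D e + ennreal (1 / B) * S e + ennreal (exp (c * B) / sqrt K) * T e" by (simp add: add_increasing)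
    thus ?thesis by (simp add: indicator_def add_increasing2)
   qed
  qed
  have "emeasure Q E = (\<integral>\<^sup>+e. indicator E e \<partial>Q)" by simp
  also have "... <= (\<integral>\<^sup>+e. D e + ennreal (1 / B) * S e + ennreal (exp (c * B) / sqrt K) * T e + ennreal K * R e \<partial>Q)"
   by (intro nn_integral_mono pt)
  also have "... = (\<integral>\<^sup>+e. D e \<partial>Q) + ennreal (1 / B) * (\<integral>\<^sup>+e. S e \<partial>Q) + ennreal (exp (c * B) / sqrt K) * (\<integral>\<^sup>+e. T e \<partial>Q) + ennreal K * (\<integral>\<^sup>+e. R e \<partial>Q)"
   by (simp add: nn_integral_add nn_integral_cmult)
  also have "... <= ennreal (2 * \<epsilon> / 5) + ennreal (1 / B) * ennreal s2 + ennreal (exp (c * B) / sqrt K) * 1 + ennreal K * emeasure Q A"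
  proof -
   have "(\<integral>\<^sup>+e. S e \<partial>Q) <= ennreal s2" using S2 by (simp only: S_def Q_def)
   with iD iT show ?thesis unfolding iR by (intro add_mono mult_left_mono order_refl) simp_all
  qed
  also have "... = ennreal (2 * \<epsilon> / 5 + 1 / B * s2 + exp (c * B) / sqrt K + K * measure Q A)"
  proof -
   have "ennreal a + ennreal b * ennreal b' + ennreal c * 1 + ennreal k * ennreal d = ennreal (a + b * b' + c + k * d)"
    if "a >= 0" "b >= 0" "b' >= 0" "c >= 0" "k >= 0" "d >= 0" for a b b' c k d
    using that by (simp add: ennreal_plus ennreal_mult)
   thus ?thesis unfolding Q.emeasure_eq_measure using \<epsilon> B s2 sK(2) by simp
  qed
  also have "... <= ennreal (K * measure Q A + \<epsilon>)"
  proof (rule ennreal_leI)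
   have "1 / B * s2 <= \<epsilon> / 5" using s2 \<epsilon> by (simp add: B_def field_simps)
   moreover have "exp (c * B) / sqrt K = \<epsilon> / 5" unfolding sK using \<epsilon> by (simp add: field_simps)
   ultimately show "2 * \<epsilon> / 5 + 1 / B * s2 + exp (c * B) / sqrt K + K * measure Q A <= K * measure Q A + \<epsilon>"
    using \<epsilon> by linarith
  qed
  finally have "ennreal (measure Q E) <= ennreal (K * measure Q A + \<epsilon>)" unfolding Q.emeasure_eq_measure .
  moreover have "0 <= K * measure Q A + \<epsilon>" using sK(2) \<epsilon> by (intro add_nonneg_nonneg mult_nonneg_nonneg) auto
  ultimately have "measure Q E <= K * measure Q A + \<epsilon>" using ennreal_le_iff by blast
  thus ?thesis unfolding E_def Q_def .
 qed
 show ?thesis using main s4 sK(2) by (intro exI[of _ K] conjI exI[of _ s4] allI impI ballI) auto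
qed

section \<open>The law of a sample and contiguity\<close>

lemma borel_measurable_matrix_vector_mult:
 fixes A :: "'a => real^'n^'m"
 assumes "A \<in> borel_measurable M" "x \<in> borel_measurable M"
 shows "(%\<omega>. A \<omega> *v x \<omega>) \<in> borel_measurable M"
 by (rule borel_measurable_continuous_Pair[OF assms])
   (intro bounded_bilinear.continuous_on[OF bounded_bilinear_matrix_vector_mult] continuous_intros)

lemma borel_measurable_lagsum:
 assumes "\<And>i. (%\<omega>. a \<omega> i) \<in> borel_measurable M" "\<And>s. s < t ==> (%\<omega>. x \<omega> s) \<in> borel_measurable M"
 shows "(%\<omega>. lagsum k (a \<omega>) (x \<omega>) t) \<in> borel_measurable M"
 unfolding lagsum_def by (intro borel_measurable_sum borel_measurable_matrix_vector_mult assms) auto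

lemma borel_measurable_block: "(%\<theta>. block \<theta> k) \<in> borel_measurable borel"
proof -
 have lin: "linear (%\<theta>::('a,'b) param. block \<theta> k)"
  by (rule linearI) (auto simp: block_def unvec_def vec_eq_iff)
 thus ?thesis by (intro borel_measurable_continuous_onI linear_continuous_on linear_conv_bounded_linear[THEN iffD1])
qed

lemma borel_measurable_ar_coeff:
 "T \<in> borel_measurable M ==> (%\<omega>. ar_coeff (T \<omega>) i) \<in> borel_measurable M"
 unfolding ar_coeff_def by (rule measurable_compose[OF _ borel_measurable_block])

lemma borel_measurable_ma_lag:
 assumes "T \<in> borel_measurable M" shows "(%\<omega>. ma_lag p (T \<omega>) i) \<in> borel_measurable M"
 unfolding ma_lag_def ma_coeff_def using measurable_compose[OF assms borel_measurable_block]
 by (cases "i = 0") (auto intro!: borel_measurable_uminus)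

lemma measurable_coord:
 "t \<in> {1..n} ==> (%e. e t) \<in> borel_measurable (paths n)"
 by (rule measurable_component_singleton)

lemma borel_measurable_varma_path:
 assumes "t <= n"
 shows "(%e. varma_path p q \<theta> e t) \<in> borel_measurable (paths n)"
 using assms
proof (induction t rule: less_induct)
 case (less t)
 show ?case
 proof (cases t)
  case (Suc s)
  show ?thesis unfolding Suc varma_path_Suc[of p q \<theta> _ s]
   by (intro borel_measurable_add borel_measurable_diff borel_measurable_lagsum less.IH measurable_coord)
    (use less.prems Suc in auto)
 qed simp
qed

lemma borel_measurable_resid:
 assumes T: "T \<in> borel_measurable M" and X: "\<And>s. 1 <= s ==> s <= t ==> (%\<omega>. X \<omega> s) \<in> borel_measurable M"
 shows "(%\<omega>. resid p q (T \<omega>) (X \<omega>) t) \<in> borel_measurable M"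
 using X
proof (induction t rule: less_induct)
 case (less t)
 show ?case
 proof (cases t)
  case (Suc s)
  show ?thesis unfolding Suc resid_Suc[of p q _ _ s]
   by (intro borel_measurable_add borel_measurable_diff borel_measurable_lagsum less.IH
     borel_measurable_ar_coeff borel_measurable_ma_lag T less.prems)
    (use Suc in auto)
 qed simp
qed

lemma sets_sample_space: "sample_space n = paths n"
 by (simp add: sample_space_def)

lemma borel_measurable_resid_sample:
 assumes "T \<in> borel_measurable (sample_space n)" "t <= n"
 shows "(%x. resid p q (T x) x t) \<in> borel_measurable (sample_space n)"
 using assms unfolding sample_space_def by (intro borel_measurable_resid measurable_coord) auto

lemma measurable_path_vector:
 "(%e. restrict (varma_path p q \<theta> e) {1..n}) \<in> measurable (paths n) (paths n)"
 by (intro measurable_restrict borel_measurable_varma_path) auto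

lemma measurable_resid_vector:
 "(%x. restrict (resid p q \<theta> x) {1..n}) \<in> measurable (paths n) (paths n)"
 using borel_measurable_resid_sample[of "%_. \<theta>" n] unfolding sample_space_def
 by (intro measurable_restrict) auto

lemma sets_varma_law [simp, measurable_cong]: "sets (varma_law p q \<theta> f n) = sets (paths n)"
 by (simp add: varma_law_def sample_space_def)

lemma space_varma_law: "space (varma_law p q \<theta> f n) = space (paths n)"
 by (rule sets_eq_imp_space_eq) simp

lemma measurable_varma_law: "measurable (varma_law p q \<theta> f n) N = measurable (paths n) N"
 by (rule measurable_cong_sets) auto

context
 fixes f :: "real^'d => real" assumes f: "f \<in> density_class"
begin

interpretation borel_prob "innov f" by (rule borel_prob_innov[OF f])

lemma prob_space_varma_law: "prob_space (varma_law p q \<theta> f n)"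
 unfolding varma_law_def sample_space_def
 by (intro prob_space.prob_space_distr prob_space_P) (simp add: measurable_path_vector[simplified])

text \<open>
 Residuals at the true parameter invert the construction of the sample from the noise.
\<close>

lemma distr_resid_varma_law:
 "distr (varma_law p q \<theta> f n) (paths n) (%x. restrict (resid p q \<theta> x) {1..n}) = noise f n"
proof -
 let ?N = "paths n :: (nat => real^'d) measure"
 have "distr (varma_law p q \<theta> f n) ?N (%x. restrict (resid p q \<theta> x) {1..n})
   = distr (noise f n) ?N (%e. restrict (resid p q \<theta> (restrict (varma_path p q \<theta> e) {1..n})) {1..n})"
  unfolding varma_law_def sample_space_def
  by (subst distr_distr) (simp_all add: measurable_path_vector[simplified] measurable_resid_vector[simplified] comp_def)
 also have "... = distr (noise f n) (noise f n) (%e. e)"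
 proof (rule distr_cong)
  fix e assume "e \<in> space (noise f n)"
  hence e: "e \<in> extensional {1..n}" by (simp add: space_PiM PiE_def)
  have "resid p q \<theta> (restrict (varma_path p q \<theta> e) {1..n}) t = e t" if "t \<in> {1..n}" for t
  proof -
   have "resid p q \<theta> (restrict (varma_path p q \<theta> e) {1..n}) t = resid p q \<theta> (varma_path p q \<theta> e) t"
    using that by (intro resid_cong) auto
   thus ?thesis using that by (simp add: resid_varma_path)
  qed
  thus "restrict (resid p q \<theta> (restrict (varma_path p q \<theta> e) {1..n})) {1..n} = e"
   by (intro extensionalityI[OF _ e]) auto
 qed auto
 also have "... = noise f n" by (rule distr_id)
 finally show ?thesis .
qed

lemma nn_integral_norm_coord:
 assumes "t \<in> {1..n::nat}"
 shows "(\<integral>\<^sup>+e. ennreal (norm (e t) ^ P) \<partial>noise f n) = (\<integral>\<^sup>+y. ennreal (norm y ^ P) \<partial>innov f)"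
proof -
 have "(\<integral>\<^sup>+e. ennreal (norm (e t) ^ P) \<partial>noise f n) = (\<integral>\<^sup>+e. (\<integral>\<^sup>+y. ennreal (norm y ^ P) \<partial>innov f) \<partial>noise f n)"
  using assms by (intro nn_integral_current[where w="%h y. ennreal (norm y ^ P)" and \<delta>="%t e. 0"])
   (auto simp: predictable_def)
 also have "... = (\<integral>\<^sup>+y. ennreal (norm y ^ P) \<partial>innov f)"
  using prob_space.emeasure_space_1[OF prob_space_P] by simp
 finally show ?thesis .
qed

lemma integrable_norm_sq: "integrable (innov f) (%e. (norm e)\<^sup>2)"
 using integrable_norm[OF density_classD(8)[OF f]] by (simp add: power2_eq_square)

text \<open>
 A sample at \<open>\<theta>n\<close> built from the noise \<open>e\<close> is the sample at \<open>\<theta>\<close>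
 built from its residuals at \<open>\<theta>\<close>. These are \<open>e\<close> plus a predictable shift, whose sum
 of squares is bounded in mean and whose sum of fourth powers is of order \<open>1 / n\<close>.
\<close>

lemma varma_shift_contiguity:
 fixes \<theta> \<tau> :: "('l::{finite,linorder}, 'd) param"
 assumes \<theta>: "\<theta> \<in> varma_params p q"
  and m4: "integrable (innov f) (%e. outer (vecm (outer e e)) (vecm (outer e e)))"
  and \<epsilon>: "\<epsilon> > 0"
 shows "\<exists>K\<ge>0. \<exists>N. \<forall>n\<ge>N. \<forall>A\<in>sets (paths n).
   measure (varma_law p q (\<theta> + (1 / sqrt (real n)) *\<^sub>R \<tau>) f n) A <= K * measure (varma_law p q \<theta> f n) A + \<epsilon>"
proof -
 have i4: "integrable (innov f) (%e. norm e ^ 4)"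
  using integrable_norm[OF m4] by (simp add: power4_eq_xxxx mult.assoc)
 define m2 where "m2 = (LINT e|innov f. (norm e)\<^sup>2)"
 define m4 where "m4 = (LINT e|innov f. norm e ^ 4)"
 have n2: "(\<integral>\<^sup>+y. ennreal (norm y ^ 2) \<partial>innov f) = ennreal m2" unfolding m2_def
  by (intro nn_integral_eq_integral integrable_norm_sq) auto
 have n4: "(\<integral>\<^sup>+y. ennreal (norm y ^ 4) \<partial>innov f) = ennreal m4" unfolding m4_def
  by (intro nn_integral_eq_integral i4) auto
 have m0: "m2 >= 0" "m4 >= 0" unfolding m2_def m4_def by auto
 obtain \<eta> \<rho> C L where \<eta>: "\<eta> > 0" and L: "L > 0" and
  lip: "\<And>\<theta>1 \<theta>2 \<theta>3 P n x. norm (\<theta>1 - \<theta>) <= \<eta> ==> norm (\<theta>2 - \<theta>) <= \<eta> ==> norm (\<theta>3 - \<theta>) <= \<eta> ==> P \<in> {1,2,4} ==>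
    ssq P n (%t. resid p q \<theta>2 x t - resid p q \<theta>3 x t) <= L * norm (\<theta>2 - \<theta>3) ^ P * ssq P n (resid p q \<theta>1 x)"
  by (rule varma_uniform_bounds[OF \<theta>]) blast
 define s2 where "s2 = L * (norm \<tau>)\<^sup>2 * m2"
 have s2: "s2 >= 0" using L m0 by (simp add: s2_def)
 obtain K s4 where K: "K >= 0" and s4: "s4 > 0" and dom: "\<And>n \<delta> A. predictable \<delta> ==>
   (\<integral>\<^sup>+e. (\<Sum>t\<in>{1..n}. ennreal ((norm (\<delta> t e))\<^sup>2)) \<partial>noise f n) <= ennreal s2 ==>
   (\<integral>\<^sup>+e. (\<Sum>t\<in>{1..n}. ennreal ((norm (\<delta> t e)) ^ 4)) \<partial>noise f n) <= ennreal s4 ==>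
   A\<in>sets (paths n) ==> measure (noise f n) {e\<in>space (noise f n). shear \<delta> n e \<in> A}
    <= K * measure (noise f n) A + \<epsilon>"
 proof -
  from shear_domination[OF f s2 \<epsilon>] show thesis
   by (elim exE conjE) (rule that, assumption, assumption, drule spec, drule spec, drule (1) mp, drule (1) mp, drule (1) mp, erule (1) bspec)
 qed
 obtain N where N: "\<And>n. n >= N ==> n >= 1 \<and> norm \<tau> / sqrt (real n) <= \<eta> \<and> L * norm \<tau> ^ 4 * m4 / real n <= s4"
 proof -
  have "((%n. norm \<tau> / sqrt (real n)) \<longlongrightarrow> 0) sequentially" "((%n. L * norm \<tau> ^ 4 * m4 / real n) \<longlongrightarrow> 0) sequentially"
   by real_asymp+
  from order_tendstoD(2)[OF this(1) \<eta>] order_tendstoD(2)[OF this(2) s4] eventually_ge_at_top[of "1::nat"]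
  have "\<forall>\<^sub>F n in sequentially. n >= 1 \<and> norm \<tau> / sqrt (real n) <= \<eta> \<and> L * norm \<tau> ^ 4 * m4 / real n <= s4"
   by eventually_elim auto
  thus ?thesis using that by (auto simp: eventually_sequentially)
 qed
 have "measure (varma_law p q (\<theta> + (1 / sqrt (real n)) *\<^sub>R \<tau>) f n) A <= K * measure (varma_law p q \<theta> f n) A + \<epsilon>"
  if n: "n >= N" and A: "A \<in> sets (paths n)" for n A
 proof -
  define \<theta>n where "\<theta>n = \<theta> + (1 / sqrt (real n)) *\<^sub>R \<tau>"
  have npos: "real n > 0" using N[OF n] by simp
  have d: "norm (\<theta>n - \<theta>) = norm \<tau> / sqrt (real n)" by (simp add: \<theta>n_def)
  hence near: "norm (\<theta>n - \<theta>) <= \<eta>" using N[OF n] by simp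
  let ?X = "%e. varma_path p q \<theta>n e"
  \<comment> \<open>The residual minus the noise. The two recursions at time \<open>t\<close> share the current observation, which
   cancels, so that only earlier times remain.\<close>
  define \<delta> where "\<delta> t e = (case t of 0 => 0 | Suc s =>
    (lagsum q (ma_lag p \<theta>) (%s. resid p q \<theta> (?X e) (Suc s)) s - lagsum p (ar_coeff \<theta>) (%s. ?X e (Suc s)) s)
    + (lagsum p (ar_coeff \<theta>n) (%s. ?X e (Suc s)) s - lagsum q (ma_lag p \<theta>n) (%s. e (Suc s)) s))" for t e
  have \<delta>: "e t + \<delta> t e = resid p q \<theta> (?X e) t" if t: "t >= 1" for t e
  proof -
   obtain s where t: "t = Suc s" using t by (cases t) auto
   show ?thesis unfolding t resid_Suc[of p q \<theta> _ s] varma_path_Suc[of p q \<theta>n e s] \<delta>_def by simp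
  qed
  have pred: "predictable \<delta>"
   unfolding predictable_def
  proof (intro conjI allI impI)
   fix t and e e' :: "nat => real^'d" assume eq: "\<forall>s. 1 <= s \<and> s < t \<longrightarrow> e s = e' s"
   show "\<delta> t e = \<delta> t e'"
   proof (cases t)
    case (Suc s)
    have X: "?X e u = ?X e' u" if "u <= s" for u
     using that eq Suc by (intro varma_path_cong) auto
    have Z: "resid p q \<theta> (?X e) u = resid p q \<theta> (?X e') u" if "u <= s" for u
     using that X by (intro resid_cong) auto
    have "lagsum k a (%u. e (Suc u)) s = lagsum k a (%u. e' (Suc u)) s" for k a
     using eq Suc by (intro lagsum_cong) auto
    moreover have "lagsum k a (%u. ?X e (Suc u)) s = lagsum k a (%u. ?X e' (Suc u)) s" for k a
     by (intro lagsum_cong X) auto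
    moreover have "lagsum k a (%u. resid p q \<theta> (?X e) (Suc u)) s = lagsum k a (%u. resid p q \<theta> (?X e') (Suc u)) s" for k a
     by (intro lagsum_cong Z) auto
    ultimately show ?thesis by (simp add: \<delta>_def Suc)
   qed (simp add: \<delta>_def)
  next
   fix t k :: nat assume t: "t <= Suc k"
   show "\<delta> t \<in> borel_measurable (PiM {1..k} (%_. borel))"
   proof (cases t)
    case (Suc s)
    show ?thesis unfolding \<delta>_def Suc nat.case
     by (intro borel_measurable_add borel_measurable_diff borel_measurable_lagsum borel_measurable_resid
       borel_measurable_varma_path measurable_coord) (use t Suc in auto)
   qed (simp add: \<delta>_def[abs_def])
  qed
  have bound: "(\<integral>\<^sup>+e. (\<Sum>t\<in>{1..n}. ennreal ((norm (\<delta> t e)) ^ P)) \<partial>noise f n)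
    <= ennreal (L * (norm \<tau> / sqrt (real n)) ^ P * (real n * mP))"
   if P: "P \<in> {1,2,4}" and mP: "(\<integral>\<^sup>+y. ennreal (norm y ^ P) \<partial>innov f) = ennreal mP" "mP >= 0" for P mP
  proof -
   have pt: "(\<Sum>t\<in>{1..n}. ennreal ((norm (\<delta> t e)) ^ P)) <= ennreal (L * (norm \<tau> / sqrt (real n)) ^ P) * (\<Sum>t\<in>{1..n}. ennreal (norm (e t) ^ P))" for e
   proof -
    have "(\<Sum>t\<in>{1..n}. norm (\<delta> t e) ^ P) = ssq P n (%t. resid p q \<theta> (?X e) t - resid p q \<theta>n (?X e) t)"
     unfolding ssq_def
    proof (intro sum.cong refl)
     fix t assume t: "t \<in> {1..n}"
     hence "\<delta> t e = resid p q \<theta> (?X e) t - resid p q \<theta>n (?X e) t"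
      using \<delta>[of t e] resid_varma_path[of t p q \<theta>n e] by (simp add: algebra_simps)
     thus "norm (\<delta> t e) ^ P = norm (resid p q \<theta> (?X e) t - resid p q \<theta>n (?X e) t) ^ P" by simp
    qed
    also have "... <= L * norm (\<theta> - \<theta>n) ^ P * ssq P n (resid p q \<theta>n (?X e))"
     using near \<eta> P by (intro lip) auto
    also have "ssq P n (resid p q \<theta>n (?X e)) = ssq P n e"
     by (rule ssq_cong) (simp add: resid_varma_path)
    finally have "(\<Sum>t\<in>{1..n}. norm (\<delta> t e) ^ P) <= L * (norm \<tau> / sqrt (real n)) ^ P * (\<Sum>t\<in>{1..n}. norm (e t) ^ P)"
     using d by (simp add: norm_minus_commute ssq_def)
    hence "ennreal (\<Sum>t\<in>{1..n}. norm (\<delta> t e) ^ P) <= ennreal (L * (norm \<tau> / sqrt (real n)) ^ P * (\<Sum>t\<in>{1..n}. norm (e t) ^ P))"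
     by (rule ennreal_leI)
    thus ?thesis using L by (simp add: ennreal_mult sum_nonneg)
   qed
   have "(\<integral>\<^sup>+e. (\<Sum>t\<in>{1..n}. ennreal ((norm (\<delta> t e)) ^ P)) \<partial>noise f n)
    <= (\<integral>\<^sup>+e. ennreal (L * (norm \<tau> / sqrt (real n)) ^ P) * (\<Sum>t\<in>{1..n}. ennreal (norm (e t) ^ P)) \<partial>noise f n)"
    by (intro nn_integral_mono pt)
   also have "... = ennreal (L * (norm \<tau> / sqrt (real n)) ^ P) * (\<Sum>t\<in>{1..n}. (\<integral>\<^sup>+e. ennreal (norm (e t) ^ P) \<partial>noise f n))"
   proof -
    have m: "(%e. ennreal (norm (e t) ^ P)) \<in> borel_measurable (noise f n)" if "t \<in> {1..n}" for t
    proof -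
     note [measurable] = measurable_coord[OF that, where ?'a="real^'d"]
     have "(%e. ennreal (norm (e t :: real^'d) ^ P)) \<in> borel_measurable (paths n)" by measurable
     thus ?thesis by (simp only: measurable_P)
    qed
    show ?thesis by (subst nn_integral_cmult, intro borel_measurable_sum m, assumption, subst nn_integral_sum) (use m in auto)
   qed
   also have "... = ennreal (L * (norm \<tau> / sqrt (real n)) ^ P) * (\<Sum>t\<in>{1..n}. ennreal mP)"
    by (simp only: nn_integral_norm_coord mP(1) cong: sum.cong)
   also have "... = ennreal (L * (norm \<tau> / sqrt (real n)) ^ P * (real n * mP))"
    using L mP(2) by (simp add: ennreal_mult ennreal_of_nat_eq_real_of_nat)
   finally show ?thesis .
  qed
  have b2: "(\<integral>\<^sup>+e. (\<Sum>t\<in>{1..n}. ennreal ((norm (\<delta> t e))\<^sup>2)) \<partial>noise f n) <= ennreal s2"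
  proof -
   have "L * (norm \<tau> / sqrt (real n))\<^sup>2 * (real n * m2) = s2" using npos by (simp add: s2_def power_divide)
   thus ?thesis using bound[of 2 m2] n2 m0 by simp
  qed
  have b4: "(\<integral>\<^sup>+e. (\<Sum>t\<in>{1..n}. ennreal ((norm (\<delta> t e)) ^ 4)) \<partial>noise f n) <= ennreal s4"
  proof -
   have s4n: "sqrt (real n) ^ 4 = real n * real n"
    using npos by (metis power2_eq_square real_sqrt_pow2 less_imp_le mult_2 numeral_Bit0 power_add)
   have "L * (norm \<tau> / sqrt (real n)) ^ 4 * (real n * m4) = L * norm \<tau> ^ 4 * m4 / real n"
    unfolding power_divide s4n using npos by simp
   thus ?thesis using bound[of 4 m4] n4 m0 N[OF n] order.trans[OF _ ennreal_leI] by simp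
  qed
  define A' where "A' = {z \<in> space (paths n). restrict (varma_path p q \<theta> z) {1..n} \<in> A}"
  have A': "A' \<in> sets (paths n)"
   using measurable_sets[OF measurable_path_vector A] by (simp add: A'_def vimage_def Int_def conj_commute)
  have law: "measure (varma_law p q \<theta>' f n) A = measure (noise f n) {e \<in> space (paths n). restrict (varma_path p q \<theta>' e) {1..n} \<in> A}" for \<theta>' :: "('l, 'd) param"
  proof -
   have "measure (varma_law p q \<theta>' f n) A = measure (noise f n) ((%e. restrict (varma_path p q \<theta>' e) {1..n}) -` A \<inter> space (noise f n))"
    unfolding varma_law_def sample_space_def using A by (intro measure_distr) (auto simp: measurable_path_vector[simplified])
   also have "space (noise f n) = space (paths n)" by (rule sets_eq_imp_space_eq) simp
   also have "(%e. restrict (varma_path p q \<theta>' e) {1..n}) -` A \<inter> space (paths n) = {e \<in> space (paths n). restrict (varma_path p q \<theta>' e) {1..n} \<in> A}"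
    by blast
   finally show ?thesis .
  qed
  have "restrict (varma_path p q \<theta> (shear \<delta> n e)) {1..n} = restrict (?X e) {1..n}" for e
  proof -
   have "varma_path p q \<theta> (shear \<delta> n e) t = ?X e t" if "t \<in> {1..n}" for t
   proof -
    have "varma_path p q \<theta> (shear \<delta> n e) t = varma_path p q \<theta> (resid p q \<theta> (?X e)) t"
     using that by (intro varma_path_cong) (auto simp: shear_def \<delta>)
    thus ?thesis using that by (simp add: varma_path_resid)
   qed
   thus ?thesis by (simp add: restrict_def fun_eq_iff)
  qed
  moreover have "shear \<delta> n e \<in> space (paths n)" for e by (simp add: shear_def space_PiM)
  moreover have sp: "space (noise f n) = space (paths n)" by (rule sets_eq_imp_space_eq) simp
  ultimately have "{e \<in> space (noise f n). shear \<delta> n e \<in> A'} = {e \<in> space (paths n). restrict (?X e) {1..n} \<in> A}"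
   by (simp add: A'_def)
  thus ?thesis using dom[OF pred b2 b4 A'] unfolding \<theta>n_def[symmetric] law A'_def[symmetric] by simp
 qed
 thus ?thesis using K by blast
qed

end

section \<open>A central limit theorem for blocks\<close>

context prob_space begin

lemma abs_expectation_le_sqrt:
 fixes Z :: "'a => real"
 assumes [measurable]: "random_variable borel Z" and Z2: "integrable M (%x. (Z x)\<^sup>2)"
 shows "integrable M Z" "expectation (%x. \<bar>Z x\<bar>) <= sqrt (expectation (%x. (Z x)\<^sup>2))"
proof -
 show Z: "integrable M Z" by (rule square_integrable_imp_integrable[OF assms])
 have "0 <= variance (%x. \<bar>Z x\<bar>)" by simp
 also have "... = expectation (%x. \<bar>Z x\<bar>\<^sup>2) - (expectation (%x. \<bar>Z x\<bar>))\<^sup>2"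
  using Z Z2 by (intro variance_eq) auto
 finally show "expectation (%x. \<bar>Z x\<bar>) <= sqrt (expectation (%x. (Z x)\<^sup>2))"
  by (intro real_le_rsqrt) simp
qed

lemma norm_iexp_diff_le: "cmod (iexp a - iexp b) <= \<bar>a - b\<bar>"
proof -
 have "iexp a - iexp b = iexp b * (iexp (a - b) - 1)" by (simp add: algebra_simps exp_add[symmetric] mult_exp_exp)
 hence "cmod (iexp a - iexp b) = cmod (iexp (a - b) - 1)" by (simp add: norm_mult)
 also have "... <= \<bar>a - b\<bar>" using iexp_approx1[of "a - b" 0] by simp
 finally show ?thesis .
qed

lemma char_diff_le_sum:
 fixes X Y :: "'i => 'a => real"
 assumes rv: "\<And>i. random_variable borel (X i)" "\<And>i. random_variable borel (Y i)"
  and i: "\<And>i. i \<in> I ==> integrable M (%x. (X i x - Y i x)\<^sup>2)"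
 shows "cmod (expectation (%x. iexp (\<Sum>i\<in>I. X i x)) - expectation (%x. iexp (\<Sum>i\<in>I. Y i x))) <= (\<Sum>i\<in>I. sqrt (expectation (%x. (X i x - Y i x)\<^sup>2)))"
proof -
 have ie: "integrable M (%x. iexp (\<Sum>i\<in>I. Z i x))" if "\<And>i. random_variable borel (Z i)" for Z :: "'i => 'a => real"
 proof -
  have "random_variable borel (%x. \<Sum>i\<in>I. Z i x)" using that by (intro borel_measurable_sum)
  thus ?thesis by (intro integrable_const_bound[where B=1]) (auto simp del: of_real_sum)
 qed
 have dm: "random_variable borel (%x. X i x - Y i x)" for i using rv by (intro borel_measurable_diff)
 note a = abs_expectation_le_sqrt[OF dm i]
 have "cmod (expectation (%x. iexp (\<Sum>i\<in>I. X i x)) - expectation (%x. iexp (\<Sum>i\<in>I. Y i x)))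
  = cmod (expectation (%x. iexp (\<Sum>i\<in>I. X i x) - iexp (\<Sum>i\<in>I. Y i x)))"
  by (subst Bochner_Integration.integral_diff[OF ie ie]) (rule rv refl)+
 also have "... <= expectation (%x. cmod (iexp (\<Sum>i\<in>I. X i x) - iexp (\<Sum>i\<in>I. Y i x)))" by (rule integral_norm_bound)
 also have "... <= expectation (%x. \<Sum>i\<in>I. \<bar>X i x - Y i x\<bar>)"
 proof (rule integral_mono)
  show "integrable M (%x. cmod (iexp (\<Sum>i\<in>I. X i x) - iexp (\<Sum>i\<in>I. Y i x)))"
   by (intro integrable_norm Bochner_Integration.integrable_diff ie rv)
  show "integrable M (%x. \<Sum>i\<in>I. \<bar>X i x - Y i x\<bar>)" using a(1) by (intro Bochner_Integration.integrable_sum) auto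
  show "cmod (iexp (\<Sum>i\<in>I. X i x) - iexp (\<Sum>i\<in>I. Y i x)) <= (\<Sum>i\<in>I. \<bar>X i x - Y i x\<bar>)" for x
   by (intro order_trans[OF norm_iexp_diff_le]) (simp only: sum_subtractf[symmetric] sum_abs)
 qed
 also have "... = (\<Sum>i\<in>I. expectation (%x. \<bar>X i x - Y i x\<bar>))" using a(1) by (intro Bochner_Integration.integral_sum) auto
 also have "... <= (\<Sum>i\<in>I. sqrt (expectation (%x. (X i x - Y i x)\<^sup>2)))" by (intro sum_mono a(2))
 finally show ?thesis .
qed

lemma char_diff_le:
 fixes X Y :: "'a => real"
 assumes "random_variable borel X" "random_variable borel Y" "integrable M (%x. (X x - Y x)\<^sup>2)"
 shows "cmod (expectation (%x. iexp (X x)) - expectation (%x. iexp (Y x))) <= sqrt (expectation (%x. (X x - Y x)\<^sup>2))"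
 using char_diff_le_sum[of "%_. X" "%_. Y" "{()}"] assms by simp

lemma orthogonal_sum_square:
 fixes \<zeta> :: "'i => 'a => real"
 assumes I: "finite I" and int: "\<And>i j. i \<in> I ==> j \<in> I ==> integrable M (%x. \<zeta> i x * \<zeta> j x)"
  and orth: "\<And>i j. i \<in> I ==> j \<in> I ==> expectation (%x. \<zeta> i x * \<zeta> j x) = (if i = j then v i else 0)"
 shows "integrable M (%x. (\<Sum>i\<in>I. c i * \<zeta> i x)\<^sup>2)" "expectation (%x. (\<Sum>i\<in>I. c i * \<zeta> i x)\<^sup>2) = (\<Sum>i\<in>I. (c i)\<^sup>2 * v i)"
proof -
 have e: "(\<Sum>i\<in>I. c i * \<zeta> i x)\<^sup>2 = (\<Sum>i\<in>I. \<Sum>j\<in>I. (c i * c j) * (\<zeta> i x * \<zeta> j x))" for x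
  unfolding power2_eq_square sum_product by (intro sum.cong refl) (simp add: mult_ac)
 show "integrable M (%x. (\<Sum>i\<in>I. c i * \<zeta> i x)\<^sup>2)" unfolding e
  by (intro Bochner_Integration.integrable_sum integrable_mult_right int)
 have "expectation (%x. (\<Sum>i\<in>I. c i * \<zeta> i x)\<^sup>2) = (\<Sum>i\<in>I. \<Sum>j\<in>I. (c i * c j) * expectation (%x. \<zeta> i x * \<zeta> j x))"
  unfolding e by (subst Bochner_Integration.integral_sum, intro Bochner_Integration.integrable_sum integrable_mult_right int, assumption+)
   (intro sum.cong refl, subst Bochner_Integration.integral_sum, intro integrable_mult_right int, assumption+, simp)
 also have "... = (\<Sum>i\<in>I. \<Sum>j\<in>I. if j = i then (c i)\<^sup>2 * v i else 0)"
  by (intro sum.cong refl) (auto simp: orth power2_eq_square)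
 also have "... = (\<Sum>i\<in>I. (c i)\<^sup>2 * v i)" using I by (intro sum.cong refl) (simp add: sum.delta)
 finally show "expectation (%x. (\<Sum>i\<in>I. c i * \<zeta> i x)\<^sup>2) = (\<Sum>i\<in>I. (c i)\<^sup>2 * v i)" .
qed

text \<open>
 Dropping a negligible share of the terms of an orthogonal sum changes its normalised value little in mean square.
\<close>

lemma normalised_sums_L2:
 fixes \<zeta> :: "'i => 'a => real"
 assumes I: "finite I" and J: "J \<subseteq> I" "J ~= {}" and int: "\<And>i j. i \<in> I ==> j \<in> I ==> integrable M (%x. \<zeta> i x * \<zeta> j x)"
  and orth: "\<And>i j. i \<in> I ==> j \<in> I ==> expectation (%x. \<zeta> i x * \<zeta> j x) = (if i = j then v else 0)"
 defines "T \<equiv> %A x. (\<Sum>i\<in>A. \<zeta> i x) / sqrt (card A)"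
 shows "integrable M (%x. (T I x - T J x)\<^sup>2)" "expectation (%x. (T I x - T J x)\<^sup>2) = 2 * v * (1 - sqrt (card J / card I))"
proof -
 define a where "a = 1 / sqrt (card I)"
 define b where "b = 1 / sqrt (card J)"
 define c where "c t = a - (if t \<in> J then b else 0)" for t
 have cp: "card J > 0" "card I > 0" using I J finite_subset[OF J(1) I] by (auto simp: card_gt_0_iff)
 have a2: "a\<^sup>2 * card I = 1" and b2: "b\<^sup>2 * card J = 1" using cp by (simp_all add: a_def b_def power_divide)
 have "b * card J = sqrt (card J)" using real_div_sqrt[of "card J"] by (simp add: b_def)
 hence ab: "a * (b * card J) = sqrt (card J / card I)" by (simp add: a_def real_sqrt_divide)
 have sJ: "(\<Sum>i\<in>I. if i \<in> J then g i else 0) = sum g J" for g :: "'i => real"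
  using J(1) I by (simp add: sum.If_cases Int_absorb1)
 have TT: "T I x - T J x = (\<Sum>i\<in>I. c i * \<zeta> i x)" for x
 proof -
  have "(\<Sum>i\<in>I. c i * \<zeta> i x) = (\<Sum>i\<in>I. a * \<zeta> i x) - (\<Sum>i\<in>I. if i \<in> J then b * \<zeta> i x else 0)"
   unfolding sum_subtractf[symmetric] by (intro sum.cong refl) (simp add: c_def left_diff_distrib)
  thus ?thesis unfolding sJ by (simp add: T_def a_def b_def sum_divide_distrib)
 qed
 note os = orthogonal_sum_square[OF I int orth, of c]
 show "integrable M (%x. (T I x - T J x)\<^sup>2)" unfolding TT by (rule os(1))
 have "expectation (%x. (T I x - T J x)\<^sup>2) = (\<Sum>i\<in>I. (c i)\<^sup>2 * v)" unfolding TT by (rule os(2))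
 also have "... = (\<Sum>i\<in>I. a\<^sup>2 * v + (if i \<in> J then (b\<^sup>2 - 2 * (a * b)) * v else 0))"
  by (intro sum.cong refl) (auto simp: c_def power2_diff algebra_simps)
 also have "... = (a\<^sup>2 * card I + b\<^sup>2 * card J - 2 * (a * (b * card J))) * v"
  unfolding sum.distrib sJ by (simp add: algebra_simps)
 finally show "expectation (%x. (T I x - T J x)\<^sup>2) = 2 * v * (1 - sqrt (card J / card I))"
  unfolding a2 b2 ab by (simp add: algebra_simps)
qed

text \<open>
 Bernstein's blocks: sums over blocks of length \<open>L\<close> separated by gaps of length \<open>m\<close> are
 independent and identically distributed, so that the classical theorem applies to them. The gaps contain the share
 \<open>m / (L + m)\<close> of the terms, which is small for large \<open>L\<close>.
\<close>

lemma block_central_limit: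
 fixes \<zeta> :: "nat => 'a => real"
 assumes rv [measurable]: "\<And>t. random_variable borel (\<zeta> t)"
  and int: "\<And>s t. integrable M (%x. \<zeta> s x * \<zeta> t x)"
  and orth: "\<And>s t. expectation (%x. \<zeta> s x * \<zeta> t x) = (if s = t then v else 0)"
  and mean: "\<And>t. expectation (\<zeta> t) = 0"
  and indep: "\<And>L. L > 0 ==> indep_vars (%_. borel) (%j x. \<Sum>i<L. \<zeta> (j * (L + m) + i) x) UNIV"
  and ident: "\<And>L j. L > 0 ==> distr M borel (%x. \<Sum>i<L. \<zeta> (j * (L + m) + i) x) = distr M borel (%x. \<Sum>i<L. \<zeta> i x)"
 shows "(%n. expectation (%x. iexp ((\<Sum>t<n. \<zeta> t x) / sqrt n))) \<longlonglongrightarrow> exp (- v / 2)"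
proof -
 have v0: "v >= 0" using orth[of 0 0] integral_nonneg_AE[of "%x. \<zeta> 0 x * \<zeta> 0 x" M] by simp
 have sq: "integrable M (%x. (\<zeta> t x)\<^sup>2)" for t using int[of t t] by (simp add: power2_eq_square)
 define T where "T n x = (\<Sum>t<n. \<zeta> t x) / sqrt n" for n x
 have Tm [measurable]: "random_variable borel (T n)" for n unfolding T_def by measurable
 define J where "J L k = (%(j,i). j * (L + m) + i) ` ({..<k} \<times> {..<L})" for L k
 have inj: "inj_on (%(j,i). j * (L + m) + i) ({..<k} \<times> {..<L})" if "L > 0" for L k
 proof (rule inj_onI, clarsimp)
  fix j i j' i' assume e: "j * (L + m) + i = j' * (L + m) + i'" and lt: "i < L" "i' < L"
  have "(j * (L + m) + i) div (L + m) = j" "(j' * (L + m) + i') div (L + m) = j'" using lt by (auto simp: div_mult_self3)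
  hence "j = j'" using e by metis
  thus "j = j' \<and> i = i'" using e by simp
 qed
 have bigsum: "(\<Sum>j<k. \<Sum>i<L. \<zeta> (j * (L + m) + i) x) = (\<Sum>t\<in>J L k. \<zeta> t x)" if "L > 0" for L k x
  unfolding J_def by (subst sum.reindex[OF inj[OF that]]) (simp add: sum.cartesian_product split_def)
 have cardJ: "card (J L k) = k * L" if "L > 0" for L k
  unfolding J_def by (subst card_image[OF inj[OF that]]) (simp add: card_cartesian_product)
 have Jsub: "J L (n div (L + m)) \<subseteq> {..<n}" for L n
 proof
  fix t assume "t \<in> J L (n div (L + m))"
  then obtain j i where t: "t = j * (L + m) + i" "j < n div (L + m)" "i < L" by (auto simp: J_def)
  hence "t < (j + 1) * (L + m)" by simp
  also have "... <= (n div (L + m)) * (L + m)" using t by (intro mult_right_mono) auto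
  also have "... <= n" by simp
  finally show "t \<in> {..<n}" by simp
 qed
 define B where "B L k x = (\<Sum>j<k. \<Sum>i<L. \<zeta> (j * (L + m) + i) x) / sqrt (k * L)" for L k x
 have Bm [measurable]: "random_variable borel (B L k)" for L k unfolding B_def by measurable
 have comp: "cmod (expectation (%x. iexp (T n x)) - expectation (%x. iexp (B L (n div (L + m)) x)))
   <= sqrt (2 * v * (1 - sqrt (real (n div (L + m) * L) / real n)))"
  if L: "L > 0" and n: "n >= L + m" for L n
 proof -
  let ?J = "J L (n div (L + m))"
  have "n div (L + m) > 0" using n L by (simp add: div_greater_zero_iff)
  hence ne: "?J ~= {}" using L by (auto simp: J_def)
  have TB: "T n x = (\<Sum>t<n. \<zeta> t x) / sqrt (card {..<n})" "B L (n div (L + m)) x = (\<Sum>t\<in>?J. \<zeta> t x) / sqrt (card ?J)" for x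
   unfolding T_def B_def bigsum[OF L] cardJ[OF L] by simp_all
  show ?thesis using char_diff_le[OF Tm Bm, of n L "n div (L + m)"]
   unfolding TB using normalised_sums_L2[OF finite_lessThan Jsub ne int orth] by (simp add: cardJ[OF L])
 qed
 have blocks: "(%k. expectation (%x. iexp (B L k x))) \<longlonglongrightarrow> exp (- v / 2)" if L: "L > 0" for L
 proof (cases "v = 0")
  case True
  have "cmod (expectation (%x. iexp (B L k x)) - 1) = 0" for k
  proof -
   have Bsum: "B L k x = (\<Sum>t\<in>J L k. 1 / sqrt (k * L) * \<zeta> t x)" for x
    unfolding B_def bigsum[OF L] by (simp add: sum_divide_distrib)
   have fin: "finite (J L k)" by (simp add: J_def)
   have "integrable M (%x. (B L k x)\<^sup>2)" "expectation (%x. (B L k x)\<^sup>2) = (\<Sum>t\<in>J L k. (1 / sqrt (k * L))\<^sup>2 * v)"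
    unfolding Bsum by (rule orthogonal_sum_square[OF fin]; use int orth in auto)+
   thus ?thesis using char_diff_le[OF Bm, of "%_. 0" L k] True prob_space by simp
  qed
  thus ?thesis using True by simp
 next
  case False
  hence vpos: "v > 0" using v0 by simp
  define X where "X j x = (\<Sum>i<L. \<zeta> (j * (L + m) + i) x)" for j x
  have Xm [measurable]: "random_variable borel (X j)" for j unfolding X_def by measurable
  have X2: "integrable M (%x. (X j x)\<^sup>2)" "expectation (%x. (X j x)\<^sup>2) = L * v" for j
  proof -
   have "integrable M (%x. (\<Sum>i<L. 1 * \<zeta> (j * (L + m) + i) x)\<^sup>2)"
    "expectation (%x. (\<Sum>i<L. 1 * \<zeta> (j * (L + m) + i) x)\<^sup>2) = (\<Sum>i<L. 1\<^sup>2 * v)"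
    by (rule orthogonal_sum_square; use int orth in auto)+
   thus "integrable M (%x. (X j x)\<^sup>2)" "expectation (%x. (X j x)\<^sup>2) = L * v" by (simp_all add: X_def)
  qed
  have zi: "integrable M (\<zeta> t)" for t by (rule square_integrable_imp_integrable[OF rv sq])
  have X0: "expectation (X j) = 0" for j unfolding X_def[abs_def] using zi mean by simp
  have "weak_conv_m (%n. distr M borel (%x. (\<Sum>j<n. X j x) / sqrt (n * (sqrt (L * v))\<^sup>2))) std_normal_distribution"
  proof (rule central_limit_theorem_zero_mean[where \<mu>="distr M borel (X 0)"])
   show "indep_vars (%i. borel) X UNIV" unfolding X_def[abs_def] by (rule indep[OF L])
   show "expectation (X n) = 0" for n by (rule X0)
   show "sqrt (L * v) > 0" using L vpos by simp
   show "integrable M (%x. (X n x)\<^sup>2)" for n by (rule X2)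
   show "variance (X n) = (sqrt (L * v))\<^sup>2" for n using X2(2)[of n] L v0 by (simp add: X0)
   show "distr M borel (X n) = distr M borel (X 0)" for n
    unfolding X_def[abs_def] using ident[OF L, of n] ident[OF L, of 0] by simp
  qed
  hence "(%n. char (distr M borel (%x. (\<Sum>j<n. X j x) / sqrt (n * (sqrt (L * v))\<^sup>2))) (sqrt v)) \<longlonglongrightarrow> char std_normal_distribution (sqrt v)"
   by (rule levy_continuity1[rotated 2])
    (auto intro!: real_distribution_distr real_dist_normal_dist)
  moreover have "char (distr M borel (%x. (\<Sum>j<n. X j x) / sqrt (n * (sqrt (L * v))\<^sup>2))) (sqrt v) = expectation (%x. iexp (B L n x))" for n
  proof -
   have "sqrt v * ((\<Sum>j<n. X j x) / sqrt (n * (sqrt (L * v))\<^sup>2)) = B L n x" for x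
    using vpos L by (simp add: B_def X_def real_sqrt_mult)
   thus ?thesis unfolding char_def by (subst integral_distr) (auto simp del: of_real_mult of_real_divide)
  qed
  moreover have "(complex_of_real (sqrt v))\<^sup>2 = complex_of_real v" using v0 by (metis of_real_power real_sqrt_pow2)
  ultimately show ?thesis by (simp add: char_std_normal_distribution exp_of_real[symmetric])
 qed
 have ratio: "(%n. real (n div (L + m) * L) / real n) \<longlonglongrightarrow> L / (L + m)" if "L > 0" for L
 proof -
  have "(%n. real_of_int \<lfloor>real n / real (L + m)\<rfloor> * real L / real n) \<longlonglongrightarrow> inverse (real L + real m) * real L" using that by real_asymp
  moreover have "real_of_int \<lfloor>real n / real (L + m)\<rfloor> = real (n div (L + m))" for n
   by (simp only: floor_divide_of_nat_eq of_int_of_nat_eq)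
  ultimately show ?thesis by (simp only:) (simp add: divide_inverse mult.commute)
 qed
 show ?thesis unfolding T_def[symmetric]
 proof (rule LIMSEQ_I)
  fix \<epsilon> :: real assume \<epsilon>: "\<epsilon> > 0"
  \<comment> \<open>The length \<open>L\<close> is fixed first, large enough for the gaps to be harmless; then the sample size
   grows.\<close>
  have "(%L. real L / (real L + real m)) \<longlonglongrightarrow> 1" by real_asymp
  hence "(%L. sqrt (2 * v * (1 - sqrt (real L / (real L + real m))))) \<longlonglongrightarrow> sqrt (2 * v * (1 - sqrt 1))"
   by (intro tendsto_intros)
  hence "(%L. sqrt (2 * v * (1 - sqrt (real L / (real L + real m))))) \<longlonglongrightarrow> 0" by simp
  from order_tendstoD(2)[OF this half_gt_zero[OF \<epsilon>]] eventually_gt_at_top[of "0::nat"]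
  have "\<forall>\<^sub>F L in sequentially. L > 0 \<and> sqrt (2 * v * (1 - sqrt (real L / (real L + real m)))) < \<epsilon> / 2" by eventually_elim auto
  then obtain L where L: "L > 0" "sqrt (2 * v * (1 - sqrt (real L / (real L + real m)))) < \<epsilon> / 2"
   by (auto simp: eventually_sequentially)
  have "(%n. sqrt (2 * v * (1 - sqrt (real (n div (L + m) * L) / real n)))) \<longlonglongrightarrow> sqrt (2 * v * (1 - sqrt (real L / real (L + m))))"
   by (intro tendsto_intros ratio[OF L(1)])
  from order_tendstoD(2)[OF this, of "\<epsilon>/2"] L(2)
  have e1: "\<forall>\<^sub>F n in sequentially. sqrt (2 * v * (1 - sqrt (real (n div (L + m) * L) / real n))) < \<epsilon> / 2" by simp
  have "(%n. expectation (%x. iexp (B L (n div (L + m)) x))) \<longlonglongrightarrow> exp (- v / 2)"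
   by (rule filterlim_compose[OF blocks[OF L(1)] filterlim_at_top_div_const_nat]) (use L in simp)
  from tendstoD[OF this half_gt_zero[OF \<epsilon>]]
  have e2: "\<forall>\<^sub>F n in sequentially. dist (expectation (%x. iexp (B L (n div (L + m)) x))) (complex_of_real (exp (- v / 2))) < \<epsilon> / 2" by simp
  have "\<forall>\<^sub>F n in sequentially. norm (expectation (%x. iexp (T n x)) - complex_of_real (exp (- v / 2))) < \<epsilon>"
   using e1 e2 eventually_ge_at_top[of "L + m"]
  proof eventually_elim
   case (elim n)
   have "norm (expectation (%x. iexp (T n x)) - complex_of_real (exp (- v / 2))) <=
    cmod (expectation (%x. iexp (T n x)) - expectation (%x. iexp (B L (n div (L + m)) x)))
    + cmod (expectation (%x. iexp (B L (n div (L + m)) x)) - complex_of_real (exp (- v / 2)))"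
    using dist_triangle[of "expectation (%x. iexp (T n x))" "complex_of_real (exp (- v / 2))" "expectation (%x. iexp (B L (n div (L + m)) x))"]
    unfolding dist_norm .
   thus ?case using comp[OF L(1) elim(3)] elim(1,2) unfolding dist_norm by linarith
  qed
  thus "\<exists>no. \<forall>n\<ge>no. norm (expectation (%x. iexp (T n x)) - complex_of_real (exp (- v / 2))) < \<epsilon>"
   by (simp add: eventually_sequentially)
 qed
qed

end

section \<open>Functionals of an infinite noise sequence\<close>

lemma (in prob_space) indep_var_restrict:
 assumes ind: "indep_vars M' X UNIV" and AB: "A \<inter> B = {}"
 shows "indep_var (PiM A M') (%\<omega>. restrict (%i. X i \<omega>) A) (PiM B M') (%\<omega>. restrict (%i. X i \<omega>) B)"
proof -
 have "indep_vars (%j. PiM (case_bool A B j) M') (%j \<omega>. restrict (%i. X i \<omega>) (case_bool A B j)) UNIV"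
  by (rule indep_vars_restrict[OF ind]) (use AB in \<open>auto simp: disjoint_family_on_def split: bool.splits\<close>)
 moreover have "(%j. PiM (case_bool A B j) M') = case_bool (PiM A M') (PiM B M')"
  "(%j \<omega>. restrict (%i. X i \<omega>) (case_bool A B j)) = case_bool (%\<omega>. restrict (%i. X i \<omega>) A) (%\<omega>. restrict (%i. X i \<omega>) B)"
  by (auto simp: fun_eq_iff split: bool.splits)
 ultimately show ?thesis unfolding indep_var_def by simp
qed

context borel_prob begin

definition \<Omega> :: "(nat => 'v) measure" where "\<Omega> = PiM UNIV (%_. \<mu>)"

sublocale \<Omega>: prob_space \<Omega> unfolding \<Omega>_def by (rule prob_space_P)

lemma sets_\<Omega> [measurable_cong, simp]: "sets \<Omega> = sets (PiM UNIV (%_. borel))" by (simp add: \<Omega>_def)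

lemma measurable_\<Omega>: "measurable \<Omega> N = measurable (PiM UNIV (%_. borel)) N" by (rule measurable_cong_sets) auto

lemma coord_\<Omega> [measurable]: "(%e. e t) \<in> borel_measurable \<Omega>"
 unfolding measurable_\<Omega> by (rule measurable_component_singleton) auto

lemma distr_coord: "distr \<Omega> \<mu> (%e. e t) = \<mu>"
 unfolding \<Omega>_def by (rule distr_PiM_component) (auto intro: prob_space_axioms)

lemma integral_coord:
 fixes g :: "'v => real"
 assumes g: "integrable \<mu> g"
 shows "integrable \<Omega> (%e. g (e t))" "\<Omega>.expectation (%e. g (e t)) = (LINT y|\<mu>. g y)"
proof -
 have gm: "g \<in> borel_measurable \<mu>" using g by simp
 have m: "(%e. e t) \<in> measurable \<Omega> \<mu>" using coord_\<Omega>[of t] by (simp cong: measurable_cong_sets)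
 have "integrable (distr \<Omega> \<mu> (%e. e t)) g" using g by (simp only: distr_coord)
 thus "integrable \<Omega> (%e. g (e t))" by (subst (asm) integrable_distr_eq[OF m gm])
 have "integral\<^sup>L (distr \<Omega> \<mu> (%e. e t)) g = \<Omega>.expectation (%e. g (e t))" by (rule integral_distr[OF m gm])
 thus "\<Omega>.expectation (%e. g (e t)) = (LINT y|\<mu>. g y)" by (simp only: distr_coord)
qed

lemma indep_coords: "\<Omega>.indep_vars (%_. \<mu>) (%i e. e i) UNIV"
proof -
 have m: "(%e. e t) \<in> measurable \<Omega> \<mu>" for t using coord_\<Omega>[of t] by (simp cong: measurable_cong_sets)
 have "distr \<Omega> (PiM UNIV (%_. \<mu>)) (%e. \<lambda>i\<in>UNIV. e i) = PiM UNIV (%i. distr \<Omega> \<mu> (%e. e i))"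
  unfolding distr_coord restrict_UNIV unfolding \<Omega>_def by (rule distr_id)
 thus ?thesis by (subst \<Omega>.indep_vars_iff_distr_eq_PiM') (auto intro: m)
qed

text \<open>
 The hypothesis that \<open>h\<close> is insensitive to the coordinate \<open>t\<close> means that it is a function of
 the other coordinates.
\<close>

lemma indep_coord_others:
 fixes g :: "'v => real" and h :: "(nat => 'v) => real"
 assumes g: "integrable \<mu> g" and h: "integrable \<Omega> h" and ins: "\<And>e y. h (e(t := y)) = h e"
 shows "integrable \<Omega> (%e. g (e t) * h e)" "\<Omega>.expectation (%e. g (e t) * h e) = (LINT y|\<mu>. g y) * \<Omega>.expectation h"
proof -
 let ?B = "UNIV - {t}"
 have hm: "h \<in> borel_measurable (PiM UNIV (%_. borel))" using h measurable_\<Omega> by auto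
 have gm: "g \<in> borel_measurable borel" using g by (simp cong: measurable_cong_sets)
 have upd: "(%w. w(t := 0)) \<in> measurable (PiM ?B (%_. borel :: 'v measure)) (PiM UNIV (%_. borel))"
 proof -
  have "(%w. (w, 0)) \<in> measurable (PiM ?B (%_. borel :: 'v measure)) (PiM ?B (%_. borel :: 'v measure) \<Otimes>\<^sub>M borel)" by measurable
  from measurable_compose[OF this measurable_add_dim[of t ?B "%_. borel"]] show ?thesis by (simp add: insert_absorb insert_Diff_if)
 qed
 have ind: "\<Omega>.indep_var borel ((%w. g (w t)) \<circ> (%e. restrict e {t})) borel ((%w. h (w(t := 0))) \<circ> (%e. restrict e ?B))"
 proof (rule \<Omega>.indep_var_compose)
  show "\<Omega>.indep_var (PiM {t} (%_. \<mu>)) (%e. restrict e {t}) (PiM ?B (%_. \<mu>)) (%e. restrict e ?B)"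
   using \<Omega>.indep_var_restrict[OF indep_coords, of "{t}" ?B] by simp
  show "(%w. g (w t)) \<in> borel_measurable (PiM {t} (%_. \<mu>))"
  proof -
   have "(%w. w t) \<in> borel_measurable (PiM {t} (%_. borel :: 'v measure))" by (rule measurable_component_singleton) simp
   from measurable_compose[OF this gm] show ?thesis unfolding measurable_P .
  qed
  show "(%w. h (w(t := 0))) \<in> borel_measurable (PiM ?B (%_. \<mu>))"
   unfolding measurable_P by (rule measurable_compose[OF upd hm])
 qed
 have h': "h ((restrict e ?B)(t := 0)) = h e" for e
 proof -
  have "(restrict e ?B)(t := 0) = e(t := 0)" by (auto simp: fun_eq_iff)
  thus ?thesis by (simp add: ins)
 qed
 have ind': "\<Omega>.indep_var borel (%e. g (e t)) borel h"
 proof -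
  have "(%w. g (w t)) \<circ> (%e. restrict e {t}) = (%e. g (e t))" by (simp add: fun_eq_iff)
  moreover have "(%w. h (w(t := 0))) \<circ> (%e. restrict e ?B) = h" by (rule ext) (simp only: comp_def h')
  ultimately show ?thesis using ind by (simp only:)
 qed
 show "integrable \<Omega> (%e. g (e t) * h e)"
  by (rule \<Omega>.indep_var_integrable[OF ind' integral_coord(1)[OF g] h])
 show "\<Omega>.expectation (%e. g (e t) * h e) = (LINT y|\<mu>. g y) * \<Omega>.expectation h"
  unfolding \<Omega>.indep_var_lebesgue_integral[OF ind' integral_coord(1)[OF g] h] integral_coord(2)[OF g] ..
qed

text \<open>
 A block of length \<open>L\<close> uses \<open>L + m\<close> consecutive coordinates of the noise, and the blocks are
 shifts of each other.
\<close>

lemma stationary_central_limit: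
 fixes F :: "(nat => 'v) => real"
 defines "\<zeta> \<equiv> %t e. F (%k. e (t + k))"
 assumes F: "F \<in> borel_measurable (PiM UNIV (%_. borel))"
  and dep: "\<And>e e'. (\<And>k. k <= m ==> e k = e' k) ==> F e = F e'"
  and int: "\<And>s t. integrable \<Omega> (%e. \<zeta> s e * \<zeta> t e)"
  and orth: "\<And>s t. \<Omega>.expectation (%e. \<zeta> s e * \<zeta> t e) = (if s = t then v else 0)"
  and mean: "\<And>t. \<Omega>.expectation (\<zeta> t) = 0"
 shows "(%n. \<Omega>.expectation (%e. iexp ((\<Sum>t<n. \<zeta> t e) / sqrt n))) \<longlonglongrightarrow> exp (- v / 2)"
proof (rule \<Omega>.block_central_limit[OF _ int orth mean])
 have shift: "(%e. (%k. e (k + c))) \<in> measurable (PiM UNIV (%_. borel :: 'v measure)) (PiM UNIV (%_. borel))" for c :: nat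
 proof -
  have "(%e. (\<lambda>k\<in>UNIV. e (k + c))) \<in> measurable (PiM UNIV (%_. borel :: 'v measure)) (PiM UNIV (%_. borel))"
   by (intro measurable_restrict measurable_component_singleton) auto
  thus ?thesis by (simp only: restrict_UNIV)
 qed
 show rv: "\<zeta> t \<in> borel_measurable \<Omega>" for t
  unfolding \<zeta>_def measurable_\<Omega> using measurable_compose[OF shift[of t] F] by (simp add: add.commute)
 fix L :: nat assume L: "L > 0"
 show "distr \<Omega> borel (%e. \<Sum>i<L. \<zeta> (j * (L + m) + i) e) = distr \<Omega> borel (%e. \<Sum>i<L. \<zeta> i e)" for j
 proof -
  let ?c = "j * (L + m)"
  have sh: "distr \<Omega> \<Omega> (%e. (%k. e (k + ?c))) = \<Omega>"
   using distr_PiM_reindex[of UNIV "%_. \<mu>" "%k. k + ?c" UNIV] prob_space_axioms unfolding \<Omega>_def by (simp add: inj_on_def restrict_UNIV)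
  have X0: "(%e. \<Sum>i<L. \<zeta> i e) \<in> borel_measurable \<Omega>" by (intro borel_measurable_sum rv)
  have "distr \<Omega> borel (%e. \<Sum>i<L. \<zeta> (j * (L + m) + i) e) = distr \<Omega> borel ((%e. \<Sum>i<L. \<zeta> i e) \<circ> (%e. (%k. e (k + ?c))))"
   by (simp add: \<zeta>_def comp_def add_ac)
  also have "... = distr (distr \<Omega> \<Omega> (%e. (%k. e (k + ?c)))) borel (%e. \<Sum>i<L. \<zeta> i e)"
   by (rule distr_distr[symmetric, OF X0]) (use shift[of ?c] in \<open>simp cong: measurable_cong_sets\<close>)
  finally show ?thesis unfolding sh .
 qed
 show "\<Omega>.indep_vars (%_. borel) (%j e. \<Sum>i<L. \<zeta> (j * (L + m) + i) e) UNIV"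
 proof -
  define K where "K j = {j * (L + m)..<(j + 1) * (L + m)}" for j
  define G where "G j w = (\<Sum>i<L. F (%k. if k <= m then w (j * (L + m) + i + k) else 0))" for j and w :: "nat => 'v"
  have disj: "disjoint_family_on K UNIV"
   unfolding disjoint_family_on_def
  proof (intro ballI impI)
   fix j j' :: nat assume "j ~= j'"
   then consider "j + 1 <= j'" | "j' + 1 <= j" by linarith
   thus "K j \<inter> K j' = {}"
   proof cases
    case 1 hence "(j + 1) * (L + m) <= j' * (L + m)" by (rule mult_right_mono) simp
    thus ?thesis unfolding K_def by auto
   next
    case 2 hence "(j' + 1) * (L + m) <= j * (L + m)" by (rule mult_right_mono) simp
    thus ?thesis unfolding K_def by auto
   qed
  qed
  have "\<Omega>.indep_vars (%j. PiM (K j) (%_. \<mu>)) (%j e. restrict (%i. e i) (K j)) UNIV"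
   by (rule \<Omega>.indep_vars_restrict[OF indep_coords _ disj]) simp
  hence "\<Omega>.indep_vars (%_. borel) (%j e. G j (restrict (%i. e i) (K j))) UNIV"
  proof (rule \<Omega>.indep_vars_compose2)
   fix j
   show "G j \<in> borel_measurable (PiM (K j) (%_. \<mu>))"
    unfolding G_def measurable_P
   proof (intro borel_measurable_sum)
    fix i assume i: "i \<in> {..<L}"
    have "(%w. (\<lambda>k\<in>UNIV. if k <= m then w (j * (L + m) + i + k) else 0)) \<in> measurable (PiM (K j) (%_. borel :: 'v measure)) (PiM UNIV (%_. borel))"
    proof (intro measurable_restrict)
     fix k
     show "(%w. if k <= m then w (j * (L + m) + i + k) else 0) \<in> borel_measurable (PiM (K j) (%_. borel :: 'v measure))"
      using i by (cases "k <= m") (auto intro!: measurable_component_singleton simp: K_def)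
    qed
    from measurable_compose[OF this F]
    show "(%w. F (%k. if k <= m then w (j * (L + m) + i + k) else 0)) \<in> borel_measurable (PiM (K j) (%_. borel :: 'v measure))" by (simp only: restrict_UNIV)
   qed
  qed
  moreover have "G j (restrict (%i. e i) (K j)) = (\<Sum>i<L. \<zeta> (j * (L + m) + i) e)" for j e
   unfolding G_def \<zeta>_def by (intro sum.cong refl dep) (auto simp: K_def)
  ultimately show ?thesis by simp
 qed
qed

end

section \<open>Lagged products of the innovations\<close>

context
 fixes f :: "real^'d => real" assumes f: "f \<in> density_class"
begin

interpretation borel_prob "innov f" by (rule borel_prob_innov[OF f])

lemma innov_moments:
 shows "integrable (innov f) (%y. y $ r)" "(LINT y|innov f. y $ r) = 0"
  "integrable (innov f) (%y. y $ r * y $ s)" "(LINT y|innov f. y $ r * y $ s) = innov_cov f $ r $ s"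
proof -
 note i = density_classD(6)[OF f] and io = density_classD(8)[OF f]
 show "integrable (innov f) (%y. y $ r)" by (rule integrable_bounded_linear[OF bounded_linear_vec_nth i])
 show "(LINT y|innov f. y $ r) = 0" using integral_bounded_linear[OF bounded_linear_vec_nth[of r] i] density_classD(7)[OF f] by simp
 have b: "bounded_linear (%A::real^'d^'d. A $ r $ s)"
  using bounded_linear_compose[OF bounded_linear_vec_nth[of s] bounded_linear_vec_nth[of r]] by simp
 show "integrable (innov f) (%y. y $ r * y $ s)" using integrable_bounded_linear[OF b io] by (simp add: outer_def)
 show "(LINT y|innov f. y $ r * y $ s) = innov_cov f $ r $ s"
  using integral_bounded_linear[OF b io] by (simp add: outer_def innov_cov_def)
qed

text \<open>
 A scalar component of a lagged cross-covariance, where the matrix \<open>N i\<close> selects the component for lag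
 \<open>i\<close>; \<open>lagvar\<close> is its variance.
\<close>

definition lagprod :: "(nat => real^'d^'d) => nat => nat => (nat => real^'d) => real" where
 "lagprod N i u e = e u \<bullet> (N i *v e (u - i))"

definition lagvar :: "real^'d^'d => real" where
 "lagvar A = (\<Sum>r\<in>UNIV. \<Sum>r'\<in>UNIV. innov_cov f $ r $ r' * (\<Sum>c\<in>UNIV. \<Sum>c'\<in>UNIV. A $ r $ c * A $ r' $ c' * innov_cov f $ c $ c'))"

lemma lagprod_measurable [measurable]: "lagprod N i u \<in> borel_measurable \<Omega>"
 unfolding lagprod_def by (intro borel_measurable_inner borel_measurable_matrix_vector_mult) auto

lemma lagged_component:
 "integrable \<Omega> (%e. (A *v e u) $ r)" "\<Omega>.expectation (%e. (A *v e u) $ r) = 0"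
 "integrable \<Omega> (%e. (A *v e u) $ r * (A' *v e u) $ r')"
 "\<Omega>.expectation (%e. (A *v e u) $ r * (A' *v e u) $ r') = (\<Sum>c\<in>UNIV. \<Sum>c'\<in>UNIV. A $ r $ c * A' $ r' $ c' * innov_cov f $ c $ c')"
 for A A' :: "real^'d^'d"
proof -
 note ic = integral_coord[OF innov_moments(1)] and ic2 = integral_coord[OF innov_moments(3)]
 show "integrable \<Omega> (%e. (A *v e u) $ r)" "\<Omega>.expectation (%e. (A *v e u) $ r) = 0"
  unfolding matrix_vector_mult_def using ic by (simp_all add: innov_moments)
 have e: "(A *v e u) $ r * (A' *v e u) $ r' = (\<Sum>c\<in>UNIV. \<Sum>c'\<in>UNIV. (A $ r $ c * A' $ r' $ c') * (e u $ c * e u $ c'))" for e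
  by (simp add: matrix_vector_mult_def sum_product mult_ac)
 show "integrable \<Omega> (%e. (A *v e u) $ r * (A' *v e u) $ r')" unfolding e
  by (intro Bochner_Integration.integrable_sum integrable_mult_right ic2)
 show "\<Omega>.expectation (%e. (A *v e u) $ r * (A' *v e u) $ r') = (\<Sum>c\<in>UNIV. \<Sum>c'\<in>UNIV. A $ r $ c * A' $ r' $ c' * innov_cov f $ c $ c')"
  unfolding e using ic2 by (simp add: innov_moments)
qed

lemma lagged_component_pair:
 fixes A A' :: "real^'d^'d"
 assumes "u ~= u'"
 shows "integrable \<Omega> (%e. (A *v e u) $ r * (A' *v e u') $ r')" "\<Omega>.expectation (%e. (A *v e u) $ r * (A' *v e u') $ r') = 0"
proof -
 have e: "(A *v e u) $ r = (\<Sum>c\<in>UNIV. A $ r $ c * e u $ c)" for e by (simp add: matrix_vector_mult_def)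
 have i: "integrable \<Omega> (%e. e u $ c * (A' *v e u') $ r')" "\<Omega>.expectation (%e. e u $ c * (A' *v e u') $ r') = 0" for c
  using indep_coord_others[OF innov_moments(1)[of c] lagged_component(1)[of A' u' r'], of u] assms by (auto simp: innov_moments)
 show "integrable \<Omega> (%e. (A *v e u) $ r * (A' *v e u') $ r')" "\<Omega>.expectation (%e. (A *v e u) $ r * (A' *v e u') $ r') = 0"
  unfolding e sum_distrib_right mult.assoc using i by simp_all
qed

lemma lagprod_expand: "lagprod N i u e = (\<Sum>r\<in>UNIV. e u $ r * (N i *v e (u - i)) $ r)"
 by (simp add: lagprod_def inner_vec_def)

lemma lagprod_same_time:
 assumes "1 <= i" "i <= u" "1 <= j" "j <= u"
 shows "integrable \<Omega> (%e. lagprod N i u e * lagprod N j u e)"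
  "\<Omega>.expectation (%e. lagprod N i u e * lagprod N j u e) = (if i = j then lagvar (N i) else 0)"
proof -
 let ?h = "%r r' e. (N i *v e (u - i)) $ r * (N j *v e (u - j)) $ r'"
 have hi: "integrable \<Omega> (?h r r')" for r r'
  using lagged_component(3)[of "N i" "u - i" r "N j" r'] lagged_component_pair(1)[of "u - i" "u - j" "N i" r "N j" r'] assms
  by (cases "i = j") auto
 have e: "lagprod N i u e * lagprod N j u e = (\<Sum>r\<in>UNIV. \<Sum>r'\<in>UNIV. (e u $ r * e u $ r') * ?h r r' e)" for e
  unfolding lagprod_expand sum_product by (simp add: mult_ac)
 have ins: "?h r r' (e(u := y)) = ?h r r' e" for r r' e y
 proof -
  have "u - i ~= u" "u - j ~= u" using assms by auto
  thus ?thesis by simp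
 qed
 note ind = indep_coord_others[OF innov_moments(3) hi ins]
 show "integrable \<Omega> (%e. lagprod N i u e * lagprod N j u e)" unfolding e
  by (intro Bochner_Integration.integrable_sum ind)
 have "\<Omega>.expectation (%e. lagprod N i u e * lagprod N j u e) = (\<Sum>r\<in>UNIV. \<Sum>r'\<in>UNIV. innov_cov f $ r $ r' * \<Omega>.expectation (?h r r'))"
  unfolding e using ind by (simp add: innov_moments)
 also have "... = (if i = j then lagvar (N i) else 0)"
 proof (cases "i = j")
  case True
  thus ?thesis using lagged_component(4)[of "N i" "u - i" _ "N i"] by (simp add: lagvar_def)
 next
  case False
  hence "u - i ~= u - j" using assms by auto
  thus ?thesis using False lagged_component_pair(2)[of "u - i" "u - j" "N i" _ "N j"] by simp
 qed
 finally show "\<Omega>.expectation (%e. lagprod N i u e * lagprod N j u e) = (if i = j then lagvar (N i) else 0)" .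
qed

lemma lagprod_square_integrable: "1 <= i ==> i <= u ==> integrable \<Omega> (%e. (lagprod N i u e)\<^sup>2)"
 using lagprod_same_time(1)[of i u i N] by (simp add: power2_eq_square)

text \<open>
 The innovation at the later time \<open>u\<close> has mean zero and is independent of the other factors.
\<close>

lemma lagprod_earlier_time:
 assumes i: "1 <= i" "i <= u" "1 <= j" "j <= s" and su: "s < u"
 shows "integrable \<Omega> (%e. lagprod N i u e * lagprod N j s e)" "\<Omega>.expectation (%e. lagprod N i u e * lagprod N j s e) = 0"
proof -
 let ?h = "%r e. (N i *v e (u - i)) $ r * lagprod N j s e"
 have hi: "integrable \<Omega> (?h r)" for r
 proof (rule Bochner_Integration.integrable_bound)
  show "integrable \<Omega> (%e. ((N i *v e (u - i)) $ r)\<^sup>2 + (lagprod N j s e)\<^sup>2)"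
   using lagged_component(3)[of "N i" "u - i" r "N i" r] lagprod_square_integrable[of j s N] i by (simp add: power2_eq_square)
  have m: "(%e. (N i *v e (u - i)) $ r) \<in> borel_measurable \<Omega>" using lagged_component(1) by blast
  show "?h r \<in> borel_measurable \<Omega>" by (intro borel_measurable_times m lagprod_measurable)
  have "\<bar>a * b\<bar> <= a\<^sup>2 + b\<^sup>2" for a b :: real
  proof -
   have "2 * (\<bar>a\<bar> * \<bar>b\<bar>) <= \<bar>a\<bar>\<^sup>2 + \<bar>b\<bar>\<^sup>2" using zero_le_power2[of "\<bar>a\<bar> - \<bar>b\<bar>"] by (simp add: power2_diff)
   moreover have "0 <= \<bar>a\<bar> * \<bar>b\<bar>" by simp
   ultimately show ?thesis unfolding abs_mult power2_abs by linarith
  qed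
  thus "AE e in \<Omega>. norm (?h r e) <= norm (((N i *v e (u - i)) $ r)\<^sup>2 + (lagprod N j s e)\<^sup>2)" by simp
 qed
 have ins: "?h r (e(u := y)) = ?h r e" for r e y
 proof -
  have "u - i ~= u" "s - j ~= u" "s ~= u" using i su by auto
  thus ?thesis by (simp add: lagprod_def)
 qed
 note ind = indep_coord_others[OF innov_moments(1) hi ins]
 have e: "lagprod N i u e * lagprod N j s e = (\<Sum>r\<in>UNIV. e u $ r * ?h r e)" for e
  unfolding lagprod_expand[of N i u] by (simp add: sum_distrib_right mult.assoc)
 show "integrable \<Omega> (%e. lagprod N i u e * lagprod N j s e)" "\<Omega>.expectation (%e. lagprod N i u e * lagprod N j s e) = 0"
  unfolding e using ind by (simp_all add: innov_moments)
qed

lemma lagprod_orthogonal: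
 assumes "1 <= i" "i <= u" "1 <= j" "j <= s"
 shows "integrable \<Omega> (%e. lagprod N i u e * lagprod N j s e)"
  "\<Omega>.expectation (%e. lagprod N i u e * lagprod N j s e) = (if i = j \<and> u = s then lagvar (N i) else 0)"
proof -
 consider "u = s" | "s < u" | "u < s" by linarith
 hence "integrable \<Omega> (%e. lagprod N i u e * lagprod N j s e) \<and>
  \<Omega>.expectation (%e. lagprod N i u e * lagprod N j s e) = (if i = j \<and> u = s then lagvar (N i) else 0)"
 proof cases
  case 1 thus ?thesis using lagprod_same_time[of i u j N] assms by auto
 next
  case 2 thus ?thesis using lagprod_earlier_time[of i u j s N] assms by auto
 next
  case 3 thus ?thesis using lagprod_earlier_time[of j s i u N] assms by (auto simp: mult.commute)
 qed
 thus "integrable \<Omega> (%e. lagprod N i u e * lagprod N j s e)"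
  "\<Omega>.expectation (%e. lagprod N i u e * lagprod N j s e) = (if i = j \<and> u = s then lagvar (N i) else 0)" by blast+
qed

lemma lagprod_mean: assumes "1 <= i" "i <= u" shows "integrable \<Omega> (lagprod N i u)" "\<Omega>.expectation (lagprod N i u) = 0"
proof -
 show "integrable \<Omega> (lagprod N i u)"
  by (rule \<Omega>.square_integrable_imp_integrable[OF lagprod_measurable lagprod_square_integrable[OF assms]])
 have ui: "u - i ~= u" using assms by auto
 have "\<Omega>.expectation (%e. e u $ r * (N i *v e (u - i)) $ r) = 0" "integrable \<Omega> (%e. e u $ r * (N i *v e (u - i)) $ r)" for r
  using indep_coord_others[OF innov_moments(1)[of r] lagged_component(1)[of "N i" "u - i" r], of u] ui by (auto simp: innov_moments)
 thus "\<Omega>.expectation (lagprod N i u) = 0" unfolding lagprod_expand[abs_def] by simp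
qed

text \<open>
 The sums for different lags are compared with sums over the common range \<open>m < u <= n\<close>, whose joint
 behaviour is that of one stationary sequence.
\<close>

lemma lagged_sums_characteristic_limit:
 "(%n. \<Omega>.expectation (%e. iexp (\<Sum>i=1..m. (\<Sum>u=i+1..n. lagprod N i u e) / sqrt (real n - real i)))) \<longlonglongrightarrow> exp (- (\<Sum>i=1..m. lagvar (N i)) / 2)"
proof -
 define v where "v = (\<Sum>i=1..m. lagvar (N i))"
 define F where "F e = (\<Sum>i=1..m. lagprod N i (m + 1) e)" for e
 have \<zeta>: "F (%k. e (t + k)) = (\<Sum>i=1..m. lagprod N i (t + (m + 1)) e)" for t e
  unfolding F_def lagprod_def by (intro sum.cong refl) auto
 have A: "(%n. \<Omega>.expectation (%e. iexp ((\<Sum>t<n. F (%k. e (t + k))) / sqrt n))) \<longlonglongrightarrow> exp (- v / 2)"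
 proof (rule stationary_central_limit)
  show "F \<in> borel_measurable (PiM UNIV (%_. borel))"
   unfolding F_def[abs_def] measurable_\<Omega>[symmetric] by measurable
  show "F e = F e'" if "\<And>k. k <= m + 1 ==> e k = e' k" for e e'
   unfolding F_def lagprod_def using that by (intro sum.cong refl) auto
  have pr: "F (%k. e (s + k)) * F (%k. e (t + k)) = (\<Sum>i=1..m. \<Sum>j=1..m. lagprod N i (s + (m + 1)) e * lagprod N j (t + (m + 1)) e)" for s t e
   unfolding \<zeta> sum_product ..
  show "integrable \<Omega> (%e. F (%k. e (s + k)) * F (%k. e (t + k)))" for s t
   unfolding pr by (intro Bochner_Integration.integrable_sum lagprod_orthogonal(1)) auto
  show "\<Omega>.expectation (%e. F (%k. e (s + k)) * F (%k. e (t + k))) = (if s = t then v else 0)" for s t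
  proof -
   have "\<Omega>.expectation (%e. F (%k. e (s + k)) * F (%k. e (t + k))) = (\<Sum>i=1..m. \<Sum>j=1..m. \<Omega>.expectation (%e. lagprod N i (s + (m + 1)) e * lagprod N j (t + (m + 1)) e))"
    unfolding pr
    by (subst Bochner_Integration.integral_sum, intro Bochner_Integration.integrable_sum lagprod_orthogonal(1), simp_all)
     (intro sum.cong refl Bochner_Integration.integral_sum lagprod_orthogonal(1), auto)
   also have "... = (\<Sum>i=1..m. \<Sum>j=1..m. if j = i then (if s = t then lagvar (N i) else 0) else 0)"
    by (intro sum.cong refl, subst lagprod_orthogonal(2)) auto
   also have "... = (if s = t then v else 0)" by (auto simp: sum.delta v_def)
   finally show ?thesis .
  qed
  show "\<Omega>.expectation (%e. F (%k. e (t + k))) = 0" for t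
   unfolding \<zeta> by (subst Bochner_Integration.integral_sum) (auto simp: lagprod_mean)
 qed
 let ?T = "%n i e. (\<Sum>u=i+1..n. lagprod N i u e) / sqrt (real n - real i)"
 let ?T' = "%n i e. (\<Sum>u=m+1..n. lagprod N i u e) / sqrt (real (n - m))"
 have T': "(\<Sum>t<n-m. F (%k. e (t + k))) / sqrt (real (n - m)) = (\<Sum>i=1..m. ?T' n i e)" for n e
 proof -
  have "(\<Sum>t<n-m. lagprod N i (t + (m + 1)) e) = (\<Sum>u=m+1..n. lagprod N i u e)" for i
   by (rule sum.reindex_bij_witness[of _ "%u. u - (m + 1)" "%t. t + (m + 1)"]) auto
  thus ?thesis unfolding \<zeta> by (subst sum.swap) (simp add: sum_divide_distrib)
 qed
 have "filterlim (%n. n - m) sequentially sequentially" by (rule filterlim_minus_const_nat_at_top)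
 from filterlim_compose[OF A this]
 have A': "(%n. \<Omega>.expectation (%e. iexp (\<Sum>i=1..m. ?T' n i e))) \<longlonglongrightarrow> exp (- v / 2)" unfolding T' .
 have diff: "cmod (\<Omega>.expectation (%e. iexp (\<Sum>i=1..m. ?T n i e)) - \<Omega>.expectation (%e. iexp (\<Sum>i=1..m. ?T' n i e)))
  <= (\<Sum>i=1..m. sqrt (2 * lagvar (N i) * (1 - sqrt ((real n - real m) / (real n - real i)))))" if n: "n > m" for n
 proof -
  have L2: "integrable \<Omega> (%e. (?T n i e - ?T' n i e)\<^sup>2)"
   "\<Omega>.expectation (%e. (?T n i e - ?T' n i e)\<^sup>2) = 2 * lagvar (N i) * (1 - sqrt ((real n - real m) / (real n - real i)))"
   if i: "i \<in> {1..m}" for i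
  proof -
   have o: "integrable \<Omega> (%e. lagprod N i u e * lagprod N i s e)"
    "\<Omega>.expectation (%e. lagprod N i u e * lagprod N i s e) = (if u = s then lagvar (N i) else 0)" if "u \<in> {i+1..n}" "s \<in> {i+1..n}" for u s
    using lagprod_orthogonal[of i u i s N] i that by auto
   have J: "{m+1..n} \<subseteq> {i+1..n}" "{m+1..n} ~= {}" using i n by auto
   have c: "real (card {i+1..n}) = real n - real i" "real (card {m+1..n}) = real n - real m" using i n by (auto simp: of_nat_diff)
   note L = \<Omega>.normalised_sums_L2[OF finite_atLeastAtMost J o, unfolded c]
   show "integrable \<Omega> (%e. (?T n i e - ?T' n i e)\<^sup>2)"
    "\<Omega>.expectation (%e. (?T n i e - ?T' n i e)\<^sup>2) = 2 * lagvar (N i) * (1 - sqrt ((real n - real m) / (real n - real i)))"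
    using L n by (simp_all add: of_nat_diff)
  qed
  have "?T n i \<in> borel_measurable \<Omega>" "?T' n i \<in> borel_measurable \<Omega>" for i by measurable
  thus ?thesis
   by (intro order_trans[OF \<Omega>.char_diff_le_sum]) (assumption, assumption, rule L2(1), assumption, rule sum_mono, simp only: L2(2) order_refl)
 qed
 have "(%n. \<Omega>.expectation (%e. iexp (\<Sum>i=1..m. ?T n i e)) - \<Omega>.expectation (%e. iexp (\<Sum>i=1..m. ?T' n i e))) \<longlonglongrightarrow> 0"
 proof (rule Lim_null_comparison)
  show "\<forall>\<^sub>F n in sequentially. norm (\<Omega>.expectation (%e. iexp (\<Sum>i=1..m. ?T n i e)) - \<Omega>.expectation (%e. iexp (\<Sum>i=1..m. ?T' n i e)))
   <= (\<Sum>i=1..m. sqrt (2 * lagvar (N i) * (1 - sqrt ((real n - real m) / (real n - real i)))))"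
   using eventually_gt_at_top[of m] by eventually_elim (rule diff)
  have "(%n. (real n - real m) / (real n - real i)) \<longlonglongrightarrow> 1" for i by real_asymp
  hence "(%n. \<Sum>i=1..m. sqrt (2 * lagvar (N i) * (1 - sqrt ((real n - real m) / (real n - real i))))) \<longlonglongrightarrow> (\<Sum>i=1..m. sqrt (2 * lagvar (N i) * (1 - sqrt 1)))"
   by (intro tendsto_intros)
  thus "(%n. \<Sum>i=1..m. sqrt (2 * lagvar (N i) * (1 - sqrt ((real n - real m) / (real n - real i))))) \<longlonglongrightarrow> 0" by simp
 qed
 from tendsto_add[OF this A'] show ?thesis unfolding v_def by simp
qed

end

section \<open>Projected quadratic forms\<close>

text \<open>
 The squared length, in the metric of the inverse of \<open>V\<close>, of the projection of \<open>w\<close> along the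
 family \<open>V c\<^sub>i' \<tau>\<close>.
\<close>

definition projected_form :: "real^'v^'v => (nat => real^'v^'r) => nat => (nat => real^'v) => real" where
 "projected_form V c m w = (\<Sum>i=1..m. w i \<bullet> (matrix_inv V *v w i)) -
   (\<Sum>j=1..m. c j *v w j) \<bullet> (matrix_inv (\<Sum>j=1..m. c j ** V ** transpose (c j)) *v (\<Sum>j=1..m. c j *v w j))"

lemma trace_matrix_mult: "trace (A ** B) = (\<Sum>i\<in>UNIV. \<Sum>j\<in>UNIV. A $ i $ j * (B $ j $ i :: real))"
 by (simp add: trace_def matrix_matrix_mult_def)

text \<open>
 The matrix of the form is the kernel of a projection of rank \<open>K\<close>, and the rank of a projection is its
 trace.
\<close>

lemma projected_form_decomposition:
 fixes V :: "real^'v^'v" and c :: "nat => real^'v^'r"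
 assumes V: "pos_def V" and inv: "invertible (\<Sum>j=1..m. c j ** V ** transpose (c j))"
 obtains K :: nat and u :: "nat => nat => real^'v" where
  "\<And>w. projected_form V c m w = (\<Sum>k<K. (\<Sum>i=1..m. u k i \<bullet> w i)\<^sup>2)"
  "\<And>k l. k < K ==> l < K ==> (\<Sum>i=1..m. u k i \<bullet> (V *v u l i)) = (if k = l then 1 else 0)"
  "real K = real m * real CARD('v) - real CARD('r)"
proof -
 define C where "C = (\<Sum>j=1..m. c j ** V ** transpose (c j))"
 define Ci where "Ci = matrix_inv C"
 define Vi where "Vi = matrix_inv V"
 have Vinv: "invertible V" by (rule pos_def_invertible[OF V])
 have Vs: "transpose V = V" using V by (simp add: pos_def_def)
 have Vis: "transpose Vi = Vi" using transpose_matrix_inv[OF Vinv] Vs by (simp add: Vi_def)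
 have Cs: "transpose C = C" unfolding C_def transpose_sum by (simp add: matrix_transpose_mul Vs matrix_mul_assoc)
 have Cinv: "invertible C" using inv by (simp add: C_def)
 have Cis: "transpose Ci = Ci" using transpose_matrix_inv[OF Cinv] Cs by (simp add: Ci_def)
 have VVi: "V ** Vi = mat 1" "Vi ** V = mat 1" using matrix_inv[OF Vinv] by (auto simp: Vi_def)
 have CCi: "C ** Ci = mat 1" "Ci ** C = mat 1" using matrix_inv[OF Cinv] by (auto simp: Ci_def)
 define P where "P i j = transpose (c i) ** Ci ** c j" for i j
 define Mm where "Mm i j = (if i = j then Vi else 0) - P i j" for i j
 have Pt: "transpose (P i j) = P j i" for i j by (simp add: P_def matrix_transpose_mul Cis matrix_mul_assoc)
 have Mt: "transpose (Mm i j) = Mm j i" for i j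
 proof -
  have "transpose (X - Y) = transpose X - transpose Y" for X Y :: "real^'v^'v" by (simp add: transpose_def vec_eq_iff)
  moreover have "transpose (0 :: real^'v^'v) = 0" by (simp add: transpose_def vec_eq_iff)
  ultimately show ?thesis by (simp add: Mm_def Pt Vis)
 qed
 have mdl: "(X - Y) ** Z = X ** Z - Y ** Z" for X Y Z :: "real^'v^'v"
  by (rule bounded_bilinear.diff_left[OF bounded_bilinear_matrix_matrix_mult])
 have mdr: "Z ** (X - Y) = Z ** X - Z ** Y" for X Y Z :: "real^'v^'v"
  by (rule bounded_bilinear.diff_right[OF bounded_bilinear_matrix_matrix_mult])
 have PVP: "(\<Sum>k=1..m. P i k ** V ** P k j) = P i j" for i j
 proof -
  have "(\<Sum>k=1..m. P i k ** V ** P k j) = transpose (c i) ** Ci ** C ** (Ci ** c j)"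
   unfolding C_def P_def matrix_mult_sum_right matrix_mult_sum_left by (simp add: matrix_mul_assoc)
  also have "... = transpose (c i) ** (Ci ** C) ** (Ci ** c j)" by (simp only: matrix_mul_assoc)
  finally show ?thesis unfolding CCi by (simp add: P_def matrix_mul_rid matrix_mul_assoc)
 qed
 have MVM: "(\<Sum>k=1..m. Mm i k ** V ** Mm k j) = Mm i j" if "i \<in> {1..m}" "j \<in> {1..m}" for i j
 proof -
  have "Mm i k ** V ** Mm k j = (if k = i then (if i = j then Vi else 0) - P i j else 0) - (if k = j then P i j else 0) + P i k ** V ** P k j" for k
  proof -
   have a: "(if i = k then Vi else 0) ** V ** Y = (if k = i then Y else 0)" for Y by (simp add: VVi matrix_mul_lid)
   have b: "Y ** V ** (if k = j then Vi else 0) = (if k = j then Y else 0)" for Y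
    by (simp add: matrix_mul_assoc[symmetric] VVi matrix_mul_rid)
   show ?thesis unfolding Mm_def mdl mdr a b by (auto simp: algebra_simps)
  qed
  hence "(\<Sum>k=1..m. Mm i k ** V ** Mm k j) = (\<Sum>k=1..m. if k = i then (if i = j then Vi else 0) - P i j else 0) - (\<Sum>k=1..m. if k = j then P i j else 0) + P i j"
   by (simp only: sum.distrib sum_subtractf PVP)
  thus ?thesis using that by (simp add: sum.delta Mm_def)
 qed
 define I where "I = {1..m} \<times> (UNIV :: 'v set)"
 have sumI: "(\<Sum>ia\<in>I. F ia) = (\<Sum>i=1..m. \<Sum>a\<in>UNIV. F (i, a))" for F :: "nat \<times> 'v => real"
  unfolding I_def by (simp only: sum.cartesian_product split_def prod.collapse)
 define B where "B x y = (\<Sum>i=1..m. (\<chi> a. x (i, a)) \<bullet> (V *v (\<chi> a. y (i, a))))" for x y :: "nat \<times> 'v => real"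
 define M where "M ia jb = Mm (fst ia) (fst jb) $ snd ia $ snd jb" for ia jb
 have rowM: "(\<chi> a. M ia (k, a)) = Mm (fst ia) k $ snd ia" for ia k by (simp add: M_def vec_eq_iff)
 have "\<exists>K u. (\<forall>i\<in>I. \<forall>j\<in>I. M i j = (\<Sum>k<K. u k i * u k j)) \<and>
  (\<forall>k<K::nat. \<forall>l<K. B (u k) (u l) = (if k = l then 1 else 0)) \<and>
  (\<forall>w. (\<forall>i\<in>I. B (M i) w = 0) \<longrightarrow> (\<forall>k<K. B (u k) w = 0))"
 proof (rule orthonormal_decomposition)
  show "finite I" by (simp add: I_def)
  show "B (%i. x i - y i) z = B x z - B y z" for x y z
  proof -
   have "(\<chi> a. x (i, a) - y (i, a)) = (\<chi> a. x (i, a)) - (\<chi> a. y (i, a))" for i by (simp add: vec_eq_iff)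
   thus ?thesis by (simp add: B_def inner_diff_left sum_subtractf)
  qed
  show "B (%i. r * x i) y = r * B x y" for r x y
  proof -
   have "(\<chi> a. r * x (i, a)) = r *\<^sub>R (\<chi> a. x (i, a))" for i by (simp add: vec_eq_iff)
   thus ?thesis by (simp add: B_def sum_distrib_left)
  qed
  show "B x y = B y x" for x y
   unfolding B_def using dot_transpose[of V] Vs by (intro sum.cong refl) (metis inner_commute)
  show "0 <= B x x" for x unfolding B_def by (intro sum_nonneg pos_def_nonneg[OF V])
  show "x ia = 0" if "B x x = 0" "ia \<in> I" for x ia
  proof -
   have "(\<chi> a. x (fst ia, a)) \<bullet> (V *v (\<chi> a. x (fst ia, a))) = 0"
    using that sum_nonneg_eq_0_iff[of "{1..m}" "%i. (\<chi> a. x (i, a)) \<bullet> (V *v (\<chi> a. x (i, a)))"] pos_def_nonneg[OF V]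
    by (auto simp: B_def I_def)
   hence "(\<chi> a. x (fst ia, a)) = 0" using V unfolding pos_def_def by (metis less_irrefl)
   thus ?thesis by (simp add: vec_eq_iff) (metis prod.collapse)
  qed
  show "B (M ia) (M jb) = M ia jb" if "ia \<in> I" "jb \<in> I" for ia jb
  proof -
   have "B (M ia) (M jb) = (\<Sum>k=1..m. (Mm (fst ia) k ** V ** Mm k (fst jb)) $ snd ia $ snd jb)"
    unfolding B_def rowM
   proof (intro sum.cong refl)
    fix k
    have "Mm k (fst jb) = transpose (Mm (fst jb) k)" by (simp only: Mt)
    thus "Mm (fst ia) k $ snd ia \<bullet> (V *v (Mm (fst jb) k $ snd jb)) = (Mm (fst ia) k ** V ** Mm k (fst jb)) $ snd ia $ snd jb"
     unfolding matrix_mul_assoc[symmetric]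
     by (simp add: inner_vec_def matrix_vector_mult_def matrix_matrix_mult_def transpose_def)
   qed
   also have "... = (\<Sum>k=1..m. Mm (fst ia) k ** V ** Mm k (fst jb)) $ snd ia $ snd jb" by (simp add: sum_component)
   also have "... = M ia jb" using that by (subst MVM) (auto simp: I_def M_def)
   finally show ?thesis .
  qed
 qed
 then obtain K :: nat and v where v: "\<And>i j. i\<in>I ==> j\<in>I ==> M i j = (\<Sum>k<K. v k i * v k j)"
  "\<And>k l. k<K ==> l<K ==> B (v k) (v l) = (if k = l then 1 else 0)" by blast
 define u where "u k i = (\<chi> a. v k (i, a))" for k i
 show ?thesis
 proof (rule that)
  show "(\<Sum>i=1..m. u k i \<bullet> (V *v u l i)) = (if k = l then 1 else 0)" if "k < K" "l < K" for k l
   using v(2)[OF that] by (simp add: B_def u_def)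
  show "projected_form V c m w = (\<Sum>k<K. (\<Sum>i=1..m. u k i \<bullet> w i)\<^sup>2)" for w
  proof -
   let ?g = "\<Sum>j=1..m. c j *v w j"
   have "(\<Sum>k<K. (\<Sum>i=1..m. u k i \<bullet> w i)\<^sup>2) = (\<Sum>k<K. (\<Sum>ia\<in>I. v k ia * w (fst ia) $ snd ia)\<^sup>2)"
    by (simp add: u_def inner_vec_def I_def sum.cartesian_product split_def)
   also have "... = (\<Sum>k<K. \<Sum>ia\<in>I. \<Sum>jb\<in>I. (v k ia * v k jb) * (w (fst ia) $ snd ia * w (fst jb) $ snd jb))"
    unfolding power2_eq_square sum_product by (intro sum.cong refl) (simp add: mult_ac)
   also have "... = (\<Sum>ia\<in>I. \<Sum>jb\<in>I. \<Sum>k<K. (v k ia * v k jb) * (w (fst ia) $ snd ia * w (fst jb) $ snd jb))"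
    by (subst sum.swap, intro sum.cong refl, rule sum.swap)
   also have "... = (\<Sum>ia\<in>I. \<Sum>jb\<in>I. M ia jb * (w (fst ia) $ snd ia * w (fst jb) $ snd jb))"
    by (intro sum.cong refl) (simp add: v sum_distrib_right)
   also have "... = (\<Sum>i=1..m. \<Sum>a\<in>UNIV. \<Sum>j=1..m. \<Sum>b\<in>UNIV. Mm i j $ a $ b * (w i $ a * w j $ b))"
    by (simp only: sumI M_def fst_conv snd_conv)
   also have "... = (\<Sum>i=1..m. \<Sum>j=1..m. \<Sum>a\<in>UNIV. \<Sum>b\<in>UNIV. Mm i j $ a $ b * (w i $ a * w j $ b))"
    by (intro sum.cong refl) (rule sum.swap)
   also have "... = (\<Sum>i=1..m. \<Sum>j=1..m. w i \<bullet> (Mm i j *v w j))"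
    by (intro sum.cong refl) (simp add: inner_vec_def matrix_vector_mult_def sum_distrib_left mult_ac)
   also have "... = (\<Sum>i=1..m. \<Sum>j=1..m. (if j = i then w i \<bullet> (Vi *v w i) else 0) - (c i *v w i) \<bullet> (Ci *v (c j *v w j)))"
   proof (intro sum.cong refl)
    fix i j
    have "w i \<bullet> (P i j *v w j) = (c i *v w i) \<bullet> (Ci *v (c j *v w j))"
     using dot_transpose[of "transpose (c i)" "w i"] by (simp add: P_def matrix_vector_mul_assoc[symmetric] del: transpose_matrix_vector)
    thus "w i \<bullet> (Mm i j *v w j) = (if j = i then w i \<bullet> (Vi *v w i) else 0) - (c i *v w i) \<bullet> (Ci *v (c j *v w j))"
     by (auto simp: Mm_def matrix_vector_mult_diff_rdistrib inner_diff_right)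
   qed
   also have "... = projected_form V c m w"
    unfolding projected_form_def C_def[symmetric] Ci_def[symmetric] Vi_def[symmetric]
    by (simp add: sum_subtractf sum.delta inner_sum_left inner_sum_right matrix_vector_mult_sum_right) (rule sum.swap)
   finally show ?thesis by simp
  qed
  have "real K = (\<Sum>k<K. B (v k) (v k))" using v(2) by simp
  also have "... = (\<Sum>k<K. \<Sum>i=1..m. \<Sum>a\<in>UNIV. \<Sum>b\<in>UNIV. V $ a $ b * (v k (i, b) * v k (i, a)))"
   by (simp add: B_def inner_vec_def matrix_vector_mult_def sum_distrib_left mult_ac)
  also have "... = (\<Sum>i=1..m. \<Sum>k<K. \<Sum>a\<in>UNIV. \<Sum>b\<in>UNIV. V $ a $ b * (v k (i, b) * v k (i, a)))" by (rule sum.swap)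
  also have "... = (\<Sum>i=1..m. \<Sum>a\<in>UNIV. \<Sum>b\<in>UNIV. \<Sum>k<K. V $ a $ b * (v k (i, b) * v k (i, a)))"
   by (intro sum.cong refl, subst sum.swap, intro sum.cong refl, rule sum.swap)
  also have "... = (\<Sum>i=1..m. \<Sum>a\<in>UNIV. \<Sum>b\<in>UNIV. V $ a $ b * M (i, b) (i, a))"
   by (intro sum.cong refl) (simp add: v I_def sum_distrib_left)
  also have "... = (\<Sum>i=1..m. trace (V ** Mm i i))" by (simp add: trace_matrix_mult M_def)
  also have "... = (\<Sum>i=1..m. trace (mat 1 :: real^'v^'v) - trace (Ci ** (c i ** V ** transpose (c i))))"
  proof (intro sum.cong refl)
   fix i
   have "trace (V ** P i i) = trace ((V ** transpose (c i)) ** (Ci ** c i))" by (simp add: P_def matrix_mul_assoc)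
   also have "... = trace ((Ci ** c i) ** (V ** transpose (c i)))" by (rule trace_mul_sym)
   finally have "trace (V ** P i i) = trace (Ci ** (c i ** V ** transpose (c i)))" by (simp add: matrix_mul_assoc)
   thus "trace (V ** Mm i i) = trace (mat 1 :: real^'v^'v) - trace (Ci ** (c i ** V ** transpose (c i)))"
    by (simp add: Mm_def mdr VVi trace_def sum_subtractf)
  qed
  also have "... = real m * trace (mat 1 :: real^'v^'v) - trace (Ci ** C)"
  proof -
   have "trace (\<Sum>i=1..m. X i) = (\<Sum>i=1..m. trace (X i))" for X :: "nat => real^'r^'r"
    by (simp add: trace_def sum_component) (rule sum.swap)
   thus ?thesis unfolding C_def matrix_mult_sum_right by (simp add: sum_subtractf)
  qed
  also have "... = real m * real CARD('v) - real CARD('r)" unfolding CCi by (simp add: trace_def mat_def)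
  finally show "real K = real m * real CARD('v) - real CARD('r)" .
 qed
qed

section \<open>Laplace transforms and the chi-square distribution\<close>

text \<open>
 The substitution \<open>u = exp (- x)\<close> turns a test function on the half line into a continuous function on
 the unit interval, which polynomials approximate uniformly; and expectations of polynomials in \<open>u\<close> are
 combinations of Laplace transforms at natural numbers.
\<close>

lemma laplace_imp_weak_conv:
 fixes \<mu> :: "nat => real measure"
 assumes d: "\<And>n. real_distribution (\<mu> n)" "real_distribution \<nu>"
  and pos: "\<And>n. AE x in \<mu> n. x >= 0" "AE x in \<nu>. x >= 0"
  and conv: "\<And>j::nat. (%n. LINT x|\<mu> n. exp (- (real j * x))) \<longlonglongrightarrow> (LINT x|\<nu>. exp (- (real j * x)))"
 shows "weak_conv_m \<mu> \<nu>"
proof (rule integral_cts_step_conv_imp_weak_conv[OF d])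
 fix a b :: real assume ab: "a < b"
 define g where "g u = (if u <= 0 then 0 else cts_step a b (- ln u))" for u :: real
 have cs: "continuous_on A (cts_step a b)" for A using uniformly_continuous_imp_continuous[OF cts_step_uniformly_continuous[OF ab]] continuous_on_subset by blast
 have contg: "continuous_on {0..1} g"
 proof -
  \<comment> \<open>Below \<open>u0\<close> the function vanishes, so that the logarithm is only used away from 0.\<close>
  define u0 where "u0 = exp (- b - 1)"
  have "continuous_on ({..u0} \<union> {u0..}) g"
  proof (rule continuous_on_closed_Un)
   have "g u = 0" if "u \<in> {..u0}" for u
   proof (cases "u <= 0")
    case False
    hence "ln u <= - b - 1" using that ln_le_cancel_iff[of u "exp (- b - 1)"] by (simp add: u0_def)
    thus ?thesis using False ab by (simp add: g_def cts_step_def)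
   qed (simp add: g_def)
   thus "continuous_on {..u0} g" by (subst continuous_on_cong[OF refl, of _ _ "%_. 0"]) auto
   have "continuous_on {u0..} (%u. cts_step a b (- ln u))"
   proof (rule continuous_on_compose2[OF cs[of UNIV]])
    show "continuous_on {u0..} (%u. - ln u)"
     by (intro continuous_intros) (auto simp: u0_def dest: order.strict_trans2[OF exp_gt_zero])
   qed auto
   moreover have "g u = cts_step a b (- ln u)" if "u \<in> {u0..}" for u
    using that by (auto simp: g_def u0_def dest: order.strict_trans2[OF exp_gt_zero])
   ultimately show "continuous_on {u0..} g" by (subst continuous_on_cong[OF refl, of _ _ "%u. cts_step a b (- ln u)"]) auto
  qed auto
  thus ?thesis by (rule continuous_on_subset) auto
 qed
 have gexp: "g (exp (- x)) = cts_step a b x" for x by (simp add: g_def)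
 show "(%n. integral\<^sup>L (\<mu> n) (cts_step a b)) \<longlonglongrightarrow> integral\<^sup>L \<nu> (cts_step a b)"
 proof (rule LIMSEQ_I)
  fix \<epsilon> :: real assume \<epsilon>: "\<epsilon> > 0"
  obtain P where P: "real_polynomial_function P" "\<And>u. u \<in> {0..1} ==> \<bar>g u - P u\<bar> < \<epsilon> / 3"
   using Stone_Weierstrass_real_polynomial_function[OF compact_Icc contg, of "\<epsilon>/3"] \<epsilon> by auto
  obtain c N where PN: "P = (%u. \<Sum>i\<le>N. c i * u ^ i)" using P(1) real_polynomial_function_iff_sum by auto
  have Pe: "P (exp (- x)) = (\<Sum>i\<le>N. c i * exp (- (real i * x)))" for x
   unfolding PN by (simp add: exp_of_nat_mult[symmetric])
  have ei: "integrable \<kappa> (%x. exp (- (real i * x)))" if "real_distribution \<kappa>" "AE x in \<kappa>. x >= 0" for \<kappa> i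
  proof -
   interpret real_distribution \<kappa> by fact
   show ?thesis by (rule integrable_const_bound[where B=1]) (use that(2) in auto)
  qed
  have close: "\<bar>integral\<^sup>L \<kappa> (cts_step a b) - (LINT x|\<kappa>. P (exp (- x)))\<bar> <= \<epsilon> / 3" if \<kappa>: "real_distribution \<kappa>" "AE x in \<kappa>. x >= 0" for \<kappa>
  proof -
   interpret real_distribution \<kappa> by fact
   have i1: "integrable \<kappa> (cts_step a b)" by (rule integrable_cts_step[OF ab])
   have i2: "integrable \<kappa> (%x. P (exp (- x)))" unfolding Pe using ei[OF \<kappa>] by (intro Bochner_Integration.integrable_sum integrable_mult_right)
   have "\<bar>integral\<^sup>L \<kappa> (cts_step a b) - (LINT x|\<kappa>. P (exp (- x)))\<bar> = \<bar>LINT x|\<kappa>. cts_step a b x - P (exp (- x))\<bar>"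
    using i1 i2 by simp
   also have "... <= (LINT x|\<kappa>. \<bar>cts_step a b x - P (exp (- x))\<bar>)" by (rule integral_abs_bound)
   also have "... <= (LINT x|\<kappa>. \<epsilon> / 3)"
   proof (rule integral_mono_AE)
    show "AE x in \<kappa>. \<bar>cts_step a b x - P (exp (- x))\<bar> <= \<epsilon> / 3"
     using \<kappa>(2) by eventually_elim (use P(2) in \<open>auto simp: gexp[symmetric] intro: less_imp_le\<close>)
   qed (use i1 i2 in auto)
   also have "... = \<epsilon> / 3" using prob_space by simp
   finally show ?thesis .
  qed
  have lim: "(%n. LINT x|\<mu> n. P (exp (- x))) \<longlonglongrightarrow> (LINT x|\<nu>. P (exp (- x)))"
  proof -
   have "(LINT x|\<kappa>. P (exp (- x))) = (\<Sum>i\<le>N. c i * (LINT x|\<kappa>. exp (- (real i * x))))" if "real_distribution \<kappa>" "AE x in \<kappa>. x >= 0" for \<kappa>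
    unfolding Pe using ei[OF that] by simp
   thus ?thesis using d pos conv by (simp add: tendsto_sum tendsto_mult_left)
  qed
  obtain n0 where n0: "\<And>n. n >= n0 ==> \<bar>(LINT x|\<mu> n. P (exp (- x))) - (LINT x|\<nu>. P (exp (- x)))\<bar> < \<epsilon> / 3"
   using LIMSEQ_D[OF lim, of "\<epsilon>/3"] \<epsilon> by auto
  have "\<bar>integral\<^sup>L (\<mu> n) (cts_step a b) - integral\<^sup>L \<nu> (cts_step a b)\<bar> < \<epsilon>" if "n >= n0" for n
   using n0[OF that] close[OF d(1) pos(1), of n] close[OF d(2) pos(2)] by linarith
  thus "\<exists>no. \<forall>n\<ge>no. norm (integral\<^sup>L (\<mu> n) (cts_step a b) - integral\<^sup>L \<nu> (cts_step a b)) < \<epsilon>" by auto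
 qed
qed

abbreviation std_normal :: "real measure" where "std_normal \<equiv> density lborel std_normal_density"

abbreviation gauss_vec :: "nat => (nat => real) measure" where "gauss_vec K \<equiv> PiM {..<K} (%_. std_normal)"

lemma prob_space_std_normal: "prob_space std_normal" by (rule prob_space_normal_density) simp

lemma prob_space_gauss_vec: "prob_space (gauss_vec K)" by (intro prob_space_PiM prob_space_std_normal)

lemma measurable_gauss_coord: "k < K ==> (%z. z k) \<in> borel_measurable (gauss_vec K)"
proof -
 assume "k < K"
 hence "(%z. z k) \<in> measurable (gauss_vec K) std_normal" by (intro measurable_component_singleton) auto
 thus ?thesis by (simp cong: measurable_cong_sets)
qed

lemma real_distribution_chi_square: "real_distribution (chi_square K)" "AE x in chi_square K. x >= 0"
proof -
 have m: "(%z. \<Sum>i<K. (z i)\<^sup>2) \<in> borel_measurable (gauss_vec K)"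
  by (intro borel_measurable_sum borel_measurable_power measurable_gauss_coord) auto
 interpret prob_space "gauss_vec K" by (rule prob_space_gauss_vec)
 show "real_distribution (chi_square K)" unfolding chi_square_def using m by (intro real_distribution_distr)
 show "AE x in chi_square K. x >= 0" unfolding chi_square_def using m by (subst AE_distr_iff) (auto intro!: AE_I2 sum_nonneg)
qed

lemma laplace_chi_square:
 "(LINT x|chi_square K. exp (- (s * x))) = (LINT z|gauss_vec K. exp (- (s * (\<Sum>k<K. (z k)\<^sup>2))))"
proof -
 have m: "(%z. \<Sum>i<K. (z i)\<^sup>2) \<in> borel_measurable (gauss_vec K)"
  by (intro borel_measurable_sum borel_measurable_power measurable_gauss_coord) auto
 show ?thesis unfolding chi_square_def using m by (subst integral_distr) auto
qed

text \<open>
 Averaging characteristic functions over a Gaussian vector produces the exponential of minus a sum of squares. This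
 leads from linear to quadratic statistics without a multivariate theory of weak convergence.
\<close>

lemma gauss_linearization:
 "(LINT z|gauss_vec K. iexp (\<Sum>k<K. z k * y k)) = complex_of_real (exp (- (\<Sum>k<K. (y k)\<^sup>2) / 2))"
proof -
 interpret N: prob_space std_normal by (rule prob_space_std_normal)
 interpret product_sigma_finite "%_::nat. std_normal" by unfold_locales
 have int: "integrable std_normal (%z. iexp (z * t))" for t by (intro N.integrable_const_bound[where B=1]) auto
 have "(LINT z|gauss_vec K. iexp (\<Sum>k<K. z k * y k)) = (LINT z|gauss_vec K. (\<Prod>k<K. iexp (z k * y k)))"
  by (simp add: exp_sum[symmetric] sum_distrib_left)
 also have "... = (\<Prod>k<K. LINT z|std_normal. iexp (z * y k))"
  by (rule product_integral_prod[OF finite_lessThan]) (rule int)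
 also have "... = (\<Prod>k<K. complex_of_real (exp (- ((y k)\<^sup>2) / 2)))"
 proof (intro prod.cong refl)
  fix k
  have "(LINT z|std_normal. iexp (z * y k)) = char std_normal (y k)" unfolding char_def by (simp add: mult.commute)
  thus "(LINT z|std_normal. iexp (z * y k)) = complex_of_real (exp (- ((y k)\<^sup>2) / 2))"
   using fun_cong[OF char_std_normal_distribution, of "y k"] by simp
 qed
 also have "... = complex_of_real (exp (\<Sum>k<K. - ((y k)\<^sup>2) / 2))" by (simp only: of_real_prod[symmetric] exp_sum[OF finite_lessThan])
 also have "(\<Sum>k<K. - ((y k)\<^sup>2) / 2) = - (\<Sum>k<K. (y k)\<^sup>2) / 2" by (simp add: sum_negf sum_divide_distrib)
 finally show ?thesis .
qed

lemma laplace_of_asymptotically_gaussian: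
 fixes y :: "nat => 'a => nat => real"
 assumes P: "\<And>n. prob_space (P n)" and m: "\<And>n k. k < K ==> (%x. y n x k) \<in> borel_measurable (P n)"
  and char: "\<And>z. (%n. LINT x|P n. iexp (\<Sum>k<K. z k * y n x k)) \<longlonglongrightarrow> complex_of_real (exp (- (\<Sum>k<K. (z k)\<^sup>2) / 2))"
  and s: "s >= 0"
 shows "(%n. LINT x|P n. exp (- (s * (\<Sum>k<K. (y n x k)\<^sup>2)))) \<longlonglongrightarrow> (LINT x|chi_square K. exp (- (s * x)))"
proof -
 \<comment> \<open>Rescaling by \<open>r\<close> turns the factor 1/2 of the Gaussian exponent into \<open>s\<close>.\<close>
 define r where "r = sqrt (2 * s)"
 have r: "r\<^sup>2 = 2 * s" using s by (simp add: r_def)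
 interpret G: prob_space "gauss_vec K" by (rule prob_space_gauss_vec)
 have swap: "complex_of_real (LINT x|P n. exp (- (s * (\<Sum>k<K. (y n x k)\<^sup>2)))) = (LINT z|gauss_vec K. (LINT x|P n. iexp (\<Sum>k<K. (r * z k) * y n x k)))" for n
 proof -
  interpret Pn: prob_space "P n" by (rule P)
  interpret PG: pair_prob_space "P n" "gauss_vec K" ..
  have mj: "(%(x, z). iexp (\<Sum>k<K. z k * (r * y n x k))) \<in> borel_measurable (P n \<Otimes>\<^sub>M gauss_vec K)"
  proof -
   have "(%xz. \<Sum>k<K. snd xz k * (r * y n (fst xz) k)) \<in> borel_measurable (P n \<Otimes>\<^sub>M gauss_vec K)"
    by (intro borel_measurable_sum borel_measurable_times borel_measurable_const measurable_compose[OF measurable_snd measurable_gauss_coord] measurable_compose[OF measurable_fst m]) auto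
   hence "(%xz. iexp (\<Sum>k<K. snd xz k * (r * y n (fst xz) k))) \<in> borel_measurable (P n \<Otimes>\<^sub>M gauss_vec K)" by measurable
   thus ?thesis by (simp add: split_beta')
  qed
  have "complex_of_real (LINT x|P n. exp (- (s * (\<Sum>k<K. (y n x k)\<^sup>2)))) = (LINT x|P n. complex_of_real (exp (- (\<Sum>k<K. (r * y n x k)\<^sup>2) / 2)))"
   by (subst integral_complex_of_real[symmetric]) (simp add: power_mult_distrib r sum_distrib_left[symmetric])
  also have "... = (LINT x|P n. (LINT z|gauss_vec K. iexp (\<Sum>k<K. z k * (r * y n x k))))"
   by (simp only: gauss_linearization)
  also have "... = (LINT z|gauss_vec K. (LINT x|P n. iexp (\<Sum>k<K. z k * (r * y n x k))))"
   by (rule PG.Fubini_integral[symmetric], rule PG.integrable_const_bound[where B=1, OF _ mj]) (simp add: split_beta')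
  finally show ?thesis by (simp add: mult_ac)
 qed
 have "(%n. LINT z|gauss_vec K. (LINT x|P n. iexp (\<Sum>k<K. (r * z k) * y n x k))) \<longlonglongrightarrow> (LINT z|gauss_vec K. complex_of_real (exp (- (\<Sum>k<K. (r * z k)\<^sup>2) / 2)))"
 proof (rule integral_dominated_convergence[where w="%_. 1"])
  have sqm: "(%z. \<Sum>k<K. (r * z k)\<^sup>2) \<in> borel_measurable (gauss_vec K)"
   by (intro borel_measurable_sum borel_measurable_power borel_measurable_times borel_measurable_const measurable_gauss_coord) auto
  thus "(%z. complex_of_real (exp (- (\<Sum>k<K. (r * z k)\<^sup>2) / 2))) \<in> borel_measurable (gauss_vec K)" by measurable
  show "(%z. LINT x|P n. iexp (\<Sum>k<K. (r * z k) * y n x k)) \<in> borel_measurable (gauss_vec K)" for n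
  proof -
   interpret Pn: prob_space "P n" by (rule P)
   have "(%zx. \<Sum>k<K. (r * fst zx k) * y n (snd zx) k) \<in> borel_measurable (gauss_vec K \<Otimes>\<^sub>M P n)"
    by (intro borel_measurable_sum borel_measurable_times borel_measurable_const measurable_compose[OF measurable_fst measurable_gauss_coord] measurable_compose[OF measurable_snd m]) auto
   hence "(%zx. iexp (\<Sum>k<K. (r * fst zx k) * y n (snd zx) k)) \<in> borel_measurable (gauss_vec K \<Otimes>\<^sub>M P n)" by measurable
   thus ?thesis by (intro Pn.borel_measurable_lebesgue_integral) (simp add: split_beta')
  qed
  show "AE z in gauss_vec K. (%n. LINT x|P n. iexp (\<Sum>k<K. (r * z k) * y n x k)) \<longlonglongrightarrow> complex_of_real (exp (- (\<Sum>k<K. (r * z k)\<^sup>2) / 2))"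
   using char[of "%k. r * _ k"] by (intro AE_I2) blast
  show "AE z in gauss_vec K. norm (LINT x|P n. iexp (\<Sum>k<K. (r * z k) * y n x k)) <= 1" for n
  proof (intro AE_I2)
   fix z
   interpret Pn: prob_space "P n" by (rule P)
   have "norm (LINT x|P n. iexp (\<Sum>k<K. (r * z k) * y n x k)) <= (LINT x|P n. norm (iexp (\<Sum>k<K. (r * z k) * y n x k)))" by (rule integral_norm_bound)
   also have "... = 1" using Pn.prob_space by simp
   finally show "norm (LINT x|P n. iexp (\<Sum>k<K. (r * z k) * y n x k)) <= 1" .
  qed
 qed auto
 moreover have "(LINT z|gauss_vec K. complex_of_real (exp (- (\<Sum>k<K. (r * z k)\<^sup>2) / 2))) = complex_of_real (LINT x|chi_square K. exp (- (s * x)))"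
  unfolding laplace_chi_square by (subst integral_complex_of_real) (simp add: power_mult_distrib r sum_distrib_left[symmetric])
 ultimately have "(%n. complex_of_real (LINT x|P n. exp (- (s * (\<Sum>k<K. (y n x k)\<^sup>2))))) \<longlonglongrightarrow> complex_of_real (LINT x|chi_square K. exp (- (s * x)))"
  unfolding swap by simp
 thus ?thesis by (rule tendsto_of_real_iff[THEN iffD1])
qed

section \<open>Cross-covariances as functions of the residuals\<close>

text \<open>
 Cross-covariances depend on sample and parameter only through the residuals. With this function the same statistic
 can be evaluated at residuals and at noise.
\<close>

definition ccov_stat :: "real^'d^'d => nat => nat => (nat => real^'d) => real^('d \<times> 'd)" where
 "ccov_stat S n i e = sqrt (real n - real i) *\<^sub>R vecm ((- 1 / (real n - real i)) *\<^sub>R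
   (matrix_inv S ** (\<Sum>t=i+1..n. outer (e t) (e (t - i)))))"

lemma gauss_ccov_resid:
 "sqrt (real n - real i) *\<^sub>R vecm (gauss_ccov p q S n i \<theta> x) = ccov_stat S n i (resid p q \<theta> x)"
 by (simp add: ccov_stat_def gauss_ccov_def)

lemma gauss_score_resid: "gauss_score p q S n \<theta> x = (\<Sum>i=1..n-1. c_mat p q \<theta> i *v ccov_stat S n i (resid p q \<theta> x))"
 by (simp add: gauss_score_def gauss_ccov_resid)

lemma ccov_stat_sum:
 "ccov_stat S n i e = (\<Sum>t=i+1..n. (- 1 / sqrt (real n - real i)) *\<^sub>R vecm (matrix_inv S ** outer (e t) (e (t - i))))"
proof (cases "i < n")
 case True
 have "matrix_inv S ** (\<Sum>t=i+1..n. outer (e t) (e (t - i))) = (\<Sum>t=i+1..n. matrix_inv S ** outer (e t) (e (t - i)))"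
  by (rule matrix_mult_sum_right)
 moreover have "sqrt (real n - real i) * (- 1 / (real n - real i)) = - 1 / sqrt (real n - real i)"
  using True real_div_sqrt[of "real n - real i"] by (simp add: field_simps)
 moreover have "vecm (sum F A) = (\<Sum>t\<in>A. vecm (F t))" for F :: "nat => real^'a^'a" and A by (rule linear_sum[OF linear_vecm])
 ultimately show ?thesis unfolding ccov_stat_def by (simp only: linear_scale[OF linear_vecm] scaleR_sum_right scaleR_scaleR)
qed (simp add: ccov_stat_def linear_0[OF linear_vecm])

lemma ccov_stat_restrict: "ccov_stat S n i (restrict e {1..n}) = ccov_stat S n i e"
 unfolding ccov_stat_sum by (intro sum.cong refl) auto

lemma inner_vecm: "a \<bullet> vecm X = (\<Sum>r\<in>UNIV. \<Sum>c\<in>UNIV. unvec a $ r $ c * X $ r $ c)"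
 by (simp add: inner_vec_def sum_UNIV_prod vecm_def unvec_def) (rule sum.swap)

lemma inner_vecm_outer: "a \<bullet> vecm (A ** outer x y) = x \<bullet> ((transpose A ** unvec a) *v y)"
proof -
 have o: "A ** outer x y = outer (A *v x) y"
  by (simp add: vec_eq_iff matrix_matrix_mult_def matrix_vector_mult_def outer_def sum_distrib_left mult_ac)
 have "a \<bullet> vecm (A ** outer x y) = (A *v x) \<bullet> (unvec a *v y)" unfolding o inner_vecm
  by (simp add: outer_def inner_vec_def matrix_vector_mult_def[of "unvec a"] sum_distrib_left mult_ac)
 also have "... = x \<bullet> (transpose A *v (unvec a *v y))" by (metis dot_transpose inner_commute transpose_transpose)
 finally show ?thesis by (simp only: matrix_vector_mul_assoc)
qed

lemma borel_measurable_outer: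
 assumes "x \<in> borel_measurable M" "y \<in> borel_measurable M"
 shows "(%\<omega>. outer (x \<omega> :: real^'m) (y \<omega> :: real^'n)) \<in> borel_measurable M"
 by (rule borel_measurable_continuous_Pair[OF assms])
   (intro bounded_bilinear.continuous_on[OF bounded_bilinear_outer] continuous_intros)

lemma borel_measurable_vecm: "x \<in> borel_measurable M ==> (%\<omega>. vecm (x \<omega> :: real^'n^'m)) \<in> borel_measurable M"
 by (rule borel_measurable_continuous_on[OF linear_continuous_on]) (simp add: linear_conv_bounded_linear[symmetric] linear_vecm)

lemma borel_measurable_matrix_mult:
 assumes "x \<in> borel_measurable M" "y \<in> borel_measurable M"
 shows "(%\<omega>. (x \<omega> :: real^'m^'k) ** (y \<omega> :: real^'n^'m)) \<in> borel_measurable M"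
 by (rule borel_measurable_continuous_Pair[OF assms])
   (intro bounded_bilinear.continuous_on[OF bounded_bilinear_matrix_matrix_mult] continuous_intros)

lemma borel_measurable_ccov_stat:
 assumes "\<And>t. 1 <= t ==> t <= n ==> (%\<omega>. e \<omega> t) \<in> borel_measurable M"
 shows "(%\<omega>. ccov_stat S n i (e \<omega>)) \<in> borel_measurable M"
 unfolding ccov_stat_sum
 by (intro borel_measurable_sum borel_measurable_scaleR borel_measurable_const borel_measurable_vecm
   borel_measurable_matrix_mult borel_measurable_outer assms) auto

text \<open>
 A semidefinite form that vanishes at \<open>v\<close> would become negative at \<open>v - t V v\<close> for small
 \<open>t > 0\<close>.
\<close>

lemma pos_defI_semidefinite:
 assumes sym: "transpose V = V" and inv: "invertible V" and nn: "\<And>v. 0 <= v \<bullet> (V *v v)"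
 shows "pos_def (V :: real^'v^'v)"
 unfolding pos_def_def
proof (intro conjI allI impI sym)
 fix v :: "real^'v" assume v: "v ~= 0"
 define y where "y = V *v v"
 have "matrix_inv V *v y = v" using matrix_inv(2)[OF inv] by (simp add: y_def matrix_vector_mul_assoc)
 hence y: "y \<bullet> y > 0" using v by auto
 define q where "q = y \<bullet> (V *v y)"
 define t where "t = (y \<bullet> y) / (q + 1)"
 have q: "q >= 0" unfolding q_def by (rule nn)
 hence t: "t > 0" "t * (q + 1) = y \<bullet> y" using y by (auto simp: t_def)
 have "v \<bullet> (V *v y) = y \<bullet> y" using dot_transpose[of V v y] sym by (simp add: y_def)
 hence "0 <= v \<bullet> y - 2 * t * (y \<bullet> y) + t * (t * q)"
  using nn[of "v - t *\<^sub>R y"] unfolding matrix_vector_mult_diff_distrib matrix_vector_mult_scaleR y_def[symmetric] inner_diff_left inner_diff_right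
  by (simp add: q_def inner_commute)
 also have "t * (t * q) <= t * (y \<bullet> y)" using t by (intro mult_left_mono) (auto simp: distrib_left)
 finally have "t * (y \<bullet> y) <= v \<bullet> y" by (simp add: algebra_simps)
 thus "0 < v \<bullet> (V *v v)" using mult_pos_pos[OF t(1) y] by (simp add: y_def)
qed

section \<open>The oracle statistic is a projected form\<close>

text \<open>
 The oracle residual vectors are orthogonal to all \<open>V c\<^sub>i' \<tau>\<close>, so Pythagoras' theorem applies.
 The second part says that the form annihilates these directions.
\<close>

lemma projected_form_residual:
 fixes V :: "real^'v^'v" and c :: "nat => real^'v^'r"
 assumes V: "pos_def V" and inv: "invertible (\<Sum>j=1..m. c j ** V ** transpose (c j))"
 defines "h w \<equiv> matrix_inv (\<Sum>j=1..m. c j ** V ** transpose (c j)) *v (\<Sum>j=1..m. c j *v w j)"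
 shows "(\<Sum>i=1..m. (w i - V *v (transpose (c i) *v h w)) \<bullet> (matrix_inv V *v (w i - V *v (transpose (c i) *v h w)))) = projected_form V c m w"
  "projected_form V c m (%i. V *v (transpose (c i) *v \<tau>)) = 0"
proof -
 define C where "C = (\<Sum>j=1..m. c j ** V ** transpose (c j))"
 have hC: "h w = matrix_inv C *v (\<Sum>j=1..m. c j *v w j)" for w by (simp add: h_def C_def)
 have Vinv: "invertible V" by (rule pos_def_invertible[OF V])
 have Vs: "transpose V = V" using V by (simp add: pos_def_def)
 have VVi: "matrix_inv V *v (V *v x) = x" for x using matrix_inv(2)[OF Vinv] by (simp add: matrix_vector_mul_assoc)
 have CCi: "C *v (matrix_inv C *v x) = x" "matrix_inv C *v (C *v x) = x" for x
  using matrix_inv[of C] inv by (auto simp: matrix_vector_mul_assoc C_def)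
 have Vi: "(V *v x) \<bullet> (matrix_inv V *v y) = x \<bullet> y" for x y
 proof -
  have "(V *v x) \<bullet> (matrix_inv V *v y) = x \<bullet> (V *v (matrix_inv V *v y))" using dot_transpose[of V x] Vs by simp
  thus ?thesis using matrix_inv(1)[OF Vinv] by (simp add: matrix_vector_mul_assoc)
 qed
 have dt: "x \<bullet> (transpose (c i) *v y) = (c i *v x) \<bullet> y" for x y i by (metis dot_transpose inner_commute)
 have Ch: "(\<Sum>i=1..m. c i *v (V *v (transpose (c i) *v y))) = C *v y" for y
  unfolding C_def matrix_vector_mult_sum_left by (simp only: matrix_vector_mul_assoc matrix_mul_assoc)
 let ?h = "h w" let ?g = "\<Sum>j=1..m. c j *v w j"
 have gh: "(\<Sum>i=1..m. w i \<bullet> (transpose (c i) *v y)) = ?g \<bullet> y" for y unfolding dt by (simp add: inner_sum_left)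
 have hh: "(\<Sum>i=1..m. (V *v (transpose (c i) *v y)) \<bullet> (transpose (c i) *v y)) = (C *v y) \<bullet> y" for y
  unfolding dt inner_sum_left[symmetric] Ch ..
 have "(w i - V *v (transpose (c i) *v ?h)) \<bullet> (matrix_inv V *v (w i - V *v (transpose (c i) *v ?h)))
   = w i \<bullet> (matrix_inv V *v w i) - 2 * (w i \<bullet> (transpose (c i) *v ?h)) + (V *v (transpose (c i) *v ?h)) \<bullet> (transpose (c i) *v ?h)" for i
  unfolding matrix_vector_mult_diff_distrib inner_diff_left inner_diff_right VVi Vi by (simp add: inner_commute)
 hence "(\<Sum>i=1..m. (w i - V *v (transpose (c i) *v ?h)) \<bullet> (matrix_inv V *v (w i - V *v (transpose (c i) *v ?h))))
  = (\<Sum>i=1..m. w i \<bullet> (matrix_inv V *v w i)) - 2 * (?g \<bullet> ?h) + (C *v ?h) \<bullet> ?h"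
  by (simp only: sum.distrib sum_subtractf sum_distrib_left[symmetric] gh hh)
 thus "(\<Sum>i=1..m. (w i - V *v (transpose (c i) *v ?h)) \<bullet> (matrix_inv V *v (w i - V *v (transpose (c i) *v ?h)))) = projected_form V c m w"
  unfolding projected_form_def C_def[symmetric] hC CCi by simp
 show "projected_form V c m (%i. V *v (transpose (c i) *v \<tau>)) = 0"
  unfolding projected_form_def C_def[symmetric] Ch CCi VVi hh by simp
qed

lemma portmanteau_resid:
 assumes "m <= n"
 shows "portmanteau p q S m n \<theta> x = (\<Sum>i=1..m. ccov_stat S n i (resid p q \<theta> x) \<bullet>
  (matrix_inv (ccov_var (resid_cov p q n \<theta> x)) *v ccov_stat S n i (resid p q \<theta> x)))"
 unfolding portmanteau_def gauss_ccov_resid[symmetric]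
proof (intro sum.cong refl)
 fix i assume "i \<in> {1..m}"
 hence "sqrt (real n - real i) * sqrt (real n - real i) = real n - real i" using assms by simp
 thus "(real n - real i) * (vecm (gauss_ccov p q S n i \<theta> x) \<bullet> (matrix_inv (ccov_var (resid_cov p q n \<theta> x)) *v vecm (gauss_ccov p q S n i \<theta> x)))
  = sqrt (real n - real i) *\<^sub>R vecm (gauss_ccov p q S n i \<theta> x) \<bullet> (matrix_inv (ccov_var (resid_cov p q n \<theta> x)) *v sqrt (real n - real i) *\<^sub>R vecm (gauss_ccov p q S n i \<theta> x))"
  by (simp add: matrix_vector_mult_scaleR mult.assoc[symmetric])
qed

lemma oracle_portmanteau_resid:
 assumes n: "m < n" and V: "pos_def (ccov_var S)" and inv: "invertible (c_gram p q S m \<theta>)"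
 shows "oracle_portmanteau p q S m n \<theta> x = projected_form (ccov_var S) (c_mat p q \<theta>) m (%i. ccov_stat S n i (resid p q \<theta> x))"
 unfolding projected_form_residual(1)[OF V inv[unfolded c_gram_def], symmetric] oracle_portmanteau_def
proof (intro sum.cong refl)
 fix i assume i: "i \<in> {1..m}"
 let ?w = "%i. ccov_stat S n i (resid p q \<theta> x)"
 define y where "y = ?w i - ccov_var S *v (transpose (c_mat p q \<theta> i) *v
   (matrix_inv (\<Sum>j=1..m. c_mat p q \<theta> j ** ccov_var S ** transpose (c_mat p q \<theta> j)) *v (\<Sum>j=1..m. c_mat p q \<theta> j *v ?w j)))"
 have "vecm (oracle_ccov p q S m n i \<theta> x) = (1 / sqrt (real n - real i)) *\<^sub>R y"
  unfolding oracle_ccov_def vecm_unvec gauss_ccov_resid y_def c_gram_def matrix_vector_mul_assoc[symmetric] ..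
 moreover have "(real n - real i) * (1 / sqrt (real n - real i) * (1 / sqrt (real n - real i))) = 1" using i n by simp
 ultimately show "(real n - real i) * (vecm (oracle_ccov p q S m n i \<theta> x) \<bullet> (matrix_inv (ccov_var S) *v vecm (oracle_ccov p q S m n i \<theta> x)))
  = y \<bullet> (matrix_inv (ccov_var S) *v y)"
  by (simp add: matrix_vector_mult_scaleR mult.assoc[symmetric] del: divide_inverse)
qed

section \<open>Moments and limits under the model\<close>

context
 fixes f :: "real^'d => real" assumes f: "f \<in> density_class"
begin

interpretation borel_prob "innov f" by (rule borel_prob_innov[OF f])

lemma resid_noise_transfer:
 "distr (varma_law p q \<theta> f n) (paths n) (%x. restrict (resid p q \<theta> x) {1..n})
  = distr \<Omega> (paths n) (%e. restrict e {1..n})"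
proof -
 interpret pp: product_prob_space "%_::nat. innov f" UNIV by (rule product_prob_spaceI) (rule prob_space_axioms)
 have "distr \<Omega> (paths n) (%e. restrict e {1..n}) = distr \<Omega> (noise f n) (%e. restrict e {1..n})"
  by (rule distr_cong) simp_all
 also have "... = noise f n" unfolding \<Omega>_def by (rule pp.distr_PiM_restrict_finite) auto
 finally show ?thesis unfolding distr_resid_varma_law[OF f] by simp
qed

lemma integral_resid:
 fixes F :: "(nat => real^'d) => 'b::{banach, second_countable_topology}"
 assumes F: "F \<in> borel_measurable (paths n)" and dep: "\<And>e. F (restrict e {1..n}) = F e"
 shows "(LINT x|varma_law p q \<theta> f n. F (resid p q \<theta> x)) = (LINT e|\<Omega>. F e)"
  "integrable (varma_law p q \<theta> f n) (%x. F (resid p q \<theta> x)) \<longleftrightarrow> integrable \<Omega> F"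
proof -
 have m1: "(%x. restrict (resid p q \<theta> x) {1..n}) \<in> measurable (varma_law p q \<theta> f n) (paths n)"
  unfolding measurable_varma_law by (rule measurable_resid_vector)
 have m2: "(%e. restrict e {1..n}) \<in> measurable \<Omega> (paths n)"
  by (intro measurable_restrict coord_\<Omega>)
 show "(LINT x|varma_law p q \<theta> f n. F (resid p q \<theta> x)) = (LINT e|\<Omega>. F e)"
  using integral_distr[OF m1 F] integral_distr[OF m2 F] unfolding resid_noise_transfer dep by simp
 show "integrable (varma_law p q \<theta> f n) (%x. F (resid p q \<theta> x)) \<longleftrightarrow> integrable \<Omega> F"
  using integrable_distr_eq[OF m1 F] integrable_distr_eq[OF m2 F] unfolding resid_noise_transfer dep by simp
qed

lemma innov_cov_symmetric: "transpose (innov_cov f) = innov_cov f" "invertible (innov_cov f)"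
 using density_classD(9)[OF f] pos_def_invertible by (auto simp: pos_def_def)

text \<open>
 The factor that the definition of the cross-covariances puts in front of the lagged products.
\<close>

definition lag_weight :: "real^('d \<times> 'd) => real^'d^'d" where
 "lag_weight a = - (matrix_inv (innov_cov f) ** unvec a)"

lemma inner_ccov_stat:
 "a i \<bullet> ccov_stat (innov_cov f) n i e = (\<Sum>u=i+1..n. lagprod (%i. lag_weight (a i)) i u e) / sqrt (real n - real i)"
proof -
 have "transpose (matrix_inv (innov_cov f)) = matrix_inv (innov_cov f)"
  using transpose_matrix_inv[OF innov_cov_symmetric(2)] innov_cov_symmetric(1) by simp
 moreover have "(- X) *v y = - (X *v y)" for X :: "real^'d^'d" and y
  by (simp add: vec_eq_iff matrix_vector_mult_def sum_negf)
 ultimately show ?thesis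
  unfolding ccov_stat_sum inner_sum_right inner_scaleR_right inner_vecm_outer lagprod_def[OF f] lag_weight_def
  by (simp add: sum_divide_distrib sum_negf)
qed

lemma lagvar_lag_weight: "lagvar f (lag_weight a) = a \<bullet> (ccov_var (innov_cov f) *v a)"
proof -
 let ?S = "innov_cov f"
 define A where "A = unvec a"
 define B where "B = matrix_inv ?S ** A"
 have Ss: "?S $ i $ j = ?S $ j $ i" for i j using innov_cov_symmetric(1) by (metis transpose_def vec_lambda_beta)
 have SB: "(\<Sum>r\<in>UNIV. ?S $ r' $ r * B $ r $ c) = A $ r' $ c" for r' c
 proof -
  have "?S ** B = A" unfolding B_def using matrix_inv(1)[OF innov_cov_symmetric(2)] by (simp add: matrix_mul_assoc)
  hence "(?S ** B) $ r' $ c = A $ r' $ c" by simp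
  thus ?thesis by (simp add: matrix_matrix_mult_def)
 qed
 have "a \<bullet> (ccov_var ?S *v a) = vecm A \<bullet> vecm (B ** ?S)"
  using kron_vecm[of ?S "matrix_inv ?S" A] innov_cov_symmetric(1) by (simp add: ccov_var_def A_def B_def)
 also have "... = (\<Sum>r'\<in>UNIV. \<Sum>c\<in>UNIV. A $ r' $ c * (\<Sum>c'\<in>UNIV. B $ r' $ c' * ?S $ c' $ c))"
  unfolding inner_vecm by (simp add: matrix_matrix_mult_def)
 also have "... = (\<Sum>r'\<in>UNIV. \<Sum>c\<in>UNIV. \<Sum>r\<in>UNIV. \<Sum>c'\<in>UNIV. ?S $ r' $ r * B $ r $ c * (B $ r' $ c' * ?S $ c' $ c))"
  unfolding SB[symmetric] by (simp add: sum_product)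
 also have "... = (\<Sum>r'\<in>UNIV. \<Sum>r\<in>UNIV. \<Sum>c\<in>UNIV. \<Sum>c'\<in>UNIV. ?S $ r' $ r * B $ r $ c * (B $ r' $ c' * ?S $ c' $ c))"
  by (intro sum.cong[OF refl] sum.swap)
 also have "... = (\<Sum>r\<in>UNIV. \<Sum>r'\<in>UNIV. \<Sum>c\<in>UNIV. \<Sum>c'\<in>UNIV. ?S $ r' $ r * B $ r $ c * (B $ r' $ c' * ?S $ c' $ c))"
  by (rule sum.swap)
 also have "... = lagvar f (lag_weight a)"
  unfolding lagvar_def[OF f] lag_weight_def A_def[symmetric] B_def[symmetric] using Ss
  by (simp add: sum_distrib_left mult_ac)
 finally show ?thesis by simp
qed

text \<open>
 The matrix is invertible by the rule for products of Kronecker products, and it is semidefinite because it is the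
 covariance matrix of a statistic.
\<close>

lemma pos_def_ccov_var: "pos_def (ccov_var (innov_cov f))"
proof (rule pos_defI_semidefinite)
 let ?S = "innov_cov f"
 show "transpose (ccov_var ?S) = ccov_var ?S"
  unfolding ccov_var_def transpose_kron transpose_matrix_inv[OF innov_cov_symmetric(2)] innov_cov_symmetric(1) ..
 show "invertible (ccov_var ?S)" unfolding invertible_def ccov_var_def
  by (intro exI[of _ "kron (matrix_inv ?S) ?S"]) (simp add: kron_mult matrix_inv[OF innov_cov_symmetric(2)] kron_mat_1)
 fix a
 have "0 <= \<Omega>.expectation (%e. lagprod (%_. lag_weight a) 1 1 e * lagprod (%_. lag_weight a) 1 1 e)" by (intro integral_nonneg_AE) auto
 hence "0 <= lagvar f (lag_weight a)" by (subst (asm) lagprod_orthogonal(2)[OF f]) auto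
 thus "0 <= a \<bullet> (ccov_var ?S *v a)" by (simp only: lagvar_lag_weight)
qed

lemma ccov_stat_measurable: "ccov_stat S n i \<in> borel_measurable (paths n)"
 by (rule borel_measurable_ccov_stat) (simp add: measurable_coord[simplified])

lemma ccov_stat_characteristic_limit:
 "(%n. LINT x|varma_law p q (\<theta>n n) f n. iexp (\<Sum>i=1..m. a i \<bullet> ccov_stat (innov_cov f) n i (resid p q (\<theta>n n) x)))
  \<longlonglongrightarrow> exp (- (\<Sum>i=1..m. a i \<bullet> (ccov_var (innov_cov f) *v a i)) / 2)"
proof -
 have "(LINT x|varma_law p q (\<theta>n n) f n. iexp (\<Sum>i=1..m. a i \<bullet> ccov_stat (innov_cov f) n i (resid p q (\<theta>n n) x)))
  = (LINT e|\<Omega>. iexp (\<Sum>i=1..m. (\<Sum>u=i+1..n. lagprod (%i. lag_weight (a i)) i u e) / sqrt (real n - real i)))" for n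
 proof -
  have "(%e. \<Sum>i=1..m. a i \<bullet> ccov_stat (innov_cov f) n i e) \<in> borel_measurable (paths n)"
   by (intro borel_measurable_sum borel_measurable_inner borel_measurable_const ccov_stat_measurable)
  hence "(%e. iexp (\<Sum>i=1..m. a i \<bullet> ccov_stat (innov_cov f) n i e)) \<in> borel_measurable (paths n)" by measurable
  from integral_resid(1)[OF this, of p q "\<theta>n n"] show ?thesis unfolding ccov_stat_restrict inner_ccov_stat by simp
 qed
 thus ?thesis using lagged_sums_characteristic_limit[OF f, of "%i. lag_weight (a i)" m] by (simp only: lagvar_lag_weight)
qed

lemma ccov_stat_second_moment:
 assumes i: "1 <= i" "i < n"
 shows "integrable (varma_law p q \<theta> f n) (%x. (norm (ccov_stat (innov_cov f) n i (resid p q \<theta> x)))\<^sup>2)"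
  "(LINT x|varma_law p q \<theta> f n. (norm (ccov_stat (innov_cov f) n i (resid p q \<theta> x)))\<^sup>2)
   = (\<Sum>b\<in>Basis. b \<bullet> (ccov_var (innov_cov f) *v b))"
proof -
 let ?W = "ccov_stat (innov_cov f) n i"
 have q: "integrable \<Omega> (%e. (b \<bullet> ?W e)\<^sup>2)" "\<Omega>.expectation (%e. (b \<bullet> ?W e)\<^sup>2) = b \<bullet> (ccov_var (innov_cov f) *v b)" for b
 proof -
  let ?N = "%_. lag_weight b" let ?c = "1 / sqrt (real n - real i)"
  have e: "b \<bullet> ?W e = (\<Sum>u\<in>{i+1..n}. ?c * lagprod ?N i u e)" for e
   using inner_ccov_stat[of "%_. b" i n e] by (simp add: sum_divide_distrib)
  have io: "integrable \<Omega> (%x. lagprod ?N i u x * lagprod ?N i s x)"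
   "\<Omega>.expectation (%x. lagprod ?N i u x * lagprod ?N i s x) = (if u = s then lagvar f (lag_weight b) else 0)"
   if "u \<in> {i+1..n}" "s \<in> {i+1..n}" for u s
   using lagprod_orthogonal[OF f, of i u i s ?N] that i by auto
  show "integrable \<Omega> (%e. (b \<bullet> ?W e)\<^sup>2)" unfolding e by (rule \<Omega>.orthogonal_sum_square(1)[OF finite_atLeastAtMost io])
  have "\<Omega>.expectation (%e. (b \<bullet> ?W e)\<^sup>2) = (\<Sum>u\<in>{i+1..n}. ?c\<^sup>2 * lagvar f (lag_weight b))"
   unfolding e by (rule \<Omega>.orthogonal_sum_square(2)[OF finite_atLeastAtMost io])
  also have "... = lagvar f (lag_weight b)" using i by (simp add: power_divide of_nat_diff)
  finally show "\<Omega>.expectation (%e. (b \<bullet> ?W e)\<^sup>2) = b \<bullet> (ccov_var (innov_cov f) *v b)" by (simp add: lagvar_lag_weight)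
 qed
 have e: "(norm (?W e))\<^sup>2 = (\<Sum>b\<in>Basis. (b \<bullet> ?W e)\<^sup>2)" for e
  unfolding power2_norm_eq_inner by (subst euclidean_inner) (simp add: power2_eq_square inner_commute)
 have m: "(%e. (norm (?W e))\<^sup>2) \<in> borel_measurable (paths n)"
  using ccov_stat_measurable by measurable
 have dep: "(norm (?W (restrict e {1..n})))\<^sup>2 = (norm (?W e))\<^sup>2" for e by (simp only: ccov_stat_restrict)
 have i: "integrable \<Omega> (%e. (norm (?W e))\<^sup>2)" unfolding e using q by simp
 thus "integrable (varma_law p q \<theta> f n) (%x. (norm (?W (resid p q \<theta> x)))\<^sup>2)"
  using integral_resid(2)[OF m dep] by simp
 have "\<Omega>.expectation (%e. (norm (?W e))\<^sup>2) = (\<Sum>b\<in>Basis. b \<bullet> (ccov_var (innov_cov f) *v b))" unfolding e using q by simp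
 thus "(LINT x|varma_law p q \<theta> f n. (norm (?W (resid p q \<theta> x)))\<^sup>2) = (\<Sum>b\<in>Basis. b \<bullet> (ccov_var (innov_cov f) *v b))"
  using integral_resid(1)[OF m dep] by simp
qed

lemma resid_cov_second_moment:
 assumes m4: "integrable (innov f) (%e. norm e ^ 4)"
 shows "\<exists>C. \<forall>n\<ge>1. \<forall>\<theta>. integrable (varma_law p q \<theta> f n) (%x. (norm (resid_cov p q n \<theta> x - innov_cov f))\<^sup>2) \<and>
  (LINT x|varma_law p q \<theta> f n. (norm (resid_cov p q n \<theta> x - innov_cov f))\<^sup>2) <= C / n"
proof -
 define g where "g r s y = (y::real^'d) $ r * y $ s - innov_cov f $ r $ s" for r s y
 have g1: "integrable (innov f) (g r s)" "(LINT y|innov f. g r s y) = 0" for r s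
  unfolding g_def using innov_moments(3,4)[OF f] prob_space by auto
 have yb: "integrable (innov f) (%y. (y $ r * y $ s)\<^sup>2)" for r s
 proof (rule Bochner_Integration.integrable_bound[OF m4])
  show "(%y. (y $ r * y $ s)\<^sup>2) \<in> borel_measurable (innov f)" using innov_moments(3)[OF f, of r s] by measurable
  have "(y $ r * y $ s)\<^sup>2 <= norm y ^ 4" for y :: "real^'d"
  proof -
   have "\<bar>y $ r * y $ s\<bar> <= norm y * norm y" unfolding abs_mult by (intro mult_mono component_le_norm_cart) auto
   hence "\<bar>y $ r * y $ s\<bar>\<^sup>2 <= (norm y * norm y)\<^sup>2" by (rule power_mono) simp
   thus ?thesis by (simp add: power_mult_distrib flip: power_add)
  qed
  thus "AE y in innov f. norm ((y $ r * y $ s)\<^sup>2) <= norm (norm y ^ 4)" by simp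
 qed
 have g2: "integrable (innov f) (%y. (g r s y)\<^sup>2)" for r s
  unfolding g_def power2_diff using yb[of r s] innov_moments(3)[OF f, of r s] by (intro Bochner_Integration.integrable_diff Bochner_Integration.integrable_add integrable_mult_left integrable_mult_right) auto
 define v where "v r s = (LINT y|innov f. (g r s y)\<^sup>2)" for r s
 define \<Delta> where "\<Delta> n e = (1 / real n) *\<^sub>R (\<Sum>t=1..n. outer (e t) (e t)) - innov_cov f" for n :: nat and e :: "nat => real^'d"
 have dc: "\<Delta> n e $ r $ s = (\<Sum>t\<in>{1..n}. (1 / real n) * g r s (e t))" if "n >= 1" for n e r s
 proof -
  have "(\<Sum>t\<in>{1..n}. (1 / real n) * g r s (e t)) = (\<Sum>t\<in>{1..n}. (1 / real n) * (e t $ r * e t $ s)) - (\<Sum>t\<in>{1..n}. (1 / real n) * innov_cov f $ r $ s)"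
   unfolding g_def right_diff_distrib sum_subtractf ..
  thus ?thesis using that by (simp add: \<Delta>_def sum_component outer_def sum_distrib_left)
 qed
 have prod: "integrable \<Omega> (%e. g r s (e t) * g r s (e u))" "\<Omega>.expectation (%e. g r s (e t) * g r s (e u)) = (if t = u then v r s else 0)" for r s and t u :: nat
 proof -
  have "integrable \<Omega> (%e. g r s (e t) * g r s (e u)) \<and> \<Omega>.expectation (%e. g r s (e t) * g r s (e u)) = (if t = u then v r s else 0)"
  proof (cases "t = u")
   case True thus ?thesis using integral_coord[OF g2[of r s], of u] by (simp add: power2_eq_square v_def)
  next
   case False
   thus ?thesis using indep_coord_others[OF g1(1)[of r s] integral_coord(1)[OF g1(1)[of r s], of u], of t] by (simp add: g1)
  qed
  thus "integrable \<Omega> (%e. g r s (e t) * g r s (e u))" "\<Omega>.expectation (%e. g r s (e t) * g r s (e u)) = (if t = u then v r s else 0)" by auto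
 qed
 have comp: "integrable \<Omega> (%e. (\<Delta> n e $ r $ s)\<^sup>2)" "\<Omega>.expectation (%e. (\<Delta> n e $ r $ s)\<^sup>2) = v r s / n" if "n >= 1" for n r s
 proof -
  show "integrable \<Omega> (%e. (\<Delta> n e $ r $ s)\<^sup>2)" unfolding dc[OF that] by (rule \<Omega>.orthogonal_sum_square(1)[OF finite_atLeastAtMost prod])
  have "\<Omega>.expectation (%e. (\<Delta> n e $ r $ s)\<^sup>2) = (\<Sum>t\<in>{1..n}. (1 / real n)\<^sup>2 * v r s)"
   unfolding dc[OF that] by (rule \<Omega>.orthogonal_sum_square(2)[OF finite_atLeastAtMost prod])
  thus "\<Omega>.expectation (%e. (\<Delta> n e $ r $ s)\<^sup>2) = v r s / n" by (simp add: power2_eq_square)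
 qed
 have nsq: "(norm (\<Delta> n e))\<^sup>2 = (\<Sum>r\<in>UNIV. \<Sum>s\<in>UNIV. (\<Delta> n e $ r $ s)\<^sup>2)" for n e
  by (simp add: norm_vec_sq)
 show ?thesis
 proof (intro exI[of _ "\<Sum>r\<in>UNIV. \<Sum>s\<in>UNIV. v r s"] allI impI)
  fix n :: nat and \<theta> :: "('e::{finite,linorder}, 'd) param" assume n: "n >= 1"
  have m: "(%e. (norm (\<Delta> n e))\<^sup>2) \<in> borel_measurable (paths n)"
  proof -
   have "\<Delta> n \<in> borel_measurable (paths n)"
    unfolding \<Delta>_def[abs_def] by (intro borel_measurable_diff borel_measurable_scaleR borel_measurable_sum borel_measurable_const borel_measurable_outer measurable_coord)
   thus ?thesis by measurable
  qed
  have dep: "(norm (\<Delta> n (restrict e {1..n})))\<^sup>2 = (norm (\<Delta> n e))\<^sup>2" for e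
  proof -
   have "(\<Sum>t=1..n. outer (restrict e {1..n} t) (restrict e {1..n} t)) = (\<Sum>t=1..n. outer (e t) (e t))" by (intro sum.cong refl) simp
   thus ?thesis by (simp only: \<Delta>_def)
  qed
  have rc: "resid_cov p q n \<theta> x - innov_cov f = \<Delta> n (resid p q \<theta> x)" for x by (simp add: resid_cov_def \<Delta>_def)
  have i: "integrable \<Omega> (%e. (norm (\<Delta> n e))\<^sup>2)" unfolding nsq using comp[OF n] by simp
  have "\<Omega>.expectation (%e. (norm (\<Delta> n e))\<^sup>2) = (\<Sum>r\<in>UNIV. \<Sum>s\<in>UNIV. v r s) / n"
   unfolding nsq using comp[OF n] by (simp add: sum_divide_distrib)
  thus "integrable (varma_law p q \<theta> f n) (%x. (norm (resid_cov p q n \<theta> x - innov_cov f))\<^sup>2) \<and>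
   (LINT x|varma_law p q \<theta> f n. (norm (resid_cov p q n \<theta> x - innov_cov f))\<^sup>2) <= (\<Sum>r\<in>UNIV. \<Sum>s\<in>UNIV. v r s) / n"
   unfolding rc using integral_resid[OF m dep, of p q \<theta>] i by simp
 qed
qed

end

section \<open>The chi-square limit\<close>

lemma char_limit_perturb:
 fixes X Y :: "nat => 'a => real"
 assumes P: "\<And>n. prob_space (P n)" and m: "\<And>n. X n \<in> borel_measurable (P n)" "\<And>n. Y n \<in> borel_measurable (P n)"
  and diff: "to_zero_in_prob P (%n x. X n x - Y n x)"
  and lim: "(%n. LINT x|P n. iexp (Y n x)) \<longlonglongrightarrow> c"
 shows "(%n. LINT x|P n. iexp (X n x)) \<longlonglongrightarrow> c"
proof -
 have "(%n. (LINT x|P n. iexp (X n x)) - (LINT x|P n. iexp (Y n x))) \<longlonglongrightarrow> 0"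
 proof (rule LIMSEQ_I)
  fix r :: real assume r: "r > 0"
  define A where "A n = {x\<in>space (P n). norm (X n x - Y n x) > r / 4}" for n
  have "(%n. measure (P n) (A n)) \<longlonglongrightarrow> 0" using diff[unfolded to_zero_in_prob_def, rule_format, of "r / 4"] r unfolding A_def by simp
  from LIMSEQ_D[OF this, of "r / 4"] r obtain N where N: "\<And>n. n >= N ==> measure (P n) (A n) < r / 4" by auto
  show "\<exists>no. \<forall>n\<ge>no. norm ((LINT x|P n. iexp (X n x)) - (LINT x|P n. iexp (Y n x)) - 0) < r"
  proof (intro exI allI impI)
   fix n assume n: "n >= N"
   interpret prob_space "P n" by (rule P)
   have [measurable]: "X n \<in> borel_measurable (P n)" "Y n \<in> borel_measurable (P n)" by (fact m)+
   have A: "A n \<in> sets (P n)" unfolding A_def by measurable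
   have i: "integrable (P n) (%x. iexp (X n x))" "integrable (P n) (%x. iexp (Y n x))"
    by (rule integrable_const_bound[where B=1]; simp)+
   have iA: "integrable (P n) (%x. indicator (A n) x :: real)" using A by (simp add: integrable_indicator_iff less_top[symmetric])
   have "norm ((LINT x|P n. iexp (X n x)) - (LINT x|P n. iexp (Y n x))) = norm (LINT x|P n. iexp (X n x) - iexp (Y n x))"
    using i by simp
   also have "... <= (LINT x|P n. norm (iexp (X n x) - iexp (Y n x)))" by (rule integral_norm_bound)
   also have "... <= (LINT x|P n. r / 4 + 2 * indicator (A n) x)"
   proof (rule integral_mono)
    fix x assume x: "x \<in> space (P n)"
    have "norm (iexp (X n x) - iexp (Y n x)) <= 2" using norm_triangle_ineq4[of "iexp (X n x)" "iexp (Y n x)"] by simp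
    moreover have "norm (iexp (X n x) - iexp (Y n x)) <= r / 4" if "x \<notin> A n"
     using prob_space.norm_iexp_diff_le[OF P, of "X n x" "Y n x"] that x by (auto simp: A_def not_less)
    ultimately show "norm (iexp (X n x) - iexp (Y n x)) <= r / 4 + 2 * indicator (A n) x" using r by (auto simp: indicator_def)
   qed (use i iA in auto)
   also have "... = r / 4 + 2 * measure (P n) (A n)" using iA A sets.sets_into_space[OF A] by (simp add: prob_space Int_absorb2)
   finally show "norm ((LINT x|P n. iexp (X n x)) - (LINT x|P n. iexp (Y n x)) - 0) < r" using N[OF n] r by simp
  qed
 qed
 from tendsto_add[OF this lim] show ?thesis by simp
qed

lemma borel_measurable_ccov_resid:
 assumes "T \<in> borel_measurable (sample_space n)"
 shows "(%x. ccov_stat S n i (resid p q (T x) x)) \<in> borel_measurable (varma_law p q' \<theta>' f n)"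
 unfolding measurable_varma_law using borel_measurable_resid_sample[OF assms]
 by (intro borel_measurable_ccov_stat) (auto simp: sets_sample_space)

lemma asymp_linear_ccov_stat:
 assumes "asymp_linear_ccov p q f \<theta>" "i >= 1"
 shows "to_zero_in_prob (varma_law p q \<theta> f) (%n x. ccov_stat (innov_cov f) n i (resid p q (\<theta> + (1 / sqrt (real n)) *\<^sub>R \<tau>) x)
   - ccov_stat (innov_cov f) n i (resid p q \<theta> x) - ccov_var (innov_cov f) *v (transpose (c_mat p q \<theta> i) *v \<tau>))"
 using assms unfolding asymp_linear_ccov_def
 by (simp only: scaleR_diff_right gauss_ccov_resid matrix_vector_mul_assoc)

lemma to_zero_in_prob_sum_inner:
 fixes R :: "'i => nat => 'a => 'b::euclidean_space"
 assumes I: "finite I" and P: "\<And>n. prob_space (P n)" and m: "\<And>i n. i \<in> I ==> R i n \<in> borel_measurable (P n)"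
  and z: "\<And>i. i \<in> I ==> to_zero_in_prob P (R i)"
 shows "to_zero_in_prob P (%n x. \<Sum>i\<in>I. a i \<bullet> R i n x)"
 unfolding to_zero_in_prob_def
proof (intro allI impI)
 fix \<eta> :: real assume \<eta>: "\<eta> > 0"
 define s where "s = 1 + (\<Sum>i\<in>I. norm (a i))"
 have s: "s > 0" unfolding s_def by (intro add_pos_nonneg sum_nonneg) auto
 let ?A = "%i n. {x\<in>space (P n). norm (R i n x) > \<eta> / s}"
 have Am: "?A i n \<in> sets (P n)" if "i \<in> I" for i n
 proof -
  have [measurable]: "R i n \<in> borel_measurable (P n)" by (rule m[OF that])
  show ?thesis by measurable
 qed
 have le: "measure (P n) {x\<in>space (P n). norm (\<Sum>i\<in>I. a i \<bullet> R i n x) > \<eta>} <= (\<Sum>i\<in>I. measure (P n) (?A i n))" for n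
 proof -
  interpret prob_space "P n" by (rule P)
  have "{x\<in>space (P n). norm (\<Sum>i\<in>I. a i \<bullet> R i n x) > \<eta>} \<subseteq> (\<Union>i\<in>I. ?A i n)"
  proof (rule ccontr)
   assume "\<not> {x\<in>space (P n). norm (\<Sum>i\<in>I. a i \<bullet> R i n x) > \<eta>} \<subseteq> (\<Union>i\<in>I. ?A i n)"
   then obtain x where x: "norm (\<Sum>i\<in>I. a i \<bullet> R i n x) > \<eta>" "\<And>i. i \<in> I ==> norm (R i n x) <= \<eta> / s" by force
   have "norm (\<Sum>i\<in>I. a i \<bullet> R i n x) <= (\<Sum>i\<in>I. norm (a i) * (\<eta> / s))"
    by (intro order_trans[OF norm_sum] sum_mono order_trans[OF Cauchy_Schwarz_ineq2[folded real_norm_def]] mult_left_mono x) auto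
   also have "... = (s - 1) * (\<eta> / s)" by (simp only: s_def sum_distrib_right[symmetric]) simp
   also have "... <= s * (\<eta> / s)" using \<eta> s by (intro mult_right_mono) auto
   finally show False using x(1) s by simp
  qed
  hence "measure (P n) {x\<in>space (P n). norm (\<Sum>i\<in>I. a i \<bullet> R i n x) > \<eta>} <= measure (P n) (\<Union>i\<in>I. ?A i n)"
   using I Am by (intro finite_measure_mono) auto
  also have "... <= (\<Sum>i\<in>I. measure (P n) (?A i n))" using I Am by (intro finite_measure_subadditive_finite) auto
  finally show ?thesis .
 qed
 have "(%n. \<Sum>i\<in>I. measure (P n) (?A i n)) \<longlonglongrightarrow> (\<Sum>i\<in>I. 0)"
  using z \<eta> s unfolding to_zero_in_prob_def by (intro tendsto_sum) auto
 hence "(%n. \<Sum>i\<in>I. measure (P n) (?A i n)) \<longlonglongrightarrow> 0" by simp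
 thus "(%n. measure (P n) {x\<in>space (P n). norm (\<Sum>i\<in>I. a i \<bullet> R i n x) > \<eta>}) \<longlonglongrightarrow> 0"
  by (rule tendsto_sandwich[OF _ _ tendsto_const, rotated 2]) (use le in \<open>auto simp: always_eventually\<close>)
qed

text \<open>
 This is contiguity in the form in which it is used below.
\<close>

lemma to_zero_in_prob_local_alternative:
 assumes f: "f \<in> density_class" and \<theta>: "\<theta> \<in> varma_params p q"
  and m4: "integrable (innov f) (%e. outer (vecm (outer e e)) (vecm (outer e e)))"
  and m: "\<And>n. Y n \<in> borel_measurable (varma_law p q \<theta> f n)"
  and z: "to_zero_in_prob (varma_law p q \<theta> f) Y"
 shows "to_zero_in_prob (%n. varma_law p q (\<theta> + (1 / sqrt (real n)) *\<^sub>R \<tau>) f n) (Y :: nat => _ => 'b::euclidean_space)"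
 unfolding to_zero_in_prob_def
proof (intro allI impI)
 fix \<eta> :: real assume \<eta>: "\<eta> > 0"
 let ?P = "varma_law p q \<theta> f" let ?Q = "%n. varma_law p q (\<theta> + (1 / sqrt (real n)) *\<^sub>R \<tau>) f n"
 define A where "A n = {x\<in>space (?P n). norm (Y n x) > \<eta>}" for n
 have A: "A n \<in> sets (?P n)" for n
 proof -
  have [measurable]: "Y n \<in> borel_measurable (?P n)" by (rule m)
  show ?thesis unfolding A_def by measurable
 qed
 have z0: "(%n. measure (?P n) (A n)) \<longlonglongrightarrow> 0" using z \<eta> by (auto simp: to_zero_in_prob_def A_def)
 have "(%n. measure (?Q n) (A n)) \<longlonglongrightarrow> 0"
 proof (rule LIMSEQ_I)
  fix r :: real assume r: "r > 0"
  hence r2: "r / 2 > 0" by simp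
  obtain K N where K: "K >= 0" "\<And>n A. n >= N ==> A \<in> sets (paths n) ==> measure (?Q n) A <= K * measure (?P n) A + r / 2"
   using varma_shift_contiguity[OF f \<theta> m4 r2, of \<tau>] by blast
  have "(%n. K * measure (?P n) (A n)) \<longlonglongrightarrow> 0" using tendsto_mult_left[OF z0, of K] by simp
  from LIMSEQ_D[OF this r2] obtain N2 where N2: "\<And>n. n >= N2 ==> \<bar>K * measure (?P n) (A n)\<bar> < r / 2" by auto
  show "\<exists>no. \<forall>n\<ge>no. norm (measure (?Q n) (A n) - 0) < r"
  proof (intro exI[of _ "max N N2"] allI impI)
   fix n assume n: "n >= max N N2"
   have "A n \<in> sets (paths n)" using A[of n] by simp
   from K(2)[OF _ this] N2[of n] n show "norm (measure (?Q n) (A n) - 0) < r" by auto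
  qed
 qed
 thus "(%n. measure (?Q n) {x\<in>space (?Q n). norm (Y n x) > \<eta>}) \<longlonglongrightarrow> 0" by (simp add: A_def space_varma_law)
qed

text \<open>
 Under the alternative the limit is known for cross-covariances at the alternative, where the residuals are the noise.
 Passing to \<open>\<theta>\<close> adds \<open>V c\<^sub>i' \<tau>\<close> up to a remainder that is negligible under
 \<open>\<theta>\<close> by hypothesis and hence under the alternative by contiguity; and the projected form does not
 see this shift.
\<close>

theorem oracle_portmanteau_chi_square:
 fixes \<theta> \<tau> :: "('l::{finite,linorder}, 'd::finite) param"
 assumes pq: "p + q = CARD('l)" and \<theta>: "\<theta> \<in> varma_params p q" and f: "f \<in> density_class"
  and lin: "asymp_linear_ccov p q f \<theta>"
  and m4: "integrable (innov f) (%e. outer (vecm (outer e e)) (vecm (outer e e)))"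
  and m: "m > p + q" and inv: "invertible (c_gram p q (innov_cov f) m \<theta>)"
 shows "weak_conv_m (%n. distr (varma_law p q (\<theta> + (1 / sqrt (real n)) *\<^sub>R \<tau>) f n) borel (oracle_portmanteau p q (innov_cov f) m n \<theta>))
  (chi_square (CARD('d)^2 * (m - p - q)))"
proof -
 define S where "S = innov_cov f"
 define V where "V = ccov_var S"
 define c where "c = c_mat p q \<theta>"
 define \<theta>n where "\<theta>n n = \<theta> + (1 / sqrt (real n)) *\<^sub>R \<tau>" for n :: nat
 define P where "P n = varma_law p q (\<theta>n n) f n" for n
 define W where "W n \<theta>' x i = ccov_stat S n i (resid p q \<theta>' x)" for n and \<theta>' :: "('l, 'd) param" and x i
 have Pp: "prob_space (P n)" for n unfolding P_def by (rule prob_space_varma_law[OF f])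
 have V: "pos_def V" unfolding V_def S_def by (rule pos_def_ccov_var[OF f])
 have inv': "invertible (\<Sum>j=1..m. c j ** V ** transpose (c j))" using inv by (simp add: c_gram_def c_def V_def S_def)
 obtain K :: nat and u where dec: "\<And>w. projected_form V c m w = (\<Sum>k<K. (\<Sum>i=1..m. u k i \<bullet> w i)\<^sup>2)"
  "\<And>k l. k < K ==> l < K ==> (\<Sum>i=1..m. u k i \<bullet> (V *v u l i)) = (if k = l then 1 else 0)"
  "real K = real m * real CARD('d \<times> 'd) - real CARD('l \<times> 'd \<times> 'd)"
 proof (rule projected_form_decomposition[OF V inv'])
  fix K :: nat and u :: "nat => nat => real^('d \<times> 'd)"
  assume "\<And>w. projected_form V c m w = (\<Sum>k<K. (\<Sum>i=1..m. u k i \<bullet> w i)\<^sup>2)"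
   "\<And>k l. k < K ==> l < K ==> (\<Sum>i=1..m. u k i \<bullet> (V *v u l i)) = (if k = l then 1 else 0)"
   "real K = real m * real CARD('d \<times> 'd) - real CARD('l \<times> 'd \<times> 'd)"
  then show thesis by (rule that)
 qed
 have "real (m - p - q) = real m - real (p + q)" using m by linarith
 hence "real K = real (CARD('d)^2 * (m - p - q))"
  unfolding dec(3) by (simp only: of_nat_mult of_nat_power pq card_prod) (simp add: power2_eq_square left_diff_distrib right_diff_distrib mult_ac)
 hence Keq: "K = CARD('d)^2 * (m - p - q)" by (simp only: of_nat_eq_iff)
 have kill: "(\<Sum>i=1..m. u k i \<bullet> (V *v (transpose (c i) *v \<tau>))) = 0" if "k < K" for k
 proof -
  have "(\<Sum>k<K. (\<Sum>i=1..m. u k i \<bullet> (V *v (transpose (c i) *v \<tau>)))\<^sup>2) = 0"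
   using projected_form_residual(2)[OF V inv', of \<tau>] dec(1) by simp
  hence "\<forall>k\<in>{..<K}. (\<Sum>i=1..m. u k i \<bullet> (V *v (transpose (c i) *v \<tau>)))\<^sup>2 = 0"
   by (subst (asm) sum_nonneg_eq_0_iff) auto
  thus ?thesis using that by simp
 qed
 have Wm: "(%x. W n \<theta>' x i) \<in> borel_measurable (varma_law p q \<theta>'' f n)" for n \<theta>' i and \<theta>'' :: "('l, 'd) param"
  unfolding W_def by (rule borel_measurable_ccov_resid) simp
 define y where "y n x k = (\<Sum>i=1..m. u k i \<bullet> W n \<theta> x i)" for n x k
 have ym: "(%x. y n x k) \<in> borel_measurable (P n)" for n k
  unfolding y_def P_def by (intro borel_measurable_sum borel_measurable_inner borel_measurable_const Wm)
 have char: "(%n. LINT x|P n. iexp (\<Sum>k<K. z k * y n x k)) \<longlonglongrightarrow> complex_of_real (exp (- (\<Sum>k<K. (z k)\<^sup>2) / 2))" for z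
 proof -
  define a where "a i = (\<Sum>k<K. z k *\<^sub>R u k i)" for i
  have ay: "(\<Sum>k<K. z k * (\<Sum>i=1..m. u k i \<bullet> w i)) = (\<Sum>i=1..m. a i \<bullet> w i)" for w
  proof -
   have "(\<Sum>k<K. z k * (\<Sum>i=1..m. u k i \<bullet> w i)) = (\<Sum>k<K. \<Sum>i=1..m. z k * (u k i \<bullet> w i))" by (simp add: sum_distrib_left)
   also have "... = (\<Sum>i=1..m. \<Sum>k<K. z k * (u k i \<bullet> w i))" by (rule sum.swap)
   finally show ?thesis by (simp add: a_def inner_sum_left)
  qed
  have "(\<Sum>i=1..m. a i \<bullet> (V *v a i)) = (\<Sum>k<K. z k * (\<Sum>i=1..m. u k i \<bullet> (V *v a i)))" by (rule ay[symmetric])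
  also have "... = (\<Sum>k<K. z k * (\<Sum>l<K. z l * (\<Sum>i=1..m. u k i \<bullet> (V *v u l i))))"
  proof (intro sum.cong[OF refl])
   fix k
   have "(\<Sum>i=1..m. u k i \<bullet> (V *v a i)) = (\<Sum>i=1..m. \<Sum>l<K. z l * (u k i \<bullet> (V *v u l i)))"
    by (simp add: a_def matrix_vector_mult_sum_right inner_sum_right matrix_vector_mult_scaleR)
   also have "... = (\<Sum>l<K. \<Sum>i=1..m. z l * (u k i \<bullet> (V *v u l i)))" by (rule sum.swap)
   finally show "z k * (\<Sum>i=1..m. u k i \<bullet> (V *v a i)) = z k * (\<Sum>l<K. z l * (\<Sum>i=1..m. u k i \<bullet> (V *v u l i)))"
    by (simp add: sum_distrib_left)
  qed
  also have "... = (\<Sum>k<K. z k * (\<Sum>l<K. if k = l then z l else 0))"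
   by (intro sum.cong[OF refl] arg_cong2[where f="(*)"]) (auto simp: dec(2)[simplified])
  also have "... = (\<Sum>k<K. (z k)\<^sup>2)" by (simp add: power2_eq_square)
  finally have aV: "(\<Sum>i=1..m. a i \<bullet> (V *v a i)) = (\<Sum>k<K. (z k)\<^sup>2)" .
  define R where "R i n x = W n (\<theta>n n) x i - W n \<theta> x i - V *v (transpose (c i) *v \<tau>)" for i n x
  have Rm: "R i n \<in> borel_measurable (varma_law p q \<theta>' f n)" for i n and \<theta>' :: "('l, 'd) param"
   unfolding R_def by (intro borel_measurable_diff Wm borel_measurable_const)
  have "to_zero_in_prob (varma_law p q \<theta> f) (%n x. \<Sum>i=1..m. (- a i) \<bullet> R i n x)"
  proof (rule to_zero_in_prob_sum_inner[OF finite_atLeastAtMost prob_space_varma_law[OF f] Rm])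
   show "to_zero_in_prob (varma_law p q \<theta> f) (R i)" if "i \<in> {1..m}" for i
    using asymp_linear_ccov_stat[OF lin, of i \<tau>] that unfolding R_def[abs_def] W_def S_def c_def V_def \<theta>n_def by auto
  qed
  hence z0: "to_zero_in_prob P (%n x. \<Sum>i=1..m. (- a i) \<bullet> R i n x)"
   unfolding P_def \<theta>n_def
   by (rule to_zero_in_prob_local_alternative[OF f \<theta> m4, rotated])
    (intro borel_measurable_sum borel_measurable_inner borel_measurable_const Rm)
  have aVc: "(\<Sum>i=1..m. a i \<bullet> (V *v (transpose (c i) *v \<tau>))) = 0"
   unfolding ay[symmetric] using kill by simp
  have eq: "(\<Sum>i=1..m. (- a i) \<bullet> R i n x) = (\<Sum>i=1..m. a i \<bullet> W n \<theta> x i) - (\<Sum>i=1..m. a i \<bullet> W n (\<theta>n n) x i)" for n x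
   using aVc by (simp add: R_def inner_diff_right sum_subtractf sum.distrib sum_negf del: transpose_matrix_vector)
  have "(%n. LINT x|P n. iexp (\<Sum>i=1..m. a i \<bullet> W n \<theta> x i)) \<longlonglongrightarrow> complex_of_real (exp (- (\<Sum>i=1..m. a i \<bullet> (V *v a i)) / 2))"
  proof (rule char_limit_perturb[OF Pp])
   show "to_zero_in_prob P (%n x. (\<Sum>i=1..m. a i \<bullet> W n \<theta> x i) - (\<Sum>i=1..m. a i \<bullet> W n (\<theta>n n) x i))" using z0 unfolding eq .
   show "(%n. LINT x|P n. iexp (\<Sum>i=1..m. a i \<bullet> W n (\<theta>n n) x i)) \<longlonglongrightarrow> complex_of_real (exp (- (\<Sum>i=1..m. a i \<bullet> (V *v a i)) / 2))"
    unfolding P_def W_def V_def S_def by (rule ccov_stat_characteristic_limit[OF f])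
  qed (unfold P_def, (intro borel_measurable_sum borel_measurable_inner borel_measurable_const Wm)+)
  thus ?thesis unfolding y_def ay aV .
 qed
 define Q where "Q n = oracle_portmanteau p q S m n \<theta>" for n
 have Q: "Q n x = (\<Sum>k<K. (y n x k)\<^sup>2)" if "n > m" for n x
  unfolding Q_def y_def oracle_portmanteau_resid[OF that V[unfolded V_def] inv[folded S_def]] V_def[symmetric] c_def[symmetric] dec(1) W_def ..
 define \<mu> where "\<mu> n = (if n > m then distr (P n) borel (Q n) else chi_square K)" for n
 have Qm: "Q n \<in> borel_measurable (P n)" if "n > m" for n
  unfolding Q[OF that] by (intro borel_measurable_sum borel_measurable_power ym)
 have "weak_conv_m \<mu> (chi_square K)"
 proof (rule laplace_imp_weak_conv)
  show "real_distribution (chi_square K)" "AE x in chi_square K. x >= 0" by (rule real_distribution_chi_square)+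
  show "real_distribution (\<mu> n)" for n
  proof (cases "n > m")
   case True
   interpret prob_space "P n" by (rule Pp)
   show ?thesis unfolding \<mu>_def using True Qm by (simp add: real_distribution_distr)
  qed (simp add: \<mu>_def real_distribution_chi_square)
  show "AE x in \<mu> n. x >= 0" for n
  proof (cases "n > m")
   case True
   thus ?thesis unfolding \<mu>_def using Qm by (simp add: AE_distr_iff Q sum_nonneg)
  next
   case False
   hence "\<mu> n = chi_square K" by (simp add: \<mu>_def)
   thus ?thesis using real_distribution_chi_square(2)[of K] by (simp only:)
  qed
  fix j :: nat
  have "(%n. LINT x|P n. exp (- (real j * (\<Sum>k<K. (y n x k)\<^sup>2)))) \<longlonglongrightarrow> (LINT x|chi_square K. exp (- (real j * x)))"
   by (rule laplace_of_asymptotically_gaussian[OF Pp ym char]) auto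
  moreover have "\<forall>\<^sub>F n in sequentially. (LINT x|P n. exp (- (real j * (\<Sum>k<K. (y n x k)\<^sup>2)))) = (LINT x|\<mu> n. exp (- (real j * x)))"
   using eventually_gt_at_top[of m]
  proof eventually_elim
   case (elim n)
   thus ?case unfolding \<mu>_def using Qm[OF elim] by (simp add: integral_distr Q)
  qed
  ultimately show "(%n. LINT x|\<mu> n. exp (- (real j * x))) \<longlonglongrightarrow> (LINT x|chi_square K. exp (- (real j * x)))"
   by (rule Lim_transform_eventually)
 qed
 moreover have "\<forall>\<^sub>F n in sequentially. \<mu> n = distr (P n) borel (Q n)"
  using eventually_gt_at_top[of m] by eventually_elim (simp add: \<mu>_def)
 ultimately have "weak_conv_m (%n. distr (P n) borel (Q n)) (chi_square K)"
  unfolding weak_conv_m_def weak_conv_def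
  by (auto elim!: Lim_transform_eventually eventually_mono)
 thus ?thesis unfolding P_def Q_def \<theta>n_def S_def Keq .
qed

section \<open>Deterministic comparison of the two statistics\<close>

lemma lagged_outer_lipschitz:
 fixes a b :: "nat => real^'d"
 assumes a: "ssq 2 n a <= A" and b: "ssq 2 n b <= A" and d: "ssq 2 n (%t. a t - b t) <= \<delta>\<^sup>2 * A" and \<delta>: "\<delta> >= 0"
 shows "norm ((\<Sum>t=i+1..n. outer (a t) (a (t - i))) - (\<Sum>t=i+1..n. outer (b t) (b (t - i)))) <= 2 * \<delta> * A"
proof -
 have A0: "A >= 0" using a ssq_nonneg[of 2 n a] by linarith
 have sub: "(\<Sum>t=i+1..n. (norm (u (t - i)))\<^sup>2) <= ssq 2 n u" "(\<Sum>t=i+1..n. (norm (u t))\<^sup>2) <= ssq 2 n u" for u :: "nat => real^'d"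
 proof -
  have "(\<Sum>t=i+1..n. (norm (u (t - i)))\<^sup>2) = (\<Sum>t\<in>(%t. t - i) ` {i+1..n}. (norm (u t))\<^sup>2)"
   by (subst sum.reindex) (auto simp: inj_on_def)
  also have "... <= ssq 2 n u" unfolding ssq_def by (rule sum_mono2) auto
  finally show "(\<Sum>t=i+1..n. (norm (u (t - i)))\<^sup>2) <= ssq 2 n u" .
  show "(\<Sum>t=i+1..n. (norm (u t))\<^sup>2) <= ssq 2 n u" unfolding ssq_def by (rule sum_mono2) auto
 qed
 have cs: "(\<Sum>t=i+1..n. norm (u t) * norm (v (t - i))) <= \<delta> * A"
  if "ssq 2 n u * ssq 2 n v <= (\<delta> * A)\<^sup>2" for u v :: "nat => real^'d"
 proof (rule power2_le_imp_le)
  have "(\<Sum>t=i+1..n. norm (u t) * norm (v (t - i)))\<^sup>2 <= (\<Sum>t=i+1..n. (norm (u t))\<^sup>2) * (\<Sum>t=i+1..n. (norm (v (t - i)))\<^sup>2)"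
   by (rule Cauchy_Schwarz_ineq_sum)
  also have "... <= ssq 2 n u * ssq 2 n v" by (intro mult_mono sub sum_nonneg ssq_nonneg) auto
  finally show "(\<Sum>t=i+1..n. norm (u t) * norm (v (t - i)))\<^sup>2 <= (\<delta> * A)\<^sup>2" using that by linarith
 qed (use \<delta> A0 in simp)
 have eq: "outer (a t) (a (t - i)) - outer (b t) (b (t - i)) = outer (a t - b t) (a (t - i)) + outer (b t) (a (t - i) - b (t - i))" for t
  by (simp add: bounded_bilinear.diff_left[OF bounded_bilinear_outer] bounded_bilinear.diff_right[OF bounded_bilinear_outer])
 have "norm ((\<Sum>t=i+1..n. outer (a t) (a (t - i))) - (\<Sum>t=i+1..n. outer (b t) (b (t - i))))
  <= (\<Sum>t=i+1..n. norm (outer (a t - b t) (a (t - i)) + outer (b t) (a (t - i) - b (t - i))))"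
  unfolding sum_subtractf[symmetric] eq by (rule norm_sum)
 also have "... <= (\<Sum>t=i+1..n. norm (a t - b t) * norm (a (t - i)) + norm (b t) * norm (a (t - i) - b (t - i)))"
  by (intro sum_mono order_trans[OF norm_triangle_ineq]) simp
 also have "... = (\<Sum>t=i+1..n. norm (a t - b t) * norm (a (t - i))) + (\<Sum>t=i+1..n. norm (b t) * norm (a (t - i) - b (t - i)))"
  by (rule sum.distrib)
 also have "... <= \<delta> * A + \<delta> * A"
 proof (rule add_mono)
  have "ssq 2 n (%t. a t - b t) * ssq 2 n a <= (\<delta>\<^sup>2 * A) * A" using d a A0 by (intro mult_mono ssq_nonneg) auto
  thus "(\<Sum>t=i+1..n. norm (a t - b t) * norm (a (t - i))) <= \<delta> * A"
   by (intro cs) (simp add: power2_eq_square mult_ac)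
  have "ssq 2 n b * ssq 2 n (%t. a t - b t) <= A * (\<delta>\<^sup>2 * A)" using d b A0 by (intro mult_mono ssq_nonneg) auto
  thus "(\<Sum>t=i+1..n. norm (b t) * norm (a (t - i) - b (t - i))) <= \<delta> * A"
   by (intro cs[where v="%t. a t - b t"]) (simp add: power2_eq_square mult_ac)
 qed
 finally show ?thesis by linarith
qed

lemma ccov_stat_lipschitz:
 fixes a b :: "nat => real^'d"
 assumes "ssq 2 n a <= A" "ssq 2 n b <= A" "ssq 2 n (%t. a t - b t) <= \<delta>\<^sup>2 * A" "\<delta> >= 0" and i: "i < n"
 shows "norm (ccov_stat S n i a - ccov_stat S n i b) <= norm (matrix_inv S) * (2 * \<delta> * A) / sqrt (real n - real i)"
proof -
 let ?D = "(\<Sum>t=i+1..n. outer (a t) (a (t - i))) - (\<Sum>t=i+1..n. outer (b t) (b (t - i)))"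
 let ?k = "real n - real i"
 have k: "?k > 0" using i by simp
 have "ccov_stat S n i a - ccov_stat S n i b = (sqrt ?k * (- 1 / ?k)) *\<^sub>R vecm (matrix_inv S ** ?D)"
  unfolding ccov_stat_def linear_scale[OF linear_vecm] scaleR_scaleR
  by (simp add: bounded_bilinear.diff_right[OF bounded_bilinear_matrix_matrix_mult] linear_diff[OF linear_vecm] scaleR_diff_right)
 moreover have "\<bar>sqrt ?k * (- 1 / ?k)\<bar> = 1 / sqrt ?k" using k real_div_sqrt[of ?k] by (simp add: abs_mult field_simps)
 ultimately have "norm (ccov_stat S n i a - ccov_stat S n i b) = norm (matrix_inv S ** ?D) / sqrt ?k"
  by (simp only: norm_scaleR norm_vecm) simp
 also have "... <= (norm (matrix_inv S) * (2 * \<delta> * A)) / sqrt ?k"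
  using lagged_outer_lipschitz[OF assms(1-4), of i] k
  by (intro divide_right_mono order_trans[OF norm_matrix_matrix_mult_le] mult_left_mono) auto
 finally show ?thesis .
qed

lemma resid_cov_lipschitz:
 assumes "ssq 2 n (resid p q \<theta>1 x) <= A" "ssq 2 n (resid p q \<theta>2 x) <= A"
  "ssq 2 n (%t. resid p q \<theta>1 x t - resid p q \<theta>2 x t) <= \<delta>\<^sup>2 * A" "\<delta> >= 0"
 shows "norm (resid_cov p q n \<theta>1 x - resid_cov p q n \<theta>2 x) <= 2 * \<delta> * A / n"
proof -
 have "resid_cov p q n \<theta>1 x - resid_cov p q n \<theta>2 x = (1 / real n) *\<^sub>R
  ((\<Sum>t=0+1..n. outer (resid p q \<theta>1 x t) (resid p q \<theta>1 x (t - 0))) - (\<Sum>t=0+1..n. outer (resid p q \<theta>2 x t) (resid p q \<theta>2 x (t - 0))))"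
  by (simp add: resid_cov_def scaleR_diff_right)
 thus ?thesis using lagged_outer_lipschitz[OF assms, of 0] by (simp add: divide_right_mono)
qed

lemma ssq_le_resid_cov:
 fixes \<theta> :: "('l::{finite,linorder}, 'd::finite) param"
 shows "ssq 2 n (resid p q \<theta> x) <= real n * (real CARD('d) * norm (resid_cov p q n \<theta> x))"
proof (cases "n = 0")
 case False
 let ?e = "resid p q \<theta> x"
 have "ssq 2 n ?e = (\<Sum>t=1..n. \<Sum>r\<in>UNIV. (?e t $ r)\<^sup>2)" unfolding ssq_def norm_vec_sq by simp
 also have "... = (\<Sum>r\<in>UNIV. \<Sum>t=1..n. (?e t $ r)\<^sup>2)" by (rule sum.swap)
 also have "... = (\<Sum>r\<in>UNIV. real n * resid_cov p q n \<theta> x $ r $ r)"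
  using False by (simp add: resid_cov_def outer_def sum_component power2_eq_square)
 also have "... <= (\<Sum>r\<in>(UNIV::'d set). real n * norm (resid_cov p q n \<theta> x))"
 proof (intro sum_mono mult_left_mono)
  fix r :: 'd
  have "\<bar>resid_cov p q n \<theta> x $ r $ r\<bar> <= norm (resid_cov p q n \<theta> x $ r)" by (rule component_le_norm_cart)
  also have "... <= norm (resid_cov p q n \<theta> x)" by (rule Finite_Cartesian_Product.norm_nth_le)
  finally show "resid_cov p q n \<theta> x $ r $ r <= norm (resid_cov p q n \<theta> x)" by simp
 qed auto
 finally show ?thesis by (simp add: mult_ac)
qed (simp add: ssq_def)

lemma projected_form_cong:
 "(\<And>i. i \<in> {1..m} ==> w i = w' i) ==> projected_form V c m w = projected_form V c m w'"
 unfolding projected_form_def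
 by (intro arg_cong2[where f="(-)"] arg_cong2[where f="(\<bullet>)"] arg_cong2[where f="(*v)"] refl sum.cong[OF refl]) auto

lemma projected_form_shift_continuous:
 fixes V :: "real^'v^'v" and c :: "nat => real^'v^'r"
 assumes V: "pos_def V" and inv: "invertible (\<Sum>j=1..m. c j ** V ** transpose (c j))" and \<epsilon>: "\<epsilon> > 0"
 shows "\<exists>\<eta>>0. \<forall>w r \<sigma>. (\<forall>i\<in>{1..m}. norm (w i) <= D \<and> norm (r i) <= \<eta>) \<longrightarrow>
  \<bar>projected_form V c m (%i. w i + V *v (transpose (c i) *v \<sigma>) + r i) - projected_form V c m w\<bar> <= \<epsilon>"
proof (rule projected_form_decomposition[OF V inv])
 fix K :: nat and u :: "nat => nat => real^'v"
 assume dec: "\<And>w. projected_form V c m w = (\<Sum>k<K. (\<Sum>i=1..m. u k i \<bullet> w i)\<^sup>2)"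
 have kill: "(\<Sum>i=1..m. u k i \<bullet> (V *v (transpose (c i) *v \<sigma>))) = 0" if "k < K" for k \<sigma>
 proof -
  have "(\<Sum>k<K. (\<Sum>i=1..m. u k i \<bullet> (V *v (transpose (c i) *v \<sigma>)))\<^sup>2) = 0"
   using projected_form_residual(2)[OF V inv, of \<sigma>] dec by simp
  hence "\<forall>k\<in>{..<K}. (\<Sum>i=1..m. u k i \<bullet> (V *v (transpose (c i) *v \<sigma>)))\<^sup>2 = 0"
   by (subst (asm) sum_nonneg_eq_0_iff) auto
  thus ?thesis using that by simp
 qed
 define U where "U = 1 + (\<Sum>k<K. \<Sum>i=1..m. norm (u k i))"
 have U1: "U >= 1" unfolding U_def by (simp add: sum_nonneg)
 have bd: "\<bar>\<Sum>i=1..m. u k i \<bullet> w i\<bar> <= U * B" if k: "k < K" and w: "\<And>i. i \<in> {1..m} ==> norm (w i) <= B" and B: "B >= 0" for k w B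
 proof -
  have "\<bar>\<Sum>i=1..m. u k i \<bullet> w i\<bar> <= (\<Sum>i=1..m. norm (u k i) * B)"
   by (intro order_trans[OF sum_abs] sum_mono order_trans[OF Cauchy_Schwarz_ineq2] mult_left_mono w) auto
  also have "... = (\<Sum>i=1..m. norm (u k i)) * B" by (simp add: sum_distrib_right)
  also have "(\<Sum>i=1..m. norm (u k i)) <= (\<Sum>k<K. \<Sum>i=1..m. norm (u k i))"
   using k by (intro member_le_sum[of k "{..<K}" "%k. \<Sum>i=1..m. norm (u k i)"]) (auto intro: sum_nonneg)
  finally show ?thesis using B by (simp add: U_def mult_right_mono distrib_right)
 qed
 define E where "E = max D 0"
 define \<eta> where "\<eta> = min 1 (\<epsilon> / (real K * (U * (2 * U * E + U)) + 1))"
 have den: "real K * (U * (2 * U * E + U)) + 1 > 0" using U1 by (intro add_nonneg_pos mult_nonneg_nonneg) (auto simp: E_def)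
 have \<eta>: "\<eta> > 0" "\<eta> <= 1" using \<epsilon> den by (auto simp: \<eta>_def)
 show ?thesis
 proof (intro exI[of _ \<eta>] conjI \<eta> allI impI)
  fix w r :: "nat => real^'v" and \<sigma>
  assume wr: "\<forall>i\<in>{1..m}. norm (w i) <= D \<and> norm (r i) <= \<eta>"
  let ?y = "%k. \<Sum>i=1..m. u k i \<bullet> w i" let ?s = "%k. \<Sum>i=1..m. u k i \<bullet> r i"
  have y: "\<bar>?y k\<bar> <= U * E" and s: "\<bar>?s k\<bar> <= U * \<eta>" if "k < K" for k
   using bd[OF that, of w E] bd[OF that, of r \<eta>] wr \<eta> by (auto simp: E_def le_max_iff_disj)
  have "projected_form V c m (%i. w i + V *v (transpose (c i) *v \<sigma>) + r i) = (\<Sum>k<K. (?y k + ?s k)\<^sup>2)"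
   unfolding dec using kill by (intro sum.cong[OF refl]) (simp add: inner_add_right sum.distrib del: transpose_matrix_vector)
  hence "projected_form V c m (%i. w i + V *v (transpose (c i) *v \<sigma>) + r i) - projected_form V c m w = (\<Sum>k<K. ?s k * (2 * ?y k + ?s k))"
   unfolding dec[of w] by (simp add: sum_subtractf[symmetric] power2_eq_square algebra_simps)
  also have "\<bar>...\<bar> <= (\<Sum>k<K. (U * \<eta>) * (2 * U * E + U))"
  proof (intro order_trans[OF sum_abs] sum_mono)
   fix k assume "k \<in> {..<K}"
   hence k: "k < K" by simp
   have U\<eta>: "U * \<eta> <= U" using mult_left_mono[OF \<eta>(2), of U] U1 by simp
   have "\<bar>?s k\<bar> <= U * \<eta>" by (rule s[OF k])
   moreover have "\<bar>2 * ?y k + ?s k\<bar> <= 2 * U * E + U"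
    using y[OF k] s[OF k] U\<eta> by linarith
   ultimately show "\<bar>?s k * (2 * ?y k + ?s k)\<bar> <= (U * \<eta>) * (2 * U * E + U)"
    unfolding abs_mult using U1 \<eta> by (intro mult_mono) auto
  qed
  also have "... = \<eta> * (real K * (U * (2 * U * E + U)))" by simp
  also have "... <= \<eta> * (real K * (U * (2 * U * E + U)) + 1)" using \<eta> by (intro mult_left_mono) auto
  also have "... <= (\<epsilon> / (real K * (U * (2 * U * E + U)) + 1)) * (real K * (U * (2 * U * E + U)) + 1)" using den by (intro mult_right_mono) (auto simp: \<eta>_def)
  also have "... = \<epsilon>" using den by (metis less_irrefl nonzero_eq_divide_eq)
  finally show "\<bar>projected_form V c m (%i. w i + V *v (transpose (c i) *v \<sigma>) + r i) - projected_form V c m w\<bar> <= \<epsilon>" .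
 qed
qed

lemma coercive_inverse_bound:
 fixes C :: "real^'r^'r"
 assumes coer: "\<And>\<tau>. \<tau> \<bullet> (C *v \<tau>) >= \<kappa> * (norm \<tau>)\<^sup>2" and \<kappa>: "\<kappa> > 0"
 shows "invertible C" "\<bar>g \<bullet> (matrix_inv C *v g)\<bar> <= (norm g)\<^sup>2 / \<kappa>"
proof -
 show inv: "invertible C"
 proof -
  have "C *v \<tau> = 0 ==> \<tau> = 0" for \<tau> using coer[of \<tau>] \<kappa> by (auto simp: mult_le_0_iff)
  thus ?thesis by (metis invertible_left_inverse matrix_left_invertible_ker)
 qed
 let ?h = "matrix_inv C *v g"
 have Ch: "C *v ?h = g" using matrix_inv(1)[OF inv] by (simp add: matrix_vector_mul_assoc)
 have "\<kappa> * (norm ?h)\<^sup>2 <= norm ?h * norm g"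
  using coer[of ?h] Cauchy_Schwarz_ineq2[of ?h g] unfolding Ch by linarith
 hence h: "norm ?h <= norm g / \<kappa>" using \<kappa> by (cases "norm ?h = 0") (auto simp: power2_eq_square field_simps)
 have "\<bar>g \<bullet> ?h\<bar> <= norm g * norm ?h" by (rule Cauchy_Schwarz_ineq2)
 also have "... <= norm g * (norm g / \<kappa>)" by (intro mult_left_mono h) auto
 finally show "\<bar>g \<bullet> ?h\<bar> <= (norm g)\<^sup>2 / \<kappa>" by (simp add: power2_eq_square)
qed

text \<open>
 Without the correction the form differs from the projected one by the square of \<open>g = \<Sum>c\<^sub>j
 v\<^sub>j\<close> in the metric of the inverse Gram matrix.
\<close>

lemma quadratic_close_to_projected_form:
 fixes V U :: "real^'v^'v" and c :: "nat => real^'v^'r" and v :: "nat => real^'v"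
 assumes coer: "\<And>\<tau>. \<tau> \<bullet> ((\<Sum>j=1..m. c j ** V ** transpose (c j)) *v \<tau>) >= \<kappa> * (norm \<tau>)\<^sup>2" and \<kappa>: "\<kappa> > 0"
  and v: "\<And>i. i \<in> {1..m} ==> norm (v i) <= D" and U: "norm (U - matrix_inv V) <= e"
  and g: "norm (\<Sum>j=1..m. c j *v v j) <= b"
 shows "\<bar>(\<Sum>i=1..m. v i \<bullet> (U *v v i)) - projected_form V c m v\<bar> <= real m * D\<^sup>2 * e + b\<^sup>2 / \<kappa>"
proof -
 let ?g = "\<Sum>j=1..m. c j *v v j"
 have b: "b >= 0" using g norm_ge_zero order_trans by blast
 have "(\<Sum>i=1..m. v i \<bullet> (U *v v i)) - projected_form V c m v
  = (\<Sum>i=1..m. v i \<bullet> ((U - matrix_inv V) *v v i)) + ?g \<bullet> (matrix_inv (\<Sum>j=1..m. c j ** V ** transpose (c j)) *v ?g)"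
  unfolding projected_form_def by (simp add: matrix_vector_mult_diff_rdistrib inner_diff_right sum_subtractf)
 moreover have "\<bar>\<Sum>i=1..m. v i \<bullet> ((U - matrix_inv V) *v v i)\<bar> <= (\<Sum>i=1..m. D * (e * D))"
 proof (intro order_trans[OF sum_abs] sum_mono)
  fix i assume i: "i \<in> {1..m}"
  have D: "D >= 0" using v[OF i] norm_ge_zero order_trans by blast
  have e: "e >= 0" using U norm_ge_zero order_trans by blast
  have "\<bar>v i \<bullet> ((U - matrix_inv V) *v v i)\<bar> <= norm (v i) * (norm (U - matrix_inv V) * norm (v i))"
   by (intro order_trans[OF Cauchy_Schwarz_ineq2] mult_left_mono norm_matrix_vector_mult_le) auto
  also have "... <= D * (e * D)" using v[OF i] U D e by (intro mult_mono) auto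
  finally show "\<bar>v i \<bullet> ((U - matrix_inv V) *v v i)\<bar> <= D * (e * D)" .
 qed
 moreover have "\<bar>?g \<bullet> (matrix_inv (\<Sum>j=1..m. c j ** V ** transpose (c j)) *v ?g)\<bar> <= b\<^sup>2 / \<kappa>"
  using coercive_inverse_bound(2)[OF coer \<kappa>, of ?g] g b \<kappa>
  by (elim order_trans) (intro divide_right_mono power_mono, auto)
 ultimately show ?thesis by (simp add: power2_eq_square mult_ac)
qed

text \<open>
 The estimating equation involves all lags. It therefore equates the part with lags up to \<open>m\<close> to minus a
 tail, up to the error of replacing \<open>c\<close> by \<open>c'\<close>.
\<close>

lemma score_tail:
 fixes v :: "nat => real^'v" and c c' :: "nat => real^'v^'r"
 assumes zero: "(\<Sum>i=1..n-1. c' i *v v i) = 0" and mn: "m < n"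
  and tail: "\<And>i. i \<in> {m+1..n-1} ==> norm (c' i) <= a i \<and> norm (v i) <= y i + z i"
  and head: "\<And>i. i \<in> {1..m} ==> norm (c i - c' i) <= e \<and> norm (v i) <= D"
 shows "norm (\<Sum>i=1..m. c i *v v i) <= (\<Sum>i=m+1..n-1. a i * y i) + (\<Sum>i=m+1..n-1. a i * z i) + real m * (e * D)"
proof -
 have "(\<Sum>i=1..n-1. c' i *v v i) = (\<Sum>i=1..m. c' i *v v i) + (\<Sum>i=m+1..n-1. c' i *v v i)"
  using mn sum.ub_add_nat[of 1 m "%i. c' i *v v i" "n - 1 - m"] by simp
 hence eq: "(\<Sum>i=1..m. c i *v v i) = (\<Sum>i=1..m. (c i - c' i) *v v i) - (\<Sum>i=m+1..n-1. c' i *v v i)"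
  using zero minus_unique[of "\<Sum>i=1..m. c' i *v v i"] by (simp add: matrix_vector_mult_diff_rdistrib sum_subtractf)
 have "norm (\<Sum>i=m+1..n-1. c' i *v v i) <= (\<Sum>i=m+1..n-1. a i * (y i + z i))"
 proof (intro order_trans[OF norm_sum] sum_mono)
  fix i assume i: "i \<in> {m+1..n-1}"
  have "norm (c' i *v v i) <= norm (c' i) * norm (v i)" by (rule norm_matrix_vector_mult_le)
  also have "... <= a i * (y i + z i)" using tail[OF i] by (intro mult_mono) (auto intro: order_trans[OF norm_ge_zero])
  finally show "norm (c' i *v v i) <= a i * (y i + z i)" .
 qed
 moreover have "norm (\<Sum>i=1..m. (c i - c' i) *v v i) <= (\<Sum>i=1..m. e * D)"
 proof (intro order_trans[OF norm_sum] sum_mono)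
  fix i assume i: "i \<in> {1..m}"
  have "norm ((c i - c' i) *v v i) <= norm (c i - c' i) * norm (v i)" by (rule norm_matrix_vector_mult_le)
  also have "... <= e * D" using head[OF i] by (intro mult_mono) (auto intro: order_trans[OF norm_ge_zero])
  finally show "norm ((c i - c' i) *v v i) <= e * D" .
 qed
 ultimately show ?thesis unfolding eq
  using norm_triangle_ineq4[of "\<Sum>i=1..m. (c i - c' i) *v v i" "\<Sum>i=m+1..n-1. c' i *v v i"]
  by (simp add: distrib_left sum.distrib)
qed

section \<open>Comparison on a good event\<close>

lemma sqrt_ratio_le: "i < n ==> sqrt (real n) / sqrt (real n - real i) <= real i + 1"
proof -
 assume i: "i < n"
 hence "1 <= real n - real i" by simp
 hence "0 <= real i * (real n - real i - 1)" by (intro mult_nonneg_nonneg) auto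
 hence "real n <= (real i + 1) * (real n - real i)" by (simp add: algebra_simps)
 hence "real n / (real n - real i) <= real i + 1" using i by (simp add: divide_le_eq)
 also have "... <= (real i + 1)\<^sup>2" by (simp add: power2_eq_square algebra_simps)
 finally have "sqrt (real n / (real n - real i)) <= real i + 1" by (intro real_le_lsqrt) auto
 thus ?thesis by (simp add: real_sqrt_divide)
qed

text \<open>
 All estimates for a single sample, with the probabilistic input as hypotheses: \<open>\<sigma>\<close> is the scaled
 estimation error, and \<open>N\<close> is a finite net of the ball in which it lies. Asymptotic linearity holds at
 the points of the net; a Lipschitz estimate extends it to \<open>\<sigma>\<close>.
\<close>

lemma good_event_gap:
 fixes \<theta> \<sigma> :: "('l::{finite,linorder}, 'd::finite) param" and x :: "nat => real^'d"
 defines "\<theta>n \<equiv> %n \<sigma>. \<theta> + (1 / sqrt (real n)) *\<^sub>R \<sigma>"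
 assumes n: "m < n" and V: "pos_def (ccov_var S)"
  and coer: "\<And>\<tau>. \<tau> \<bullet> (c_gram p q S m \<theta> *v \<tau>) >= \<kappa> * (norm \<tau>)\<^sup>2" and \<kappa>: "\<kappa> > 0"
  and \<sigma>: "norm \<sigma> <= R" and Rn: "R / sqrt (real n) <= \<eta>"
  and ssq1: "\<And>\<theta>'. norm (\<theta>' - \<theta>) <= \<eta> ==> ssq 2 n (resid p q \<theta>' x) <= real n * A"
  and ssq2: "\<And>\<theta>1 \<theta>2. norm (\<theta>1 - \<theta>) <= \<eta> ==> norm (\<theta>2 - \<theta>) <= \<eta> ==>
   ssq 2 n (%t. resid p q \<theta>1 x t - resid p q \<theta>2 x t) <= (norm (\<theta>1 - \<theta>2))\<^sup>2 * (real n * A)"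
  and L: "L = norm (matrix_inv S) * 2 * A"
  and zero: "gauss_score p q S n (\<theta>n n \<sigma>) x = 0"
  and cb: "\<And>i. norm (c_mat p q (\<theta>n n \<sigma>) i) <= a i"
  and cc: "\<And>i. i \<in> {1..m} ==> norm (c_mat p q \<theta> i - c_mat p q (\<theta>n n \<sigma>) i) <= ec"
  and W: "\<And>i. i \<in> {1..m} ==> norm (ccov_stat S n i (resid p q \<theta> x)) <= D"
  and t1: "(\<Sum>i=m+1..n-1. a i * norm (ccov_stat S n i (resid p q \<theta> x))) <= \<beta>"
  and t2: "(\<Sum>i=m+1..n-1. a i * (L * R * (real i + 1))) <= \<beta>"
  and t3: "real m * (ec * (D + L * R * (real m + 1))) <= \<beta>"
  and net: "\<And>\<sigma>. norm \<sigma> <= R ==> \<exists>\<sigma>0\<in>N. norm (\<sigma> - \<sigma>0) <= h" "\<And>\<sigma>0. \<sigma>0 \<in> N ==> norm \<sigma>0 <= R"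
  and lin: "\<And>\<sigma>0 i. \<sigma>0 \<in> N ==> i \<in> {1..m} ==> norm (ccov_stat S n i (resid p q (\<theta>n n \<sigma>0) x) - ccov_stat S n i (resid p q \<theta> x)
   - ccov_var S *v (transpose (c_mat p q \<theta> i) *v \<sigma>0)) <= \<eta>' / 2"
  and h: "h >= 0" "h * (L * (real m + 1) + norm (ccov_var S) * (\<Sum>i=1..m. norm (c_mat p q \<theta> i))) <= \<eta>' / 2"
  and pf: "\<And>w r \<sigma>. (\<forall>i\<in>{1..m}. norm (w i) <= D \<and> norm (r i) <= \<eta>') ==>
   \<bar>projected_form (ccov_var S) (c_mat p q \<theta>) m (%i. w i + ccov_var S *v (transpose (c_mat p q \<theta> i) *v \<sigma>) + r i)
    - projected_form (ccov_var S) (c_mat p q \<theta>) m w\<bar> <= \<epsilon>"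
  and U: "norm (matrix_inv (ccov_var (resid_cov p q n (\<theta>n n \<sigma>) x)) - matrix_inv (ccov_var S)) <= eU"
 shows "\<bar>portmanteau p q S m n (\<theta>n n \<sigma>) x - oracle_portmanteau p q S m n \<theta> x\<bar>
  <= real m * (D + L * R * (real m + 1))\<^sup>2 * eU + (3 * \<beta>)\<^sup>2 / \<kappa> + \<epsilon>"
proof -
 define w where "w \<theta>' i = ccov_stat S n i (resid p q \<theta>' x)" for \<theta>' :: "('l, 'd) param" and i
 let ?V = "ccov_var S" let ?c = "c_mat p q \<theta>" let ?v = "w (\<theta>n n \<sigma>)"
 have n0: "n > 0" using n by simp
 have R0: "R >= 0" by (rule order_trans[OF norm_ge_zero \<sigma>])
 have ball: "norm (\<theta>n n \<sigma>' - \<theta>) <= \<eta>" if "norm \<sigma>' <= R" for \<sigma>'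
  using that Rn n0 divide_right_mono[OF that, of "sqrt (real n)"] by (simp add: \<theta>n_def)
 have A0: "0 <= real n * A" by (rule order_trans[OF ssq_nonneg ssq1[OF ball[OF \<sigma>]]])
 hence A: "A >= 0" using n0 by (simp add: zero_le_mult_iff)
 have L0: "L >= 0" using A by (simp add: L)
 have lip: "norm (w \<theta>1 i - w \<theta>2 i) <= L * b * (real i + 1)"
  if \<theta>: "norm (\<theta>1 - \<theta>) <= \<eta>" "norm (\<theta>2 - \<theta>) <= \<eta>" and i: "i < n" and b: "norm (\<theta>1 - \<theta>2) <= b / sqrt (real n)" for \<theta>1 \<theta>2 i b
 proof -
  have b0: "b >= 0" using n0 order_trans[OF norm_ge_zero b] by (simp add: zero_le_divide_iff)
  have "norm (w \<theta>1 i - w \<theta>2 i) <= norm (matrix_inv S) * (2 * norm (\<theta>1 - \<theta>2) * (real n * A)) / sqrt (real n - real i)"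
   unfolding w_def by (rule ccov_stat_lipschitz[OF ssq1[OF \<theta>(1)] ssq1[OF \<theta>(2)] ssq2[OF \<theta>] norm_ge_zero i])
  also have "... = L * (norm (\<theta>1 - \<theta>2) * (real n / sqrt (real n - real i)))" by (simp add: L)
  also have "... <= L * (b / sqrt (real n) * (real n / sqrt (real n - real i)))"
   using L0 i by (intro mult_left_mono mult_right_mono b) auto
  also have "b / sqrt (real n) * (real n / sqrt (real n - real i)) = b * (sqrt (real n) / sqrt (real n - real i))"
  proof -
   have "b / sqrt (real n) * (real n / sqrt (real n - real i)) = b * ((real n / sqrt (real n)) / sqrt (real n - real i))" by simp
   thus ?thesis by (simp only: real_div_sqrt of_nat_0_le_iff)
  qed
  also have "L * ... <= L * (b * (real i + 1))" using L0 b0 sqrt_ratio_le[OF i] by (intro mult_left_mono) auto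
  finally show ?thesis by (simp add: mult.assoc)
 qed
 have vw: "norm (?v i) <= norm (w \<theta> i) + L * R * (real i + 1)" if "i < n" for i
 proof -
  have \<eta>0: "norm (\<theta> - \<theta>) <= \<eta>" using order_trans[OF norm_ge_zero ball[OF \<sigma>]] by simp
  have "norm (\<theta>n n \<sigma> - \<theta>) <= R / sqrt (real n)"
   using divide_right_mono[OF \<sigma>, of "sqrt (real n)"] by (simp add: \<theta>n_def)
  from lip[OF ball[OF \<sigma>] \<eta>0 that this] norm_triangle_ineq2[of "?v i" "w \<theta> i"] show ?thesis by linarith
 qed
 have vD: "norm (?v i) <= D + L * R * (real m + 1)" if i: "i \<in> {1..m}" for i
 proof -
  have "norm (?v i) <= norm (w \<theta> i) + L * R * (real i + 1)" using vw[of i] i n by simp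
  also have "... <= D + L * R * (real m + 1)"
   using W[OF i] i L0 R0 by (intro add_mono mult_left_mono) (auto simp: w_def)
  finally show ?thesis .
 qed
 have inv: "invertible (c_gram p q S m \<theta>)" by (rule coercive_inverse_bound(1)[OF coer \<kappa>])
 have g: "norm (\<Sum>i=1..m. ?c i *v ?v i) <= 3 * \<beta>"
 proof -
  have "norm (\<Sum>i=1..m. ?c i *v ?v i) <= (\<Sum>i=m+1..n-1. a i * norm (w \<theta> i)) + (\<Sum>i=m+1..n-1. a i * (L * R * (real i + 1))) + real m * (ec * (D + L * R * (real m + 1)))"
  proof (rule score_tail[where c'="c_mat p q (\<theta>n n \<sigma>)"])
   show "(\<Sum>i=1..n-1. c_mat p q (\<theta>n n \<sigma>) i *v ?v i) = 0" using zero by (simp add: gauss_score_resid w_def)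
   show "m < n" by (rule n)
   show "norm (c_mat p q (\<theta>n n \<sigma>) i) <= a i \<and> norm (?v i) <= norm (w \<theta> i) + L * R * (real i + 1)" if "i \<in> {m+1..n-1}" for i
    using cb vw[of i] that by auto
   show "norm (?c i - c_mat p q (\<theta>n n \<sigma>) i) <= ec \<and> norm (?v i) <= D + L * R * (real m + 1)" if "i \<in> {1..m}" for i
    using cc[OF that] vD[OF that] by simp
  qed
  thus ?thesis using t1 t2 t3 by (simp add: w_def)
 qed
 have quad: "\<bar>(\<Sum>i=1..m. ?v i \<bullet> (matrix_inv (ccov_var (resid_cov p q n (\<theta>n n \<sigma>) x)) *v ?v i)) - projected_form ?V ?c m ?v\<bar>
  <= real m * (D + L * R * (real m + 1))\<^sup>2 * eU + (3 * \<beta>)\<^sup>2 / \<kappa>"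
  by (rule quadratic_close_to_projected_form[OF coer[unfolded c_gram_def] \<kappa> vD U g])
 define r where "r i = ?v i - w \<theta> i - ?V *v (transpose (?c i) *v \<sigma>)" for i
 have r: "norm (r i) <= \<eta>'" if i: "i \<in> {1..m}" for i
 proof -
  obtain \<sigma>0 where \<sigma>0: "\<sigma>0 \<in> N" "norm (\<sigma> - \<sigma>0) <= h" using net(1)[OF \<sigma>] by blast
  have d: "\<theta>n n \<sigma> - \<theta>n n \<sigma>0 = (1 / sqrt (real n)) *\<^sub>R (\<sigma> - \<sigma>0)" by (simp add: \<theta>n_def scaleR_diff_right)
  have "norm (\<theta>n n \<sigma> - \<theta>n n \<sigma>0) <= h / sqrt (real n)" unfolding d using \<sigma>0(2) by (simp add: divide_right_mono)
  from lip[OF ball[OF \<sigma>] ball[OF net(2)[OF \<sigma>0(1)]] _ this, of i] i n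
  have e1: "norm (?v i - w (\<theta>n n \<sigma>0) i) <= L * h * (real i + 1)" by simp
  have e2: "norm (?V *v (transpose (?c i) *v (\<sigma>0 - \<sigma>))) <= norm ?V * (norm (?c i) * h)"
   using \<sigma>0(2) norm_minus_commute[of \<sigma> \<sigma>0]
   by (intro order_trans[OF norm_matrix_vector_mult_le] mult_left_mono order_trans[OF norm_matrix_vector_mult_le[of "transpose (?c i)"]]) (auto intro: mult_left_mono)
  have "r i = (?v i - w (\<theta>n n \<sigma>0) i) + (w (\<theta>n n \<sigma>0) i - w \<theta> i - ?V *v (transpose (?c i) *v \<sigma>0)) + ?V *v (transpose (?c i) *v (\<sigma>0 - \<sigma>))"
   by (simp add: r_def matrix_vector_mult_diff_distrib del: transpose_matrix_vector)
  hence "norm (r i) <= norm (?v i - w (\<theta>n n \<sigma>0) i) + norm (w (\<theta>n n \<sigma>0) i - w \<theta> i - ?V *v (transpose (?c i) *v \<sigma>0)) + norm (?V *v (transpose (?c i) *v (\<sigma>0 - \<sigma>)))"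
   by (simp only: norm_triangle_mono[OF norm_triangle_ineq] order_refl)
  also have "... <= L * h * (real i + 1) + \<eta>' / 2 + norm ?V * (norm (?c i) * h)"
   using e1 e2 lin[OF \<sigma>0(1) i] by (simp only: w_def)
  also have "... <= L * h * (real m + 1) + \<eta>' / 2 + norm ?V * ((\<Sum>i=1..m. norm (?c i)) * h)"
   using i L0 h(1) by (intro add_mono mult_left_mono mult_right_mono order_refl member_le_sum) auto
  also have "... = h * (L * (real m + 1) + norm ?V * (\<Sum>i=1..m. norm (?c i))) + \<eta>' / 2" by (simp add: algebra_simps)
  also have "... <= \<eta>'" using h(2) by linarith
  finally show ?thesis .
 qed
 have "projected_form ?V ?c m ?v = projected_form ?V ?c m (%i. w \<theta> i + ?V *v (transpose (?c i) *v \<sigma>) + r i)"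
  by (rule projected_form_cong) (simp add: r_def)
 hence "\<bar>projected_form ?V ?c m ?v - projected_form ?V ?c m (w \<theta>)\<bar> <= \<epsilon>"
  using pf[of "w \<theta>" r \<sigma>] W r by (simp add: w_def)
 moreover have "portmanteau p q S m n (\<theta>n n \<sigma>) x = (\<Sum>i=1..m. ?v i \<bullet> (matrix_inv (ccov_var (resid_cov p q n (\<theta>n n \<sigma>) x)) *v ?v i))"
  unfolding w_def by (rule portmanteau_resid) (use n in simp)
 moreover have "oracle_portmanteau p q S m n \<theta> x = projected_form ?V ?c m (w \<theta>)"
  unfolding w_def by (rule oracle_portmanteau_resid[OF n V inv])
 ultimately show ?thesis using quad by linarith
qed

lemma (in prob_space) markov_gt:
 fixes Z :: "'a => real"
 assumes Z: "integrable M Z" and nn: "\<And>x. x \<in> space M ==> Z x >= 0" and b: "expectation Z <= b" and t: "t > 0"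
 shows "prob {x\<in>space M. Z x > t} <= b / t"
proof -
 have [measurable]: "Z \<in> borel_measurable M" using Z by simp
 have "prob {x\<in>space M. Z x > t} <= prob {x\<in>space M. Z x >= t}" by (intro finite_measure_mono) auto
 also have "... <= expectation Z / t" using nn t by (intro integral_Markov_inequality_measure[OF Z sets.top]) auto
 also have "... <= b / t" using b t by (intro divide_right_mono) auto
 finally show ?thesis .
qed

lemma (in prob_space) prob_Int_gt:
 assumes "A \<in> events" "B \<in> events" "prob A > 1 - a" "prob B > 1 - b"
 shows "prob (A \<inter> B) > 1 - (a + b)"
proof -
 have "prob A + prob B = prob (A \<union> B) + prob (A \<inter> B)" using finite_measure_Union'[OF assms(1,2)] finite_measure_Diff'[OF assms(2,1)] by (simp add: Int_commute)
 moreover have "prob (A \<union> B) <= 1" by simp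
 ultimately show ?thesis using assms(3,4) by linarith
qed

lemma (in prob_space) prob_le_gt:
 assumes [measurable]: "Z \<in> borel_measurable M" and "prob {x\<in>space M. Z x > t} < a"
 shows "prob {x\<in>space M. Z x <= (t::real)} > 1 - a" "{x\<in>space M. Z x <= t} \<in> events"
proof -
 have "{x\<in>space M. Z x <= t} = space M - {x\<in>space M. Z x > t}" by auto
 hence "prob {x\<in>space M. Z x <= t} = 1 - prob {x\<in>space M. Z x > t}" by (simp add: prob_compl)
 thus "prob {x\<in>space M. Z x <= t} > 1 - a" using assms(2) by simp
 show "{x\<in>space M. Z x <= t} \<in> events" by measurable
qed

lemma summable_tail_small:
 fixes s :: "nat => real"
 assumes "summable s" "\<And>i. s i >= 0" "e > 0"
 shows "\<exists>M. \<forall>m\<ge>M. \<forall>n. (\<Sum>i=m+1..n. s i) <= e"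
proof -
 obtain N where N: "\<And>m n. m >= N ==> norm (sum s {m..<n}) < e" using assms(1,3) unfolding summable_Cauchy by blast
 have "(\<Sum>i=m+1..n. s i) <= e" if "m >= N" for m n
  using N[of "m+1" "Suc n"] that by (simp add: atLeastLessThanSuc_atLeastAtMost)
 thus ?thesis by blast
qed

lemma finite_net:
 fixes R h :: real
 assumes "h > 0"
 obtains N :: "'a::euclidean_space set" where "finite N" "\<And>\<sigma>. norm \<sigma> <= R ==> \<exists>\<sigma>0\<in>N. norm (\<sigma> - \<sigma>0) <= h" "\<And>\<sigma>0. \<sigma>0 \<in> N ==> norm \<sigma>0 <= R"
proof -
 have "cball (0::'a) R \<subseteq> (\<Union>x\<in>cball 0 R. ball x h)" using assms by auto
 hence "\<exists>k. k \<subseteq> cball (0::'a) R \<and> finite k \<and> cball 0 R \<subseteq> (\<Union>x\<in>k. ball x h)"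
  by (rule compactE_image[OF compact_cball open_ball]) (intro exI conjI)
 then obtain k where k: "finite k" "k \<subseteq> cball (0::'a) R" "cball 0 R \<subseteq> (\<Union>x\<in>k. ball x h)" by (elim exE conjE)
 show ?thesis
 proof (rule that[OF k(1)])
  fix \<sigma> :: 'a assume "norm \<sigma> <= R"
  hence "\<sigma> \<in> (\<Union>x\<in>k. ball x h)" by (intro subsetD[OF k(3)]) simp
  then obtain y where "y \<in> k" "\<sigma> \<in> ball y h" by blast
  thus "\<exists>\<sigma>0\<in>k. norm (\<sigma> - \<sigma>0) <= h" by (intro bexI[of _ y]) (auto simp: dist_norm norm_minus_commute)
 qed (use k(2) in auto)
qed

lemma isCont_matrix_inv_ccov_var:
 assumes S: "invertible S" and V: "invertible (ccov_var S)"
 shows "isCont (%A. matrix_inv (ccov_var A)) S"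
proof -
 have "isCont matrix_inv S" by (rule isCont_matrix_inv[OF S])
 hence "isCont (%A. ccov_var A) S" unfolding ccov_var_def
  by (intro bounded_bilinear.isCont[OF bounded_bilinear_kron] continuous_ident)
 thus ?thesis by (rule isCont_o2) (rule isCont_matrix_inv[OF V])
qed

lemma to_zero_in_prob_sum_norm:
 fixes R :: "'i => nat => 'a => 'b::euclidean_space"
 assumes I: "finite I" and P: "\<And>n. prob_space (P n)" and m: "\<And>i n. i \<in> I ==> R i n \<in> borel_measurable (P n)"
  and z: "\<And>i. i \<in> I ==> to_zero_in_prob P (R i)"
 shows "to_zero_in_prob P (%n x. \<Sum>i\<in>I. norm (R i n x))"
proof -
 have "to_zero_in_prob P (%n x. \<Sum>i\<in>I. (1::real) \<bullet> norm (R i n x))"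
 proof (rule to_zero_in_prob_sum_inner[OF I P])
  fix i n assume "i \<in> I"
  thus "(%x. norm (R i n x)) \<in> borel_measurable (P n)" using m by measurable
 next
  fix i assume "i \<in> I"
  thus "to_zero_in_prob P (%n x. norm (R i n x))" using z by (simp add: to_zero_in_prob_def)
 qed
 thus ?thesis by simp
qed

section \<open>The good event has large probability\<close>

lemma summable_polynomial_geometric:
 assumes \<rho>: "0 < \<rho>" "\<rho> < 1"
 shows "summable (%i. (real i + 1)\<^sup>2 * \<rho> ^ i)"
proof -
 define c where "c = (1 + \<rho>) / 2"
 have "(%i. ((real i + 2) / (real i + 1))\<^sup>2) \<longlonglongrightarrow> 1" by real_asymp
 hence "(%i. ((real i + 2) / (real i + 1))\<^sup>2 * \<rho>) \<longlonglongrightarrow> 1 * \<rho>" by (intro tendsto_mult tendsto_const)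
 hence "\<forall>\<^sub>F i in sequentially. ((real i + 2) / (real i + 1))\<^sup>2 * \<rho> < c"
  using \<rho> by (intro order_tendstoD) (auto simp: c_def)
 then obtain N where N: "\<And>i. i >= N ==> ((real i + 2) / (real i + 1))\<^sup>2 * \<rho> < c" by (auto simp: eventually_sequentially)
 show ?thesis
 proof (rule summable_ratio_test)
  show "c < 1" using \<rho> by (simp add: c_def)
  fix i assume "N <= i"
  from N[OF this] have "((real i + 2) / (real i + 1))\<^sup>2 * \<rho> * ((real i + 1)\<^sup>2 * \<rho> ^ i) <= c * ((real i + 1)\<^sup>2 * \<rho> ^ i)"
   using \<rho> by (intro mult_right_mono) auto
  moreover have "((real i + 2) / (real i + 1))\<^sup>2 * \<rho> * ((real i + 1)\<^sup>2 * \<rho> ^ i) = (real (Suc i) + 1)\<^sup>2 * \<rho> ^ Suc i"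
   by (simp add: power_divide add.commute)
  ultimately show "norm ((real (Suc i) + 1)\<^sup>2 * \<rho> ^ Suc i) <= c * norm ((real i + 1)\<^sup>2 * \<rho> ^ i)"
   using \<rho> by (simp add: abs_mult)
 qed
qed

lemma eventually_over_sqrt_less: "t > 0 ==> \<forall>\<^sub>F n in sequentially. R / sqrt (real n) < t"
proof -
 assume t: "t > 0"
 have "(%n. R / sqrt (real n)) \<longlonglongrightarrow> 0" by real_asymp
 thus ?thesis using t by (rule order_tendstoD)
qed

lemma borel_measurable_resid_cov:
 assumes "T \<in> borel_measurable (sample_space n)"
 shows "(%x. resid_cov p q n (T x) x) \<in> borel_measurable (varma_law p q' \<theta>' f n)"
 unfolding measurable_varma_law resid_cov_def using borel_measurable_resid_sample[OF assms]
 by (intro borel_measurable_scaleR borel_measurable_sum borel_measurable_const borel_measurable_outer) (auto simp: sets_sample_space)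

lemma scale_below:
 fixes a b :: real
 assumes "a >= 0" "b > 0"
 obtains e where "e > 0" "a * e <= b"
proof (rule that[of "b / (a + 1)"])
 have "a * b <= (a + 1) * b" using assms by simp
 thus "a * (b / (a + 1)) <= b" using assms by (simp add: divide_le_eq mult.commute)
qed (use assms in simp)

text \<open>
 Six events, each of probability close to 1, provide the hypotheses of \<open>good_event_gap\<close>. The bound on the
 tail sum and the choice of \<open>M\<close> come first, as they must not depend on \<open>m\<close>; then the
 constants that depend on \<open>m\<close>, and finally those that hold for large \<open>n\<close>.
\<close>

theorem portmanteau_oracle_gap:
 fixes \<theta> :: "('l::{finite,linorder}, 'd::finite) param"
 assumes pq: "p + q = CARD('l)" and \<theta>: "\<theta> \<in> varma_params p q" and f: "f \<in> density_class"
  and lin: "asymp_linear_ccov p q f \<theta>"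
  and m4: "integrable (innov f) (%e. outer (vecm (outer e e)) (vecm (outer e e)))"
  and qmle: "gaussian_qmle p q f \<theta> T"
  and \<delta>: "\<delta> > 0" and \<epsilon>: "\<epsilon> > 0"
 shows "\<exists>M. \<forall>m\<ge>M. invertible (c_gram p q (innov_cov f) m \<theta>) \<and> (\<exists>N. \<forall>n\<ge>N. n > m \<and>
  (\<exists>G\<in>sets (varma_law p q \<theta> f n). measure (varma_law p q \<theta> f n) G > 1 - \<epsilon> \<and>
   (\<forall>x\<in>G. \<bar>portmanteau p q (innov_cov f) m n (T n x) x - oracle_portmanteau p q (innov_cov f) m n \<theta> x\<bar> < \<delta>)))"
proof (rule varma_uniform_bounds[OF \<theta>])
 fix \<eta> \<rho> C K :: real
 assume \<eta>: "\<eta> > 0" and \<rho>: "0 < \<rho>" "\<rho> < 1" and C: "C > 0" and K: "K > 0"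
  and st: "\<And>\<theta>'. norm (\<theta>' - \<theta>) <= \<eta> ==> geom_stable p q C \<rho> \<theta>'"
  and ssq1: "\<And>\<theta>1 \<theta>2 P n x. norm (\<theta>1 - \<theta>) <= \<eta> ==> norm (\<theta>2 - \<theta>) <= \<eta> ==> P \<in> {1,2,4} ==>
    ssq P n (resid p q \<theta>2 x) <= K * ssq P n (resid p q \<theta>1 x)"
  and ssq2: "\<And>\<theta>1 \<theta>2 \<theta>3 P n x. norm (\<theta>1 - \<theta>) <= \<eta> ==> norm (\<theta>2 - \<theta>) <= \<eta> ==> norm (\<theta>3 - \<theta>) <= \<eta> ==> P \<in> {1,2,4} ==>
    ssq P n (%t. resid p q \<theta>2 x t - resid p q \<theta>3 x t) <= K * norm (\<theta>2 - \<theta>3) ^ P * ssq P n (resid p q \<theta>1 x)"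
 show ?thesis
 proof (rule c_mat_uniform_decay[OF pq \<rho> C st \<eta>])
  fix Kc :: real
  assume Kc: "Kc > 0" and decay: "\<And>\<theta>' i. norm (\<theta>' - \<theta>) <= \<eta> ==> norm (c_mat p q \<theta>' i) <= Kc * ((real i + 1) * \<rho> ^ i)"
  define S where "S = innov_cov f"
  define V where "V = ccov_var S"
  define P where "P n = varma_law p q \<theta> f n" for n
  define W where "W n \<theta>' i x = ccov_stat S n i (resid p q \<theta>' x)" for n and \<theta>' :: "('l, 'd) param" and i x
  have Pp: "prob_space (P n)" for n unfolding P_def by (rule prob_space_varma_law[OF f])
  have S: "pos_def S" unfolding S_def by (rule density_classD(9)[OF f])
  have V: "pos_def V" unfolding V_def S_def by (rule pos_def_ccov_var[OF f])
  have Wm: "W n \<theta>' i \<in> borel_measurable (P n)" for n \<theta>' i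
   unfolding W_def[abs_def] P_def by (rule borel_measurable_ccov_resid) simp
  have Tm: "T n \<in> borel_measurable (sample_space n)" for n using qmle by (simp add: gaussian_qmle_def)
  obtain M0 \<kappa> where \<kappa>: "\<kappa> > 0" and coer: "\<And>m \<tau>. m >= M0 ==> \<tau> \<bullet> (c_gram p q S m \<theta> *v \<tau>) >= \<kappa> * (norm \<tau>)\<^sup>2"
   using c_gram_eventually_coercive[OF pq \<theta> V[unfolded V_def]] by (elim exE conjE) blast
  define \<epsilon>1 where "\<epsilon>1 = \<epsilon> / 6"
  have \<epsilon>1: "\<epsilon>1 > 0" using \<epsilon> by (simp add: \<epsilon>1_def)
  obtain R0 where R0: "\<forall>\<^sub>F n in sequentially. measure (P n) {x\<in>space (P n). norm (sqrt n *\<^sub>R (T n x - \<theta>)) > R0} < \<epsilon>1"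
   using qmle \<epsilon>1 unfolding gaussian_qmle_def bounded_in_prob_def P_def by blast
  define R where "R = max R0 1"
  have R: "R > 0" by (simp add: R_def)
  \<comment> \<open>\<open>B\<close> bounds the mean square of the residuals at \<open>\<theta>\<close> once the empirical
   covariance is within distance 1 of \<open>S\<close>, and \<open>A\<close> the one at all nearby parameters.
   \<open>L\<close> is the resulting Lipschitz constant of the cross-covariances.\<close>
  define B where "B = real CARD('d) * (norm S + 1)"
  have B: "B >= 0" by (simp add: B_def)
  define A where "A = K * B"
  have A: "A >= 0" using K B by (simp add: A_def)
  define L where "L = norm (matrix_inv S) * 2 * A"
  have L: "L >= 0" using A by (simp add: L_def)
  \<comment> \<open>The score over the lags up to \<open>m\<close> will consist of three parts of size at most
   \<open>\<beta>\<close>. Its square in the metric of the inverse Gram matrix is then at most \<open>\<delta> /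
   4\<close>.\<close>
  define \<beta> where "\<beta> = sqrt (\<kappa> * \<delta>) / 6"
  have \<beta>: "\<beta> > 0" "(3 * \<beta>)\<^sup>2 / \<kappa> = \<delta> / 4" using \<kappa> \<delta> by (auto simp: \<beta>_def power_mult_distrib power_divide)
  define \<tau>V where "\<tau>V = (\<Sum>b\<in>Basis. b \<bullet> (V *v b))"
  have \<tau>V: "\<tau>V >= 0" unfolding \<tau>V_def by (intro sum_nonneg pos_def_nonneg[OF V])
  have W2: "integrable (P n) (%x. (norm (W n \<theta> i x))\<^sup>2)" "(LINT x|P n. (norm (W n \<theta> i x))\<^sup>2) = \<tau>V" if "1 <= i" "i < n" for i n
   using ccov_stat_second_moment[OF f that, of p q \<theta>] by (auto simp: W_def P_def \<tau>V_def V_def S_def)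
  have W1: "integrable (P n) (%x. norm (W n \<theta> i x))" "(LINT x|P n. norm (W n \<theta> i x)) <= sqrt \<tau>V" if "1 <= i" "i < n" for i n
  proof -
   interpret prob_space "P n" by (rule Pp)
   have m: "(%x. norm (W n \<theta> i x)) \<in> borel_measurable (P n)" using Wm by measurable
   show "integrable (P n) (%x. norm (W n \<theta> i x))" "(LINT x|P n. norm (W n \<theta> i x)) <= sqrt \<tau>V"
    using abs_expectation_le_sqrt[OF m W2(1)[OF that]] W2(2)[OF that] by simp_all
  qed
  define a where "a i = Kc * ((real i + 1) * \<rho> ^ i)" for i
  have a0: "a i >= 0" for i using Kc \<rho> by (simp add: a_def)
  have sa: "summable (%i. a i * (real i + 1))"
   using summable_mult[OF summable_polynomial_geometric[OF \<rho>], of Kc] by (simp add: a_def power2_eq_square mult_ac)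
  \<comment> \<open>The tail has a random part of mean at most \<open>e0\<close> times the root of \<open>\<tau>V\<close>, and a
   part at most \<open>L R e0\<close> due to the estimation error.\<close>
  obtain e0 where e0: "e0 > 0" "(sqrt \<tau>V + L * R) * e0 <= min (\<beta> * \<epsilon>1 / 2) \<beta>"
   by (rule scale_below[of "sqrt \<tau>V + L * R" "min (\<beta> * \<epsilon>1 / 2) \<beta>"]) (use \<beta> \<epsilon>1 L R \<tau>V in auto)
  have e0': "e0 * sqrt \<tau>V <= \<beta> * \<epsilon>1 / 2" "L * R * e0 <= \<beta>"
  proof -
   have "e0 * sqrt \<tau>V + L * R * e0 = (sqrt \<tau>V + L * R) * e0" "0 <= e0 * sqrt \<tau>V" "0 <= L * R * e0"
    using e0(1) L R \<tau>V by (auto simp: algebra_simps)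
   thus "e0 * sqrt \<tau>V <= \<beta> * \<epsilon>1 / 2" "L * R * e0 <= \<beta>" using e0(2) unfolding min.bounded_iff by linarith+
  qed
  obtain M1 where M1: "\<And>m n. m >= M1 ==> (\<Sum>i=m+1..n. a i * (real i + 1)) <= e0"
   using summable_tail_small[OF sa _ e0(1)] a0 by auto
  show ?thesis
  proof (intro exI[of _ "max M0 M1"] allI impI, rule conjI)
   fix m assume "m >= max M0 M1"
   hence mM: "m >= M0" "m >= M1" by auto
   have inv: "invertible (c_gram p q S m \<theta>)" by (rule coercive_inverse_bound(1)[OF coer[OF mM(1)] \<kappa>])
   thus "invertible (c_gram p q (innov_cov f) m \<theta>)" by (simp add: S_def)
   \<comment> \<open>Markov's inequality for the sum of the squared norms of the first \<open>m\<close> cross-covariances, which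
    has mean \<open>m \<tau>V\<close>.\<close>
   define D2 where "D2 = 2 * (real m * \<tau>V) / \<epsilon>1 + 1"
   have D2: "D2 > 0" "real m * \<tau>V / D2 < \<epsilon>1"
   proof -
    show "D2 > 0" using \<tau>V \<epsilon>1 by (auto simp: D2_def intro!: add_nonneg_pos)
    moreover have "real m * \<tau>V < \<epsilon>1 * D2" using \<epsilon>1 \<tau>V by (simp add: D2_def distrib_left add_nonneg_pos)
    ultimately show "real m * \<tau>V / D2 < \<epsilon>1" by (simp add: divide_less_eq)
   qed
   define D where "D = sqrt D2"
   have D: "D > 0" "D\<^sup>2 = D2" using D2 by (auto simp: D_def)
   define D' where "D' = D + L * R * (real m + 1)"
   have D': "D' >= 0" using D L R by (simp add: D'_def)
   obtain eU where eU: "eU > 0" "real m * D'\<^sup>2 * eU <= \<delta> / 4"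
    by (rule scale_below[of "real m * D'\<^sup>2" "\<delta> / 4"]) (use \<delta> in auto)
   obtain s1 where s1: "s1 > 0" "\<And>A. norm (A - S) < s1 ==> norm (matrix_inv (ccov_var A) - matrix_inv V) < eU"
    using isCont_matrix_inv_ccov_var[OF pos_def_invertible[OF S] pos_def_invertible[OF V[unfolded V_def]]] eU(1) unfolding continuous_at_eps_delta V_def dist_norm by blast
   define s where "s = min 1 (s1 / 4)"
   have s: "s > 0" "s <= 1" "s <= s1 / 4" using s1 by (auto simp: s_def)
   obtain ec where ec: "ec > 0" "real m * D' * ec <= \<beta>"
    by (rule scale_below[of "real m * D'" \<beta>]) (use \<beta> D' in auto)
   have "\<forall>i. \<exists>d>0. \<forall>\<theta>'. norm (\<theta>' - \<theta>) < d \<longrightarrow> norm (c_mat p q \<theta>' i - c_mat p q \<theta> i) < ec"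
    using isCont_c_mat[OF \<rho> st \<eta>] ec(1) unfolding continuous_at_eps_delta dist_norm by blast
   then obtain dd where dd: "\<And>i. dd i > (0::real)" "\<And>i \<theta>'. norm (\<theta>' - \<theta>) < dd i ==> norm (c_mat p q \<theta>' i - c_mat p q \<theta> i) < ec" by metis
   define \<eta>c where "\<eta>c = Min (insert 1 (dd ` {1..m}))"
   have \<eta>c: "\<eta>c > 0" "\<And>i. i \<in> {1..m} ==> \<eta>c <= dd i"
   proof -
    show "\<eta>c > 0" using dd(1) by (simp add: \<eta>c_def)
    show "\<eta>c <= dd i" if "i \<in> {1..m}" for i unfolding \<eta>c_def by (rule Min_le) (use that in auto)
   qed
   have \<delta>4: "\<delta> / 4 > 0" using \<delta> by simp
   obtain \<eta>' where \<eta>': "\<eta>' > 0" and pf: "\<And>w r \<sigma>. (\<forall>i\<in>{1..m}. norm (w i) <= D \<and> norm (r i) <= \<eta>') ==>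
     \<bar>projected_form V (c_mat p q \<theta>) m (%i. w i + V *v (transpose (c_mat p q \<theta> i) *v \<sigma>) + r i) - projected_form V (c_mat p q \<theta>) m w\<bar> <= \<delta> / 4"
    using projected_form_shift_continuous[OF V inv[unfolded c_gram_def, folded V_def] \<delta>4, of D] by blast
   define H where "H = L * (real m + 1) + norm V * (\<Sum>i=1..m. norm (c_mat p q \<theta> i))"
   have H: "H >= 0" using L by (auto simp: H_def intro!: add_nonneg_nonneg mult_nonneg_nonneg sum_nonneg)
   obtain h where h: "h > 0" "H * h <= \<eta>' / 2" by (rule scale_below[of H "\<eta>' / 2"]) (use H \<eta>' in auto)
   obtain t0 where t0: "t0 > 0" "2 * A * t0 <= s1 / 4" by (rule scale_below[of "2 * A" "s1 / 4"]) (use A s1 in auto)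
   show "\<exists>N. \<forall>n\<ge>N. n > m \<and> (\<exists>G\<in>sets (varma_law p q \<theta> f n). measure (varma_law p q \<theta> f n) G > 1 - \<epsilon> \<and>
    (\<forall>x\<in>G. \<bar>portmanteau p q (innov_cov f) m n (T n x) x - oracle_portmanteau p q (innov_cov f) m n \<theta> x\<bar> < \<delta>))"
   proof (rule finite_net[OF h(1), where R=R and 'a="(real, 'l \<times> 'd \<times> 'd) vec"])
    fix Net :: "('l, 'd) param set"
    assume net: "finite Net" "\<And>\<sigma>. norm \<sigma> <= R ==> \<exists>\<sigma>0\<in>Net. norm (\<sigma> - \<sigma>0) <= h" "\<And>\<sigma>0. \<sigma>0 \<in> Net ==> norm \<sigma>0 <= R"
    define rem where "rem k n x = W n (\<theta> + (1 / sqrt (real n)) *\<^sub>R snd k) (fst k) x - W n \<theta> (fst k) x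
     - V *v (transpose (c_mat p q \<theta> (fst k)) *v snd k)" for k n x
    define Z1 where "Z1 n x = norm (sqrt (real n) *\<^sub>R (T n x - \<theta>))" for n x
    define Z3 where "Z3 n x = (norm (resid_cov p q n \<theta> x - S))\<^sup>2" for n x
    define Z4 where "Z4 n x = (\<Sum>i=1..m. (norm (W n \<theta> i x))\<^sup>2)" for n x
    define Z5 where "Z5 n x = (\<Sum>i=m+1..n-1. a i * norm (W n \<theta> i x))" for n x
    define Z6 where "Z6 n x = (\<Sum>k\<in>{1..m} \<times> Net. norm (rem k n x))" for n x
    have nn3: "Z3 n x >= 0" and nn4: "Z4 n x >= 0" for n x by (auto simp: Z3_def Z4_def intro: sum_nonneg)
    have nn5: "Z5 n x >= 0" for n x using a0 by (auto simp: Z5_def intro: sum_nonneg)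
    have remm: "rem k n \<in> borel_measurable (P n)" for k n
     unfolding rem_def[abs_def] by (intro borel_measurable_diff borel_measurable_const Wm)
    have Zm: "Z1 n \<in> borel_measurable (P n)" "Z3 n \<in> borel_measurable (P n)" "Z4 n \<in> borel_measurable (P n)"
     "Z5 n \<in> borel_measurable (P n)" "Z6 n \<in> borel_measurable (P n)" for n
    proof -
     have [measurable]: "T n \<in> borel_measurable (P n)" using Tm[of n] unfolding P_def measurable_varma_law sets_sample_space .
     show "Z1 n \<in> borel_measurable (P n)" unfolding Z1_def[abs_def] by measurable
     have [measurable]: "(%x. resid_cov p q n \<theta> x) \<in> borel_measurable (P n)" unfolding P_def by (rule borel_measurable_resid_cov) simp
     show "Z3 n \<in> borel_measurable (P n)" unfolding Z3_def[abs_def] by measurable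
     have [measurable]: "W n \<theta> i \<in> borel_measurable (P n)" for i by (rule Wm)
     show "Z4 n \<in> borel_measurable (P n)" unfolding Z4_def[abs_def] by measurable
     show "Z5 n \<in> borel_measurable (P n)" unfolding Z5_def[abs_def] by measurable
     have [measurable]: "rem k n \<in> borel_measurable (P n)" for k by (rule remm)
     show "Z6 n \<in> borel_measurable (P n)" unfolding Z6_def[abs_def] by measurable
    qed
    have ev1: "\<forall>\<^sub>F n in sequentially. measure (P n) {x\<in>space (P n). Z1 n x > R} < \<epsilon>1"
     using R0
    proof eventually_elim
     case (elim n)
     interpret prob_space "P n" by (rule Pp)
     note [measurable] = Zm(1)[of n]
     have "measure (P n) {x\<in>space (P n). Z1 n x > R} <= measure (P n) {x\<in>space (P n). Z1 n x > R0}"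
      by (intro finite_measure_mono) (auto simp: R_def)
     thus ?case using elim by (simp add: Z1_def)
    qed
    have ev2: "\<forall>\<^sub>F n in sequentially. measure (P n) {x\<in>space (P n). gauss_score p q S n (T n x) x = 0} > max 0 (1 - \<epsilon>1)"
    proof (rule order_tendstoD(1))
     show "(%n. measure (P n) {x\<in>space (P n). gauss_score p q S n (T n x) x = 0}) \<longlonglongrightarrow> 1"
      using qmle by (simp add: gaussian_qmle_def P_def S_def)
    qed (use \<epsilon>1 in simp)
    have ev3: "\<forall>\<^sub>F n in sequentially. measure (P n) {x\<in>space (P n). Z3 n x > s\<^sup>2} < \<epsilon>1"
    proof -
     have i4: "integrable (innov f) (%e. norm e ^ 4)" using integrable_norm[OF m4] by (simp add: power4_eq_xxxx mult.assoc)
     obtain Cr where Cr: "\<And>n. n >= 1 ==> integrable (P n) (Z3 n) \<and> (LINT x|P n. Z3 n x) <= Cr / n"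
      using resid_cov_second_moment[OF f i4, where 'a='l] unfolding P_def Z3_def S_def by blast
     have "(%n. (Cr / real n) / s\<^sup>2) \<longlonglongrightarrow> 0"
      using tendsto_divide[OF lim_const_over_n[of Cr] tendsto_const[of "s\<^sup>2"]] s by simp
     hence "\<forall>\<^sub>F n in sequentially. (Cr / real n) / s\<^sup>2 < \<epsilon>1" using \<epsilon>1 by (rule order_tendstoD)
     thus ?thesis using eventually_ge_at_top[of 1]
     proof eventually_elim
      case (elim n)
      interpret prob_space "P n" by (rule Pp)
      have "measure (P n) {x\<in>space (P n). Z3 n x > s\<^sup>2} <= (Cr / real n) / s\<^sup>2"
       using Cr[OF elim(2)] s nn3 by (intro markov_gt) auto
      thus ?case using elim(1) by simp
     qed
    qed
    have ev4: "\<forall>\<^sub>F n in sequentially. measure (P n) {x\<in>space (P n). Z4 n x > D2} < \<epsilon>1"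
     using eventually_gt_at_top[of m]
    proof eventually_elim
     case (elim n)
     interpret prob_space "P n" by (rule Pp)
     have i: "integrable (P n) (%x. (norm (W n \<theta> i x))\<^sup>2)" "(LINT x|P n. (norm (W n \<theta> i x))\<^sup>2) = \<tau>V" if "i \<in> {1..m}" for i
      using W2[of i n] that elim by auto
     have "integrable (P n) (Z4 n)" unfolding Z4_def[abs_def] using i by (intro Bochner_Integration.integrable_sum) auto
     moreover have "(LINT x|P n. Z4 n x) = real m * \<tau>V" unfolding Z4_def using i by (subst Bochner_Integration.integral_sum) auto
     ultimately have "measure (P n) {x\<in>space (P n). Z4 n x > D2} <= real m * \<tau>V / D2"
      using D2 nn4 by (intro markov_gt) auto
     thus ?case using D2 by simp
    qed
    have ev5: "\<forall>\<^sub>F n in sequentially. measure (P n) {x\<in>space (P n). Z5 n x > \<beta>} < \<epsilon>1"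
     using eventually_gt_at_top[of m]
    proof eventually_elim
     case (elim n)
     interpret prob_space "P n" by (rule Pp)
     have i: "integrable (P n) (%x. norm (W n \<theta> i x))" "(LINT x|P n. norm (W n \<theta> i x)) <= sqrt \<tau>V" if "i \<in> {m+1..n-1}" for i
      using W1[of i n] that by auto
     have int: "integrable (P n) (Z5 n)" unfolding Z5_def[abs_def] using i by (intro Bochner_Integration.integrable_sum integrable_mult_right) auto
     have "(LINT x|P n. Z5 n x) = (\<Sum>i=m+1..n-1. a i * (LINT x|P n. norm (W n \<theta> i x)))"
      unfolding Z5_def using i by (subst Bochner_Integration.integral_sum) auto
     also have "... <= (\<Sum>i=m+1..n-1. (a i * (real i + 1)) * sqrt \<tau>V)"
     proof (rule sum_mono)
      fix k assume k: "k \<in> {m+1..n-1}"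
      have "a k * (LINT x|P n. norm (W n \<theta> k x)) <= a k * sqrt \<tau>V" by (intro mult_left_mono i(2)[OF k] a0)
      also have "... <= (a k * (real k + 1)) * sqrt \<tau>V" using a0[of k] \<tau>V by (intro mult_right_mono) (auto simp: distrib_left)
      finally show "a k * (LINT x|P n. norm (W n \<theta> k x)) <= (a k * (real k + 1)) * sqrt \<tau>V" .
     qed
     also have "... = (\<Sum>i=m+1..n-1. a i * (real i + 1)) * sqrt \<tau>V" by (rule sum_distrib_right[symmetric])
     also have "... <= e0 * sqrt \<tau>V" using \<tau>V by (intro mult_right_mono M1 mM) auto
     also note e0'(1)
     finally have "(LINT x|P n. Z5 n x) <= \<beta> * \<epsilon>1 / 2" .
     hence "measure (P n) {x\<in>space (P n). Z5 n x > \<beta>} <= (\<beta> * \<epsilon>1 / 2) / \<beta>"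
      using nn5 \<beta>(1) by (intro markov_gt[OF int])
     also have "... < \<epsilon>1" using \<beta> \<epsilon>1 by simp
     finally show ?case .
    qed
    have ev6: "\<forall>\<^sub>F n in sequentially. measure (P n) {x\<in>space (P n). Z6 n x > \<eta>' / 2} < \<epsilon>1"
    proof -
     have "to_zero_in_prob P Z6" unfolding Z6_def[abs_def]
     proof (rule to_zero_in_prob_sum_norm[OF _ Pp remm])
      show "finite ({1..m} \<times> Net)" using net(1) by simp
      fix k assume "k \<in> {1..m} \<times> Net"
      thus "to_zero_in_prob P (rem k)"
       using asymp_linear_ccov_stat[OF lin, of "fst k" "snd k"] unfolding rem_def[abs_def] W_def P_def[abs_def] V_def S_def by auto
     qed
     moreover have "norm (Z6 n x) = Z6 n x" for n x by (simp add: Z6_def sum_nonneg)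
     ultimately have "\<forall>\<eta>>0. (%n. measure (P n) {x\<in>space (P n). Z6 n x > \<eta>}) \<longlonglongrightarrow> 0" unfolding to_zero_in_prob_def by (simp only:)
     hence "(%n. measure (P n) {x\<in>space (P n). Z6 n x > \<eta>' / 2}) \<longlonglongrightarrow> 0"
      using half_gt_zero[OF \<eta>'] by blast
     thus ?thesis using \<epsilon>1 by (rule order_tendstoD)
    qed
    have t: "min \<eta> \<eta>c > 0" using \<eta> \<eta>c by simp
    have "\<forall>\<^sub>F n in sequentially. n > m \<and> (\<exists>G\<in>sets (P n). measure (P n) G > 1 - \<epsilon> \<and>
     (\<forall>x\<in>G. \<bar>portmanteau p q S m n (T n x) x - oracle_portmanteau p q S m n \<theta> x\<bar> < \<delta>))"
     using ev1 ev2 ev3 ev4 ev5 ev6 eventually_gt_at_top[of m] eventually_over_sqrt_less[OF t, of R] eventually_over_sqrt_less[OF t0(1), of R]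
    proof eventually_elim
     case (elim n)
     note n = elim(7) and Rn = elim(8) and Rs = elim(9)
     interpret prob_space "P n" by (rule Pp)
     let ?sc = "{x\<in>space (P n). gauss_score p q S n (T n x) x = 0}"
     have sc: "?sc \<in> sets (P n)"
     proof (rule ccontr)
      assume "?sc \<notin> sets (P n)"
      then show False using elim(2) by (simp add: measure_notin_sets)
     qed
     define G where "G = {x\<in>space (P n). Z1 n x <= R} \<inter> (?sc \<inter> ({x\<in>space (P n). Z3 n x <= s\<^sup>2} \<inter> ({x\<in>space (P n). Z4 n x <= D2}
      \<inter> ({x\<in>space (P n). Z5 n x <= \<beta>} \<inter> {x\<in>space (P n). Z6 n x <= \<eta>' / 2}))))"
     note pl = prob_le_gt[OF Zm(1) elim(1)] prob_le_gt[OF Zm(2) elim(3)] prob_le_gt[OF Zm(3) elim(4)] prob_le_gt[OF Zm(4) elim(5)] prob_le_gt[OF Zm(5) elim(6)]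
     have sc': "prob ?sc > 1 - \<epsilon>1" using elim(2) by simp
     have "prob G > 1 - (\<epsilon>1 + (\<epsilon>1 + (\<epsilon>1 + (\<epsilon>1 + (\<epsilon>1 + \<epsilon>1)))))"
      unfolding G_def by (intro prob_Int_gt sets.Int sc sc' pl)
     hence "prob G > 1 - \<epsilon>" by (simp add: \<epsilon>1_def)
     moreover have "G \<in> sets (P n)" unfolding G_def by (intro sets.Int sc pl)
     moreover have "\<bar>portmanteau p q S m n (T n x) x - oracle_portmanteau p q S m n \<theta> x\<bar> < \<delta>" if x: "x \<in> G" for x
     proof -
      have g: "Z1 n x <= R" "gauss_score p q S n (T n x) x = 0" "Z3 n x <= s\<^sup>2" "Z4 n x <= D2" "Z5 n x <= \<beta>" "Z6 n x <= \<eta>' / 2"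
       using x by (auto simp: G_def)
      have n0: "n > 0" using n by simp
      define \<sigma> where "\<sigma> = sqrt (real n) *\<^sub>R (T n x - \<theta>)"
      have Th: "\<theta> + (1 / sqrt (real n)) *\<^sub>R \<sigma> = T n x" using n0 by (simp add: \<sigma>_def)
      have \<sigma>: "norm \<sigma> <= R" using g(1) by (simp add: \<sigma>_def Z1_def)
      have nT: "norm (T n x - \<theta>) <= R / sqrt (real n)"
      proof -
       have "T n x - \<theta> = (1 / sqrt (real n)) *\<^sub>R \<sigma>" using n0 by (simp add: \<sigma>_def)
       thus ?thesis using divide_right_mono[OF \<sigma>, of "sqrt (real n)"] by simp
      qed
      have Tball: "norm (T n x - \<theta>) <= \<eta>" using nT Rn by simp
      have \<theta>ball: "norm (\<theta> - \<theta>) <= \<eta>" using \<eta> by simp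
      have rc: "norm (resid_cov p q n \<theta> x - S) <= s" using g(3) s by (simp add: Z3_def power2_le_iff_abs_le)
      have "ssq 2 n (resid p q \<theta> x) <= real n * (real CARD('d) * norm (resid_cov p q n \<theta> x))" by (rule ssq_le_resid_cov)
      also have "... <= real n * B"
       unfolding B_def using rc s(2) norm_triangle_sub[of "resid_cov p q n \<theta> x" S] by (intro mult_left_mono) auto
      finally have E: "ssq 2 n (resid p q \<theta> x) <= real n * B" .
      have KE: "K * ssq 2 n (resid p q \<theta> x) <= real n * A" using mult_left_mono[OF E, of K] K by (simp add: A_def mult_ac)
      have q1: "ssq 2 n (resid p q \<theta>' x) <= real n * A" if "norm (\<theta>' - \<theta>) <= \<eta>" for \<theta>'
       using ssq1[OF \<theta>ball that, of 2 n x] KE by simp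
      have q2: "ssq 2 n (%t. resid p q \<theta>1 x t - resid p q \<theta>2 x t) <= (norm (\<theta>1 - \<theta>2))\<^sup>2 * (real n * A)"
       if "norm (\<theta>1 - \<theta>) <= \<eta>" "norm (\<theta>2 - \<theta>) <= \<eta>" for \<theta>1 \<theta>2
       using ssq2[OF \<theta>ball that, of 2 n x] mult_left_mono[OF KE, of "(norm (\<theta>1 - \<theta>2))\<^sup>2"] by (simp add: mult_ac)
      have Uclose: "norm (matrix_inv (ccov_var (resid_cov p q n (T n x) x)) - matrix_inv V) <= eU"
      proof -
       have "norm (resid_cov p q n (T n x) x - resid_cov p q n \<theta> x) <= 2 * norm (T n x - \<theta>) * (real n * A) / real n"
        by (rule resid_cov_lipschitz[OF q1[OF Tball] q1[OF \<theta>ball] q2[OF Tball \<theta>ball] norm_ge_zero])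
       also have "... = 2 * norm (T n x - \<theta>) * A" using n0 by simp
       also have "... <= 2 * t0 * A" using nT Rs A by (intro mult_right_mono mult_left_mono) auto
       also have "... <= s1 / 4" using t0(2) by (simp add: mult_ac)
       finally have "norm (resid_cov p q n (T n x) x - resid_cov p q n \<theta> x) <= s1 / 4" .
       hence "norm (resid_cov p q n (T n x) x - S) < s1"
        using rc s(3) s1(1) norm_triangle_ineq[of "resid_cov p q n (T n x) x - resid_cov p q n \<theta> x" "resid_cov p q n \<theta> x - S"] by simp
       thus ?thesis using s1(2) by (simp add: less_imp_le)
      qed
      have Wb: "norm (W n \<theta> i x) <= D" if "i \<in> {1..m}" for i
      proof -
       have "(norm (W n \<theta> i x))\<^sup>2 <= Z4 n x" unfolding Z4_def using that by (intro member_le_sum[of i "{1..m}" "%i. (norm (W n \<theta> i x))\<^sup>2"]) auto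
       hence "(norm (W n \<theta> i x))\<^sup>2 <= D\<^sup>2" using g(4) D by simp
       thus ?thesis using D(1) by (simp add: power2_le_iff_abs_le)
      qed
      have remb: "norm (rem (i, \<sigma>0) n x) <= \<eta>' / 2" if "\<sigma>0 \<in> Net" "i \<in> {1..m}" for i \<sigma>0
      proof -
       have "norm (rem (i, \<sigma>0) n x) <= Z6 n x" unfolding Z6_def using that net(1)
        by (intro member_le_sum[of "(i, \<sigma>0)" "{1..m} \<times> Net" "%k. norm (rem k n x)"]) auto
       thus ?thesis using g(6) by simp
      qed
      have tail2: "(\<Sum>i=m+1..n-1. a i * (L * R * (real i + 1))) <= \<beta>"
      proof -
       have "(\<Sum>i=m+1..n-1. a i * (L * R * (real i + 1))) = L * R * (\<Sum>i=m+1..n-1. a i * (real i + 1))"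
        unfolding sum_distrib_left by (intro sum.cong[OF refl]) (simp add: mult_ac)
       also have "... <= L * R * e0" using L R by (intro mult_left_mono M1 mM) auto
       also note e0'(2)
       finally show ?thesis .
      qed
      have "\<bar>portmanteau p q S m n (\<theta> + (1 / sqrt (real n)) *\<^sub>R \<sigma>) x - oracle_portmanteau p q S m n \<theta> x\<bar>
       <= real m * (D + L * R * (real m + 1))\<^sup>2 * eU + (3 * \<beta>)\<^sup>2 / \<kappa> + \<delta> / 4"
      proof (rule good_event_gap[OF n V[unfolded V_def] coer[OF mM(1)] \<kappa> \<sigma> _ q1 q2 L_def, where a=a and ec=ec and N=Net and h=h and \<eta>'=\<eta>'])
       show "R / sqrt (real n) <= \<eta>" using Rn by simp
       show "gauss_score p q S n (\<theta> + (1 / sqrt (real n)) *\<^sub>R \<sigma>) x = 0" using g(2) by (simp only: Th)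
       show "norm (c_mat p q (\<theta> + (1 / sqrt (real n)) *\<^sub>R \<sigma>) i) <= a i" for i unfolding Th a_def by (rule decay[OF Tball])
       show "norm (c_mat p q \<theta> i - c_mat p q (\<theta> + (1 / sqrt (real n)) *\<^sub>R \<sigma>) i) <= ec" if "i \<in> {1..m}" for i
       proof -
        have "norm (T n x - \<theta>) < dd i" using nT Rn \<eta>c(2)[OF that] by simp
        from dd(2)[OF this] show ?thesis unfolding Th by (simp add: norm_minus_commute)
       qed
       show "norm (ccov_stat S n i (resid p q \<theta> x)) <= D" if "i \<in> {1..m}" for i using Wb[OF that] by (simp add: W_def)
       show "(\<Sum>i=m+1..n-1. a i * norm (ccov_stat S n i (resid p q \<theta> x))) <= \<beta>" using g(5) by (simp add: Z5_def W_def)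
       show "(\<Sum>i=m+1..n-1. a i * (L * R * (real i + 1))) <= \<beta>" by (rule tail2)
       show "real m * (ec * (D + L * R * (real m + 1))) <= \<beta>" using ec(2) by (simp add: D'_def mult_ac)
       show "\<exists>\<sigma>0\<in>Net. norm (\<sigma> - \<sigma>0) <= h" if "norm \<sigma> <= R" for \<sigma> by (rule net(2)[OF that])
       show "norm \<sigma>0 <= R" if "\<sigma>0 \<in> Net" for \<sigma>0 by (rule net(3)[OF that])
       show "norm (ccov_stat S n i (resid p q (\<theta> + (1 / sqrt (real n)) *\<^sub>R \<sigma>0) x) - ccov_stat S n i (resid p q \<theta> x)
        - ccov_var S *v (transpose (c_mat p q \<theta> i) *v \<sigma>0)) <= \<eta>' / 2" if "\<sigma>0 \<in> Net" "i \<in> {1..m}" for \<sigma>0 i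
        using remb[OF that] by (simp only: rem_def W_def V_def fst_conv snd_conv)
       show "h >= 0" using h(1) by simp
       show "h * (L * (real m + 1) + norm (ccov_var S) * (\<Sum>i=1..m. norm (c_mat p q \<theta> i))) <= \<eta>' / 2" using h(2) by (simp only: H_def V_def mult.commute[of h])
       show "\<bar>projected_form (ccov_var S) (c_mat p q \<theta>) m (%i. w i + ccov_var S *v (transpose (c_mat p q \<theta> i) *v \<sigma>) + r i)
        - projected_form (ccov_var S) (c_mat p q \<theta>) m w\<bar> <= \<delta> / 4" if "\<forall>i\<in>{1..m}. norm (w i) <= D \<and> norm (r i) <= \<eta>'" for w r \<sigma>
        using pf[OF that] by (simp only: V_def)
       show "norm (matrix_inv (ccov_var (resid_cov p q n (\<theta> + (1 / sqrt (real n)) *\<^sub>R \<sigma>) x)) - matrix_inv (ccov_var S)) <= eU"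
        using Uclose by (simp only: Th V_def)
      qed
      thus ?thesis using eU(2) \<beta>(2) \<delta> unfolding Th D'_def by linarith
     qed
     ultimately show ?case using n by blast
    qed
    thus ?thesis by (simp add: eventually_sequentially P_def S_def)
   qed
  qed
 qed
qed

section \<open>Contiguous alternatives\<close>

lemma borel_measurable_portmanteau:
 assumes T: "T \<in> borel_measurable (sample_space n)" and n: "m <= n"
 shows "(%x. portmanteau p q S m n (T x) x) \<in> borel_measurable (varma_law p q' \<theta>' f n)"
proof -
 have mi: "(%\<omega>. matrix_inv (A \<omega>)) \<in> borel_measurable M" if "A \<in> borel_measurable M" for A :: "'z => real^'v^'v" and M
  by (rule measurable_compose[OF that borel_measurable_matrix_inv])
 have cv: "(%\<omega>. ccov_var (A \<omega>)) \<in> borel_measurable M" if "A \<in> borel_measurable M" for A :: "'z => real^'v^'v" and M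
  unfolding ccov_var_def
  by (rule borel_measurable_continuous_Pair[OF that mi[OF that]])
    (intro bounded_bilinear.continuous_on[OF bounded_bilinear_kron] continuous_intros)
 show ?thesis unfolding portmanteau_resid[OF n]
  by (intro borel_measurable_sum borel_measurable_inner borel_measurable_matrix_vector_mult mi cv
    borel_measurable_ccov_resid[OF T] borel_measurable_resid_cov[OF T])
qed

lemma borel_measurable_oracle_portmanteau:
 assumes "m < n" "pos_def (ccov_var S)" "invertible (c_gram p q S m \<theta>)"
 shows "(%x. oracle_portmanteau p q S m n \<theta> x) \<in> borel_measurable (varma_law p q' \<theta>' f n)"
 unfolding oracle_portmanteau_resid[OF assms] projected_form_def
 by (intro borel_measurable_diff borel_measurable_sum borel_measurable_inner borel_measurable_matrix_vector_mult
   borel_measurable_const borel_measurable_ccov_resid)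

text \<open>
 Both parts under \<open>\<theta>\<close> are transferred to the alternatives by contiguity: for the first part, to
 the exceptional set of the comparison.
\<close>

theorem proposition3p3:
  fixes p q :: nat
    and \<theta> :: "real^('l::{finite,linorder} \<times> 'd::finite \<times> 'd)"
    and f :: "real^'d \<Rightarrow> real"
    and \<theta>hat :: "nat \<Rightarrow> (nat \<Rightarrow> real^'d) \<Rightarrow> real^('l \<times> 'd \<times> 'd)"
  assumes "p + q = CARD('l)"
    and "\<theta> \<in> varma_params p q"
    and "f \<in> density_class"
    and "asymp_linear_ccov p q f \<theta>"
    and "integrable (innov f) (\<lambda>e. outer (vecm (outer e e)) (vecm (outer e e)))"
    and "gaussian_qmle p q f \<theta> \<theta>hat"
  shows "\<forall>\<tau>. let P = (\<lambda>n. varma_law p q (\<theta> + (1 / sqrt (real n)) *\<^sub>R \<tau>) f n); S = innov_cov f in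
    (\<forall>\<delta>>0. \<forall>\<epsilon>>0. \<exists>M. \<forall>m\<ge>M. \<exists>N. \<forall>n\<ge>N.
       measure (P n) {x \<in> space (P n).
         \<bar>portmanteau p q S m n (\<theta>hat n x) x - oracle_portmanteau p q S m n \<theta> x\<bar> < \<delta>} > 1 - \<epsilon>) \<and>
    (\<forall>m>p + q. invertible (c_gram p q S m \<theta>) \<longrightarrow>
       weak_conv_m (\<lambda>n. distr (P n) borel (oracle_portmanteau p q S m n \<theta>))
         (chi_square (CARD('d)^2 * (m - p - q))))"
 unfolding Let_def
proof (intro allI conjI impI)
 fix \<tau> :: "real^('l \<times> 'd \<times> 'd)" and m
 assume "p + q < m" "invertible (c_gram p q (innov_cov f) m \<theta>)"
 thus "weak_conv_m (%n. distr (varma_law p q (\<theta> + (1 / sqrt (real n)) *\<^sub>R \<tau>) f n) borel (oracle_portmanteau p q (innov_cov f) m n \<theta>))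
  (chi_square (CARD('d)^2 * (m - p - q)))"
  by (rule oracle_portmanteau_chi_square[OF assms(1-5)])
next
 fix \<tau> :: "real^('l \<times> 'd \<times> 'd)" and \<delta> \<epsilon> :: real
 assume \<delta>: "0 < \<delta>" and \<epsilon>: "0 < \<epsilon>"
 let ?S = "innov_cov f" let ?P = "varma_law p q \<theta> f" let ?Q = "%n. varma_law p q (\<theta> + (1 / sqrt (real n)) *\<^sub>R \<tau>) f n"
 let ?gap = "%m n x. \<bar>portmanteau p q ?S m n (\<theta>hat n x) x - oracle_portmanteau p q ?S m n \<theta> x\<bar>"
 have "\<epsilon> / 4 > 0" using \<epsilon> by simp
 from varma_shift_contiguity[OF assms(3,2,5) this, of \<tau>] obtain K N0 where K: "K >= 0" and
  cont: "\<And>n A. n >= N0 ==> A \<in> sets (paths n) ==> measure (?Q n) A <= K * measure (?P n) A + \<epsilon> / 4"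
  by blast
 define \<epsilon>' where "\<epsilon>' = \<epsilon> / (2 * (K + 1))"
 have \<epsilon>': "\<epsilon>' > 0" using \<epsilon> K by (simp add: \<epsilon>'_def)
 have K\<epsilon>: "K * \<epsilon>' <= \<epsilon> / 2"
 proof -
  have "K * \<epsilon>' <= (K + 1) * \<epsilon>'" using \<epsilon>' by (intro mult_right_mono) auto
  also have "... = \<epsilon> / 2" using K by (simp add: \<epsilon>'_def divide_simps)
  finally show ?thesis .
 qed
 obtain M where M: "\<And>m. m >= M ==> invertible (c_gram p q ?S m \<theta>) \<and> (\<exists>N. \<forall>n\<ge>N. n > m \<and>
  (\<exists>G\<in>sets (?P n). measure (?P n) G > 1 - \<epsilon>' \<and> (\<forall>x\<in>G. ?gap m n x < \<delta>)))"
  using portmanteau_oracle_gap[OF assms \<delta> \<epsilon>'] by blast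
 show "\<exists>M. \<forall>m\<ge>M. \<exists>N. \<forall>n\<ge>N. measure (?Q n) {x \<in> space (?Q n). ?gap m n x < \<delta>} > 1 - \<epsilon>"
 proof (rule exI[of _ M], intro allI impI)
  fix m assume m: "M <= m"
  obtain N where N: "\<And>n. n >= N ==> n > m \<and> (\<exists>G\<in>sets (?P n). measure (?P n) G > 1 - \<epsilon>' \<and> (\<forall>x\<in>G. ?gap m n x < \<delta>))"
   using M[OF m] by blast
  have inv: "invertible (c_gram p q ?S m \<theta>)" using M[OF m] by blast
  show "\<exists>N. \<forall>n\<ge>N. measure (?Q n) {x \<in> space (?Q n). ?gap m n x < \<delta>} > 1 - \<epsilon>"
  proof (rule exI[of _ "max N N0"], intro allI impI)
   fix n assume n: "max N N0 <= n"
   then obtain G where mn: "m < n" and G: "G \<in> sets (?P n)" "measure (?P n) G > 1 - \<epsilon>'" "\<And>x. x \<in> G ==> ?gap m n x < \<delta>"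
    using N[of n] by auto
   interpret P: prob_space "?P n" by (rule prob_space_varma_law[OF assms(3)])
   interpret Q: prob_space "?Q n" by (rule prob_space_varma_law[OF assms(3)])
   have sp: "space (?Q n) = space (?P n)" by (simp only: space_varma_law)
   have GQ: "G \<in> sets (?Q n)" using G(1) by simp
   have "space (?P n) - G \<in> sets (paths n)" using sets.compl_sets[OF G(1)] by simp
   from cont[OF _ this] n have "measure (?Q n) (space (?Q n) - G) <= K * measure (?P n) (space (?P n) - G) + \<epsilon> / 4" by (simp add: sp)
   also have "measure (?P n) (space (?P n) - G) <= \<epsilon>'" using G(2) by (simp add: P.prob_compl[OF G(1)])
   finally have "measure (?Q n) (space (?Q n) - G) <= K * \<epsilon>' + \<epsilon> / 4" using K by (simp add: mult_left_mono)
   hence "1 - \<epsilon> < measure (?Q n) G" using K\<epsilon> \<epsilon> by (simp add: Q.prob_compl[OF GQ])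
   also have "measure (?Q n) G <= measure (?Q n) {x \<in> space (?Q n). ?gap m n x < \<delta>}"
   proof (rule Q.finite_measure_mono)
    show "G \<subseteq> {x \<in> space (?Q n). ?gap m n x < \<delta>}" using sets.sets_into_space[OF GQ] G(3) by auto
    have T: "\<theta>hat n \<in> borel_measurable (sample_space n)" using assms(6) by (simp add: gaussian_qmle_def)
    have [measurable]: "(%x. portmanteau p q ?S m n (\<theta>hat n x) x) \<in> borel_measurable (?Q n)"
     by (rule borel_measurable_portmanteau[OF T]) (use mn in simp)
    have [measurable]: "(%x. oracle_portmanteau p q ?S m n \<theta> x) \<in> borel_measurable (?Q n)"
     by (rule borel_measurable_oracle_portmanteau[OF mn pos_def_ccov_var[OF assms(3)] inv])
    show "{x \<in> space (?Q n). ?gap m n x < \<delta>} \<in> sets (?Q n)" by measurable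
   qed
   finally show "measure (?Q n) {x \<in> space (?Q n). ?gap m n x < \<delta>} > 1 - \<epsilon>" .
  qed
 qed
qed

end
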